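(* Let $\kappa$ be a cardinal, let $\mathbb{P}$ be a forcing notion with $|\mathbb{P}|<\kappa$, and let $\dot{\mathbb{Q}}$ be a $\mathbb{P}$-name such that $\Vdash_{\mathbb{P}}$ "$\dot{\mathbb{Q}}$ is ${<}\kappa$-closed and adds a new set". Then in $V^{\mathbb{P}*\dot{\mathbb{Q}}}$, $\kappa$ is not supercompact, and indeed $\kappa$ is not strongly compact.
   Context: A forcing notion is ${<}\kappa$-closed if every descending sequence of conditions of length less than $\kappa$ has a lower bound. "Adds a new set" means that in $V^{\mathbb{P}*\dot{\mathbb{Q}}}$ there is a set not in $V^{\mathbb{P}}$.
   Formalization: The forcing notion P is additionally assumed to be nontrivial, in the sense that it is forced that P adds a new set over V (P has no atoms); for trivial P the claim fails, e.g. for a Laver-indestructible supercompact κ and Q = Add(κ,1). *)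

theory Defs
  imports Main
begin

text \<open>
  The universe \<open>V\<close> is an arbitrary model \<open>(UNIV :: 'a set, E)\<close> of first-order ZFC, where
  \<open>E x y\<close> means that \<open>x\<close> is an element of \<open>y\<close>. The model need not be well-founded, so all
  recursions over \<open>V\<close> below are carried out inside \<open>V\<close>, by means of approximations that are
  elements of \<open>V\<close>.
\<close>

section \<open>Models of ZFC\<close>

text \<open>First-order formulas with named variables; they are only used in the two axiom schemas.\<close>

datatype fm = VMem nat nat | VEq nat nat | VNeg fm | VAnd fm fm | VAll nat fm

primrec sat :: "('a \<Rightarrow> 'a \<Rightarrow> bool) \<Rightarrow> fm \<Rightarrow> (nat \<Rightarrow> 'a) \<Rightarrow> bool" where
  "sat E (VMem i j) e = E (e i) (e j)"
| "sat E (VEq i j) e = (e i = e j)"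
| "sat E (VNeg \<phi>) e = (\<not> sat E \<phi> e)"
| "sat E (VAnd \<phi> \<psi>) e = (sat E \<phi> e \<and> sat E \<psi> e)"
| "sat E (VAll i \<phi>) e = (\<forall>x. sat E \<phi> (e(i := x)))"

definition ZFC :: "('a \<Rightarrow> 'a \<Rightarrow> bool) \<Rightarrow> bool" where
  "ZFC E \<longleftrightarrow>
    \<comment> \<open>extensionality\<close>
    (\<forall>x y. (\<forall>z. E z x \<longleftrightarrow> E z y) \<longrightarrow> x = y) \<and>
    \<comment> \<open>foundation\<close>
    (\<forall>x. (\<exists>y. E y x) \<longrightarrow> (\<exists>y. E y x \<and> \<not> (\<exists>z. E z y \<and> E z x))) \<and>
    \<comment> \<open>pairing\<close>
    (\<forall>x y. \<exists>z. \<forall>u. E u z \<longleftrightarrow> u = x \<or> u = y) \<and>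
    \<comment> \<open>union\<close>
    (\<forall>x. \<exists>z. \<forall>u. E u z \<longleftrightarrow> (\<exists>y. E y x \<and> E u y)) \<and>
    \<comment> \<open>power set\<close>
    (\<forall>x. \<exists>z. \<forall>u. E u z \<longleftrightarrow> (\<forall>v. E v u \<longrightarrow> E v x)) \<and>
    \<comment> \<open>infinity\<close>
    (\<exists>x. (\<exists>n. E n x \<and> (\<forall>u. \<not> E u n)) \<and>
         (\<forall>y. E y x \<longrightarrow> (\<exists>s. E s x \<and> (\<forall>u. E u s \<longleftrightarrow> E u y \<or> u = y)))) \<and>
    \<comment> \<open>choice\<close>
    (\<forall>x. (\<forall>y. E y x \<longrightarrow> (\<exists>u. E u y)) \<and>
         (\<forall>y z u. E y x \<and> E z x \<and> E u y \<and> E u z \<longrightarrow> y = z)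
       \<longrightarrow> (\<exists>c. \<forall>y. E y x \<longrightarrow> (\<exists>!u. E u y \<and> E u c))) \<and>
    \<comment> \<open>separation\<close>
    (\<forall>\<phi> e a. \<exists>b. \<forall>x. E x b \<longleftrightarrow> E x a \<and> sat E \<phi> (e(0 := x))) \<and>
    \<comment> \<open>replacement\<close>
    (\<forall>\<phi> e a. (\<forall>x. E x a \<longrightarrow> (\<exists>!y. sat E \<phi> (e(0 := x, 1 := y))))
       \<longrightarrow> (\<exists>b. \<forall>y. E y b \<longleftrightarrow> (\<exists>x. E x a \<and> sat E \<phi> (e(0 := x, 1 := y)))))"

section \<open>Formulas with parameters\<close>

text \<open>
  Set-theoretic notions are written once, as formulas whose parameters come from \<open>'a\<close>. They can
  then be read in \<open>V\<close> (\<open>holds\<close>, parameters are sets) or in a forcing extension (\<open>forces\<close>,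
  parameters are names). Bound variables are represented by functions.
\<close>

datatype 'a form =
    FMem 'a 'a  (infix "\<^bold>\<in>" 50)
  | FEq 'a 'a  (infix "\<^bold>=" 50)
  | FNeg "'a form"  ("\<^bold>\<not> _" [40] 40)
  | FAnd "'a form" "'a form"  (infixr "\<^bold>\<and>" 35)
  | FAll "'a \<Rightarrow> 'a form"

notation FAll (binder "\<^bold>\<forall>" 10)

definition FOr :: "'a form \<Rightarrow> 'a form \<Rightarrow> 'a form" (infixr "\<^bold>\<or>" 30) where
  "(\<phi> \<^bold>\<or> \<psi>) = (\<^bold>\<not> (\<^bold>\<not> \<phi> \<^bold>\<and> \<^bold>\<not> \<psi>))"

definition FImp :: "'a form \<Rightarrow> 'a form \<Rightarrow> 'a form" (infixr "\<^bold>\<longrightarrow>" 25) where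
  "(\<phi> \<^bold>\<longrightarrow> \<psi>) = (\<^bold>\<not> (\<phi> \<^bold>\<and> \<^bold>\<not> \<psi>))"

definition FIff :: "'a form \<Rightarrow> 'a form \<Rightarrow> 'a form" (infixr "\<^bold>\<longleftrightarrow>" 25) where
  "(\<phi> \<^bold>\<longleftrightarrow> \<psi>) = ((\<phi> \<^bold>\<longrightarrow> \<psi>) \<^bold>\<and> (\<psi> \<^bold>\<longrightarrow> \<phi>))"

definition FEx :: "('a \<Rightarrow> 'a form) \<Rightarrow> 'a form" (binder "\<^bold>\<exists>" 10) where
  "FEx \<phi> = (\<^bold>\<not> (\<^bold>\<forall>x. \<^bold>\<not> \<phi> x))"

primrec holds :: "('a \<Rightarrow> 'a \<Rightarrow> bool) \<Rightarrow> 'a form \<Rightarrow> bool" where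
  "holds E (x \<^bold>\<in> y) = E x y"
| "holds E (x \<^bold>= y) = (x = y)"
| "holds E (\<^bold>\<not> \<phi>) = (\<not> holds E \<phi>)"
| "holds E (\<phi> \<^bold>\<and> \<psi>) = (holds E \<phi> \<and> holds E \<psi>)"
| "holds E (FAll \<phi>) = (\<forall>x. holds E (\<phi> x))"

lemma holds_derived [simp]:
  "holds E (\<phi> \<^bold>\<or> \<psi>) \<longleftrightarrow> holds E \<phi> \<or> holds E \<psi>"
  "holds E (\<phi> \<^bold>\<longrightarrow> \<psi>) \<longleftrightarrow> (holds E \<phi> \<longrightarrow> holds E \<psi>)"
  "holds E (\<phi> \<^bold>\<longleftrightarrow> \<psi>) \<longleftrightarrow> (holds E \<phi> \<longleftrightarrow> holds E \<psi>)"
  "holds E (FEx \<chi>) \<longleftrightarrow> (\<exists>x. holds E (\<chi> x))"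
  by (auto simp: FOr_def FImp_def FIff_def FEx_def)

section \<open>Basic set-theoretic notions\<close>

definition sub :: "'a \<Rightarrow> 'a \<Rightarrow> 'a form" (infix "\<^bold>\<subseteq>" 50) where
  "(x \<^bold>\<subseteq> y) = (\<^bold>\<forall>z. z \<^bold>\<in> x \<^bold>\<longrightarrow> z \<^bold>\<in> y)"

definition nonempty :: "'a \<Rightarrow> 'a form" where
  "nonempty x = (\<^bold>\<exists>z. z \<^bold>\<in> x)"

definition is_upair :: "'a \<Rightarrow> 'a \<Rightarrow> 'a \<Rightarrow> 'a form" where
  "is_upair z x y = (\<^bold>\<forall>u. u \<^bold>\<in> z \<^bold>\<longleftrightarrow> u \<^bold>= x \<^bold>\<or> u \<^bold>= y)"

definition is_pair :: "'a \<Rightarrow> 'a \<Rightarrow> 'a \<Rightarrow> 'a form" where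
  "is_pair z x y = (\<^bold>\<exists>a b. is_upair a x x \<^bold>\<and> is_upair b x y \<^bold>\<and> is_upair z a b)"

text \<open>\<open>rel r x y\<close>: the ordered pair of \<open>x\<close> and \<open>y\<close> belongs to \<open>r\<close>.\<close>

definition rel :: "'a \<Rightarrow> 'a \<Rightarrow> 'a \<Rightarrow> 'a form" where
  "rel r x y = (\<^bold>\<exists>z. is_pair z x y \<^bold>\<and> z \<^bold>\<in> r)"

definition trans_set :: "'a \<Rightarrow> 'a form" where
  "trans_set x = (\<^bold>\<forall>y. y \<^bold>\<in> x \<^bold>\<longrightarrow> y \<^bold>\<subseteq> x)"

definition ordinal :: "'a \<Rightarrow> 'a form" where
  "ordinal x = (trans_set x \<^bold>\<and> (\<^bold>\<forall>y. y \<^bold>\<in> x \<^bold>\<longrightarrow> trans_set y))"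

definition is_fun :: "'a \<Rightarrow> 'a \<Rightarrow> 'a \<Rightarrow> 'a form" where
  "is_fun f a b =
    ((\<^bold>\<forall>z. z \<^bold>\<in> f \<^bold>\<longrightarrow> (\<^bold>\<exists>x y. x \<^bold>\<in> a \<^bold>\<and> y \<^bold>\<in> b \<^bold>\<and> is_pair z x y)) \<^bold>\<and>
     (\<^bold>\<forall>x. x \<^bold>\<in> a \<^bold>\<longrightarrow> (\<^bold>\<exists>y. rel f x y \<^bold>\<and> (\<^bold>\<forall>y'. rel f x y' \<^bold>\<longrightarrow> y' \<^bold>= y))))"

definition is_inj :: "'a \<Rightarrow> 'a \<Rightarrow> 'a \<Rightarrow> 'a form" where
  "is_inj f a b =
    (is_fun f a b \<^bold>\<and> (\<^bold>\<forall>x x' y. rel f x y \<^bold>\<and> rel f x' y \<^bold>\<longrightarrow> x \<^bold>= x'))"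

definition cardinal :: "'a \<Rightarrow> 'a form" where
  "cardinal k = (ordinal k \<^bold>\<and> (\<^bold>\<forall>a. a \<^bold>\<in> k \<^bold>\<longrightarrow> \<^bold>\<not> (\<^bold>\<exists>f. is_inj f k a)))"

text \<open>\<open>smaller x k\<close>: the cardinality of \<open>x\<close> is less than the cardinal \<open>k\<close>.\<close>

definition smaller :: "'a \<Rightarrow> 'a \<Rightarrow> 'a form" where
  "smaller x k = (\<^bold>\<exists>a f. a \<^bold>\<in> k \<^bold>\<and> is_inj f x a)"

definition limit_ordinal :: "'a \<Rightarrow> 'a form" where
  "limit_ordinal w =
    (ordinal w \<^bold>\<and> nonempty w \<^bold>\<and> (\<^bold>\<forall>u. u \<^bold>\<in> w \<^bold>\<longrightarrow> (\<^bold>\<exists>v. v \<^bold>\<in> w \<^bold>\<and> u \<^bold>\<in> v)))"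

definition uncountable_cardinal :: "'a \<Rightarrow> 'a form" where
  "uncountable_cardinal k = (cardinal k \<^bold>\<and> (\<^bold>\<exists>w. w \<^bold>\<in> k \<^bold>\<and> limit_ordinal w))"

section \<open>Strongly compact and supercompact cardinals\<close>

text \<open>\<open>s\<close> is the set \<open>P\<^sub>k(l)\<close> of all subsets of \<open>l\<close> of size less than \<open>k\<close>.\<close>

definition is_Pk :: "'a \<Rightarrow> 'a \<Rightarrow> 'a \<Rightarrow> 'a form" where
  "is_Pk s k l = (\<^bold>\<forall>x. x \<^bold>\<in> s \<^bold>\<longleftrightarrow> x \<^bold>\<subseteq> l \<^bold>\<and> smaller x k)"

definition ultrafilter :: "'a \<Rightarrow> 'a \<Rightarrow> 'a form" where
  "ultrafilter U s =
    ((\<^bold>\<forall>x. x \<^bold>\<in> U \<^bold>\<longrightarrow> x \<^bold>\<subseteq> s \<^bold>\<and> nonempty x) \<^bold>\<and>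
     s \<^bold>\<in> U \<^bold>\<and>
     (\<^bold>\<forall>x y. x \<^bold>\<in> U \<^bold>\<and> x \<^bold>\<subseteq> y \<^bold>\<and> y \<^bold>\<subseteq> s \<^bold>\<longrightarrow> y \<^bold>\<in> U) \<^bold>\<and>
     (\<^bold>\<forall>x y z. x \<^bold>\<in> U \<^bold>\<and> y \<^bold>\<in> U \<^bold>\<and> (\<^bold>\<forall>u. u \<^bold>\<in> z \<^bold>\<longleftrightarrow> u \<^bold>\<in> x \<^bold>\<and> u \<^bold>\<in> y) \<^bold>\<longrightarrow> z \<^bold>\<in> U) \<^bold>\<and>
     (\<^bold>\<forall>x y. x \<^bold>\<subseteq> s \<^bold>\<and> (\<^bold>\<forall>u. u \<^bold>\<in> y \<^bold>\<longleftrightarrow> u \<^bold>\<in> s \<^bold>\<and> \<^bold>\<not> (u \<^bold>\<in> x)) \<^bold>\<longrightarrow> x \<^bold>\<in> U \<^bold>\<or> y \<^bold>\<in> U))"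

definition complete_for :: "'a \<Rightarrow> 'a \<Rightarrow> 'a form" where
  "complete_for k U =
    (\<^bold>\<forall>A i. A \<^bold>\<subseteq> U \<^bold>\<and> nonempty A \<^bold>\<and> smaller A k \<^bold>\<and>
       (\<^bold>\<forall>x. x \<^bold>\<in> i \<^bold>\<longleftrightarrow> (\<^bold>\<forall>a. a \<^bold>\<in> A \<^bold>\<longrightarrow> x \<^bold>\<in> a)) \<^bold>\<longrightarrow> i \<^bold>\<in> U)"

text \<open>Fineness and normality of an ultrafilter \<open>U\<close> on \<open>s = P\<^sub>k(l)\<close>.\<close>

definition fine :: "'a \<Rightarrow> 'a \<Rightarrow> 'a \<Rightarrow> 'a form" where
  "fine U s l =
    (\<^bold>\<forall>a z. a \<^bold>\<in> l \<^bold>\<and> (\<^bold>\<forall>x. x \<^bold>\<in> z \<^bold>\<longleftrightarrow> x \<^bold>\<in> s \<^bold>\<and> a \<^bold>\<in> x) \<^bold>\<longrightarrow> z \<^bold>\<in> U)"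

definition normal :: "'a \<Rightarrow> 'a \<Rightarrow> 'a \<Rightarrow> 'a form" where
  "normal U s l =
    (\<^bold>\<forall>f z. is_fun f s l \<^bold>\<and>
       (\<^bold>\<forall>x. x \<^bold>\<in> z \<^bold>\<longleftrightarrow> x \<^bold>\<in> s \<^bold>\<and> (\<^bold>\<exists>a. rel f x a \<^bold>\<and> a \<^bold>\<in> x)) \<^bold>\<and> z \<^bold>\<in> U
     \<^bold>\<longrightarrow> (\<^bold>\<exists>a w. a \<^bold>\<in> l \<^bold>\<and> w \<^bold>\<in> U \<^bold>\<and> (\<^bold>\<forall>x. x \<^bold>\<in> w \<^bold>\<longrightarrow> rel f x a)))"

definition strongly_compact :: "'a \<Rightarrow> 'a form" where
  "strongly_compact k =
    (uncountable_cardinal k \<^bold>\<and>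
     (\<^bold>\<forall>l s. cardinal l \<^bold>\<and> k \<^bold>\<subseteq> l \<^bold>\<and> is_Pk s k l \<^bold>\<longrightarrow>
       (\<^bold>\<exists>U. ultrafilter U s \<^bold>\<and> complete_for k U \<^bold>\<and> fine U s l)))"

definition supercompact :: "'a \<Rightarrow> 'a form" where
  "supercompact k =
    (uncountable_cardinal k \<^bold>\<and>
     (\<^bold>\<forall>l s. cardinal l \<^bold>\<and> k \<^bold>\<subseteq> l \<^bold>\<and> is_Pk s k l \<^bold>\<longrightarrow>
       (\<^bold>\<exists>U. ultrafilter U s \<^bold>\<and> complete_for k U \<^bold>\<and> fine U s l \<^bold>\<and> normal U s l)))"

section \<open>Forcing notions\<close>

text \<open>A forcing notion is a nonempty preorder; smaller conditions are stronger.\<close>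

definition forcing_notion :: "'a \<Rightarrow> 'a \<Rightarrow> 'a form" where
  "forcing_notion Q L =
    (nonempty Q \<^bold>\<and>
     (\<^bold>\<forall>p. p \<^bold>\<in> Q \<^bold>\<longrightarrow> rel L p p) \<^bold>\<and>
     (\<^bold>\<forall>p q r. p \<^bold>\<in> Q \<^bold>\<and> q \<^bold>\<in> Q \<^bold>\<and> r \<^bold>\<in> Q \<^bold>\<and> rel L p q \<^bold>\<and> rel L q r \<^bold>\<longrightarrow> rel L p r))"

definition less_closed :: "'a \<Rightarrow> 'a \<Rightarrow> 'a \<Rightarrow> 'a form" where
  "less_closed k Q L =
    (\<^bold>\<forall>a f. a \<^bold>\<in> k \<^bold>\<and> is_fun f a Q \<^bold>\<and>
       (\<^bold>\<forall>b c x y. b \<^bold>\<in> c \<^bold>\<and> rel f b x \<^bold>\<and> rel f c y \<^bold>\<longrightarrow> rel L y x)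
     \<^bold>\<longrightarrow> (\<^bold>\<exists>q. q \<^bold>\<in> Q \<^bold>\<and> (\<^bold>\<forall>b x. rel f b x \<^bold>\<longrightarrow> rel L q x)))"

text \<open>A preorder as seen from outside \<open>V\<close>: its conditions and its order relation.\<close>

record 'a poset =
  Cond :: "'a set"
  Leq :: "'a \<Rightarrow> 'a \<Rightarrow> bool"

definition ext_poset :: "('a \<Rightarrow> 'a \<Rightarrow> bool) \<Rightarrow> 'a \<Rightarrow> 'a \<Rightarrow> 'a poset" where
  "ext_poset E P L = \<lparr>Cond = {p. E p P}, Leq = (\<lambda>p q. holds E (rel L p q))\<rparr>"

definition below :: "'a poset \<Rightarrow> 'a \<Rightarrow> 'a set" where
  "below PP p = {q \<in> Cond PP. Leq PP q p}"

section \<open>The forcing relation\<close>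

text \<open>
  Every element of \<open>V\<close> serves as a name: of a set \<open>y\<close> only those elements matter that are ordered
  pairs of a name and a condition. Thus each \<open>y\<close> names the same set as the hereditary name
  obtained from it by discarding all other elements.
\<close>

definition name_elem :: "('a \<Rightarrow> 'a \<Rightarrow> bool) \<Rightarrow> 'a poset \<Rightarrow> 'a \<Rightarrow> 'a \<Rightarrow> 'a \<Rightarrow> bool" where
  "name_elem E PP z s y \<longleftrightarrow> s \<in> Cond PP \<and> holds E (rel y z s)"

definition name_dom :: "('a \<Rightarrow> 'a \<Rightarrow> bool) \<Rightarrow> 'a poset \<Rightarrow> 'a \<Rightarrow> 'a set" where
  "name_dom E PP y = {z. \<exists>s. name_elem E PP z s y}"

text \<open>
  The usual mutual recursion for the atomic cases: \<open>p\<close> forces \<open>x \<in> y\<close> iff the conditions \<open>r\<close> such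
  that \<open>r \<le> s\<close> and \<open>r\<close> forces \<open>x = z\<close>, for some element \<open>(z, s)\<close> of \<open>y\<close>, are dense below \<open>p\<close>;
  and \<open>p\<close> forces \<open>x = y\<close> iff all \<open>z\<close> in the domain of \<open>x\<close> or of \<open>y\<close> and all \<open>q \<le> p\<close> satisfy that
  \<open>q\<close> forces \<open>z \<in> x\<close> iff \<open>q\<close> forces \<open>z \<in> y\<close>. The parameter \<open>R\<close> stands for the forcing of
  equations between names of smaller rank.
\<close>

definition mem_clause ::
  "('a \<Rightarrow> 'a \<Rightarrow> bool) \<Rightarrow> 'a poset \<Rightarrow> ('a \<Rightarrow> 'a \<Rightarrow> 'a \<Rightarrow> bool) \<Rightarrow> 'a \<Rightarrow> 'a \<Rightarrow> 'a \<Rightarrow> bool" where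
  "mem_clause E PP R p x y \<longleftrightarrow>
    (\<forall>q \<in> below PP p. \<exists>r \<in> below PP q. \<exists>z s. name_elem E PP z s y \<and> Leq PP r s \<and> R r x z)"

definition eq_clause ::
  "('a \<Rightarrow> 'a \<Rightarrow> bool) \<Rightarrow> 'a poset \<Rightarrow> ('a \<Rightarrow> 'a \<Rightarrow> 'a \<Rightarrow> bool) \<Rightarrow> 'a \<Rightarrow> 'a \<Rightarrow> 'a \<Rightarrow> bool" where
  "eq_clause E PP R p x y \<longleftrightarrow>
    (\<forall>z \<in> name_dom E PP x \<union> name_dom E PP y. \<forall>q \<in> below PP p.
       mem_clause E PP R q z x \<longleftrightarrow> mem_clause E PP R q z y)"

definition coded_rel :: "('a \<Rightarrow> 'a \<Rightarrow> bool) \<Rightarrow> 'a \<Rightarrow> 'a \<Rightarrow> 'a \<Rightarrow> 'a \<Rightarrow> bool" where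
  "coded_rel E F p x y \<longleftrightarrow> holds E (\<^bold>\<exists>u. is_pair u x y \<^bold>\<and> rel F p u)"

text \<open>\<open>p\<close> forces \<open>x = y\<close> iff this is so according to a set \<open>F\<close> obeying the recursion on a
  transitive set \<open>t\<close>.\<close>

definition forces_eq :: "('a \<Rightarrow> 'a \<Rightarrow> bool) \<Rightarrow> 'a poset \<Rightarrow> 'a \<Rightarrow> 'a \<Rightarrow> 'a \<Rightarrow> bool" where
  "forces_eq E PP p x y \<longleftrightarrow>
    (\<exists>t F. holds E (trans_set t) \<and> E x t \<and> E y t \<and>
       (\<forall>x' y'. E x' t \<and> E y' t \<longrightarrow>
          (\<forall>q \<in> Cond PP. coded_rel E F q x' y' \<longleftrightarrow> eq_clause E PP (coded_rel E F) q x' y')) \<and>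
       coded_rel E F p x y)"

primrec forces :: "('a \<Rightarrow> 'a \<Rightarrow> bool) \<Rightarrow> 'a poset \<Rightarrow> 'a form \<Rightarrow> 'a \<Rightarrow> bool" where
  "forces E PP (x \<^bold>\<in> y) p = mem_clause E PP (forces_eq E PP) p x y"
| "forces E PP (x \<^bold>= y) p = forces_eq E PP p x y"
| "forces E PP (\<^bold>\<not> \<phi>) p = (\<forall>q \<in> below PP p. \<not> forces E PP \<phi> q)"
| "forces E PP (\<phi> \<^bold>\<and> \<psi>) p = (forces E PP \<phi> p \<and> forces E PP \<psi> p)"
| "forces E PP (FAll \<phi>) p = (\<forall>x. forces E PP (\<phi> x) p)"

definition forced :: "('a \<Rightarrow> 'a \<Rightarrow> bool) \<Rightarrow> 'a poset \<Rightarrow> 'a form \<Rightarrow> bool" where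
  "forced E PP \<phi> \<longleftrightarrow> (\<forall>p \<in> Cond PP. forces E PP \<phi> p)"

section \<open>Canonical names\<close>

text \<open>
  \<open>translate E B x\<close> is the value at \<open>x\<close> of the function \<open>T\<close> defined by recursion in \<open>V\<close> as
  \<open>T(x) = {(T(z), c) | B z c x}\<close>, where \<open>B z c x\<close> entails that \<open>z\<close> is in the transitive closure
  of \<open>x\<close>. In the definition, \<open>f\<close> is the restriction of \<open>T\<close> to a transitive set \<open>t\<close>.
\<close>

definition is_translation ::
  "('a \<Rightarrow> 'a \<Rightarrow> bool) \<Rightarrow> ('a \<Rightarrow> 'a \<Rightarrow> 'a \<Rightarrow> bool) \<Rightarrow> 'a \<Rightarrow> 'a \<Rightarrow> bool" where
  "is_translation E B x y \<longleftrightarrow>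
    (\<exists>t b f. holds E (trans_set t) \<and> holds E (is_fun f t b) \<and>
       (\<forall>x' y'. holds E (rel f x' y') \<longrightarrow>
          (\<forall>u. E u y' \<longleftrightarrow>
             (\<exists>z c w. B z c x' \<and> holds E (rel f z w) \<and> holds E (is_pair u w c)))) \<and>
       holds E (rel f x y))"

definition translate :: "('a \<Rightarrow> 'a \<Rightarrow> bool) \<Rightarrow> ('a \<Rightarrow> 'a \<Rightarrow> 'a \<Rightarrow> bool) \<Rightarrow> 'a \<Rightarrow> 'a" where
  "translate E B x = (THE y. is_translation E B x y)"

text \<open>The canonical name of an element \<open>x\<close> of \<open>V\<close>. There need not be a largest condition, so all
  conditions are used.\<close>

definition check :: "('a \<Rightarrow> 'a \<Rightarrow> bool) \<Rightarrow> 'a poset \<Rightarrow> 'a \<Rightarrow> 'a" where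
  "check E PP = translate E (\<lambda>z c x. E z x \<and> c \<in> Cond PP)"

section \<open>Two-step iterations\<close>

text \<open>
  For \<open>PP\<close>-names \<open>Q\<close> and \<open>L\<close> of a forcing notion and its order, the conditions of the iteration
  are the pairs \<open>(p, q)\<close> where \<open>q\<close> is in the domain of the name \<open>Q\<close> and \<open>p\<close> forces \<open>q \<in> Q\<close>.
\<close>

definition iteration :: "('a \<Rightarrow> 'a \<Rightarrow> bool) \<Rightarrow> 'a poset \<Rightarrow> 'a \<Rightarrow> 'a \<Rightarrow> 'a poset" where
  "iteration E PP Q L =
    \<lparr>Cond = {c. \<exists>p q. holds E (is_pair c p q) \<and> p \<in> Cond PP \<and> q \<in> name_dom E PP Q \<and>
               forces E PP (q \<^bold>\<in> Q) p},
     Leq = (\<lambda>c c'. \<exists>p q p' q'. holds E (is_pair c p q) \<and> holds E (is_pair c' p' q') \<and>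
               Leq PP p p' \<and> forces E PP (rel L q q') p)\<rparr>"

text \<open>The name, with respect to the iteration, of the set named by the \<open>PP\<close>-name \<open>x\<close>.\<close>

definition lift_name :: "('a \<Rightarrow> 'a \<Rightarrow> bool) \<Rightarrow> 'a poset \<Rightarrow> 'a \<Rightarrow> 'a \<Rightarrow> 'a \<Rightarrow> 'a" where
  "lift_name E PP Q L =
    translate E (\<lambda>z c x. c \<in> Cond (iteration E PP Q L) \<and>
      (\<exists>s p q. name_elem E PP z s x \<and> holds E (is_pair c p q) \<and> Leq PP p s))"

section \<open>Adding new sets\<close>

text \<open>
  Let \<open>N\<close> be a collection of names whose interpretations make up an intermediate model. It is
  forced that some set lies outside of this model iff, densely often, some name is forced to be
  different from every name in \<open>N\<close>.
\<close>

definition adds_set_outside :: "('a \<Rightarrow> 'a \<Rightarrow> bool) \<Rightarrow> 'a poset \<Rightarrow> 'a set \<Rightarrow> bool" where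
  "adds_set_outside E PP N \<longleftrightarrow>
    (\<forall>p \<in> Cond PP. \<exists>q \<in> below PP p. \<exists>x. \<forall>y \<in> N. forces E PP (\<^bold>\<not> (x \<^bold>= y)) q)"

text \<open>The extension by \<open>PP\<close> contains a set that is not in \<open>V\<close>.\<close>

definition adds_new_set :: "('a \<Rightarrow> 'a \<Rightarrow> bool) \<Rightarrow> 'a poset \<Rightarrow> bool" where
  "adds_new_set E PP \<longleftrightarrow> adds_set_outside E PP (range (check E PP))"

text \<open>The extension by the iteration contains a set that is not in the extension by \<open>PP\<close>.\<close>

definition second_adds_new_set :: "('a \<Rightarrow> 'a \<Rightarrow> bool) \<Rightarrow> 'a poset \<Rightarrow> 'a \<Rightarrow> 'a \<Rightarrow> bool" where
  "second_adds_new_set E PP Q L \<longleftrightarrow>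
    adds_set_outside E (iteration E PP Q L) (range (lift_name E PP Q L))"

end

theory Submission
  imports Defs
begin

text \<open>
  Let \<open>G\<close> be generic for \<open>P\<close>, let \<open>H\<close> be generic for \<open>Q\<close> over \<open>V[G]\<close>, and suppose that \<open>\<kappa>\<close> is
  strongly compact in \<open>V[G][H]\<close>. As \<open>P\<close> adds a set, every condition of \<open>P\<close> has incompatible
  extensions. Since \<open>Q\<close> is closed, a single name for a condition of \<open>Q\<close> can be arranged to decide
  some element of a given new set differently below incompatible extensions of every condition of
  \<open>P\<close>. This gives the approximation property of Hamkins: a subset of a set of \<open>V\<close> in \<open>V[G][H]\<close>
  whose traces on sets of \<open>V\<close> of size at most \<open>|P|\<close> belong to \<open>V\<close> is itself in \<open>V\<close>.

  A set of minimal rank in \<open>V[G][H]\<close> outside of \<open>V[G]\<close> is coded by a set \<open>A\<close> of ordinals below some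
  cardinal \<open>l\<close>. For \<open>x\<close> in \<open>P\<^sub>\<kappa>(l)\<close> closure of \<open>Q\<close> puts \<open>A \<inter> x\<close> into \<open>V[G]\<close>, so that it is
  \<open>{v. \<exists>p \<in> G. (p, v) \<in> \<tau>}\<close> for some \<open>\<tau> = \<tau>(x)\<close> in \<open>V\<close>. Let \<open>B\<close> consist of the \<open>(p, v)\<close> that
  belong to \<open>\<tau>(x)\<close> for almost all \<open>x\<close> with respect to a fine \<open>\<kappa>\<close>-complete ultrafilter on
  \<open>P\<^sub>\<kappa>(l)\<close>. By completeness every small trace of \<open>B\<close> is a trace of some \<open>\<tau>(x)\<close>, hence \<open>B\<close> is in
  \<open>V\<close> by approximation. By fineness and completeness \<open>A = {v. \<exists>p \<in> G. (p, v) \<in> B}\<close>, so \<open>A\<close> is in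
  \<open>V[G]\<close>, a contradiction.

  Generic filters over \<open>V\<close> need not exist. Sets of the extensions are therefore replaced by names
  and by families of regular open sets of conditions.
\<close>

section \<open>Definable predicates and functions\<close>

text \<open>Nontriviality of \<open>P\<close> is the point: by Laver's theorem a supercompact
  cardinal can be made indestructible under <\<kappa>-directed closed forcing, so closed forcing
  alone need not harm it. The splitting of \<open>P\<close> is exploited by a diagonal argument,
  which is why approximation is tested on families indexed by \<open>P\<close>: for each
  \<open>p\<close> an element \<open>e\<close> is prepared that is decided in opposite ways at two
  incompatible extensions of \<open>p\<close>. A condition \<open>(p', q')\<close> deciding all
  prepared elements fails at the one prepared for \<open>p'\<close>, because \<open>q'\<close> can
  be combined with both extensions. Only |P| many preparations are made, so closure of
  \<open>Q\<close> can carry them out in one descending sequence. A second constraint comes from the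
  setting. The model may be ill-founded, and separation and replacement hold for first-order
  formulas with parameters only. Hence HOL sets, predicates and functions act as classes of the
  model, each use of them inside the model requires a proof that they are definable, and all
  recursions, injections and choices are made internally.\<close>

primrec ren :: "(nat \<Rightarrow> nat) \<Rightarrow> fm \<Rightarrow> fm" where
  "ren f (VMem i j) = VMem (f i) (f j)"
| "ren f (VEq i j) = VEq (f i) (f j)"
| "ren f (VNeg \<phi>) = VNeg (ren f \<phi>)"
| "ren f (VAnd \<phi> \<psi>) = VAnd (ren f \<phi>) (ren f \<psi>)"
| "ren f (VAll i \<phi>) = VAll (f i) (ren f \<phi>)"

text \<open>Injectivity prevents capture: an update at the bound variable \<open>f i\<close> must
  not change the value of any other renamed variable.\<close>

lemma sat_ren: "inj f \<Longrightarrow> sat E (ren f \<phi>) e = sat E \<phi> (\<lambda>n. e (f n))"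
proof (induction \<phi> arbitrary: e)
  case (VAll i \<phi>)
  have "(\<lambda>n. (e(f i := x)) (f n)) = (\<lambda>n. e (f n))(i := x)" for x
    using VAll.prems by (auto simp: fun_eq_iff inj_eq)
  then show ?case using VAll by simp
qed auto

definition ilv :: "(nat \<Rightarrow> 'a) \<Rightarrow> (nat \<Rightarrow> 'a) \<Rightarrow> nat \<Rightarrow> 'a" where
  "ilv e d n = (if even n then e (n div 2) else d (n div 2))"

text \<open>Definability goals are solved by following the shape of the predicate or term with these
  rules.\<close>

named_theorems dfn_intros

locale model =
  fixes E :: "'a \<Rightarrow> 'a \<Rightarrow> bool"
begin

text \<open>An environment lists the free variables in de Bruijn fashion. In the witnessing formula
  they occupy the even indices, whereas the odd ones are left to the parameters.\<close>

definition dfn :: "((nat \<Rightarrow> 'a) \<Rightarrow> bool) \<Rightarrow> bool" where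
  "dfn P \<longleftrightarrow> (\<exists>\<phi> d. \<forall>e. P e \<longleftrightarrow> sat E \<phi> (ilv e d))"

text \<open>The graph has the value as its innermost variable, so that a term is substituted into a
  predicate by quantifying over this value.\<close>

definition dft :: "((nat \<Rightarrow> 'a) \<Rightarrow> 'a) \<Rightarrow> bool" where
  "dft t \<longleftrightarrow> dfn (\<lambda>e. t (\<lambda>n. e (Suc n)) = e 0)"

lemma dfn_mem_var: "dfn (\<lambda>e. E (e i) (e j))"
  unfolding dfn_def by (rule exI[of _ "VMem (2*i) (2*j)"]) (auto simp: ilv_def)

lemma dfn_eq_var: "dfn (\<lambda>e. e i = e j)"
  unfolding dfn_def by (rule exI[of _ "VEq (2*i) (2*j)"]) (auto simp: ilv_def)

lemma dfn_closed [dfn_intros]: "dfn (\<lambda>e. B)"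
proof (cases B)
  case True
  then show ?thesis unfolding dfn_def by (intro exI[of _ "VEq 0 0"]) auto
next
  case False
  then show ?thesis unfolding dfn_def by (intro exI[of _ "VNeg (VEq 0 0)"]) auto
qed

lemma dfn_not [dfn_intros]: "dfn P \<Longrightarrow> dfn (\<lambda>e. \<not> P e)"
  unfolding dfn_def by (elim exE, rule_tac x = "VNeg \<phi>" in exI, auto)

text \<open>The two parameter lists are merged by a second interleaving. The renamings fix the even
  indices, which hold the variables, and send the odd ones to the two halves of the merged
  list.\<close>

lemma dfn_conj [dfn_intros]:
  assumes "dfn P" "dfn Q" shows "dfn (\<lambda>e. P e \<and> Q e)"
proof -
  obtain \<phi> d where 1: "\<And>e. P e \<longleftrightarrow> sat E \<phi> (ilv e d)" using assms(1) by (auto simp: dfn_def)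
  obtain \<psi> d' where 2: "\<And>e. Q e \<longleftrightarrow> sat E \<psi> (ilv e d')" using assms(2) by (auto simp: dfn_def)
  let ?f = "\<lambda>n::nat. if even n then n else 2 * (2 * (n div 2)) + 1"
  let ?g = "\<lambda>n::nat. if even n then n else 2 * (2 * (n div 2) + 1) + 1"
  have f: "inj ?f" "inj ?g"
    by (rule injI, simp split: if_splits, presburger+)+
  have 3: "(\<lambda>n. ilv e (ilv d d') (?f n)) = ilv e d" "(\<lambda>n. ilv e (ilv d d') (?g n)) = ilv e d'" for e
    by (auto simp: ilv_def fun_eq_iff elim!: oddE)
  have "P e \<and> Q e \<longleftrightarrow> sat E (VAnd (ren ?f \<phi>) (ren ?g \<psi>)) (ilv e (ilv d d'))" for e
    unfolding sat.simps sat_ren[OF f(1)] sat_ren[OF f(2)] 3 1 2 ..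
  then show ?thesis unfolding dfn_def by blast
qed

text \<open>Binding removes the innermost variable from index 0 and moves the others down. A dummy
  parameter \<open>c\<close> in front of the list frees the odd index 1, where the bound variable
  can live.\<close>

lemma shift_aux:
  obtains f :: "nat \<Rightarrow> nat" where "inj f" and
    "\<And>e d x (c::'a). ilv (case_nat x e) d = (\<lambda>n. ((ilv e (case_nat c d))(1 := x)) (f n))"
proof
  let ?f = "\<lambda>n::nat. if n = 0 then 1 else if even n then n - 2 else n + 2"
  show "inj ?f"
  proof (rule injI)
    fix x y assume "?f x = ?f y"
    then show "x = y" by (simp split: if_splits) presburger+
  qed
  show "ilv (case_nat x e) d = (\<lambda>n. ((ilv e (case_nat c d))(1 := x)) (?f n))" for e d x and c :: 'a
  proof
    fix n
    show "ilv (case_nat x e) d n = ((ilv e (case_nat c d))(1 := x)) (?f n)"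
    proof (cases "even n")
      case True
      then obtain k where "n = 2 * k" by auto
      then show ?thesis by (cases k) (auto simp: ilv_def)
    next
      case False
      then obtain k where "n = 2 * k + 1" by (auto elim: oddE)
      then show ?thesis by (auto simp: ilv_def)
    qed
  qed
qed

lemma dfn_all [dfn_intros]:
  assumes "dfn (\<lambda>e. P (e 0) (\<lambda>n. e (Suc n)))" shows "dfn (\<lambda>e. \<forall>x. P x e)"
proof -
  obtain \<phi> d where 1: "\<And>e. P (e 0) (\<lambda>n. e (Suc n)) \<longleftrightarrow> sat E \<phi> (ilv e d)"
    using assms by (auto simp: dfn_def)
  obtain f :: "nat \<Rightarrow> nat" where f: "inj f"
    "\<And>e d x (c::'a). ilv (case_nat x e) d = (\<lambda>n. ((ilv e (case_nat c d))(1 := x)) (f n))"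
    by (rule shift_aux) blast
  have "P x e \<longleftrightarrow> sat E \<phi> (ilv (case_nat x e) d)" for x e
    using 1[of "case_nat x e"] by simp
  then have "(\<forall>x. P x e) \<longleftrightarrow> sat E (VAll 1 (ren f \<phi>)) (ilv e (case_nat undefined d))" for e
    unfolding sat.simps sat_ren[OF f(1)] f(2)[symmetric] by simp
  then show ?thesis unfolding dfn_def by blast
qed

text \<open>The renaming is the one for quantifiers, but the freed slot stores the fixed value
  \<open>c\<close> instead of being quantified.\<close>

lemma dfn_param:
  assumes "dfn (\<lambda>e. P (e 0) (\<lambda>n. e (Suc n)))" shows "dfn (\<lambda>e. P c e)"
proof -
  obtain \<phi> d where 1: "\<And>e. P (e 0) (\<lambda>n. e (Suc n)) \<longleftrightarrow> sat E \<phi> (ilv e d)"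
    using assms by (auto simp: dfn_def)
  obtain f :: "nat \<Rightarrow> nat" where f: "inj f"
    "\<And>e d x (c::'a). ilv (case_nat x e) d = (\<lambda>n. ((ilv e (case_nat c d))(1 := x)) (f n))"
    by (rule shift_aux) blast
  have 2: "(ilv e (case_nat c d))(1 := c) = ilv e (case_nat c d)" for e
    by (auto simp: ilv_def fun_eq_iff)
  have "P c e \<longleftrightarrow> sat E \<phi> (ilv (case_nat c e) d)" for e
    using 1[of "case_nat c e"] by simp
  also have "\<dots> e \<longleftrightarrow> sat E (ren f \<phi>) (ilv e (case_nat c d))" for e
    unfolding f(2)[of c e d c] 2 sat_ren[OF f(1)] ..
  finally show ?thesis unfolding dfn_def by blast
qed

lemma dfn_ren:
  assumes "inj g" "dfn P" shows "dfn (\<lambda>e. P (\<lambda>n. e (g n)))"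
proof -
  obtain \<phi> d where 1: "\<And>e. P e \<longleftrightarrow> sat E \<phi> (ilv e d)" using assms(2) by (auto simp: dfn_def)
  let ?f = "\<lambda>n. if even n then 2 * g (n div 2) else n"
  have f: "inj ?f"
  proof (rule injI)
    fix x y assume "?f x = ?f y"
    then show "x = y"
      using assms(1)[THEN injD, of "x div 2" "y div 2"] by (simp split: if_splits) presburger+
  qed
  have 2: "(\<lambda>n. ilv e d (?f n)) = ilv (\<lambda>n. e (g n)) d" for e by (auto simp: ilv_def fun_eq_iff)
  have "P (\<lambda>n. e (g n)) \<longleftrightarrow> sat E (ren ?f \<phi>) (ilv e d)" for e
    unfolding sat_ren[OF f] 2 1 ..
  then show ?thesis unfolding dfn_def by blast
qed

lemma dfn_cong: "(\<And>e. P e \<longleftrightarrow> Q e) \<Longrightarrow> dfn P \<longleftrightarrow> dfn Q"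
  by presburger

lemma dfn_ex [dfn_intros]:
  assumes "dfn (\<lambda>e. P (e 0) (\<lambda>n. e (Suc n)))" shows "dfn (\<lambda>e. \<exists>x. P x e)"
proof -
  have "dfn (\<lambda>e. \<not> (\<forall>x. \<not> P x e))"
    by (intro dfn_not dfn_all[where P = "\<lambda>x e. \<not> P x e"] assms)
  then show ?thesis by simp
qed

lemma dfn_disj [dfn_intros]: assumes "dfn P" "dfn Q" shows "dfn (\<lambda>e. P e \<or> Q e)"
proof -
  have "dfn (\<lambda>e. \<not> (\<not> P e \<and> \<not> Q e))" by (intro dfn_intros assms)
  then show ?thesis by simp
qed

lemma dfn_imp [dfn_intros]: assumes "dfn P" "dfn Q" shows "dfn (\<lambda>e. P e \<longrightarrow> Q e)"
proof -
  have "dfn (\<lambda>e. \<not> P e \<or> Q e)" by (intro dfn_intros assms)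
  then show ?thesis unfolding imp_conv_disj .
qed

lemma dfn_iff [dfn_intros]: assumes "dfn P" "dfn Q" shows "dfn (\<lambda>e. P e \<longleftrightarrow> Q e)"
proof -
  have "dfn (\<lambda>e. (P e \<longrightarrow> Q e) \<and> (Q e \<longrightarrow> P e))" by (intro dfn_intros assms)
  then show ?thesis unfolding iff_conv_conj_imp .
qed

lemma dfn_comp:
  assumes "dfn (\<lambda>e. P (e 0) (\<lambda>n. e (Suc n)))" "dft t" shows "dfn (\<lambda>e. P (t e) e)"
proof -
  have "dfn (\<lambda>e. \<exists>x. t e = x \<and> P x e)"
    using assms by (intro dfn_ex dfn_conj) (auto simp: dft_def)
  then show ?thesis by simp
qed

lemma dft_var [dfn_intros]: "dft (\<lambda>e. e i)"
  unfolding dft_def by (rule dfn_eq_var)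

lemma dft_const [dfn_intros]: "dft (\<lambda>e. c)"
  unfolding dft_def by (rule dfn_param[where P = "\<lambda>x e. x = e 0"]) (rule dfn_eq_var)

lemma dft_shift: "dft t \<Longrightarrow> dft (\<lambda>e. t (\<lambda>n. e (Suc n)))"
  unfolding dft_def
  using dfn_ren[of "case_nat 0 (\<lambda>n. Suc (Suc n))" "\<lambda>e. t (\<lambda>n. e (Suc n)) = e 0"]
  by (auto simp: inj_def split: nat.splits)

lemma dfn_comp2:
  assumes "dfn (\<lambda>e. R (e 0) (e 1))" "dft t" "dft u" shows "dfn (\<lambda>e. R (t e) (u e))"
proof (rule dfn_comp[OF _ assms(2)])
  have "dfn (\<lambda>e. R (e (Suc 0)) (e 0))"
    using dfn_ren[of "\<lambda>n. if n = 0 then 1 else if n = 1 then 0 else n", OF _ assms(1)]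
    by (auto simp: inj_def)
  then show "dfn (\<lambda>e. R (e 0) (u (\<lambda>n. e (Suc n))))"
    using dfn_comp[of "\<lambda>y e. R (e 0) y", OF _ dft_shift[OF assms(3)]] by simp
qed

lemma dfn_mem [dfn_intros]: "dft t \<Longrightarrow> dft u \<Longrightarrow> dfn (\<lambda>e. E (t e) (u e))"
  by (rule dfn_comp2[where R = E]) (rule dfn_mem_var)

lemma dfn_eq [dfn_intros]: "dft t \<Longrightarrow> dft u \<Longrightarrow> dfn (\<lambda>e. t e = u e)"
  by (rule dfn_comp2[where R = "(=)"]) (rule dfn_eq_var)

lemma dfn_ex1 [dfn_intros]:
  assumes "dfn (\<lambda>e. P (e 0) (\<lambda>n. e (Suc n)))" shows "dfn (\<lambda>e. \<exists>!x. P x e)"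
proof -
  have "dfn (\<lambda>e. \<exists>y. \<forall>x. P x e \<longleftrightarrow> x = y)"
  proof (intro dfn_intros)
    show "dfn (\<lambda>e. P (e 0) (\<lambda>n. e (Suc (Suc n))))"
      using dfn_ren[of "case_nat 0 (\<lambda>n. Suc (Suc n))", OF _ assms]
      by (auto simp: inj_def split: nat.splits)
  qed
  moreover have "(\<exists>!x. P x e) \<longleftrightarrow> (\<exists>y. \<forall>x. P x e \<longleftrightarrow> x = y)" for e by auto
  ultimately show ?thesis by simp
qed

lemma dft_comp:
  assumes "dft (\<lambda>e. F (e 0) (\<lambda>n. e (Suc n)))" "dft t" shows "dft (\<lambda>e. F (t e) e)"
proof -
  have "dfn (\<lambda>e. F (e (Suc 0)) (\<lambda>n. e (Suc (Suc n))) = e 0)"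
    using assms(1) by (simp add: dft_def)
  then have "dfn (\<lambda>e. F (e 0) (\<lambda>n. e (Suc (Suc n))) = e (Suc 0))"
    by (drule_tac dfn_ren[of "\<lambda>n. if n = 0 then 1 else if n = 1 then 0 else n", rotated])
       (auto simp: inj_def)
  then show ?thesis
    using dfn_comp[of "\<lambda>y e. F y (\<lambda>n. e (Suc n)) = e 0", OF _ dft_shift[OF assms(2)]]
    by (simp add: dft_def)
qed

lemma dft_comp1: "dft (\<lambda>e. F (e 0)) \<Longrightarrow> dft t \<Longrightarrow> dft (\<lambda>e. F (t e))"
  by (rule dft_comp)

lemma dft_comp2:
  assumes "dft (\<lambda>e. F (e 0) (e 1))" "dft t" "dft u" shows "dft (\<lambda>e. F (t e) (u e))"
proof (rule dft_comp[OF _ assms(2)])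
  have "dfn (\<lambda>e. F (e 1) (e 2) = e 0)"
    using assms(1) by (simp add: dft_def numeral_2_eq_2)
  then have "dfn (\<lambda>e. F (e 2) (e 1) = e 0)"
    by (drule_tac dfn_ren[of "\<lambda>n. if n = 2 then 1 else if n = 1 then 2 else n", rotated])
       (auto simp: inj_def)
  then have "dft (\<lambda>e. F (e (Suc 0)) (e 0))" by (simp add: dft_def numeral_2_eq_2)
  then show "dft (\<lambda>e. F (e 0) (u (\<lambda>n. e (Suc n))))"
    using dft_comp[of "\<lambda>y e. F (e 0) y", OF _ dft_shift[OF assms(3)]] by simp
qed

lemma dfn_comp1: "dfn (\<lambda>e. P (e 0)) \<Longrightarrow> dft t \<Longrightarrow> dfn (\<lambda>e. P (t e))"
  by (rule dfn_comp)

lemma dfn_comp3: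
  assumes "dfn (\<lambda>e. R (e 0) (e 1) (e 2))" "dft t" "dft u" "dft v"
  shows "dfn (\<lambda>e. R (t e) (u e) (v e))"
proof (rule dfn_comp[OF _ assms(2)])
  have "dfn (\<lambda>e. R (e 2) (e 0) (e 1))"
    using dfn_ren[of "\<lambda>n. if n = 0 then 2 else if n = 1 then 0 else if n = 2 then 1 else n", OF _ assms(1)]
    by (auto simp: inj_def)
  then have "dfn (\<lambda>e. R (e (Suc 0)) (e 0) (v (\<lambda>n. e (Suc (Suc n)))))"
  proof -
    have 1: "dfn (\<lambda>e. R (e 2) (e 1) (e 0))"
      using dfn_ren[of "\<lambda>n. if n = 0 then 2 else if n = 2 then 0 else n", OF _ assms(1)]
      by (auto simp: inj_def)
    show ?thesis
      by (rule dfn_comp[of "\<lambda>y e. R (e (Suc 0)) (e 0) y"])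
         (use 1 in \<open>simp add: numeral_2_eq_2\<close>, intro dft_shift assms)
  qed
  then show "dfn (\<lambda>e. R (e 0) (u (\<lambda>n. e (Suc n))) (v (\<lambda>n. e (Suc n))))"
    using dfn_comp[of "\<lambda>y e. R (e 0) y (v (\<lambda>n. e (Suc n)))", OF _ dft_shift[OF assms(3)]] by simp
qed

lemma dfn_Ball [dfn_intros]:
  "dfn (\<lambda>e. e 0 \<in> A (\<lambda>n. e (Suc n))) \<Longrightarrow> dfn (\<lambda>e. P (e 0) (\<lambda>n. e (Suc n)))
    \<Longrightarrow> dfn (\<lambda>e. \<forall>x\<in>A e. P x e)"
  unfolding Ball_def by (intro dfn_intros)

lemma dfn_Bex [dfn_intros]:
  "dfn (\<lambda>e. e 0 \<in> A (\<lambda>n. e (Suc n))) \<Longrightarrow> dfn (\<lambda>e. P (e 0) (\<lambda>n. e (Suc n)))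
    \<Longrightarrow> dfn (\<lambda>e. \<exists>x\<in>A e. P x e)"
  unfolding Bex_def by (intro dfn_intros)

lemma dfn_Collect [dfn_intros]: "dfn (\<lambda>e. P (t e) e) \<Longrightarrow> dfn (\<lambda>e. t e \<in> {x. P x e})"
  by simp

lemma dfn_Un [dfn_intros]:
  "dfn (\<lambda>e. t e \<in> A e) \<Longrightarrow> dfn (\<lambda>e. t e \<in> B e) \<Longrightarrow> dfn (\<lambda>e. t e \<in> A e \<union> B e)"
  unfolding Un_iff by (intro dfn_intros)

lemma dfn_subset [dfn_intros]:
  "dfn (\<lambda>e. e 0 \<in> A (\<lambda>n. e (Suc n))) \<Longrightarrow> dfn (\<lambda>e. e 0 \<in> B (\<lambda>n. e (Suc n)))
    \<Longrightarrow> dfn (\<lambda>e. A e \<subseteq> B e)"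
  unfolding subset_eq by (intro dfn_intros)

lemma dft_if [dfn_intros]:
  assumes "dfn P" "dft t" "dft u" shows "dft (\<lambda>e. if P e then t e else u e)"
proof -
  have "dfn (\<lambda>e. P (\<lambda>n. e (Suc n)))" using assms(1) dfn_ren[of Suc P] by simp
  then have "dfn (\<lambda>e. (P (\<lambda>n. e (Suc n)) \<longrightarrow> t (\<lambda>n. e (Suc n)) = e 0) \<and>
      (\<not> P (\<lambda>n. e (Suc n)) \<longrightarrow> u (\<lambda>n. e (Suc n)) = e 0))"
    using assms by (intro dfn_intros dft_shift)
  then show ?thesis unfolding dft_def by (rule dfn_cong[THEN iffD1, rotated]) auto
qed

end

section \<open>Sets inside a model of ZFC\<close>

locale zfc = model E for E :: "'a \<Rightarrow> 'a \<Rightarrow> bool" +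
  assumes ZFC: "ZFC E"
begin

lemmas ext_ax = ZFC[unfolded ZFC_def, THEN conjunct1]
lemmas found_ax = ZFC[unfolded ZFC_def, THEN conjunct2, THEN conjunct1]
lemmas pair_ax = ZFC[unfolded ZFC_def, THEN conjunct2, THEN conjunct2, THEN conjunct1]
lemmas axs4 = ZFC[unfolded ZFC_def, THEN conjunct2, THEN conjunct2, THEN conjunct2]
lemmas union_ax = axs4[THEN conjunct1]
lemmas pow_ax = axs4[THEN conjunct2, THEN conjunct1]
lemmas inf_ax = axs4[THEN conjunct2, THEN conjunct2, THEN conjunct1]
lemmas axs7 = axs4[THEN conjunct2, THEN conjunct2, THEN conjunct2]
lemmas choice_ax = axs7[THEN conjunct1]
lemmas sep_ax = axs7[THEN conjunct2, THEN conjunct1]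
lemmas repl_ax = axs7[THEN conjunct2, THEN conjunct2]

definition els :: "'a \<Rightarrow> 'a set" where "els a = {x. E x a}"

text \<open>HOL sets stand for classes. Those with \<open>isset\<close> are sets of the model and
  can be moved back and forth by \<open>code\<close> and \<open>els\<close>.\<close>

definition isset :: "'a set \<Rightarrow> bool" where "isset A \<longleftrightarrow> (\<exists>a. els a = A)"

definition code :: "'a set \<Rightarrow> 'a" where "code A = (THE a. els a = A)"

lemma mem_els [simp]: "x \<in> els a \<longleftrightarrow> E x a" by (simp add: els_def)

lemma els_inject: "els a = els b \<longleftrightarrow> a = b"
  using ext_ax unfolding els_def by blast

lemma extensionality: "(\<And>x. E x a \<longleftrightarrow> E x b) \<Longrightarrow> a = b"
  using els_inject[of a b] by auto

lemma isset_els [simp, intro]: "isset (els a)" by (auto simp: isset_def)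

lemma code_els [simp]: "code (els a) = a" by (simp add: code_def els_inject)

lemma els_code [simp]: "isset A \<Longrightarrow> els (code A) = A" by (auto simp: isset_def)

lemma mem_code [simp]: "isset A \<Longrightarrow> E x (code A) \<longleftrightarrow> x \<in> A"
  using els_code[of A] by (metis mem_els)

lemma foundation: "E y x \<Longrightarrow> \<exists>y. E y x \<and> \<not> (\<exists>z. E z y \<and> E z x)"
  using found_ax by blast

lemma issetI: "\<forall>x. E x a \<longleftrightarrow> x \<in> A \<Longrightarrow> isset A"
  by (auto simp: isset_def els_def)

lemma isset_pair [simp, intro]: "isset {x, y}"
proof -
  obtain z where "\<forall>u. E u z \<longleftrightarrow> u = x \<or> u = y" using pair_ax by blast
  then show ?thesis by (auto intro: issetI)
qed

lemma isset_single [simp, intro]: "isset {x}" using isset_pair[of x x] by simp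

lemma isset_Union: assumes "isset A" shows "isset (\<Union>x\<in>A. els x)"
proof -
  obtain z where "\<forall>u. E u z \<longleftrightarrow> (\<exists>y. E y (code A) \<and> E u y)"
    using union_ax by blast
  then show ?thesis using assms by (auto intro!: issetI)
qed

lemma isset_Pow [simp, intro]: assumes "isset A" shows "isset {x. els x \<subseteq> A}"
proof -
  obtain z where "\<forall>u. E u z \<longleftrightarrow> (\<forall>v. E v u \<longrightarrow> E v (code A))"
    using pow_ax by blast
  then show ?thesis using assms by (intro issetI[of z]) auto
qed

lemma isset_sep: assumes "isset A" "dfn (\<lambda>e. P (e 0))" shows "isset {x \<in> A. P x}"
proof -
  obtain \<phi> d where 1: "\<And>e. P (e 0) \<longleftrightarrow> sat E \<phi> (ilv e d)" using assms(2) by (auto simp: dfn_def)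
  obtain b where b: "\<forall>x. E x b \<longleftrightarrow> E x (code A) \<and> sat E \<phi> ((ilv undefined d)(0 := x))"
    using sep_ax by blast
  have "(ilv undefined d)(0 := x) = ilv (undefined(0 := x)) d" for x
    by (auto simp: ilv_def fun_eq_iff)
  then have "sat E \<phi> ((ilv undefined d)(0 := x)) \<longleftrightarrow> P x" for x
    using 1[of "undefined(0 := x)"] by simp
  with b show ?thesis using assms(1) by (auto intro!: issetI)
qed

lemma isset_subset: "isset A \<Longrightarrow> B \<subseteq> A \<Longrightarrow> dfn (\<lambda>e. e 0 \<in> B) \<Longrightarrow> isset B"
  using isset_sep[of A "\<lambda>x. x \<in> B"] by (simp add: Collect_conj_eq Int_absorb1)

lemma isset_replace:
  assumes "isset A" "dfn (\<lambda>e. R (e 0) (e 1))" "\<And>x. x \<in> A \<Longrightarrow> \<exists>!y. R x y"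
  shows "isset {y. \<exists>x\<in>A. R x y}"
proof -
  obtain \<phi> d where 1: "\<And>e. R (e 0) (e 1) \<longleftrightarrow> sat E \<phi> (ilv e d)" using assms(2) by (auto simp: dfn_def)
  \<comment> \<open>The schema expects the two variables at indices 0 and 1, whereas
    \<open>ilv\<close> keeps the second one at index 2.\<close>
  let ?f = "\<lambda>n::nat. if n = 1 then 2 else if n = 2 then 1 else n"
  have f: "inj ?f" by (auto simp: inj_def)
  let ?e = "\<lambda>n. ilv undefined d (?f n)"
  have ax: "(\<forall>x. E x a \<longrightarrow> (\<exists>!y. sat E \<phi> (e(0 := x, 1 := y))))
       \<longrightarrow> (\<exists>b. \<forall>y. E y b \<longleftrightarrow> (\<exists>x. E x a \<and> sat E \<phi> (e(0 := x, 1 := y))))" for \<phi> e a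
    using repl_ax by blast
  have "(\<lambda>n. (?e(0 := x, 1 := y)) (?f n)) = ilv (undefined(0 := x, 1 := y)) d" for x y
    by (auto simp: ilv_def fun_eq_iff)
  then have 2: "sat E (ren ?f \<phi>) (?e(0 := x, 1 := y)) \<longleftrightarrow> R x y" for x y
    unfolding sat_ren[OF f] using 1[of "undefined(0 := x, 1 := y)"] by simp
  obtain b where "\<forall>y. E y b \<longleftrightarrow> (\<exists>x. E x (code A) \<and> R x y)"
    using ax[of "code A" "ren ?f \<phi>" ?e] assms(1,3) unfolding 2 by auto
  then show ?thesis using assms(1) by (intro issetI[of b]) auto
qed

lemma isset_image:
  assumes "isset A" "dft (\<lambda>e. F (e 0))" shows "isset (F ` A)"
proof -
  have "isset {y. \<exists>x\<in>A. F x = y}"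
    using assms by (intro isset_replace dfn_intros dft_comp1[OF assms(2)]) auto
  moreover have "{y. \<exists>x\<in>A. F x = y} = F ` A" by auto
  ultimately show ?thesis by simp
qed

lemma dfn_els [dfn_intros]: "dft t \<Longrightarrow> dft u \<Longrightarrow> dfn (\<lambda>e. t e \<in> els (u e))"
  unfolding mem_els by (intro dfn_intros)

text \<open>Whatever the HOL description of \<open>A\<close>, membership in it is membership in the
  single parameter \<open>code A\<close>.\<close>

lemma dfn_in_set: assumes "isset A" "dft t" shows "dfn (\<lambda>e. t e \<in> A)"
proof -
  have "dfn (\<lambda>e. E (t e) (code A))" by (intro dfn_intros assms)
  then show ?thesis using assms by simp
qed

lemma dft_code:
  assumes "\<And>e. isset (A e)" "dfn (\<lambda>e. e 0 \<in> A (\<lambda>n. e (Suc n)))"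
  shows "dft (\<lambda>e. code (A e))"
proof -
  have "dfn (\<lambda>e. e 0 \<in> A (\<lambda>n. e (Suc (Suc n))))"
    using dfn_ren[of "case_nat 0 (\<lambda>n. Suc (Suc n))", OF _ assms(2)]
    by (auto simp: inj_def split: nat.splits)
  then have "dfn (\<lambda>e. \<forall>x. E x (e 0) \<longleftrightarrow> x \<in> A (\<lambda>n. e (Suc n)))"
    by (intro dfn_intros)
  moreover have "(\<forall>x. E x y \<longleftrightarrow> x \<in> A e) \<longleftrightarrow> code (A e) = y" for y e
    using assms(1)[of e] by (metis extensionality mem_code)
  ultimately show ?thesis unfolding dft_def by simp
qed

lemma isset_UN:
  assumes "isset A" "\<And>x. isset (B x)" "dfn (\<lambda>e. e 0 \<in> B (e 1))"
  shows "isset (\<Union>x\<in>A. B x)"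
proof -
  have "dft (\<lambda>e. code (B (e 0)))" using assms by (intro dft_code) auto
  then have "isset (\<Union>y\<in>(\<lambda>x. code (B x)) ` A. els y)"
    using assms by (intro isset_Union isset_image) auto
  then show ?thesis using assms by simp
qed

lemma isset_empty [simp, intro]: "isset {}"
  using isset_sep[OF isset_single, of "\<lambda>_. False"] dfn_closed by simp

lemma isset_Un [simp, intro]: assumes "isset A" "isset B" shows "isset (A \<union> B)"
proof -
  have "isset (\<Union>x\<in>{code A, code B}. els x)" by (intro isset_Union) auto
  then show ?thesis using assms by simp
qed

lemma isset_insert [simp, intro]: "isset A \<Longrightarrow> isset (insert x A)"
  using isset_Un[of "{x}" A] by simp

lemma isset_Diff [simp, intro]: "isset A \<Longrightarrow> isset B \<Longrightarrow> isset (A - B)"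
  by (rule isset_subset[of A]) (auto intro!: dfn_intros dfn_in_set)

definition emp :: 'a where "emp = code {}"

lemma mem_emp [simp]: "\<not> E x emp" by (simp add: emp_def)

lemma emp_eq: "(\<And>x. \<not> E x a) \<Longrightarrow> a = emp" by (rule extensionality) simp

definition upr :: "'a \<Rightarrow> 'a \<Rightarrow> 'a" where "upr x y = code {x, y}"

definition pr :: "'a \<Rightarrow> 'a \<Rightarrow> 'a" where "pr x y = upr (upr x x) (upr x y)"

lemma mem_upr [simp]: "E z (upr x y) \<longleftrightarrow> z = x \<or> z = y" by (simp add: upr_def)

lemma upr_eq: "upr x y = upr u v \<longleftrightarrow> (x = u \<and> y = v) \<or> (x = v \<and> y = u)"
proof
  assume "upr x y = upr u v"
  then have "\<forall>z. z = x \<or> z = y \<longleftrightarrow> z = u \<or> z = v" using mem_upr by metis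
  then show "(x = u \<and> y = v) \<or> (x = v \<and> y = u)" by metis
qed (auto intro: extensionality)

lemma pr_inject [simp]: "pr x y = pr u v \<longleftrightarrow> x = u \<and> y = v"
  by (auto simp: pr_def upr_eq)

lemma mem_pr: "E z (pr x y) \<longleftrightarrow> z = upr x x \<or> z = upr x y" by (simp add: pr_def)

lemma dft_upr [dfn_intros]: "dft t \<Longrightarrow> dft u \<Longrightarrow> dft (\<lambda>e. upr (t e) (u e))"
  unfolding upr_def
proof (rule dft_code)
  show "dft t \<Longrightarrow> dft u \<Longrightarrow> dfn (\<lambda>e. e 0 \<in> {t (\<lambda>n. e (Suc n)), u (\<lambda>n. e (Suc n))})"
    unfolding insert_iff empty_iff by (intro dfn_intros dft_shift)
qed simp

lemma dft_pr [dfn_intros]: "dft t \<Longrightarrow> dft u \<Longrightarrow> dft (\<lambda>e. pr (t e) (u e))"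
  unfolding pr_def by (intro dfn_intros)

definition vprod :: "'a set \<Rightarrow> 'a set \<Rightarrow> 'a set" where
  "vprod A B = {pr x y |x y. x \<in> A \<and> y \<in> B}"

lemma pr_mem_vprod [simp]: "pr x y \<in> vprod A B \<longleftrightarrow> x \<in> A \<and> y \<in> B"
  by (auto simp: vprod_def)

lemma vprodE [elim!]: "z \<in> vprod A B \<Longrightarrow> (\<And>x y. z = pr x y \<Longrightarrow> x \<in> A \<Longrightarrow> y \<in> B \<Longrightarrow> thesis) \<Longrightarrow> thesis"
  by (auto simp: vprod_def)

lemma isset_vprod [simp, intro]: assumes "isset A" "isset B" shows "isset (vprod A B)"
proof -
  have "isset (pr x ` B)" for x using assms by (intro isset_image dfn_intros)
  then have "isset (\<Union>x\<in>A. pr x ` B)"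
    using assms by (intro isset_UN) (auto simp: image_iff intro!: dfn_intros dfn_in_set)
  moreover have "(\<Union>x\<in>A. pr x ` B) = vprod A B" by (auto simp: vprod_def)
  ultimately show ?thesis by simp
qed

lemma dfn_vprod [dfn_intros]:
  assumes "dfn (\<lambda>e. e 0 \<in> A (\<lambda>n. e (Suc n)))" "dfn (\<lambda>e. e 0 \<in> B (\<lambda>n. e (Suc n)))" "dft t"
  shows "dfn (\<lambda>e. t e \<in> vprod (A e) (B e))"
proof -
  have "dfn (\<lambda>e. e 0 \<in> A (\<lambda>n. e (Suc (Suc n))))"
    using dfn_ren[of "case_nat 0 (\<lambda>n. Suc (Suc n))", OF _ assms(1)]
    by (auto simp: inj_def split: nat.splits)
  then have "dfn (\<lambda>e. e (Suc 0) \<in> A (\<lambda>n. e (Suc (Suc n))))"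
    by (drule_tac dfn_ren[of "case_nat 1 (case_nat 0 (\<lambda>n. Suc (Suc n)))", rotated])
      (auto simp: inj_def split: nat.splits)
  moreover have "dfn (\<lambda>e. e 0 \<in> B (\<lambda>n. e (Suc (Suc n))))"
    using dfn_ren[of "case_nat 0 (\<lambda>n. Suc (Suc n))", OF _ assms(2)]
    by (auto simp: inj_def split: nat.splits)
  ultimately have "dfn (\<lambda>e. \<exists>x y. t e = pr x y \<and> x \<in> A e \<and> y \<in> B e)"
    by (intro dfn_intros dft_shift assms(3))
  then show ?thesis by (simp add: vprod_def)
qed

section \<open>Functions\<close>

text \<open>A definite description with default \<open>emp\<close>: unlike the unspecified value of
  \<open>THE\<close>, the default keeps the function definable where there is no unique
  value.\<close>

definition vthe :: "('a \<Rightarrow> bool) \<Rightarrow> 'a" where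
  "vthe P = (if \<exists>!y. P y then THE y. P y else emp)"

lemma vthe_eq: "P y \<Longrightarrow> (\<And>z. P z \<Longrightarrow> z = y) \<Longrightarrow> vthe P = y"
  unfolding vthe_def by (subst if_P, blast, rule the_equality, blast+)

lemma vthe_iff: "vthe P = y \<longleftrightarrow> (if \<exists>!y. P y then P y else emp = y)"
proof (cases "\<exists>!y. P y")
  case True
  then obtain z where z: "P z" "\<And>x. P x \<Longrightarrow> x = z" by blast
  then have "vthe P = z" by (rule vthe_eq)
  moreover have "P y \<longleftrightarrow> z = y" using z by blast
  ultimately show ?thesis unfolding if_P[OF True] by simp
next
  case False
  then show ?thesis unfolding vthe_def by (simp only: if_False)
qed

lemma vthe_holds: "\<exists>!y. P y \<Longrightarrow> P (vthe P)"
  using vthe_iff[of P "vthe P"] by (metis (no_types))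

lemma dft_vthe [dfn_intros]:
  assumes "dfn (\<lambda>e. P (e 0) (\<lambda>n. e (Suc n)))" shows "dft (\<lambda>e. vthe (\<lambda>y. P y e))"
proof -
  have 1: "dfn (\<lambda>e. P (e 0) (\<lambda>n. e (Suc (Suc n))))"
    using dfn_ren[of "case_nat 0 (\<lambda>n. Suc (Suc n))", OF _ assms]
    by (auto simp: inj_def split: nat.splits)
  have "dfn (\<lambda>e. if \<exists>!y. P y (\<lambda>n. e (Suc n)) then P (e 0) (\<lambda>n. e (Suc n)) else emp = e 0)"
    unfolding if_bool_eq_conj by (intro dfn_intros 1 assms)
  then show ?thesis unfolding dft_def vthe_iff .
qed

definition app :: "'a \<Rightarrow> 'a \<Rightarrow> 'a" where "app f x = vthe (\<lambda>y. E (pr x y) f)"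

lemma dft_app [dfn_intros]: "dft t \<Longrightarrow> dft u \<Longrightarrow> dft (\<lambda>e. app (t e) (u e))"
  unfolding app_def by (intro dfn_intros dft_shift)

definition lam :: "'a set \<Rightarrow> ('a \<Rightarrow> 'a) \<Rightarrow> 'a" where "lam A F = code ((\<lambda>x. pr x (F x)) ` A)"

lemma isset_lam: "isset A \<Longrightarrow> dft (\<lambda>e. F (e 0)) \<Longrightarrow> isset ((\<lambda>x. pr x (F x)) ` A)"
  by (intro isset_image dfn_intros)

lemma mem_lam: "isset A \<Longrightarrow> dft (\<lambda>e. F (e 0)) \<Longrightarrow> E z (lam A F) \<longleftrightarrow> (\<exists>x\<in>A. z = pr x (F x))"
  unfolding lam_def by (subst mem_code[OF isset_lam]) auto

lemma app_lam [simp]: "isset A \<Longrightarrow> dft (\<lambda>e. F (e 0)) \<Longrightarrow> x \<in> A \<Longrightarrow> app (lam A F) x = F x"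
  unfolding app_def by (rule vthe_eq) (auto simp: mem_lam)

lemma lam_cong: "(\<And>x. x \<in> A \<Longrightarrow> F x = G x) \<Longrightarrow> lam A F = lam A G"
  unfolding lam_def by (metis (mono_tags, lifting) image_cong)

lemma dft_lam:
  assumes "\<And>e. isset (A e)" "dfn (\<lambda>e. e 0 \<in> A (\<lambda>n. e (Suc n)))"
    "\<And>e. dft (\<lambda>e'. F (e' 0) e)" "dft (\<lambda>e. F (e 0) (\<lambda>n. e (Suc n)))"
  shows "dft (\<lambda>e. lam (A e) (\<lambda>x. F x e))"
  unfolding lam_def
proof (rule dft_code)
  show "isset ((\<lambda>x. pr x (F x e)) ` A e)" for e using assms by (intro isset_lam) auto
  have 1: "dfn (\<lambda>e. e 0 \<in> A (\<lambda>n. e (Suc (Suc n))))"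
    using dfn_ren[of "case_nat 0 (\<lambda>n. Suc (Suc n))", OF _ assms(2)]
    by (auto simp: inj_def split: nat.splits)
  have "dfn (\<lambda>e. F (e 1) (\<lambda>n. e (Suc (Suc n))) = e 0)" using assms(4) by (simp add: dft_def)
  then have "dfn (\<lambda>e. F (e (Suc 0)) (\<lambda>n. e (Suc (Suc (Suc n)))) = e 0)"
    by (drule_tac dfn_ren[of "case_nat 0 (case_nat 1 (\<lambda>n. Suc (Suc (Suc n))))", rotated])
      (auto simp: inj_def split: nat.splits)
  then have 2: "dft (\<lambda>e. F (e 0) (\<lambda>n. e (Suc (Suc n))))" by (simp add: dft_def)
  have "dfn (\<lambda>e. \<exists>x\<in>A (\<lambda>n. e (Suc n)). e 0 = pr x (F x (\<lambda>n. e (Suc n))))"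
    by (intro dfn_intros 1 2)
  then show "dfn (\<lambda>e. e 0 \<in> (\<lambda>x. pr x (F x (\<lambda>n. e (Suc n)))) ` A (\<lambda>n. e (Suc n)))"
    by (simp add: image_iff)
qed

text \<open>The axiom chooses from families of disjoint nonempty sets. The sets \<open>S x\<close>
  are made disjoint by pairing with \<open>x\<close>, and a transversal cut down to these pairs is
  the graph of a choice function.\<close>

lemma vchoice:
  assumes A: "isset A" and B: "isset B" and R: "dfn (\<lambda>e. R (e 0) (e 1))"
    and ex: "\<And>x. x \<in> A \<Longrightarrow> \<exists>y\<in>B. R x y"
  shows "\<exists>f. \<forall>x\<in>A. app f x \<in> B \<and> R x (app f x)"
proof -
  have R': "dft t \<Longrightarrow> dft u \<Longrightarrow> dfn (\<lambda>e. R (t e) (u e))" for t u by (rule dfn_comp2[OF R])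
  define S where "S x = {z \<in> vprod {x} B. \<exists>y. z = pr x y \<and> R x y}" for x
  have S: "isset (S x)" for x unfolding S_def
    using B by (intro isset_sep dfn_intros R') auto
  have Sd: "dft (\<lambda>e. code (S (e 0)))"
    by (intro dft_code S) (auto simp: S_def intro!: dfn_intros R' dfn_in_set B)
  define F where "F = code ((\<lambda>x. code (S x)) ` A)"
  have F: "E u F \<longleftrightarrow> (\<exists>x\<in>A. u = code (S x))" for u
    unfolding F_def by (subst mem_code[OF isset_image[OF A Sd]]) auto
  have mS: "E z (code (S x)) \<longleftrightarrow> (\<exists>y\<in>B. z = pr x y \<and> R x y)" for z x
    unfolding mem_code[OF S] by (auto simp: S_def)
  have ch: "(\<forall>y. E y x \<longrightarrow> (\<exists>u. E u y)) \<and>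
         (\<forall>y z u. E y x \<and> E z x \<and> E u y \<and> E u z \<longrightarrow> y = z)
       \<longrightarrow> (\<exists>c. \<forall>y. E y x \<longrightarrow> (\<exists>!u. E u y \<and> E u c))" for x
    using choice_ax by blast
  have "\<forall>y. E y F \<longrightarrow> (\<exists>u. E u y)" using ex by (auto simp: F mS) blast
  moreover have "\<forall>y z u. E y F \<and> E z F \<and> E u y \<and> E u z \<longrightarrow> y = z" by (auto simp: F mS)
  ultimately obtain c where c: "\<And>y. E y F \<Longrightarrow> \<exists>!u. E u y \<and> E u c" using ch by blast
  define f where "f = code {z \<in> els c. \<exists>x\<in>A. \<exists>y\<in>B. z = pr x y \<and> R x y}"
  have f: "E z f \<longleftrightarrow> E z c \<and> (\<exists>x\<in>A. \<exists>y\<in>B. z = pr x y \<and> R x y)" for z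
    unfolding f_def
    by (subst mem_code, intro isset_sep dfn_intros dfn_in_set A B R' isset_els) simp
  have "app f x \<in> B \<and> R x (app f x)" if x: "x \<in> A" for x
  proof -
    have "E (code (S x)) F" using x by (auto simp: F)
    from c[OF this] obtain u where u: "E u (code (S x))" "E u c"
      "\<And>v. E v (code (S x)) \<Longrightarrow> E v c \<Longrightarrow> v = u" by blast
    obtain y where y: "u = pr x y" "R x y" "y \<in> B" using u(1) mS by blast
    have "app f x = y" unfolding app_def
    proof (rule vthe_eq)
      show "E (pr x y) f" unfolding f using u(2) y x by blast
      fix z assume "E (pr x z) f"
      then have "E (pr x z) c" "z \<in> B" "R x z" unfolding f by auto
      then have "pr x z = u" using u(3)[of "pr x z"] mS by blast
      then show "z = y" using y(1) by simp
    qed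
    then show ?thesis using y by simp
  qed
  then show ?thesis by blast
qed

section \<open>Reading the basic notions in the model\<close>

lemma holds_sub [simp]: "holds E (x \<^bold>\<subseteq> y) \<longleftrightarrow> els x \<subseteq> els y"
  by (auto simp: sub_def)

lemma holds_is_upair [simp]: "holds E (is_upair z x y) \<longleftrightarrow> z = upr x y"
  by (auto simp: is_upair_def intro: extensionality)

lemma holds_is_pair [simp]: "holds E (is_pair z x y) \<longleftrightarrow> z = pr x y"
  by (auto simp: is_pair_def pr_def)

lemma holds_rel [simp]: "holds E (rel r x y) \<longleftrightarrow> E (pr x y) r"
  by (auto simp: rel_def)

definition Trans :: "'a \<Rightarrow> bool" where "Trans x \<longleftrightarrow> (\<forall>y\<in>els x. els y \<subseteq> els x)"

lemma holds_trans_set [simp]: "holds E (trans_set x) \<longleftrightarrow> Trans x"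
  by (auto simp: trans_set_def Trans_def)

lemma dfn_Trans [dfn_intros]: "dft t \<Longrightarrow> dfn (\<lambda>e. Trans (t e))"
  unfolding Trans_def by (intro dfn_intros dft_shift)

definition Ord :: "'a \<Rightarrow> bool" where "Ord x \<longleftrightarrow> Trans x \<and> (\<forall>y\<in>els x. Trans y)"

lemma holds_ordinal [simp]: "holds E (ordinal x) \<longleftrightarrow> Ord x"
  by (auto simp: ordinal_def Ord_def)

lemma dfn_Ord [dfn_intros]: "dft t \<Longrightarrow> dfn (\<lambda>e. Ord (t e))"
  unfolding Ord_def by (intro dfn_intros dft_shift)

lemma holds_is_fun:
  "holds E (is_fun f a b) \<longleftrightarrow> els f \<subseteq> vprod (els a) (els b) \<and> (\<forall>x\<in>els a. \<exists>!y. E (pr x y) f)"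
proof -
  have 1: "(\<forall>z. E z f \<longrightarrow> (\<exists>x y. E x a \<and> E y b \<and> z = pr x y)) \<longleftrightarrow> els f \<subseteq> vprod (els a) (els b)"
    unfolding vprod_def subset_eq mem_els Ball_def mem_Collect_eq by metis
  have 2: "(\<exists>y. E (pr x y) f \<and> (\<forall>y'. E (pr x y') f \<longrightarrow> y' = y)) \<longleftrightarrow> (\<exists>!y. E (pr x y) f)" for x
    unfolding Ex1_def ..
  show ?thesis unfolding is_fun_def holds.simps holds_derived holds_is_pair holds_rel 1 2 Ball_def mem_els ..
qed

text \<open>Comparing sizes by definable class functions avoids coding graphs and allows plain
  composition; \<open>holds_ex_inj\<close> shows that on sets nothing changes.\<close>

definition vinj :: "'a set \<Rightarrow> 'a set \<Rightarrow> bool" where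
  "vinj A B \<longleftrightarrow> (\<exists>F. dft (\<lambda>e. F (e 0)) \<and> F ` A \<subseteq> B \<and> inj_on F A)"

lemma holds_ex_inj: "(\<exists>f. holds E (is_inj f a b)) \<longleftrightarrow> vinj (els a) (els b)"
proof
  assume "\<exists>f. holds E (is_inj f a b)"
  then obtain f where f: "els f \<subseteq> vprod (els a) (els b)" "\<forall>x\<in>els a. \<exists>!y. E (pr x y) f"
    "\<And>x x' y. E (pr x y) f \<Longrightarrow> E (pr x' y) f \<Longrightarrow> x = x'"
    by (auto simp: is_inj_def holds_is_fun) blast
  have app: "E (pr x (app f x)) f" if "E x a" for x
    unfolding app_def using vthe_holds[of "\<lambda>y. E (pr x y) f"] f(2) that by (metis mem_els)
  show "vinj (els a) (els b)" unfolding vinj_def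
  proof (intro exI[of _ "app f"] conjI)
    show "dft (\<lambda>e. app f (e 0))" by (intro dfn_intros)
    show "app f ` els a \<subseteq> els b"
    proof
      fix y assume "y \<in> app f ` els a"
      then obtain x where "E x a" "y = app f x" by auto
      then have "pr x y \<in> els f" using app by simp
      then show "y \<in> els b" using f(1) by auto
    qed
    show "inj_on (app f) (els a)"
      using app f(3) by (metis inj_onI mem_els)
  qed
next
  assume "vinj (els a) (els b)"
  then obtain F where F: "dft (\<lambda>e. F (e 0))" "F ` els a \<subseteq> els b" "inj_on F (els a)"
    by (auto simp: vinj_def)
  have "holds E (is_inj (lam (els a) F) a b)"
    using F by (auto simp: is_inj_def holds_is_fun mem_lam inj_on_def subset_eq)
  then show "\<exists>f. holds E (is_inj f a b)" by blast
qed

lemma vinj_trans: assumes "vinj A B" "vinj B C" shows "vinj A C"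
proof -
  obtain F G where "dft (\<lambda>e. F (e 0))" "F ` A \<subseteq> B" "inj_on F A"
    and "dft (\<lambda>e. G (e 0))" "G ` B \<subseteq> C" "inj_on G B" using assms by (auto simp: vinj_def)
  then show ?thesis unfolding vinj_def
    by (intro exI[of _ "\<lambda>x. G (F x)"]) (auto intro: dft_comp1 simp: inj_on_def subset_eq)
qed

lemma vinj_subset: "A \<subseteq> B \<Longrightarrow> vinj A B"
  unfolding vinj_def by (intro exI[of _ "\<lambda>x. x"]) (auto intro: dfn_intros)

lemma holds_cardinal: "holds E (cardinal k) \<longleftrightarrow> Ord k \<and> (\<forall>a\<in>els k. \<not> vinj (els k) (els a))"
  by (auto simp: cardinal_def holds_ex_inj[symmetric])

lemma holds_smaller: "holds E (smaller x k) \<longleftrightarrow> (\<exists>a\<in>els k. vinj (els x) (els a))"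
  by (auto simp: smaller_def holds_ex_inj[symmetric])

end

context zfc begin

section \<open>Induction and recursion\<close>

lemma TransD: "Trans t \<Longrightarrow> E y t \<Longrightarrow> E z y \<Longrightarrow> E z t"
  by (auto simp: Trans_def subset_iff)

lemma TransI: "(\<And>y z. E y t \<Longrightarrow> E z y \<Longrightarrow> E z t) \<Longrightarrow> Trans t"
  by (auto simp: Trans_def subset_iff)

definition vsucc :: "'a \<Rightarrow> 'a" where "vsucc y = code (insert y (els y))"

lemma mem_vsucc [simp]: "E x (vsucc y) \<longleftrightarrow> x = y \<or> E x y"
  by (simp add: vsucc_def)

lemma dft_vsucc [dfn_intros]: assumes "dft t" shows "dft (\<lambda>e. vsucc (t e))"
  unfolding vsucc_def
  by (rule dft_code, simp) (unfold insert_iff, intro dfn_intros dft_shift assms)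

lemma no_2_cycle: "E x y \<Longrightarrow> \<not> E y x"
  using foundation[of x "upr x y"] by auto

lemma mem_irrefl [simp]: "\<not> E x x" using no_2_cycle by blast

lemma vsucc_inject [simp]: "vsucc n = vsucc m \<longleftrightarrow> n = m"
  by (metis mem_vsucc no_2_cycle)

lemma vsucc_not_emp [simp]: "vsucc n \<noteq> emp" "emp \<noteq> vsucc n"
  by (metis mem_vsucc mem_emp)+

text \<open>\<open>W\<close> is the least inductive set in the sense of the model. It may contain
  nonstandard elements, so induction along it is restricted to definable predicates.\<close>

lemma obtain_omega:
  obtains W where "isset W" "emp \<in> W" "\<And>n. n \<in> W \<Longrightarrow> vsucc n \<in> W"
    "\<And>P n. dfn (\<lambda>e. P (e 0)) \<Longrightarrow> P emp \<Longrightarrow> (\<And>n. n \<in> W \<Longrightarrow> P n \<Longrightarrow> P (vsucc n)) \<Longrightarrow> n \<in> W \<Longrightarrow> P n"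
proof -
  obtain I where "\<exists>n. E n I \<and> (\<forall>u. \<not> E u n)"
    "\<And>y. E y I \<Longrightarrow> \<exists>s. E s I \<and> (\<forall>u. E u s \<longleftrightarrow> E u y \<or> u = y)"
    using inf_ax by blast
  moreover have "(\<forall>u. E u s \<longleftrightarrow> E u y \<or> u = y) \<Longrightarrow> s = vsucc y" for s y
    by (rule extensionality) auto
  ultimately have I: "E emp I" "\<And>y. E y I \<Longrightarrow> E (vsucc y) I" using emp_eq by metis+
  define W where "W = {n \<in> els I. \<forall>J. E emp J \<and> (\<forall>y. E y J \<longrightarrow> E (vsucc y) J) \<longrightarrow> E n J}"
  have W: "isset W" unfolding W_def by (intro isset_sep isset_els dfn_intros)
  show thesis
  proof (rule that[of W, OF W])
    show "emp \<in> W" "\<And>n. n \<in> W \<Longrightarrow> vsucc n \<in> W" using I by (auto simp: W_def)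
    fix P n assume P: "dfn (\<lambda>e. P (e 0))" "P emp" "\<And>n. n \<in> W \<Longrightarrow> P n \<Longrightarrow> P (vsucc n)" and n: "n \<in> W"
    define J where "J = code {n \<in> W. P n}"
    have J: "E n J \<longleftrightarrow> n \<in> W \<and> P n" for n unfolding J_def
      by (subst mem_code[OF isset_sep[OF W P(1)]]) simp
    have "E emp J \<and> (\<forall>y. E y J \<longrightarrow> E (vsucc y) J)" using P I by (auto simp: J W_def)
    then have "E n J" using n by (auto simp: W_def)
    then show "P n" by (simp add: J)
  qed
qed

definition vUn :: "'a \<Rightarrow> 'a" where "vUn v = code (\<Union>y\<in>els v. els y)"

lemma mem_vUn [simp]: "E x (vUn v) \<longleftrightarrow> (\<exists>y. E y v \<and> E x y)"
  unfolding vUn_def by (subst mem_code[OF isset_Union]) auto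

lemma dft_vUn [dfn_intros]: assumes "dft t" shows "dft (\<lambda>e. vUn (t e))"
  unfolding vUn_def
  by (rule dft_code, simp add: isset_Union)
     (unfold UN_iff, intro dfn_intros dft_shift assms)

text \<open>The set wanted is the union of the iterated unions of {x}. The recursion theorem itself
  rests on this lemma, so the iterates are described by certificates: in a \<open>valid\<close> set
  \<open>f\<close> every pair is the initial one or is derived from another pair in
  \<open>f\<close>. Uniqueness of the n-th iterate follows by induction on \<open>n\<close>, and
  replacement collects the iterates.\<close>

lemma ex_Trans: "\<exists>t. Trans t \<and> E x t"
proof -
  obtain W where W: "isset W" "emp \<in> W" "\<And>n. n \<in> W \<Longrightarrow> vsucc n \<in> W"
    "\<And>P n. dfn (\<lambda>e. P (e 0)) \<Longrightarrow> P emp \<Longrightarrow> (\<And>n. n \<in> W \<Longrightarrow> P n \<Longrightarrow> P (vsucc n)) \<Longrightarrow> n \<in> W \<Longrightarrow> P n"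
    by (rule obtain_omega) blast
  define s where "s = upr x x"
  define valid where "valid f \<longleftrightarrow> (\<forall>z. E z f \<longrightarrow> z = pr emp s \<or> (\<exists>k v. E (pr k v) f \<and> z = pr (vsucc k) (vUn v)))" for f
  define A where "A n u \<longleftrightarrow> (\<exists>f. valid f \<and> E (pr n u) f)" for n u
  have dA: "dft t \<Longrightarrow> dft u \<Longrightarrow> dfn (\<lambda>e. A (t e) (u e))" for t u
    unfolding A_def valid_def by (intro dfn_intros dft_shift)
  have A0: "A emp s" unfolding A_def
    by (rule exI[of _ "upr (pr emp s) (pr emp s)"]) (auto simp: valid_def)
  have AS: "A (vsucc n) (vUn u)" if A: "A n u" for n u
  proof -
    obtain f where f: "valid f" "E (pr n u) f" using A by (auto simp: A_def)
    have m: "E z (code (insert (pr (vsucc n) (vUn u)) (els f))) \<longleftrightarrow> z = pr (vsucc n) (vUn u) \<or> E z f" for z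
      by simp
    show ?thesis unfolding A_def valid_def
      by (rule exI[of _ "code (insert (pr (vsucc n) (vUn u)) (els f))"])
         (use f in \<open>auto simp: m valid_def\<close>)
  qed
  have uniq: "\<forall>u v. A n u \<longrightarrow> A n v \<longrightarrow> u = v" if "n \<in> W" for n
  proof (rule W(4)[where P = "\<lambda>n. \<forall>u v. A n u \<longrightarrow> A n v \<longrightarrow> u = v", OF _ _ _ that])
    show "dfn (\<lambda>e. \<forall>u v. A (e 0) u \<longrightarrow> A (e 0) v \<longrightarrow> u = v)" by (intro dfn_intros dA)
    have "A emp u \<Longrightarrow> u = s" for u by (auto simp: A_def valid_def)
    then show "\<forall>u v. A emp u \<longrightarrow> A emp v \<longrightarrow> u = v" by blast
    fix n assume IH: "\<forall>u v. A n u \<longrightarrow> A n v \<longrightarrow> u = v"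
    have "\<exists>v. A n v \<and> u = vUn v" if "A (vsucc n) u" for u
    proof -
      obtain f where f: "valid f" "E (pr (vsucc n) u) f" using \<open>A (vsucc n) u\<close> by (auto simp: A_def)
      then obtain k v where "E (pr k v) f" "pr (vsucc n) u = pr (vsucc k) (vUn v)"
        unfolding valid_def using vsucc_not_emp by (metis pr_inject)
      then show ?thesis using f unfolding A_def by auto
    qed
    then show "\<forall>u v. A (vsucc n) u \<longrightarrow> A (vsucc n) v \<longrightarrow> u = v" using IH by blast
  qed
  have ex: "\<exists>u. A n u" if "n \<in> W" for n
    by (rule W(4)[where P = "\<lambda>n. \<exists>u. A n u", OF _ _ _ that])
       (use A0 AS in \<open>auto intro!: dfn_intros dA\<close>)
  have S: "isset {u. \<exists>n\<in>W. A n u}"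
    by (rule isset_replace[OF W(1)]) (use uniq ex in \<open>auto intro!: dA dfn_intros\<close>)
  define t where "t = code (\<Union>u\<in>{u. \<exists>n\<in>W. A n u}. els u)"
  have t: "E z t \<longleftrightarrow> (\<exists>u n. n \<in> W \<and> A n u \<and> E z u)" for z
    unfolding t_def by (subst mem_code[OF isset_Union[OF S]]) auto
  have "Trans t" unfolding Trans_def
  proof (intro ballI subsetI)
    fix y z assume "y \<in> els t" "z \<in> els y"
    then obtain u n where "n \<in> W" "A n u" "E y u" "E z y" by (auto simp: t)
    then have "vsucc n \<in> W" "A (vsucc n) (vUn u)" "E z (vUn u)" using W(3) AS by auto
    then have "E z t" unfolding t by blast
    then show "z \<in> els t" by simp
  qed
  moreover have "E x t" unfolding t using W(2) A0 s_def mem_upr by blast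
  ultimately show ?thesis by blast
qed

definition tc :: "'a \<Rightarrow> 'a" where
  "tc x = code {z. \<forall>t. Trans t \<and> els x \<subseteq> els t \<longrightarrow> E z t}"

lemma isset_tc: "isset {z. \<forall>t. Trans t \<and> els x \<subseteq> els t \<longrightarrow> E z t}"
proof -
  obtain t where t: "Trans t" "E x t" using ex_Trans by blast
  then have "{z. \<forall>t. Trans t \<and> els x \<subseteq> els t \<longrightarrow> E z t} \<subseteq> els t" by (auto simp: Trans_def)
  then show ?thesis by (rule isset_subset[OF isset_els]) (intro dfn_intros)
qed

lemma mem_tc: "E z (tc x) \<longleftrightarrow> (\<forall>t. Trans t \<and> els x \<subseteq> els t \<longrightarrow> E z t)"
  unfolding tc_def by (subst mem_code[OF isset_tc]) simp

lemma dft_tc [dfn_intros]: "dft t \<Longrightarrow> dft (\<lambda>e. tc (t e))"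
  unfolding tc_def by (intro dft_code isset_tc dfn_intros dft_shift)

lemma Trans_tc: "Trans (tc x)" 
proof (unfold Trans_def, intro ballI subsetI)
  fix y z assume "y \<in> els (tc x)" "z \<in> els y"
  then have "E z t" if "Trans t \<and> els x \<subseteq> els t" for t
    using that by (auto simp: mem_tc[of y] TransD)
  then show "z \<in> els (tc x)" by (simp add: mem_tc)
qed

lemma mem_tcI: "E z x \<Longrightarrow> E z (tc x)" by (auto simp: mem_tc)

lemma mem_tc_step: "E z y \<Longrightarrow> E y (tc x) \<Longrightarrow> E z (tc x)"
  using Trans_tc by (rule TransD)

lemma tc_least: "Trans t \<Longrightarrow> els x \<subseteq> els t \<Longrightarrow> E z (tc x) \<Longrightarrow> E z t" by (auto simp: mem_tc)

lemma tc_sub_Trans: "Trans t \<Longrightarrow> E x t \<Longrightarrow> E z (tc x) \<Longrightarrow> E z t"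
  by (rule tc_least) (auto dest: TransD)

lemma tc_mono: "E z (tc x) \<Longrightarrow> E w (tc z) \<Longrightarrow> E w (tc x)"
  by (rule tc_least[OF Trans_tc]) (auto intro: mem_tc_step)

lemma tc_cases: "E z (tc x) \<Longrightarrow> E z x \<or> (\<exists>y. E y x \<and> E z (tc y))"
proof -
  assume z: "E z (tc x)"
  have 1: "isset (\<Union>y\<in>els x. els (tc y))"
    by (intro isset_UN isset_els dfn_intros)
  define t where "t = code (els x \<union> (\<Union>y\<in>els x. els (tc y)))"
  have t: "E z t \<longleftrightarrow> E z x \<or> (\<exists>y. E y x \<and> E z (tc y))" for z
    unfolding t_def by (subst mem_code[OF isset_Un[OF isset_els 1]]) auto
  have "Trans t" by (rule TransI) (auto simp: t intro: mem_tcI mem_tc_step)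
  then have "E z t" by (rule tc_least[OF _ _ z]) (auto simp: t)
  then show ?thesis by (simp add: t)
qed

text \<open>Foundation applies to sets, so the counterexamples are separated from a transitive set
  containing \<open>x\<close>; this is where definability enters.\<close>

lemma eps_induct:
  assumes "dfn (\<lambda>e. P (e 0))" "\<And>x. (\<And>z. E z x \<Longrightarrow> P z) \<Longrightarrow> P x" shows "P x"
proof (rule ccontr)
  assume "\<not> P x"
  obtain t where t: "Trans t" "E x t" using ex_Trans by blast
  define s where "s = code {z \<in> els t. \<not> P z}"
  have s: "E z s \<longleftrightarrow> E z t \<and> \<not> P z" for z
    unfolding s_def
    by (subst mem_code[OF isset_sep[OF isset_els dfn_not[OF assms(1)]]]) simp
  obtain y where "E y s" "\<And>z. E z y \<Longrightarrow> \<not> E z s" using foundation[of x s] t \<open>\<not> P x\<close> s by blast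
  then show False using assms(2)[of y] t by (auto simp: s intro: TransD)
qed

lemma tc_induct:
  assumes P: "dfn (\<lambda>e. P (e 0))" and step: "\<And>x. (\<And>z. E z (tc x) \<Longrightarrow> P z) \<Longrightarrow> P x" shows "P x"
proof -
  have "P x \<and> (\<forall>z. E z (tc x) \<longrightarrow> P z)"
  proof (rule eps_induct[where P = "\<lambda>x. P x \<and> (\<forall>z. E z (tc x) \<longrightarrow> P z)"])
    show "dfn (\<lambda>e. P (e 0) \<and> (\<forall>z. E z (tc (e 0)) \<longrightarrow> P z))"
      by (intro dfn_intros dfn_comp1[OF P])
  next
    fix x assume "\<And>z. E z x \<Longrightarrow> P z \<and> (\<forall>w. E w (tc z) \<longrightarrow> P w)"
    then have "E z (tc x) \<Longrightarrow> P z" for z using tc_cases by blast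
    then show "P x \<and> (\<forall>z. E z (tc x) \<longrightarrow> P z)" using step by blast
  qed
  then show ?thesis by blast
qed

lemma not_mem_tc: "\<not> E x (tc x)"
  by (rule tc_induct[where P = "\<lambda>x. \<not> E x (tc x)"]) (auto intro!: dfn_intros)

lemma dft_lam_app [dfn_intros]: "dft t \<Longrightarrow> dft u \<Longrightarrow> dft (\<lambda>e. lam (els (t e)) (app (u e)))"
  by (rule dft_lam) (intro dfn_intros dft_shift isset_els; assumption)+

text \<open>The step function sees the values on all of \<open>tc x\<close>, not only on the
  elements of \<open>x\<close>, because recursions on names pass from \<open>x\<close> to
  \<open>z\<close> through pairs \<open>(z, c)\<close> in \<open>x\<close>.\<close>

definition vrec :: "('a \<Rightarrow> 'a \<Rightarrow> 'a) \<Rightarrow> 'a \<Rightarrow> 'a" where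
  "vrec G x = vthe (\<lambda>y. \<exists>t f. Trans t \<and> E x t \<and>
     (\<forall>x'\<in>els t. app f x' = G x' (lam (els (tc x')) (app f))) \<and> y = app f x)"

lemma dft_vrec:
  assumes "dft (\<lambda>e. G (e 0) (e 1))" "dft t" shows "dft (\<lambda>e. vrec G (t e))"
  by (rule dft_comp1[OF _ assms(2)], unfold vrec_def) (intro dfn_intros dft_comp2[OF assms(1)])

lemma vrec_unfold:
  assumes G: "dft (\<lambda>e. G (e 0) (e 1))"
  shows "vrec G x = G x (lam (els (tc x)) (vrec G))"
proof -
  let ?ok = "\<lambda>t f. Trans t \<and> (\<forall>x'\<in>els t. app f x' = G x' (lam (els (tc x')) (app f)))"
  note G' = dft_comp2[OF G]
  have agree: "app f x = app g x" if "?ok t f" "?ok s g" "E x t" "E x s" for t f s g x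
  proof -
    have "E x t \<longrightarrow> E x s \<longrightarrow> app f x = app g x"
    proof (rule tc_induct[where P = "\<lambda>x. E x t \<longrightarrow> E x s \<longrightarrow> app f x = app g x"], intro dfn_intros, intro impI)
      fix x assume IH: "\<And>z. E z (tc x) \<Longrightarrow> E z t \<longrightarrow> E z s \<longrightarrow> app f z = app g z" and x: "E x t" "E x s"
      have "E z t" "E z s" if "E z (tc x)" for z
        using that tc_sub_Trans x \<open>?ok t f\<close> \<open>?ok s g\<close> by blast+
      then have "lam (els (tc x)) (app f) = lam (els (tc x)) (app g)"
        using IH by (intro lam_cong) auto
      then show "app f x = app g x" using x \<open>?ok t f\<close> \<open>?ok s g\<close> by auto
    qed
    then show ?thesis using that by blast
  qed
  have val: "vrec G x = app f x" if "?ok t f" "E x t" for t f x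
    unfolding vrec_def by (rule vthe_eq) (use that agree in blast)+
  have val': "vrec G x = G x (lam (els (tc x)) (vrec G))" if "?ok t f" "E x t" for t f x
  proof -
    have "E z t" if "E z (tc x)" for z
      using that tc_sub_Trans \<open>E x t\<close> \<open>?ok t f\<close> by blast
    then have "lam (els (tc x)) (app f) = lam (els (tc x)) (vrec G)"
      using val that by (intro lam_cong) auto
    then show ?thesis using that val by auto
  qed
  have "\<exists>t f. ?ok t f \<and> E x t"
  proof (rule tc_induct[where P = "\<lambda>x. \<exists>t f. ?ok t f \<and> E x t"])
    show "dfn (\<lambda>e. \<exists>t f. ?ok t f \<and> E (e 0) t)" by (intro dfn_intros G')
  next
    fix x assume IH: "\<And>z. E z (tc x) \<Longrightarrow> \<exists>t f. ?ok t f \<and> E z t"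
    define t where "t = code (insert x (els (tc x)))"
    have t: "E z t \<longleftrightarrow> z = x \<or> E z (tc x)" for z by (simp add: t_def)
    \<comment> \<open>Below \<open>x\<close> the induction hypothesis already determines
      \<open>vrec G\<close>, which therefore supplies the old values without any gluing of
      approximations. Only the value at \<open>x\<close> is new.\<close>
    define h where "h z = (if z = x then G x (lam (els (tc x)) (vrec G)) else vrec G z)" for z
    have dv: "dft (\<lambda>e. vrec G (e 0))" by (intro dft_vrec[OF G] dfn_intros)
    have h: "dft (\<lambda>e. h (e 0))" unfolding h_def by (intro dfn_intros dv)
    define f where "f = lam (els t) h"
    have f: "app f z = h z" if "E z t" for z unfolding f_def using h that by simp
    have "app f z = G z (lam (els (tc z)) (app f))" if z: "E z t" for z
    proof -
      have "app f w = vrec G w" if "E w (tc z)" for w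
      proof -
        have "E w (tc x)" using that z tc_mono[of z x w] by (auto simp: t)
        then have "E w t" "w \<noteq> x" using not_mem_tc by (auto simp: t)
        then show ?thesis by (simp add: f h_def)
      qed
      then have 1: "lam (els (tc z)) (app f) = lam (els (tc z)) (vrec G)" by (intro lam_cong) auto
      show ?thesis
      proof (cases "z = x")
        case True then show ?thesis unfolding 1 using z by (simp add: f h_def)
      next
        case False
        then have "E z (tc x)" using z by (simp add: t)
        then have "vrec G z = G z (lam (els (tc z)) (vrec G))" using IH val' by blast
        then show ?thesis unfolding 1 using z False by (simp add: f h_def)
      qed
    qed
    moreover have "Trans t" by (rule TransI) (auto simp: t intro: mem_tcI mem_tc_step)
    ultimately show "\<exists>t f. ?ok t f \<and> E x t" by (intro exI[of _ t] exI[of _ f]) (auto simp: t)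
  qed
  then show ?thesis using val' by blast
qed

section \<open>Ordinals and ranks\<close>

lemma Ord_mem: "Ord a \<Longrightarrow> E b a \<Longrightarrow> Ord b"
  by (auto simp: Ord_def dest: TransD)

lemma Ord_trans: "Ord a \<Longrightarrow> E b a \<Longrightarrow> E c b \<Longrightarrow> E c a"
  by (auto simp: Ord_def dest: TransD)

lemma Ord_linear:
  assumes "Ord a" "Ord b" shows "E a b \<or> a = b \<or> E b a"
proof -
  let ?C = "\<lambda>a b. E a b \<or> a = b \<or> E b a"
  have "Ord a \<longrightarrow> (\<forall>b. Ord b \<longrightarrow> ?C a b)"
  proof (rule eps_induct[where P = "\<lambda>a. Ord a \<longrightarrow> (\<forall>b. Ord b \<longrightarrow> ?C a b)"], intro dfn_intros, intro impI allI)
    fix a b assume IHa: "\<And>z. E z a \<Longrightarrow> Ord z \<longrightarrow> (\<forall>b. Ord b \<longrightarrow> ?C z b)" and a: "Ord a" and b: "Ord b"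
    have "Ord b \<longrightarrow> ?C a b"
    proof (rule eps_induct[where P = "\<lambda>b. Ord b \<longrightarrow> ?C a b"], intro dfn_intros, rule impI)
      fix b assume IHb: "\<And>z. E z b \<Longrightarrow> Ord z \<longrightarrow> ?C a z" and b: "Ord b"
      show "?C a b"
      proof (rule ccontr)
        assume n: "\<not> ?C a b"
        have "E z b" if "E z a" for z using n that IHa[OF that] a b Ord_mem Ord_trans by blast
        moreover have "E z a" if "E z b" for z using n that IHb[OF that] a b Ord_mem Ord_trans by blast
        ultimately have "a = b" by (intro extensionality) blast
        then show False using n by blast
      qed
    qed
    then show "?C a b" using b by blast
  qed
  then show ?thesis using assms by blast
qed

lemma Ord_subset_mem: "Ord a \<Longrightarrow> Ord b \<Longrightarrow> \<not> els a \<subseteq> els b \<Longrightarrow> E b a"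
  using Ord_linear[of a b] Ord_trans[of b a] unfolding subset_eq Ball_def mem_els by blast

lemma least_Ord:
  assumes "dfn (\<lambda>e. P (e 0))" "Ord a" "P a"
  shows "\<exists>b. Ord b \<and> P b \<and> (\<forall>c. E c b \<longrightarrow> \<not> P c)"
proof (rule ccontr)
  assume "\<not> ?thesis"
  then have 1: "Ord b \<Longrightarrow> P b \<Longrightarrow> \<exists>c. E c b \<and> P c" for b by blast
  have "Ord a \<longrightarrow> \<not> P a"
    by (rule eps_induct[where P = "\<lambda>a. Ord a \<longrightarrow> \<not> P a"], intro dfn_intros assms(1))
       (use 1 Ord_mem in blast)
  then show False using assms by blast
qed

definition rk :: "'a \<Rightarrow> 'a" where
  "rk = vrec (\<lambda>x f. code (\<Union>z\<in>els x. els (vsucc (app f z))))"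

lemma isset_rk_aux: "dft (\<lambda>e. F (e 0)) \<Longrightarrow> isset (\<Union>z\<in>els x. els (vsucc (F z)))"
  by (intro isset_UN isset_els dfn_intros) (rule dft_comp1, assumption, rule dft_var)

lemma dft_rk_aux: "dft (\<lambda>e. code (\<Union>z\<in>els (e 0). els (vsucc (app (e 1) z))))"
  by (rule dft_code, rule isset_rk_aux, intro dfn_intros) (unfold UN_iff, intro dfn_intros)

lemma dft_rk [dfn_intros]: "dft t \<Longrightarrow> dft (\<lambda>e. rk (t e))"
  unfolding rk_def by (rule dft_vrec[OF dft_rk_aux])

lemma mem_rk: "E a (rk x) \<longleftrightarrow> (\<exists>z. E z x \<and> (a = rk z \<or> E a (rk z)))"
proof -
  have 1: "dft (\<lambda>e. rk (e 0))" by (intro dfn_intros)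
  have "rk x = code (\<Union>z\<in>els x. els (vsucc (app (lam (els (tc x)) rk) z)))"
    unfolding rk_def by (rule vrec_unfold[OF dft_rk_aux])
  also have "(\<Union>z\<in>els x. els (vsucc (app (lam (els (tc x)) rk) z))) = (\<Union>z\<in>els x. els (vsucc (rk z)))"
    using 1 by (intro SUP_cong refl) (simp add: mem_tcI)
  finally show ?thesis by (simp add: isset_rk_aux[OF 1] Bex_def)
qed

lemma rk_mono: "E z x \<Longrightarrow> E (rk z) (rk x)" unfolding mem_rk[of _ x] by blast

lemma Ord_rk: "Ord (rk x)"
proof (rule eps_induct[where P = "\<lambda>x. Ord (rk x)"], intro dfn_intros)
  fix x assume IH: "\<And>z. E z x \<Longrightarrow> Ord (rk z)"
  then have "Ord a" if "E a (rk x)" for a using that Ord_mem unfolding mem_rk[of _ x] by blast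
  moreover have "Trans (rk x)"
    unfolding Trans_def subset_eq Ball_def mem_els mem_rk[of _ x] using IH Ord_trans by blast
  ultimately show "Ord (rk x)" by (auto simp: Ord_def)
qed

text \<open>The cumulative hierarchy, indexed by arbitrary sets; at ordinals it gives the usual
  levels.\<close>

definition Vh :: "'a \<Rightarrow> 'a" where
  "Vh = vrec (\<lambda>x f. code (\<Union>z\<in>els x. {y. els y \<subseteq> els (app f z)}))"

lemma isset_Vh_aux: "dft (\<lambda>e. F (e 0)) \<Longrightarrow> isset (\<Union>z\<in>els x. {y. els y \<subseteq> els (F z)})"
  by (intro isset_UN isset_els isset_Pow dfn_intros) (rule dft_comp1, assumption, rule dft_var)

lemma dft_Vh_aux: "dft (\<lambda>e. code (\<Union>z\<in>els (e 0). {y. els y \<subseteq> els (app (e 1) z)}))"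
  by (rule dft_code, rule isset_Vh_aux, intro dfn_intros) (unfold UN_iff, intro dfn_intros)

lemma dft_Vh [dfn_intros]: "dft t \<Longrightarrow> dft (\<lambda>e. Vh (t e))"
  unfolding Vh_def by (rule dft_vrec[OF dft_Vh_aux])

lemma mem_Vh: "E y (Vh x) \<longleftrightarrow> (\<exists>z. E z x \<and> els y \<subseteq> els (Vh z))"
proof -
  have 1: "dft (\<lambda>e. Vh (e 0))" by (intro dfn_intros)
  have "Vh x = code (\<Union>z\<in>els x. {y. els y \<subseteq> els (app (lam (els (tc x)) Vh) z)})"
    unfolding Vh_def by (rule vrec_unfold[OF dft_Vh_aux])
  also have "(\<Union>z\<in>els x. {y. els y \<subseteq> els (app (lam (els (tc x)) Vh) z)}) = (\<Union>z\<in>els x. {y. els y \<subseteq> els (Vh z)})"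
    using 1 by (intro SUP_cong refl) (simp add: mem_tcI)
  finally show ?thesis by (simp add: isset_Vh_aux[OF 1] Bex_def)
qed

lemma subset_Vh_rk: "els y \<subseteq> els (Vh (rk y))"
proof (rule eps_induct[where P = "\<lambda>y. els y \<subseteq> els (Vh (rk y))"], intro dfn_intros)
  show "els y \<subseteq> els (Vh (rk y))" if "\<And>z. E z y \<Longrightarrow> els z \<subseteq> els (Vh (rk z))" for y
    using that rk_mono unfolding subset_iff[of "els y"] mem_els mem_Vh[of _ "rk y"] by blast
qed

text \<open>Scott's trick derives collection from replacement: each \<open>x\<close> is sent to the
  least rank of a witness, which is unique, and the power sets of the corresponding levels contain
  witnesses by \<open>subset_Vh_rk\<close>.\<close>

lemma vcollect:
  assumes A: "isset A" and R: "dfn (\<lambda>e. R (e 0) (e 1))" and ex: "\<And>x. x \<in> A \<Longrightarrow> \<exists>y. R x y"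
  shows "\<exists>B. isset B \<and> (\<forall>x\<in>A. \<exists>y\<in>B. R x y)"
proof -
  note R' = dfn_comp2[OF R]
  let ?L = "\<lambda>x a. Ord a \<and> (\<exists>y. rk y = a \<and> R x y) \<and> (\<forall>c. E c a \<longrightarrow> \<not> (\<exists>y. rk y = c \<and> R x y))"
  have dL: "dft t \<Longrightarrow> dft u \<Longrightarrow> dfn (\<lambda>e. ?L (t e) (u e))" for t u
    by (intro dfn_intros R' dft_shift)
  have exL: "\<exists>!a. ?L x a" if x: "x \<in> A" for x
  proof -
    obtain y where y: "R x y" using ex x by blast
    have "\<exists>a. Ord a \<and> (\<exists>y. rk y = a \<and> R x y) \<and> (\<forall>c. E c a \<longrightarrow> \<not> (\<exists>y. rk y = c \<and> R x y))"
      by (rule least_Ord[where P = "\<lambda>a. \<exists>y. rk y = a \<and> R x y", of "rk y"])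
         (use y Ord_rk in \<open>auto intro!: dfn_intros R'\<close>)
    then show ?thesis using Ord_linear by blast
  qed
  have S: "isset {a. \<exists>x\<in>A. ?L x a}" using exL by (intro isset_replace[OF A] dL dfn_intros)
  define B where "B = (\<Union>a\<in>{a. \<exists>x\<in>A. ?L x a}. {y. els y \<subseteq> els (Vh a)})"
  have "isset B" unfolding B_def by (intro isset_UN S isset_Pow isset_els dfn_intros)
  moreover have "\<exists>y\<in>B. R x y" if x: "x \<in> A" for x
    using exL[OF x] subset_Vh_rk x unfolding B_def by blast
  ultimately show ?thesis by blast
qed

lemma vchoice_class:
  assumes A: "isset A" and R: "dfn (\<lambda>e. R (e 0) (e 1))" and ex: "\<And>x. x \<in> A \<Longrightarrow> \<exists>y. R x y"
  shows "\<exists>f. \<forall>x\<in>A. R x (app f x)"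
proof -
  obtain B where B: "isset B" "\<And>x. x \<in> A \<Longrightarrow> \<exists>y\<in>B. R x y" using vcollect[OF assms] by blast
  show ?thesis using vchoice[OF A B(1) R B(2)] by blast
qed

section \<open>The well-ordering theorem\<close>

lemma Ord_not_set: "\<not> isset {a. Ord a}"
proof
  assume o: "isset {a. Ord a}"
  let ?o = "code {a. Ord a}"
  have m: "E z ?o \<longleftrightarrow> Ord z" for z unfolding mem_code[OF o] by simp
  have "Trans ?o" by (rule TransI) (auto simp: m intro: Ord_mem)
  moreover have "Trans z" if "E z ?o" for z using that unfolding m by (simp add: Ord_def)
  ultimately have "Ord ?o" unfolding Ord_def[of ?o] Ball_def mem_els by blast
  then show False using m mem_irrefl by blast
qed

text \<open>Zermelo's argument: \<open>F\<close> picks an element of \<open>a\<close> not picked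
  before. If \<open>a\<close> were never exhausted, \<open>F\<close> would be injective on all
  ordinals and replacement along its inverse would make them a set. The least ordinal at which
  \<open>a\<close> is exhausted is the order type.\<close>

lemma well_ordering:
  obtains \<theta> F where "Ord \<theta>" "dft (\<lambda>e. F (e 0))" "bij_betw F (els \<theta>) (els a)"
proof -
  have "\<exists>c. \<forall>u\<in>{u. els u \<subseteq> els a} - {emp}. app c u \<in> els a \<and> E (app c u) u"
  proof (rule vchoice)
    show "dfn (\<lambda>e. E (e 1) (e 0))" by (intro dfn_intros)
    show "\<exists>y\<in>els a. E y u" if u: "u \<in> {u. els u \<subseteq> els a} - {emp}" for u
    proof -
      obtain y where "E y u" using u emp_eq[of u] by (metis DiffE singletonI)
      then show ?thesis using u by (auto simp: subset_iff)
    qed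
  qed auto
  then obtain c where c: "\<And>u. els u \<subseteq> els a \<Longrightarrow> u \<noteq> emp \<Longrightarrow> E (app c u) u" by blast
  define G where "G x f = app c (code {y \<in> els a. \<not> (\<exists>z\<in>els x. y = app f z)})" for x f
  have S: "isset {y \<in> els a. \<not> (\<exists>z\<in>els x. y = app f z)}" for x f
    by (intro isset_sep dfn_intros isset_els)
  have G: "dft (\<lambda>e. G (e 0) (e 1))" unfolding G_def
    by (intro dfn_intros dft_code S)
  define F where "F = vrec G"
  have dF: "dft (\<lambda>e. F (e 0))" unfolding F_def by (intro dft_vrec[OF G] dfn_intros)
  have F: "F x = app c (code (els a - F ` els x))" for x
  proof -
    have "F x = app c (code {y \<in> els a. \<not> (\<exists>z\<in>els x. y = app (lam (els (tc x)) F) z)})"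
      unfolding F_def by (subst vrec_unfold[OF G]) (simp add: G_def)
    also have "{y \<in> els a. \<not> (\<exists>z\<in>els x. y = app (lam (els (tc x)) F) z)} = els a - F ` els x"
      using dF by (auto simp: mem_tcI image_iff)
    finally show ?thesis .
  qed
  have iF: "isset (F ` els x)" for x by (intro isset_image dF isset_els)
  have Fn: "F x \<in> els a - F ` els x" if "\<not> els a \<subseteq> F ` els x" for x
  proof -
    let ?u = "code (els a - F ` els x)"
    have u: "els ?u = els a - F ` els x" by (intro els_code isset_Diff isset_els iF)
    have "?u \<noteq> emp" using that u mem_emp by (metis Diff_eq_empty_iff all_not_in_conv mem_els)
    then have "E (F x) ?u" unfolding F[of x] using c[of ?u] u by auto
    then show ?thesis using u by (metis mem_els)
  qed
  have "\<exists>\<theta>. Ord \<theta> \<and> els a \<subseteq> F ` els \<theta>"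
  proof (rule ccontr)
    assume n: "\<nexists>\<theta>. Ord \<theta> \<and> els a \<subseteq> F ` els \<theta>"
    then have Fn': "F x \<in> els a - F ` els x" if "Ord x" for x using that Fn by blast
    have inj: "x = y" if "Ord x" "Ord y" "F x = F y" for x y
      using Ord_linear[of x y] Fn'[of x] Fn'[of y] that by (metis DiffE imageI mem_els)
    define S where "S = {y \<in> els a. \<exists>x. Ord x \<and> F x = y}"
    have "isset S" unfolding S_def by (intro isset_sep dfn_intros isset_els dft_comp1[OF dF])
    moreover have "dft (\<lambda>e. vthe (\<lambda>x. Ord x \<and> F x = e 0))" by (intro dfn_intros dft_comp1[OF dF])
    ultimately have 1: "isset ((\<lambda>y. vthe (\<lambda>x. Ord x \<and> F x = y)) ` S)" by (rule isset_image)
    have 2: "vthe (\<lambda>x'. Ord x' \<and> F x' = F x) = x" if "Ord x" for x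
      by (rule vthe_eq) (use inj that in auto)
    have "(\<lambda>y. vthe (\<lambda>x. Ord x \<and> F x = y)) ` S = {x. Ord x}"
    proof (intro equalityI subsetI)
      fix x assume "x \<in> {x. Ord x}"
      then have "F x \<in> S" "x = vthe (\<lambda>x'. Ord x' \<and> F x' = F x)" using Fn' 2 by (auto simp: S_def)
      then show "x \<in> (\<lambda>y. vthe (\<lambda>x. Ord x \<and> F x = y)) ` S" by blast
    qed (auto simp: S_def 2)
    then show False using 1 Ord_not_set by simp
  qed
  then obtain \<theta> where "Ord \<theta>" "els a \<subseteq> F ` els \<theta>" by blast
  moreover have "dfn (\<lambda>e. els a \<subseteq> F ` els (e 0))"
    unfolding subset_eq image_iff by (intro dfn_intros dft_comp1[OF dF])
  ultimately obtain \<theta> where \<theta>: "Ord \<theta>" "els a \<subseteq> F ` els \<theta>" "\<And>c. E c \<theta> \<Longrightarrow> \<not> els a \<subseteq> F ` els c"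
    using least_Ord[of "\<lambda>\<theta>. els a \<subseteq> F ` els \<theta>" \<theta>] by blast
  have *: "F x \<in> els a - F ` els x" if "E x \<theta>" for x using Fn \<theta>(3) that by blast
  have "bij_betw F (els \<theta>) (els a)" unfolding bij_betw_def
  proof
    show "inj_on F (els \<theta>)"
    proof (rule inj_onI)
      fix x y assume "x \<in> els \<theta>" "y \<in> els \<theta>" "F x = F y"
      then show "x = y"
        using Ord_linear[of x y] *[of x] *[of y] Ord_mem[OF \<theta>(1)] by (metis DiffE imageI mem_els)
    qed
    show "F ` els \<theta> = els a" using \<theta>(2) * by auto
  qed
  then show thesis using that \<theta>(1) dF by blast
qed

lemma dft_inverse:
  assumes "dft (\<lambda>e. F (e 0))" "isset A" "inj_on F A"
  obtains G where "dft (\<lambda>e. G (e 0))" "\<And>x. x \<in> A \<Longrightarrow> G (F x) = x"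
proof
  show "dft (\<lambda>e. vthe (\<lambda>x. x \<in> A \<and> F x = e 0))"
    by (intro dfn_intros dfn_in_set assms(2) dft_comp1[OF assms(1)])
  show "vthe (\<lambda>x'. x' \<in> A \<and> F x' = F x) = x" if "x \<in> A" for x
    by (rule vthe_eq) (use assms(3) that in \<open>auto dest: inj_onD\<close>)
qed

lemma vinj_inverse:
  assumes "dft (\<lambda>e. F (e 0))" "isset A" "bij_betw F A B" shows "vinj B A"
proof -
  obtain G where "dft (\<lambda>e. G (e 0))" "\<And>x. x \<in> A \<Longrightarrow> G (F x) = x"
    using dft_inverse assms by (metis bij_betw_def)
  then show ?thesis using assms(3) unfolding vinj_def
    by (intro exI[of _ G]) (auto simp: bij_betw_def inj_on_def)
qed

lemma dfn_vinj [dfn_intros]: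
  "dft t \<Longrightarrow> dft u \<Longrightarrow> dfn (\<lambda>e. vinj (els (t e)) (els (u e)))"
  unfolding holds_ex_inj[symmetric] is_inj_def holds.simps holds_derived holds_is_fun holds_rel
  by (intro dfn_intros dft_shift)

definition vfst :: "'a \<Rightarrow> 'a" where "vfst z = vthe (\<lambda>x. \<exists>y. z = pr x y)"
definition vsnd :: "'a \<Rightarrow> 'a" where "vsnd z = vthe (\<lambda>y. \<exists>x. z = pr x y)"

lemma vfst_pr [simp]: "vfst (pr x y) = x" unfolding vfst_def by (rule vthe_eq) auto
lemma vsnd_pr [simp]: "vsnd (pr x y) = y" unfolding vsnd_def by (rule vthe_eq) auto

lemma dft_vfst [dfn_intros]: "dft t \<Longrightarrow> dft (\<lambda>e. vfst (t e))"
  unfolding vfst_def by (intro dfn_intros dft_shift)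
lemma dft_vsnd [dfn_intros]: "dft t \<Longrightarrow> dft (\<lambda>e. vsnd (t e))"
  unfolding vsnd_def by (intro dfn_intros dft_shift)

lemma vinj_vprod: assumes "vinj A B" shows "vinj (vprod C A) (vprod C B)"
proof -
  obtain F where "dft (\<lambda>e. F (e 0))" "F ` A \<subseteq> B" "inj_on F A" using assms by (auto simp: vinj_def)
  then show ?thesis unfolding vinj_def
    by (intro exI[of _ "\<lambda>z. pr (vfst z) (F (vsnd z))"])
       (auto simp: inj_on_def subset_eq intro!: dfn_intros intro: dft_comp1)
qed

lemma cantor: assumes X: "isset X" shows "\<not> vinj {s. els s \<subseteq> X} X"
proof
  assume "vinj {s. els s \<subseteq> X} X"
  then obtain F where F: "dft (\<lambda>e. F (e 0))" "F ` {s. els s \<subseteq> X} \<subseteq> X" "inj_on F {s. els s \<subseteq> X}"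
    by (auto simp: vinj_def)
  define D where "D = {x \<in> X. \<exists>s. els s \<subseteq> X \<and> x = F s \<and> \<not> E x s}"
  have D: "isset D" unfolding D_def
    by (intro isset_sep dfn_intros X dfn_in_set dft_comp1[OF F(1)])
  let ?d = "code D"
  have sub: "els ?d \<subseteq> X" unfolding els_code[OF D] by (auto simp: D_def)
  then have X: "F ?d \<in> X" using F(2) by blast
  have "E (F ?d) ?d \<longleftrightarrow> \<not> E (F ?d) ?d"
  proof
    assume "E (F ?d) ?d"
    then have "F ?d \<in> D" unfolding mem_code[OF D] .
    then obtain s where s: "els s \<subseteq> X" "F ?d = F s" "\<not> E (F ?d) s" unfolding D_def by blast
    then have "?d = s" using F(3) sub by (auto dest: inj_onD)
    then show "\<not> E (F ?d) ?d" using s by simp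
  next
    assume "\<not> E (F ?d) ?d"
    then have "\<exists>s. els s \<subseteq> X \<and> F ?d = F s \<and> \<not> E (F ?d) s" using sub by blast
    then have "F ?d \<in> D" unfolding D_def[THEN eqset_imp_iff] using X by blast
    then show "E (F ?d) ?d" unfolding mem_code[OF D] .
  qed
  then show False by blast
qed

text \<open>\<open>X\<close> is the power set of the product of omega with \<open>C\<close>, chosen
  because it absorbs a further factor \<open>C\<close>. The ordinal \<open>l\<close> is the Hartogs
  number of \<open>X\<close>: every \<open>a\<close> below \<open>l\<close> injects into
  \<open>X\<close>, hence so does the product of \<open>C\<close> and \<open>a\<close>, whereas
  \<open>l\<close> does not.\<close>

lemma big_cardinal:
  assumes C: "isset C"
  obtains l where "Ord l" "\<And>a. E a l \<Longrightarrow> \<not> vinj (els l) (vprod C (els a))"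
    "\<And>a. E a l \<Longrightarrow> \<not> vinj (els l) (els a)" "vinj C (els l)"
    "\<And>\<theta>. Ord \<theta> \<Longrightarrow> vinj (els \<theta>) C \<Longrightarrow> E \<theta> l"
proof -
  obtain W where W: "isset W" "emp \<in> W" "\<And>n. n \<in> W \<Longrightarrow> vsucc n \<in> W"
    by (rule obtain_omega) blast
  define X where "X = {S. els S \<subseteq> vprod W C}"
  have X: "isset X" unfolding X_def using W C by auto
  \<comment> \<open>By Cantor's theorem a well-ordering of the power set of \<open>X\<close> has an
    order type that does not inject into \<open>X\<close>, so a least such ordinal exists.\<close>
  obtain \<theta> F where \<theta>: "Ord \<theta>" "dft (\<lambda>e. F (e 0))" "bij_betw F (els \<theta>) (els (code {s. els s \<subseteq> X}))"
    by (rule well_ordering)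
  have "\<not> vinj (els \<theta>) (els (code X))"
    using vinj_trans[OF vinj_inverse[OF \<theta>(2) isset_els \<theta>(3)]] cantor[OF X] X by auto
  moreover have "dfn (\<lambda>e. \<not> vinj (els (e 0)) (els (code X)))" by (intro dfn_intros)
  ultimately obtain l where l: "Ord l" "\<not> vinj (els l) X" "\<And>a. E a l \<Longrightarrow> vinj (els a) X"
    using least_Ord[of "\<lambda>a. \<not> vinj (els a) (els (code X))", OF _ \<theta>(1)] X by auto
  \<comment> \<open>The pair \<open>(r, S)\<close> is coded by moving every column of
    \<open>S\<close> up by one and writing \<open>r\<close> into the free column 0.\<close>
  define g where "g z = code (insert (pr emp (vfst z)) ((\<lambda>w. pr (vsucc (vfst w)) (vsnd w)) ` els (vsnd z)))" for z
  have ig: "isset (insert (pr emp (vfst z)) ((\<lambda>w. pr (vsucc (vfst w)) (vsnd w)) ` els (vsnd z)))" for z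
    by (intro isset_insert isset_image isset_els dfn_intros)
  have dg: "dft (\<lambda>e. g (e 0))" unfolding g_def
    by (rule dft_code, rule ig) (unfold insert_iff image_iff, intro dfn_intros)
  have mg: "E w (g (pr r S)) \<longleftrightarrow> w = pr emp r \<or> (\<exists>v\<in>els S. w = pr (vsucc (vfst v)) (vsnd v))" for w r S
    unfolding g_def by (subst mem_code[OF ig]) auto
  have inj: "r = r' \<and> S = S'" if eq: "g (pr r S) = g (pr r' S')" and S: "S \<in> X" "S' \<in> X" for r S r' S'
  proof
    have "E (pr emp r) (g (pr r' S'))" unfolding eq[symmetric] mg by simp
    then show "r = r'" unfolding mg by auto
    have *: "E v S'" if h: "g (pr r S) = g (pr r' S')" "E v S" "S \<in> X" "S' \<in> X" for r S r' S' v
    proof -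
      obtain n y where v: "v = pr n y" using h(2,3) by (auto simp: X_def subset_iff vprod_def)
      have "E (pr (vsucc n) y) (g (pr r' S'))" unfolding that(1)[symmetric] mg using that(2) v by force
      then obtain v' where v': "E v' S'" "n = vfst v'" "y = vsnd v'" unfolding mg by auto
      then obtain n' y' where "v' = pr n' y'" using h(4) by (auto simp: X_def subset_iff vprod_def)
      then show ?thesis using v v' by simp
    qed
    show "S = S'" using *[OF eq] *[OF eq[symmetric]] S by (intro extensionality) blast
  qed
  have CX: "vinj (vprod C X) X" unfolding vinj_def
  proof (intro exI[of _ g] conjI dg)
    show "inj_on g (vprod C X)"
    proof (rule inj_onI)
      fix z z' assume z: "z \<in> vprod C X" "z' \<in> vprod C X" "g z = g z'"
      from z(1,2) obtain r S r' S' where "z = pr r S" "S \<in> X" "z' = pr r' S'" "S' \<in> X"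
        unfolding vprod_def by blast
      then show "z = z'" using inj[of r S r' S'] z(3) by simp
    qed
    show "g ` vprod C X \<subseteq> X"
    proof (intro image_subsetI)
      fix z assume "z \<in> vprod C X"
      then obtain r S where z: "z = pr r S" "r \<in> C" "S \<in> X" by auto
      have "w \<in> vprod W C" if w: "E w (g z)" for w
      proof -
        consider "w = pr emp r" | v where "v \<in> els S" "w = pr (vsucc (vfst v)) (vsnd v)"
          using w unfolding z(1) mg by blast
        then show ?thesis
        proof cases
          case 2
          then have "v \<in> vprod W C" using z(3) unfolding X_def by blast
          then show ?thesis using 2(2) W(3) by auto
        qed (use z(2) W(2) in simp)
      qed
      then show "g z \<in> X" by (auto simp: X_def)
    qed
  qed
  have XX: "vinj C X" unfolding vinj_def
    by (rule exI[of _ "\<lambda>r. upr (pr emp r) (pr emp r)"])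
       (use W in \<open>auto simp: X_def inj_on_def upr_eq intro!: dfn_intros\<close>)
  have th: "E \<theta> l" if "Ord \<theta>" "vinj (els \<theta>) C" for \<theta>
  proof (rule Ord_subset_mem[OF l(1) that(1)], rule notI)
    assume "els l \<subseteq> els \<theta>"
    from vinj_trans[OF vinj_trans[OF vinj_subset[OF this] that(2)] XX] show False using l(2) by simp
  qed
  show thesis
  proof (rule that[OF l(1)])
    show "\<not> vinj (els l) (vprod C (els a))" if "E a l" for a
      using l(2) vinj_trans[OF _ vinj_trans[OF vinj_vprod[OF l(3)[OF that]] CX]] by blast
    show "\<not> vinj (els l) (els a)" if "E a l" for a
      using l(2) vinj_trans[OF _ l(3)[OF that]] by blast
    show "E \<theta> l" if "Ord \<theta>" "vinj (els \<theta>) C" for \<theta> using th that by blast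
    obtain \<theta> F where \<theta>: "Ord \<theta>" "dft (\<lambda>e. F (e 0))" "bij_betw F (els \<theta>) (els (code C))"
      by (rule well_ordering)
    then have "vinj (els \<theta>) C" using C by (auto simp: vinj_def bij_betw_def)
    then have "els \<theta> \<subseteq> els l" using th[OF \<theta>(1)] Ord_trans[OF l(1)] by auto
    then show "vinj C (els l)"
      using vinj_trans[OF vinj_inverse[OF \<theta>(2) isset_els \<theta>(3)] vinj_subset] C by simp
  qed
qed

end

section \<open>The forcing relation\<close>

text \<open>The order is a definable relation rather than a set of the model, since the order of the
  iteration is defined through the forcing relation of the first step.\<close>

locale forcing = zfc E for E :: "'a \<Rightarrow> 'a \<Rightarrow> bool" +
  fixes PP :: "'a poset"
  assumes isset_Cond: "isset (Cond PP)"
    and dfn_Leq_aux: "dfn (\<lambda>e. Leq PP (e 0) (e 1))"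
    and Leq_refl: "p \<in> Cond PP \<Longrightarrow> Leq PP p p"
    and Leq_trans: "\<lbrakk>p \<in> Cond PP; q \<in> Cond PP; r \<in> Cond PP; Leq PP p q; Leq PP q r\<rbrakk> \<Longrightarrow> Leq PP p r"
begin

abbreviation "C \<equiv> Cond PP"
abbreviation "BL \<equiv> below PP"
abbreviation "FE \<equiv> forces_eq E PP"
abbreviation "FM \<equiv> mem_clause E PP (forces_eq E PP)"

lemma dfn_Leq [dfn_intros]: "dft t \<Longrightarrow> dft u \<Longrightarrow> dfn (\<lambda>e. Leq PP (t e) (u e))"
  by (rule dfn_comp2[OF dfn_Leq_aux])

lemma dfn_Cond [dfn_intros]: "dft t \<Longrightarrow> dfn (\<lambda>e. t e \<in> C)"
  by (rule dfn_in_set[OF isset_Cond])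

lemma mem_below: "q \<in> BL p \<longleftrightarrow> q \<in> C \<and> Leq PP q p" by (simp add: below_def)

lemma dfn_below [dfn_intros]: "dft t \<Longrightarrow> dft u \<Longrightarrow> dfn (\<lambda>e. t e \<in> BL (u e))"
  unfolding mem_below by (intro dfn_intros)

lemma below_refl [simp]: "p \<in> C \<Longrightarrow> p \<in> BL p" by (simp add: mem_below Leq_refl)

lemma below_Cond: "q \<in> BL p \<Longrightarrow> q \<in> C" by (simp add: mem_below)

lemma below_trans: "r \<in> BL q \<Longrightarrow> q \<in> BL p \<Longrightarrow> p \<in> C \<Longrightarrow> r \<in> BL p"
  by (auto simp: mem_below intro: Leq_trans)

lemma name_elem_iff: "name_elem E PP z s y \<longleftrightarrow> s \<in> C \<and> E (pr z s) y"
  by (simp add: name_elem_def)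

lemma mem_name_dom: "z \<in> name_dom E PP y \<longleftrightarrow> (\<exists>s\<in>C. E (pr z s) y)"
  by (auto simp: name_dom_def name_elem_iff)

lemma dfn_name_elem [dfn_intros]:
  "dft t \<Longrightarrow> dft u \<Longrightarrow> dft v \<Longrightarrow> dfn (\<lambda>e. name_elem E PP (t e) (u e) (v e))"
  unfolding name_elem_iff by (intro dfn_intros)

lemma dfn_name_dom [dfn_intros]: "dft t \<Longrightarrow> dft u \<Longrightarrow> dfn (\<lambda>e. t e \<in> name_dom E PP (u e))"
  unfolding mem_name_dom by (intro dfn_intros dft_shift)

lemma isset_name_dom: "isset (name_dom E PP y)"
proof (rule isset_subset[of "vfst ` els y"])
  show "isset (vfst ` els y)" by (intro isset_image isset_els dfn_intros)
  show "name_dom E PP y \<subseteq> vfst ` els y" by (force simp: mem_name_dom image_iff)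
qed (intro dfn_intros)

lemma name_dom_rk: "z \<in> name_dom E PP y \<Longrightarrow> E (rk z) (rk y)"
proof -
  assume "z \<in> name_dom E PP y"
  then obtain s where "E (pr z s) y" by (auto simp: mem_name_dom)
  moreover have "E (upr z z) (pr z s)" "E z (upr z z)" by (auto simp: mem_pr)
  ultimately show ?thesis using rk_mono Ord_trans[OF Ord_rk] by blast
qed

lemma name_dom_Trans: "Trans t \<Longrightarrow> E y t \<Longrightarrow> z \<in> name_dom E PP y \<Longrightarrow> E z t"
proof -
  assume t: "Trans t" "E y t" and "z \<in> name_dom E PP y"
  then obtain s where "E (pr z s) y" by (auto simp: mem_name_dom)
  moreover have "E (upr z z) (pr z s)" "E z (upr z z)" by (auto simp: mem_pr)
  ultimately show ?thesis using t TransD by blast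
qed

lemma name_dom_tc: "z \<in> name_dom E PP y \<Longrightarrow> E z (tc y)"
proof -
  assume "z \<in> name_dom E PP y"
  then obtain s where "E (pr z s) y" by (auto simp: mem_name_dom)
  moreover have "E (upr z z) (pr z s)" "E z (upr z z)" by (auto simp: mem_pr)
  ultimately show ?thesis using mem_tcI mem_tc_step by blast
qed

text \<open>In the recursion for equality the names change sides, so the induction hypothesis must
  cover all triples from the three domains. Induction on a common bound of the ranks provides
  this.\<close>

lemma name_induct3:
  assumes P: "dfn (\<lambda>e. P (e 0) (e 1) (e 2))"
    and step: "\<And>x y z. (\<And>x' y' z'. {x', y', z'} \<subseteq> name_dom E PP x \<union> name_dom E PP y \<union> name_dom E PP z
      \<Longrightarrow> P x' y' z') \<Longrightarrow> P x y z"
  shows "P x y z"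
proof -
  have "Ord a \<longrightarrow> (\<forall>x y z. E (rk x) a \<and> E (rk y) a \<and> E (rk z) a \<longrightarrow> P x y z)" for a
  proof (rule eps_induct[where P = "\<lambda>a. Ord a \<longrightarrow> (\<forall>x y z. E (rk x) a \<and> E (rk y) a \<and> E (rk z) a \<longrightarrow> P x y z)"])
    show "dfn (\<lambda>e. Ord (e 0) \<longrightarrow> (\<forall>x y z. E (rk x) (e 0) \<and> E (rk y) (e 0) \<and> E (rk z) (e 0) \<longrightarrow> P x y z))"
      by (intro dfn_intros dfn_comp3[OF P])
  next
    fix a assume IH: "\<And>b. E b a \<Longrightarrow> Ord b \<longrightarrow> (\<forall>x y z. E (rk x) b \<and> E (rk y) b \<and> E (rk z) b \<longrightarrow> P x y z)"
    show "Ord a \<longrightarrow> (\<forall>x y z. E (rk x) a \<and> E (rk y) a \<and> E (rk z) a \<longrightarrow> P x y z)"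
    proof (intro impI allI)
      fix x y z assume a: "Ord a" and xyz: "E (rk x) a \<and> E (rk y) a \<and> E (rk z) a"
      obtain b' where b': "E b' a" "b' = rk x \<or> E (rk x) b'" "b' = rk y \<or> E (rk y) b'"
        using Ord_linear[OF Ord_rk[of x] Ord_rk[of y]] xyz by metis
      have "\<exists>b. E b a \<and> (b = rk x \<or> E (rk x) b) \<and> (b = rk y \<or> E (rk y) b) \<and> (b = rk z \<or> E (rk z) b)"
        using Ord_linear[OF Ord_mem[OF a b'(1)] Ord_rk[of z]] b' xyz Ord_trans[OF Ord_rk[of z], of b'] by metis
      then obtain b where b: "E b a" "b = rk x \<or> E (rk x) b" "b = rk y \<or> E (rk y) b" "b = rk z \<or> E (rk z) b"
        by blast
      have ob: "Ord b" using a b Ord_mem by blast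
      have lt: "E (rk w) b" if "w \<in> name_dom E PP x \<union> name_dom E PP y \<union> name_dom E PP z" for w
        using that b(2-4) name_dom_rk[of w x] name_dom_rk[of w y] name_dom_rk[of w z] Ord_trans[OF ob]
        by (metis Un_iff)
      show "P x y z" by (rule step) (use lt IH[OF b(1)] ob in auto)
    qed
  qed
  moreover have "isset {x, y, z}" by auto
  then have "E (rk x) (rk (code {x, y, z}))" "E (rk y) (rk (code {x, y, z}))" "E (rk z) (rk (code {x, y, z}))"
    by (auto intro!: rk_mono)
  ultimately show ?thesis using Ord_rk by blast
qed

lemma name_induct2:
  assumes P: "dfn (\<lambda>e. P (e 0) (e 1))"
    and step: "\<And>x y. (\<And>x' y'. {x', y'} \<subseteq> name_dom E PP x \<union> name_dom E PP y \<Longrightarrow> P x' y') \<Longrightarrow> P x y"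
  shows "P x y"
proof (rule name_induct3[where P = "\<lambda>x y z. P x y"])
  show "P x y" if "\<And>x' y' z'. {x', y', z'} \<subseteq> name_dom E PP x \<union> name_dom E PP y \<union> name_dom E PP z \<Longrightarrow> P x' y'" for x y z
    by (rule step) (use that in blast)
qed (rule P)

lemma mem_clause_mono:
  assumes "\<And>r v s. r \<in> C \<Longrightarrow> name_elem E PP v s w \<Longrightarrow> R r z v \<Longrightarrow> R' r z v" "mem_clause E PP R q z w"
  shows "mem_clause E PP R' q z w"
  unfolding mem_clause_def
proof
  fix q' assume "q' \<in> BL q"
  then obtain r v s where "r \<in> BL q'" "name_elem E PP v s w" "Leq PP r s" "R r z v"
    using assms(2) unfolding mem_clause_def by blast
  then show "\<exists>r\<in>BL q'. \<exists>v s. name_elem E PP v s w \<and> Leq PP r s \<and> R' r z v"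
    using assms(1) below_Cond by blast
qed

lemma eq_clause_cong:
  assumes "\<And>r x' y'. r \<in> C \<Longrightarrow> {x', y'} \<subseteq> name_dom E PP x \<union> name_dom E PP y \<Longrightarrow> R r x' y' \<longleftrightarrow> R' r x' y'"
  shows "eq_clause E PP R p x y \<longleftrightarrow> eq_clause E PP R' p x y"
proof -
  have "mem_clause E PP R q z w \<longleftrightarrow> mem_clause E PP R' q z w"
    if zw: "z \<in> name_dom E PP x \<union> name_dom E PP y" "w \<in> {x, y}" for q z w
  proof -
    have "R r z v \<longleftrightarrow> R' r z v" if "r \<in> C" "name_elem E PP v s w" for r v s
      using zw that assms[of r z v] by (auto simp: name_dom_def)
    then show ?thesis
      using mem_clause_mono[of w R z R' q] mem_clause_mono[of w R' z R q] by blast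
  qed
  then show ?thesis unfolding eq_clause_def by simp
qed

lemma coded_rel_iff: "coded_rel E F p x y \<longleftrightarrow> E (pr p (pr x y)) F"
  by (simp add: coded_rel_def)

definition sol :: "'a \<Rightarrow> 'a \<Rightarrow> bool" where
  "sol t F \<longleftrightarrow> Trans t \<and> (\<forall>x' y'. E x' t \<and> E y' t \<longrightarrow>
     (\<forall>q \<in> C. coded_rel E F q x' y' \<longleftrightarrow> eq_clause E PP (coded_rel E F) q x' y'))"

lemma dfn_coded_rel [dfn_intros]:
  "\<lbrakk>dft F; dft p; dft x; dft y\<rbrakk> \<Longrightarrow> dfn (\<lambda>e. coded_rel E (F e) (p e) (x e) (y e))"
  unfolding coded_rel_iff by (intro dfn_intros)

lemma dfn_sol [dfn_intros]: "dft t \<Longrightarrow> dft F \<Longrightarrow> dfn (\<lambda>e. sol (t e) (F e))"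
  unfolding sol_def eq_clause_def mem_clause_def by (intro dfn_intros dft_shift)

lemma forces_eq_iff: "FE p x y \<longleftrightarrow> (\<exists>t F. sol t F \<and> E x t \<and> E y t \<and> coded_rel E F p x y)"
  unfolding forces_eq_def sol_def holds_trans_set by blast

lemma sol_unique:
  assumes F: "sol t F" "sol t' F'" and "E x t" "E y t" "E x t'" "E y t'" "p \<in> C"
  shows "coded_rel E F p x y \<longleftrightarrow> coded_rel E F' p x y"
proof -
  have "\<forall>p\<in>C. E x t \<and> E y t \<and> E x t' \<and> E y t' \<longrightarrow> (coded_rel E F p x y \<longleftrightarrow> coded_rel E F' p x y)"
  proof (rule name_induct2[where P = "\<lambda>x y. \<forall>p\<in>C. E x t \<and> E y t \<and> E x t' \<and> E y t' \<longrightarrow> (coded_rel E F p x y \<longleftrightarrow> coded_rel E F' p x y)"],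
      intro dfn_intros, intro ballI impI)
    fix x y p
    assume IH: "\<And>x' y'. {x', y'} \<subseteq> name_dom E PP x \<union> name_dom E PP y \<Longrightarrow>
        \<forall>p\<in>C. E x' t \<and> E y' t \<and> E x' t' \<and> E y' t' \<longrightarrow> (coded_rel E F p x' y' \<longleftrightarrow> coded_rel E F' p x' y')"
      and p: "p \<in> C" and xy: "E x t \<and> E y t \<and> E x t' \<and> E y t'"
    have tt: "Trans t" "Trans t'" using F by (auto simp: sol_def)
    have "eq_clause E PP (coded_rel E F) p x y \<longleftrightarrow> eq_clause E PP (coded_rel E F') p x y"
    proof (rule eq_clause_cong)
      fix r x' y' assume r: "r \<in> C" and s: "{x', y'} \<subseteq> name_dom E PP x \<union> name_dom E PP y"
      have "E x' t \<and> E y' t \<and> E x' t' \<and> E y' t'"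
        using s xy name_dom_Trans[OF tt(1)] name_dom_Trans[OF tt(2)] by blast
      then show "coded_rel E F r x' y' \<longleftrightarrow> coded_rel E F' r x' y'" using IH[OF s] r by blast
    qed
    then show "coded_rel E F p x y \<longleftrightarrow> coded_rel E F' p x y" using F p xy unfolding sol_def by blast
  qed
  then show ?thesis using assms by blast
qed

text \<open>The recursion on pairs of names is turned into one on ordinals: \<open>K a\<close> codes
  the verdicts on pairs of rank below \<open>a\<close>, computed by the clause for equality from the
  union of the earlier stages. The stage \<open>rk t\<close> then obeys the clause on all of
  \<open>t\<close>.\<close>

lemma sol_exists: assumes t: "Trans t" shows "\<exists>F. sol t F"
proof -
  define G where "G a f = code {u \<in> vprod C (vprod (els t) (els t)). \<exists>p x y. u = pr p (pr x y) \<and>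
     E (rk x) a \<and> E (rk y) a \<and>
     eq_clause E PP (\<lambda>p x y. \<exists>b\<in>els a. E (pr p (pr x y)) (app f b)) p x y}" for a f
  have S: "isset {u \<in> vprod C (vprod (els t) (els t)). \<exists>p x y. u = pr p (pr x y) \<and>
     E (rk x) a \<and> E (rk y) a \<and>
     eq_clause E PP (\<lambda>p x y. \<exists>b\<in>els a. E (pr p (pr x y)) (app f b)) p x y}" for a f
    unfolding eq_clause_def mem_clause_def
    by (intro isset_sep isset_vprod isset_Cond isset_els dfn_intros)
  have G: "dft (\<lambda>e. G (e 0) (e 1))" unfolding G_def
    by (rule dft_code, rule S, unfold eq_clause_def mem_clause_def) (intro dfn_intros)
  define K where "K = vrec G"
  have dK: "dft t \<Longrightarrow> dft (\<lambda>e. K (t e))" for t unfolding K_def by (rule dft_vrec[OF G])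
  define cr where "cr a p x y \<longleftrightarrow> E (pr p (pr x y)) (K a)" for a p x y
  have dcr: "\<lbrakk>dft a; dft p; dft x; dft y\<rbrakk> \<Longrightarrow> dfn (\<lambda>e. cr (a e) (p e) (x e) (y e))" for a p x y
    unfolding cr_def by (intro dfn_intros dK)
  define U where "U a p x y \<longleftrightarrow> (\<exists>b\<in>els a. cr b p x y)" for a p x y
  have cr: "cr a p x y \<longleftrightarrow> p \<in> C \<and> E x t \<and> E y t \<and> E (rk x) a \<and> E (rk y) a \<and> eq_clause E PP (U a) p x y"
    for a p x y
  proof -
    have 1: "app (lam (els (tc a)) K) b = K b" if "E b a" for b
      by (rule app_lam) (auto intro!: dK dfn_intros mem_tcI that)
    have "(\<lambda>p x y. \<exists>b\<in>els a. E (pr p (pr x y)) (app (lam (els (tc a)) K) b)) = U a"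
      unfolding U_def cr_def by (intro ext bex_cong refl) (simp add: 1)
    moreover have "K a = G a (lam (els (tc a)) K)" unfolding K_def by (rule vrec_unfold[OF G])
    ultimately show ?thesis unfolding cr_def G_def using S[of a "lam (els (tc a)) K"] by auto
  qed
  have top: "\<exists>b. Ord b \<and> E b a \<and> (\<forall>w \<in> name_dom E PP x \<union> name_dom E PP y. E (rk w) b)"
    if "Ord a" "E (rk x) a" "E (rk y) a" for a x y
  proof -
    obtain b where b: "b = rk x \<or> b = rk y" "b = rk x \<or> E (rk x) b" "b = rk y \<or> E (rk y) b"
      using Ord_linear[OF Ord_rk[of x] Ord_rk[of y]] by metis
    have ob: "Ord b" using b(1) Ord_rk by blast
    moreover have "E b a" using b(1) that by blast
    moreover have "E (rk w) b" if "w \<in> name_dom E PP x \<union> name_dom E PP y" for w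
      using that b(2,3) name_dom_rk[of w x] name_dom_rk[of w y] Ord_trans[OF ob] by (metis Un_iff)
    ultimately show ?thesis by blast
  qed
  have step: "U b r x' y'" if IH: "\<And>a b p. Ord a \<Longrightarrow> Ord b \<Longrightarrow> E (rk x') a \<Longrightarrow> E (rk y') a \<Longrightarrow> E (rk x') b
      \<Longrightarrow> E (rk y') b \<Longrightarrow> cr a p x' y' \<longleftrightarrow> cr b p x' y'"
    and h: "U a r x' y'" "Ord a" "Ord b" "E (rk x) b" "E (rk y) b"
      "{x', y'} \<subseteq> name_dom E PP x \<union> name_dom E PP y" for a b r x y x' y'
  proof -
    obtain c where c: "E c a" "cr c r x' y'" using h(1) by (auto simp: U_def)
    obtain d where d: "Ord d" "E d b" "E (rk x') d" "E (rk y') d" using top[OF h(3-5)] h(6) by blast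
    have "Ord c" using c h(2) Ord_mem by blast
    then have "cr d r x' y'" using IH[of c d r] c cr[of c] d by blast
    then show ?thesis using d by (auto simp: U_def)
  qed
  \<comment> \<open>The verdict on a pair is the same at every stage above both ranks. This lets the
    union of the earlier stages be replaced by the current one.\<close>
  have coh: "\<forall>a b p. Ord a \<longrightarrow> Ord b \<longrightarrow> E (rk x) a \<longrightarrow> E (rk y) a \<longrightarrow> E (rk x) b
      \<longrightarrow> E (rk y) b \<longrightarrow> (cr a p x y \<longleftrightarrow> cr b p x y)" for x y
  proof (rule name_induct2[where P = "\<lambda>x y. \<forall>a b p. Ord a \<longrightarrow> Ord b \<longrightarrow> E (rk x) a \<longrightarrow> E (rk y) a \<longrightarrow> E (rk x) b
      \<longrightarrow> E (rk y) b \<longrightarrow> (cr a p x y \<longleftrightarrow> cr b p x y)"], intro dfn_intros dcr, intro allI impI)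
    fix x y a b p
    assume IH: "\<And>x' y'. {x', y'} \<subseteq> name_dom E PP x \<union> name_dom E PP y \<Longrightarrow>
       \<forall>a b p. Ord a \<longrightarrow> Ord b \<longrightarrow> E (rk x') a \<longrightarrow> E (rk y') a \<longrightarrow> E (rk x') b
      \<longrightarrow> E (rk y') b \<longrightarrow> (cr a p x' y' \<longleftrightarrow> cr b p x' y')"
      and ab: "Ord a" "Ord b" "E (rk x) a" "E (rk y) a" "E (rk x) b" "E (rk y) b"
    have "eq_clause E PP (U a) p x y \<longleftrightarrow> eq_clause E PP (U b) p x y"
    proof (rule eq_clause_cong)
      fix r x' y' assume s: "{x', y'} \<subseteq> name_dom E PP x \<union> name_dom E PP y"
      have i: "cr a p x' y' \<longleftrightarrow> cr b p x' y'" if "Ord a" "Ord b" "E (rk x') a" "E (rk y') a" "E (rk x') b"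
        "E (rk y') b" for a b p using IH[OF s] that by blast
      show "U a r x' y' \<longleftrightarrow> U b r x' y'"
        using step[OF i _ ab(1,2,5,6) s] step[OF i _ ab(2,1,3,4) s] by blast
    qed
    then show "cr a p x y \<longleftrightarrow> cr b p x y" using cr ab by simp
  qed
  have "sol t (K (rk t))" unfolding sol_def
  proof (intro conjI t allI impI ballI)
    fix x y p assume xy: "E x t \<and> E y t" and p: "p \<in> C"
    have rxy: "E (rk x) (rk t)" "E (rk y) (rk t)" using xy rk_mono by auto
    have "eq_clause E PP (U (rk t)) p x y \<longleftrightarrow> eq_clause E PP (coded_rel E (K (rk t))) p x y"
    proof (rule eq_clause_cong)
      fix r x' y' assume s: "{x', y'} \<subseteq> name_dom E PP x \<union> name_dom E PP y"
      have x': "E (rk x') (rk t)" "E (rk y') (rk t)" using s xy name_dom_Trans[OF t] rk_mono by blast+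
      obtain d where d: "Ord d" "E d (rk t)" "E (rk x') d" "E (rk y') d"
        using top[OF Ord_rk rxy] s by blast
      have "U (rk t) r x' y' \<longleftrightarrow> cr (rk t) r x' y'"
      proof
        assume "U (rk t) r x' y'"
        then obtain c where c: "E c (rk t)" "cr c r x' y'" by (auto simp: U_def)
        then show "cr (rk t) r x' y'" using coh Ord_mem[OF Ord_rk] Ord_rk x' cr[of c] by blast
      next
        assume "cr (rk t) r x' y'"
        then have "cr d r x' y'" using coh Ord_rk x' d by blast
        then show "U (rk t) r x' y'" using d by (auto simp: U_def)
      qed
      then show "U (rk t) r x' y' \<longleftrightarrow> coded_rel E (K (rk t)) r x' y'" by (simp add: cr_def coded_rel_iff)
    qed
    then show "coded_rel E (K (rk t)) p x y \<longleftrightarrow> eq_clause E PP (coded_rel E (K (rk t))) p x y"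
      using cr[of "rk t" p x y] xy p rxy by (simp add: cr_def coded_rel_iff)
  qed
  then show ?thesis by blast
qed

lemma FE_unfold: assumes p: "p \<in> C" shows "FE p x y \<longleftrightarrow> eq_clause E PP FE p x y"
proof -
  obtain t where t: "Trans t" "E (upr x y) t" using ex_Trans by blast
  then have xy: "E x t" "E y t" using TransD by auto
  obtain F where F: "sol t F" using sol_exists t by blast
  have *: "FE q x' y' \<longleftrightarrow> coded_rel E F q x' y'" if "q \<in> C" "E x' t" "E y' t" for q x' y'
    unfolding forces_eq_iff using that F sol_unique[OF F] by blast
  have "eq_clause E PP FE p x y \<longleftrightarrow> eq_clause E PP (coded_rel E F) p x y"
  proof (rule eq_clause_cong)
    fix r x' y' assume r: "r \<in> C" and s: "{x', y'} \<subseteq> name_dom E PP x \<union> name_dom E PP y"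
    have "E w t" if "w \<in> name_dom E PP x \<union> name_dom E PP y" for w
      using that name_dom_Trans[OF t(1) xy(1)] name_dom_Trans[OF t(1) xy(2)] by blast
    then show "FE r x' y' \<longleftrightarrow> coded_rel E F r x' y'" using * r s by simp
  qed
  then show ?thesis using *[OF p xy] F p xy unfolding sol_def by blast
qed

lemma dfn_FE [dfn_intros]:
  "\<lbrakk>dft p; dft x; dft y\<rbrakk> \<Longrightarrow> dfn (\<lambda>e. FE (p e) (x e) (y e))"
  unfolding forces_eq_iff by (intro dfn_intros dft_shift)

lemma FM_iff: "FM p x y \<longleftrightarrow> (\<forall>q\<in>BL p. \<exists>r\<in>BL q. \<exists>z s. s \<in> C \<and> E (pr z s) y \<and> Leq PP r s \<and> FE r x z)"
  unfolding mem_clause_def name_elem_iff by simp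

lemma dfn_FM [dfn_intros]:
  "\<lbrakk>dft p; dft x; dft y\<rbrakk> \<Longrightarrow> dfn (\<lambda>e. FM (p e) (x e) (y e))"
  unfolding FM_iff by (intro dfn_intros dft_shift)

lemma FE_iff: "p \<in> C \<Longrightarrow> FE p x y \<longleftrightarrow>
   (\<forall>z \<in> name_dom E PP x \<union> name_dom E PP y. \<forall>q \<in> BL p. FM q z x \<longleftrightarrow> FM q z y)"
  unfolding FE_unfold[of p] eq_clause_def by simp

lemma FE_refl [simp]: "p \<in> C \<Longrightarrow> FE p x x" by (simp add: FE_iff)

lemma FE_sym: "p \<in> C \<Longrightarrow> FE p x y \<Longrightarrow> FE p y x" by (auto simp: FE_iff)

lemma FE_mono: "p \<in> C \<Longrightarrow> q \<in> BL p \<Longrightarrow> FE p x y \<Longrightarrow> FE q x y"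
  unfolding FE_iff[of p] FE_iff[OF below_Cond[of q p]] using below_trans[of _ q p] by blast

lemma FM_mono: "p \<in> C \<Longrightarrow> q \<in> BL p \<Longrightarrow> FM p x y \<Longrightarrow> FM q x y"
  unfolding FM_iff[of p] FM_iff[of q] using below_trans[of _ q p] by blast

lemma FM_dense: "p \<in> C \<Longrightarrow> (\<And>q. q \<in> BL p \<Longrightarrow> \<exists>r\<in>BL q. FM r x y) \<Longrightarrow> FM p x y"
  unfolding FM_iff[of p]
proof
  fix q assume p: "p \<in> C" "\<And>q. q \<in> BL p \<Longrightarrow> \<exists>r\<in>BL q. FM r x y" and q: "q \<in> BL p"
  then obtain r where r: "r \<in> BL q" "FM r x y" by blast
  then have "r \<in> BL r" using below_Cond by simp
  then obtain r' z s where "r' \<in> BL r" "s \<in> C \<and> E (pr z s) y \<and> Leq PP r' s \<and> FE r' x z"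
    using r(2) unfolding FM_iff by blast
  then show "\<exists>r\<in>BL q. \<exists>z s. s \<in> C \<and> E (pr z s) y \<and> Leq PP r s \<and> FE r x z"
    using below_trans[OF _ r(1)] q below_Cond by blast
qed

lemma FM_own: "p \<in> C \<Longrightarrow> s \<in> C \<Longrightarrow> E (pr z s) y \<Longrightarrow> Leq PP p s \<Longrightarrow> FM p z y"
  unfolding FM_iff using Leq_trans by (metis FE_refl below_refl mem_below)

lemma FM_witness: assumes "p \<in> C" "FM p x y"
  obtains r z s where "r \<in> BL p" "s \<in> C" "E (pr z s) y" "Leq PP r s" "FE r x z"
  using assms unfolding FM_iff by (metis below_refl)

text \<open>Transitivity of forced equality and invariance of membership depend on each other.
  Isolating the instances of transitivity as the hypothesis \<open>tr\<close> allows this lemma to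
  be used inside the induction for \<open>FE_trans\<close>, with \<open>tr\<close> coming from names
  of smaller rank.\<close>

lemma FM_transfer_aux:
  assumes p: "p \<in> C" and eq: "FE p x y" and m: "FM p w x"
    and tr: "\<And>r z z'. r \<in> C \<Longrightarrow> z \<in> name_dom E PP x \<Longrightarrow> z' \<in> name_dom E PP y \<Longrightarrow> FE r w z \<Longrightarrow> FE r z z' \<Longrightarrow> FE r w z'"
  shows "FM p w y"
proof (rule FM_dense[OF p])
  fix q assume q: "q \<in> BL p"
  then have qC: "q \<in> C" using below_Cond by blast
  obtain r z s where r: "r \<in> BL q" "s \<in> C" "E (pr z s) x" "Leq PP r s" "FE r w z"
    using FM_witness[OF qC FM_mono[OF p q m]] by blast
  then have rC: "r \<in> C" and rp: "r \<in> BL p" using below_Cond below_trans[OF _ q p] by blast+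
  have "z \<in> name_dom E PP x \<union> name_dom E PP y" using r(2,3) by (auto simp: mem_name_dom)
  then have "FM r z x \<longleftrightarrow> FM r z y" using eq rp unfolding FE_iff[OF p] by blast
  then have "FM r z y" using FM_own[OF rC r(2-4)] by blast
  then obtain r' z' s' where r': "r' \<in> BL r" "s' \<in> C" "E (pr z' s') y" "Leq PP r' s'" "FE r' z z'"
    using FM_witness[OF rC] by blast
  have r'C: "r' \<in> C" using r' below_Cond by blast
  have "FE r' w z'" by (rule tr[of r' z]) (use r r' r'C FE_mono[OF rC r'(1)] in \<open>auto simp: mem_name_dom\<close>)
  then have "FM r' w y" unfolding FM_iff
    using r'(2-4) below_Cond r'C Leq_trans FE_mono[OF r'C] by (metis below_refl mem_below)
  then show "\<exists>r\<in>BL q. FM r w y" using below_trans[OF r'(1) r(1) qC] by blast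
qed

lemma FE_trans: assumes "p \<in> C" "FE p x y" "FE p y z" shows "FE p x z"
proof -
  have "\<forall>p\<in>C. FE p x y \<longrightarrow> FE p y z \<longrightarrow> FE p x z"
  proof (rule name_induct3[where P = "\<lambda>x y z. \<forall>p\<in>C. FE p x y \<longrightarrow> FE p y z \<longrightarrow> FE p x z"], intro dfn_intros, intro ballI impI)
    fix x y z p
    assume IH: "\<And>x' y' z'. {x', y', z'} \<subseteq> name_dom E PP x \<union> name_dom E PP y \<union> name_dom E PP z \<Longrightarrow>
        \<forall>p\<in>C. FE p x' y' \<longrightarrow> FE p y' z' \<longrightarrow> FE p x' z'"
      and p: "p \<in> C" and eq: "FE p x y" "FE p y z"
    have tr: "FM q w b" if "w \<in> name_dom E PP x \<union> name_dom E PP z" "FE q a b" "FM q w a" "q \<in> C"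
      "a \<in> {x, y, z}" "b \<in> {x, y, z}" for q w a b
      by (rule FM_transfer_aux[OF that(4,2,3)]) (use IH that in blast)
    show "FE p x z" unfolding FE_iff[OF p]
    proof (intro ballI)
      fix w q assume w: "w \<in> name_dom E PP x \<union> name_dom E PP z" and q: "q \<in> BL p"
      have qC: "q \<in> C" using q below_Cond by blast
      have e: "FE q x y" "FE q y z" "FE q y x" "FE q z y" using eq FE_mono[OF p q] FE_sym[OF qC] by blast+
      show "FM q w x \<longleftrightarrow> FM q w z" using tr[OF w _ _ qC] e by blast
    qed
  qed
  then show ?thesis using assms by blast
qed

lemma FM_eq_right: "p \<in> C \<Longrightarrow> FE p x y \<Longrightarrow> FM p w x \<Longrightarrow> FM p w y"
  by (erule FM_transfer_aux) (auto intro: FE_trans)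

lemma FM_eq_left: assumes "p \<in> C" "FE p w w'" "FM p w x" shows "FM p w' x"
  unfolding FM_iff
proof
  fix q assume q: "q \<in> BL p"
  then obtain r z s where r: "r \<in> BL q" "s \<in> C \<and> E (pr z s) x \<and> Leq PP r s \<and> FE r w z"
    using assms(3) unfolding FM_iff by blast
  have "r \<in> BL p" "r \<in> C" using below_trans[OF r(1) q assms(1)] below_Cond by blast+
  then have "FE r w' z" using r(2) FE_mono[OF assms(1) _ assms(2)] FE_sym FE_trans by blast
  then show "\<exists>r\<in>BL q. \<exists>z s. s \<in> C \<and> E (pr z s) x \<and> Leq PP r s \<and> FE r w' z" using r by blast
qed

lemma FE_ext: assumes "p \<in> C" "\<And>w q. q \<in> BL p \<Longrightarrow> FM q w x \<longleftrightarrow> FM q w y" shows "FE p x y"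
  unfolding FE_iff[OF assms(1)] using assms(2) by blast

lemma FE_dense: assumes p: "p \<in> C" and d: "\<And>q. q \<in> BL p \<Longrightarrow> \<exists>r\<in>BL q. FE r x y" shows "FE p x y"
proof (rule FE_ext[OF p])
  have *: "FM q w b" if q: "q \<in> BL p" and e: "\<And>r. r \<in> C \<Longrightarrow> FE r x y \<Longrightarrow> FE r a b" and m: "FM q w a" for q w a b
  proof (rule FM_dense)
    show qC: "q \<in> C" using q below_Cond by blast
    fix q' assume q': "q' \<in> BL q"
    then obtain r where r: "r \<in> BL q'" "FE r x y" using d below_trans[OF q' q p] by blast
    have "r \<in> C" "r \<in> BL q" using r below_Cond below_trans[OF r(1) q' qC] by blast+
    then have "FM r w b" using FM_eq_right e r FM_mono[OF qC _ m] by blast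
    then show "\<exists>r\<in>BL q'. FM r w b" using r by blast
  qed
  show "FM q w x \<longleftrightarrow> FM q w y" if "q \<in> BL p" for q w
    using *[OF that, of x y w] *[OF that, of y x w] FE_sym by blast
qed

lemma forces_mono: "p \<in> C \<Longrightarrow> q \<in> BL p \<Longrightarrow> forces E PP \<phi> p \<Longrightarrow> forces E PP \<phi> q"
  by (induction \<phi>) (auto intro: FM_mono FE_mono below_trans)

lemma forces_dense:
  "p \<in> C \<Longrightarrow> (\<And>q. q \<in> BL p \<Longrightarrow> \<exists>r\<in>BL q. forces E PP \<phi> r) \<Longrightarrow> forces E PP \<phi> p"
proof (induction \<phi> arbitrary: p)
  case (FMem x y)
  show ?case unfolding forces.simps
    by (rule FM_dense[OF FMem.prems(1)]) (use FMem.prems(2) in \<open>unfold forces.simps, blast\<close>)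
next
  case (FEq x y)
  show ?case unfolding forces.simps
    by (rule FE_dense[OF FEq.prems(1)]) (use FEq.prems(2) in \<open>unfold forces.simps, blast\<close>)
next
  case (FNeg \<phi>)
  show ?case unfolding forces.simps
  proof
    fix q assume "q \<in> BL p"
    then obtain r where r: "r \<in> BL q" "\<forall>q\<in>BL r. \<not> forces E PP \<phi> q"
      using FNeg.prems by auto
    then show "\<not> forces E PP \<phi> q" using forces_mono[of q r \<phi>] below_Cond[of q] below_Cond[of r] \<open>q \<in> BL p\<close> by auto
  qed
next
  case (FAnd \<phi> \<psi>)
  have "forces E PP \<phi> p" by (rule FAnd.IH(1)[OF FAnd.prems(1)]) (use FAnd.prems(2) in fastforce)
  moreover have "forces E PP \<psi> p" by (rule FAnd.IH(2)[OF FAnd.prems(1)]) (use FAnd.prems(2) in fastforce)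
  ultimately show ?case by simp
next
  case (FAll \<phi>)
  have "forces E PP (\<phi> x) p" for x
    by (rule FAll.IH[OF rangeI FAll.prems(1)]) (use FAll.prems(2) in \<open>unfold forces.simps, blast\<close>)
  then show ?case by simp
qed

lemma forces_or: "p \<in> C \<Longrightarrow> forces E PP (\<phi> \<^bold>\<or> \<psi>) p \<longleftrightarrow>
    (\<forall>q\<in>BL p. \<exists>r\<in>BL q. forces E PP \<phi> r \<or> forces E PP \<psi> r)"
proof -
  assume p: "p \<in> C"
  have "forces E PP (\<phi> \<^bold>\<or> \<psi>) p \<longleftrightarrow>
     (\<forall>q\<in>BL p. \<not> ((\<forall>r\<in>BL q. \<not> forces E PP \<phi> r) \<and> (\<forall>r\<in>BL q. \<not> forces E PP \<psi> r)))"
    unfolding FOr_def forces.simps ..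
  then show ?thesis by blast
qed

text \<open>By its definition through negation, a forced implication only makes the conclusion
  dense; \<open>forces_dense\<close> turns this into the conclusion itself.\<close>

lemma forces_imp: assumes p: "p \<in> C"
  shows "forces E PP (\<phi> \<^bold>\<longrightarrow> \<psi>) p \<longleftrightarrow> (\<forall>q\<in>BL p. forces E PP \<phi> q \<longrightarrow> forces E PP \<psi> q)"
proof -
  have 1: "forces E PP (\<phi> \<^bold>\<longrightarrow> \<psi>) p \<longleftrightarrow>
     (\<forall>q\<in>BL p. \<not> (forces E PP \<phi> q \<and> (\<forall>r\<in>BL q. \<not> forces E PP \<psi> r)))"
    unfolding FImp_def forces.simps ..
  show ?thesis unfolding 1
  proof (intro iffI ballI impI)
    fix q assume a: "\<forall>q\<in>BL p. \<not> (forces E PP \<phi> q \<and> (\<forall>r\<in>BL q. \<not> forces E PP \<psi> r))"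
      and q: "q \<in> BL p" "forces E PP \<phi> q"
    have qC: "q \<in> C" using q below_Cond by blast
    show "forces E PP \<psi> q"
      by (rule forces_dense[OF qC]) (use a q forces_mono[OF qC] below_trans[OF _ q(1) p] in blast)
  next
    fix q assume a: "\<forall>q\<in>BL p. forces E PP \<phi> q \<longrightarrow> forces E PP \<psi> q" and q: "q \<in> BL p"
    then show "\<not> (forces E PP \<phi> q \<and> (\<forall>r\<in>BL q. \<not> forces E PP \<psi> r))" using below_Cond below_refl by blast
  qed
qed

lemma forces_iff: "p \<in> C \<Longrightarrow> forces E PP (\<phi> \<^bold>\<longleftrightarrow> \<psi>) p \<longleftrightarrow> (\<forall>q\<in>BL p. forces E PP \<phi> q \<longleftrightarrow> forces E PP \<psi> q)"
  unfolding FIff_def forces.simps by (auto simp: forces_imp)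

text \<open>Witnesses exist only densely. No maximum principle is invoked; proofs pass to an
  extension whenever a name is to be chosen.\<close>

lemma forces_ex: "forces E PP (FEx \<phi>) p \<longleftrightarrow> (\<forall>q\<in>BL p. \<exists>r\<in>BL q. \<exists>x. forces E PP (\<phi> x) r)"
proof -
  have "forces E PP (FEx \<phi>) p \<longleftrightarrow> (\<forall>q\<in>BL p. \<not> (\<forall>x. \<forall>r\<in>BL q. \<not> forces E PP (\<phi> x) r))"
    unfolding FEx_def forces.simps ..
  then show ?thesis by blast
qed

lemma forces_exI: "p \<in> C \<Longrightarrow> forces E PP (\<phi> x) p \<Longrightarrow> forces E PP (FEx \<phi>) p"
  unfolding forces_ex using forces_mono[of p _ "\<phi> x"] below_Cond below_refl by blast

end

section \<open>Names obtained by recursive translation\<close>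

context zfc begin

text \<open>All approximations in \<open>is_translation\<close> agree with a function
  \<open>Tr\<close> obtained from \<open>vrec\<close>. Afterwards canonical and lifted names are
  handled by the recursion equation and definability alone.\<close>

lemma translate_props:
  assumes B: "dfn (\<lambda>e. B (e 0) (e 1) (e 2))" and tcB: "\<And>z c x. B z c x \<Longrightarrow> E z (tc x)"
    and setB: "\<And>x. isset {pr z c |z c. B z c x}"
  shows "E u (translate E B x) \<longleftrightarrow> (\<exists>z c. B z c x \<and> u = pr (translate E B z) c)" (is ?mem)
    and "dft t \<Longrightarrow> dft (\<lambda>e. translate E B (t e))" (is "PROP ?dft")
proof -
  note B' = dfn_comp3[OF B]
  define G where "G x f = code {u. \<exists>z c. B z c x \<and> u = pr (app f z) c}" for x f
  have S: "isset {u. \<exists>z c. B z c x \<and> u = pr (F z) c}" if "dft (\<lambda>e. F (e 0))" for F x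
  proof -
    have "isset ((\<lambda>w. pr (F (vfst w)) (vsnd w)) ` {pr z c |z c. B z c x})"
      by (intro isset_image setB dfn_intros dft_comp1[OF that])
    moreover have "(\<lambda>w. pr (F (vfst w)) (vsnd w)) ` {pr z c |z c. B z c x} = {u. \<exists>z c. B z c x \<and> u = pr (F z) c}"
      by (force simp: image_iff)
    ultimately show ?thesis by simp
  qed
  have G: "dft (\<lambda>e. G (e 0) (e 1))" unfolding G_def
    by (rule dft_code, rule S, intro dfn_intros) (intro dfn_intros B')
  define Tr where "Tr = vrec G"
  have dTr: "dft t \<Longrightarrow> dft (\<lambda>e. Tr (t e))" for t unfolding Tr_def by (rule dft_vrec[OF G])
  have dTr0: "dft (\<lambda>e. Tr (e 0))" by (intro dTr dfn_intros)
  have Tr: "E u (Tr x) \<longleftrightarrow> (\<exists>z c. B z c x \<and> u = pr (Tr z) c)" for u x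
  proof -
    have 2: "app (lam (els (tc x)) Tr) z = Tr z" if "B z c x" for z c
      by (rule app_lam) (use tcB[OF that] dTr0 in auto)
    have "Tr x = G x (lam (els (tc x)) Tr)" unfolding Tr_def by (rule vrec_unfold[OF G])
    also have "\<dots> = code {u. \<exists>z c. B z c x \<and> u = pr (app (lam (els (tc x)) Tr) z) c}" by (simp add: G_def)
    also have "{u. \<exists>z c. B z c x \<and> u = pr (app (lam (els (tc x)) Tr) z) c} = {u. \<exists>z c. B z c x \<and> u = pr (Tr z) c}"
      by (intro Collect_cong ex_cong1 conj_cong refl) (simp add: 2)
    finally have 3: "Tr x = code {u. \<exists>z c. B z c x \<and> u = pr (Tr z) c}" .
    show ?thesis by (subst 3, subst mem_code[OF S[OF dTr0, of x]]) simp
  qed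
  have tr: "is_translation E B x y \<longleftrightarrow> y = Tr x" for x y
  proof
    assume "is_translation E B x y"
    then obtain t b f where t: "Trans t"
      and f12: "els f \<subseteq> vprod (els t) (els b) \<and> (\<forall>x\<in>els t. \<exists>!y. E (pr x y) f)"
      and rec: "\<forall>x' y'. E (pr x' y') f \<longrightarrow> (\<forall>u. E u y' \<longleftrightarrow> (\<exists>z c w. B z c x' \<and> E (pr z w) f \<and> u = pr w c))"
      and xy: "E (pr x y) f"
      unfolding is_translation_def holds_is_fun holds_rel holds_is_pair holds_trans_set by blast
    have f: "els f \<subseteq> vprod (els t) (els b)" "\<And>x. E x t \<Longrightarrow> \<exists>!y. E (pr x y) f"
      using f12 by (simp_all only: mem_els Ball_def)
    have ft: "E x t" if "E (pr x y) f" for x y using f(1) that by (auto simp: subset_iff)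
    have "\<forall>y. E (pr x y) f \<longrightarrow> y = Tr x" for x
    proof (rule tc_induct[where P = "\<lambda>x. \<forall>y. E (pr x y) f \<longrightarrow> y = Tr x"], intro dfn_intros dTr, intro allI impI)
      fix x y assume IH: "\<And>z. E z (tc x) \<Longrightarrow> \<forall>y. E (pr z y) f \<longrightarrow> y = Tr z" and xy: "E (pr x y) f"
      have *: "E (pr z w) f \<longleftrightarrow> w = Tr z" if "B z c x" for z c w
      proof -
        have z: "E z (tc x)" using tcB that by blast
        then have "E z t" using tc_sub_Trans[OF t ft[OF xy]] by blast
        then show ?thesis using f(2)[of z] IH[OF z] by blast
      qed
      show "y = Tr x"
      proof (rule extensionality)
        fix u show "E u y \<longleftrightarrow> E u (Tr x)" unfolding rec[rule_format, OF xy] Tr[of u x] using * by metis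
      qed
    qed
    then show "y = Tr x" using xy by blast
  next
    assume y: "y = Tr x"
    obtain t where t: "Trans t" "E x t" using ex_Trans by blast
    have sub: "E z t" if "B z c x'" "E x' t" for z c x' using tc_sub_Trans[OF t(1) that(2)] tcB[OF that(1)] by blast
    let ?f = "lam (els t) Tr"
    have f: "E (pr x' y') ?f \<longleftrightarrow> E x' t \<and> y' = Tr x'" for x' y'
      by (subst mem_lam) (auto intro: dTr0)
    have fn: "holds E (is_fun ?f t (code (Tr ` els t)))"
      unfolding holds_is_fun
    proof
      have i: "isset (Tr ` els t)" by (intro isset_image isset_els dTr0)
      show "els ?f \<subseteq> vprod (els t) (els (code (Tr ` els t)))"
        using i by (auto simp: mem_lam dTr0)
      show "\<forall>x\<in>els t. \<exists>!y. E (pr x y) ?f" unfolding f by simp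
    qed
    have *: "E u (Tr x') \<longleftrightarrow> (\<exists>z c w. B z c x' \<and> (E z t \<and> w = Tr z) \<and> u = pr w c)" if "E x' t" for x' u
      using sub[OF _ that] by (auto simp: Tr)
    show "is_translation E B x y" unfolding is_translation_def holds_trans_set holds_rel holds_is_pair
      by (rule exI[of _ t], rule exI[of _ "code (Tr ` els t)"], rule exI[of _ ?f])
         (use t fn in \<open>simp add: f * y\<close>)
  qed
  have eq: "translate E B = Tr"
    unfolding translate_def tr by simp
  show ?mem unfolding eq by (rule Tr)
  show "PROP ?dft" unfolding eq by (rule dTr)
qed

end

context forcing begin

section \<open>Names for pairs\<close>

text \<open>Names for unordered and ordered pairs. All conditions are attached, as for canonical
  names, because there need not be a largest one.\<close>

definition up :: "'a \<Rightarrow> 'a \<Rightarrow> 'a" where "up x y = code (vprod {x, y} C)"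
definition op :: "'a \<Rightarrow> 'a \<Rightarrow> 'a" where "op x y = up (up x x) (up x y)"

lemma mem_up: "E (pr z s) (up x y) \<longleftrightarrow> s \<in> C \<and> (z = x \<or> z = y)"
  unfolding up_def by (subst mem_code) (auto simp: isset_Cond)

lemma dft_up [dfn_intros]: assumes "dft t" "dft u" shows "dft (\<lambda>e. up (t e) (u e))"
  unfolding up_def
proof (rule dft_code)
  show "dfn (\<lambda>e. e 0 \<in> vprod {t (\<lambda>n. e (Suc n)), u (\<lambda>n. e (Suc n))} C)"
    by (intro dfn_intros dft_var, unfold insert_iff empty_iff) (intro dfn_intros dft_shift assms)+
qed (auto simp: isset_Cond)

lemma dft_op [dfn_intros]: "dft t \<Longrightarrow> dft u \<Longrightarrow> dft (\<lambda>e. op (t e) (u e))"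
  unfolding op_def by (intro dfn_intros)

lemma FM_up: assumes p: "p \<in> C"
  shows "FM p w (up x y) \<longleftrightarrow> (\<forall>q\<in>BL p. \<exists>r\<in>BL q. FE r w x \<or> FE r w y)"
  unfolding FM_iff mem_up
proof (intro ball_cong refl iffI)
  fix q assume "\<exists>r\<in>BL q. FE r w x \<or> FE r w y"
  then obtain r where r: "r \<in> BL q" "FE r w x \<or> FE r w y" by blast
  then have "r \<in> C" "Leq PP r r" using below_Cond Leq_refl by blast+
  then show "\<exists>r\<in>BL q. \<exists>z s. s \<in> C \<and> (s \<in> C \<and> (z = x \<or> z = y)) \<and> Leq PP r s \<and> FE r w z"
    using r by blast
qed blast

lemma forces_eq_or: "p \<in> C \<Longrightarrow> forces E PP (u \<^bold>= x \<^bold>\<or> u \<^bold>= y) p \<longleftrightarrow> FM p u (up x y)"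
  by (simp add: forces_or FM_up)

lemma forces_is_upair: assumes p: "p \<in> C"
  shows "forces E PP (is_upair z x y) p \<longleftrightarrow> FE p z (up x y)"
proof -
  have "forces E PP (is_upair z x y) p \<longleftrightarrow> (\<forall>u. \<forall>q\<in>BL p. FM q u z \<longleftrightarrow> FM q u (up x y))"
    unfolding is_upair_def forces.simps forces_iff[OF p]
    by (intro iff_allI ball_cong refl) (simp add: forces_eq_or below_Cond)
  also have "\<dots> \<longleftrightarrow> FE p z (up x y)"
  proof
    assume "\<forall>u. \<forall>q\<in>BL p. FM q u z \<longleftrightarrow> FM q u (up x y)"
    then show "FE p z (up x y)" by (intro FE_ext[OF p]) blast
  next
    assume e: "FE p z (up x y)"
    show "\<forall>u. \<forall>q\<in>BL p. FM q u z \<longleftrightarrow> FM q u (up x y)"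
    proof (intro allI ballI)
      fix u q assume q: "q \<in> BL p"
      then have "q \<in> C" "FE q z (up x y)" using below_Cond FE_mono[OF p q e] by blast+
      then show "FM q u z \<longleftrightarrow> FM q u (up x y)" using FM_eq_right FE_sym by blast
    qed
  qed
  finally show ?thesis .
qed

lemma up_cong: assumes p: "p \<in> C" and e: "FE p x x'" "FE p y y'" shows "FE p (up x y) (up x' y')"
proof (rule FE_ext[OF p])
  have *: "FM q w (up a' b')" if q: "q \<in> C" and e: "FE q a a'" "FE q b b'" and m: "FM q w (up a b)" for a b a' b' q w
    unfolding FM_up[OF q]
  proof
    fix q' assume q': "q' \<in> BL q"
    then obtain r where r: "r \<in> BL q'" "FE r w a \<or> FE r w b" using m unfolding FM_up[OF q] by blast
    then have "r \<in> C" "r \<in> BL q" using below_Cond below_trans[OF _ q' q] by blast+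
    then show "\<exists>r\<in>BL q'. FE r w a' \<or> FE r w b'" using r e FE_mono[OF q] FE_trans by blast
  qed
  fix w q assume q: "q \<in> BL p"
  then have "q \<in> C" "FE q x x'" "FE q y y'" using below_Cond FE_mono[OF p q] e by blast+
  then show "FM q w (up x y) \<longleftrightarrow> FM q w (up x' y')" using * FE_sym by meson
qed

lemma op_cong: "p \<in> C \<Longrightarrow> FE p x x' \<Longrightarrow> FE p y y' \<Longrightarrow> FE p (op x y) (op x' y')"
  unfolding op_def by (intro up_cong)

lemma forces_is_pair: assumes p: "p \<in> C"
  shows "forces E PP (is_pair z x y) p \<longleftrightarrow> FE p z (op x y)"
proof
  assume f: "forces E PP (is_pair z x y) p"
  show "FE p z (op x y)"
  proof (rule FE_dense[OF p])
    fix q assume q: "q \<in> BL p"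
    then obtain r a where r: "r \<in> BL q" "forces E PP (\<^bold>\<exists>b. is_upair a x x \<^bold>\<and> is_upair b x y \<^bold>\<and> is_upair z a b) r"
      using f unfolding is_pair_def forces_ex[of _ p] by blast
    have rC: "r \<in> C" using r below_Cond by blast
    then obtain r' b where r': "r' \<in> BL r" "forces E PP (is_upair a x x \<^bold>\<and> is_upair b x y \<^bold>\<and> is_upair z a b) r'"
      using r(2) unfolding forces_ex[of _ r] using below_refl by blast
    have r'C: "r' \<in> C" using r' below_Cond by blast
    then have "FE r' a (up x x)" "FE r' b (up x y)" "FE r' z (up a b)"
      using r'(2) by (auto simp: forces_is_upair)
    then have "FE r' z (op x y)" unfolding op_def using up_cong FE_trans r'C by blast
    moreover have "r' \<in> BL q" using below_trans[OF r'(1) r(1)] q below_Cond by blast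
    ultimately show "\<exists>r\<in>BL q. FE r z (op x y)" by blast
  qed
next
  assume "FE p z (op x y)"
  then have "forces E PP (is_upair (up x x) x x \<^bold>\<and> is_upair (up x y) x y \<^bold>\<and> is_upair z (up x x) (up x y)) p"
    using p by (simp add: forces_is_upair op_def)
  then show "forces E PP (is_pair z x y) p" unfolding is_pair_def using p by (intro forces_exI)
qed

lemma forces_rel: assumes p: "p \<in> C"
  shows "forces E PP (rel R x y) p \<longleftrightarrow> FM p (op x y) R"
proof
  assume f: "forces E PP (rel R x y) p"
  show "FM p (op x y) R"
  proof (rule FM_dense[OF p])
    fix q assume q: "q \<in> BL p"
    then obtain r z where r: "r \<in> BL q" "forces E PP (is_pair z x y \<^bold>\<and> z \<^bold>\<in> R) r"
      using f unfolding rel_def forces_ex[of _ p] by blast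
    then have "r \<in> C" using below_Cond by blast
    then show "\<exists>r\<in>BL q. FM r (op x y) R" using r by (auto simp: forces_is_pair intro: FM_eq_left)
  qed
next
  assume "FM p (op x y) R"
  then show "forces E PP (rel R x y) p" unfolding rel_def
    using p by (intro forces_exI[where x = "op x y"]) (auto simp: forces_is_pair)
qed

text \<open>Four successive extensions decide, for each of \<open>x\<close>, \<open>y\<close>,
  \<open>u\<close>, \<open>v\<close>, which member of the other pair it equals; the two combinations
  stated are then the only ones.\<close>

lemma up_eqD: assumes p: "p \<in> C" and e: "FE p (up x y) (up u v)" and q: "q \<in> BL p"
  shows "\<exists>r\<in>BL q. (FE r x u \<and> FE r y v) \<or> (FE r x v \<and> FE r y u)"
proof -
  have step: "\<exists>r'\<in>BL r. FE r' w a \<or> FE r' w b" if "r \<in> BL p" "FE r (up w w') (up a b) \<or> FE r (up w' w) (up a b)" for r w w' a b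
  proof -
    have rC: "r \<in> C" using that below_Cond by blast
    have "FM r w (up w w')" "FM r w (up w' w)" unfolding FM_up[OF rC] using below_Cond FE_refl below_refl by blast+
    then have "FM r w (up a b)" using that FM_eq_right[OF rC] by blast
    then show ?thesis unfolding FM_up[OF rC] using rC below_refl by blast
  qed
  have qC: "q \<in> C" using q below_Cond by blast
  have e1: "FE r (up x y) (up u v)" "FE r (up u v) (up x y)" if "r \<in> BL p" for r
    using FE_mono[OF p that e] FE_sym below_Cond[OF that] by blast+
  obtain r1 where r1: "r1 \<in> BL q" "FE r1 x u \<or> FE r1 x v" using step[OF q] e1[OF q] by blast
  have b1: "r1 \<in> BL p" using below_trans[OF r1(1) q p] .
  obtain r2 where r2: "r2 \<in> BL r1" "FE r2 y u \<or> FE r2 y v" using step[OF b1] e1[OF b1] by blast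
  have b2: "r2 \<in> BL p" using below_trans[OF r2(1) b1 p] .
  obtain r3 where r3: "r3 \<in> BL r2" "FE r3 u x \<or> FE r3 u y" using step[OF b2] e1[OF b2] by blast
  have b3: "r3 \<in> BL p" using below_trans[OF r3(1) b2 p] .
  obtain r4 where r4: "r4 \<in> BL r3" "FE r4 v x \<or> FE r4 v y" using step[OF b3] e1[OF b3] by blast
  have c: "r1 \<in> C" "r2 \<in> C" "r3 \<in> C" "r4 \<in> C" using b1 b2 b3 r4(1) below_Cond by blast+
  have "r4 \<in> BL r2" using below_trans[OF r4(1) r3(1) c(2)] .
  then have m: "r4 \<in> BL r1" using below_trans[OF _ r2(1) c(1)] by blast
  have "FE r4 x u \<or> FE r4 x v" using r1(2) FE_mono[OF c(1) m] by blast
  moreover have "FE r4 y u \<or> FE r4 y v" using r2(2) FE_mono[OF c(2) \<open>r4 \<in> BL r2\<close>] by blast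
  moreover have "FE r4 u x \<or> FE r4 u y" using r3(2) FE_mono[OF c(3) r4(1)] by blast
  moreover have "r4 \<in> BL q" using below_trans[OF m r1(1) qC] .
  ultimately show ?thesis using r4(2) FE_sym[OF c(4)] FE_trans[OF c(4)] by meson
qed

text \<open>The usual argument for Kuratowski pairs, made below an arbitrary \<open>q\<close>, where
  an extension decides the case distinctions; \<open>FE_dense\<close> brings the result back to
  \<open>p\<close>.\<close>

lemma op_inj: assumes p: "p \<in> C" and e: "FE p (op x y) (op x' y')"
  shows "FE p x x'" "FE p y y'"
proof -
  have "\<exists>r\<in>BL q. FE r x x' \<and> FE r y y'" if q: "q \<in> BL p" for q
  proof -
    obtain r where r: "r \<in> BL q" "(FE r (up x x) (up x' x') \<and> FE r (up x y) (up x' y')) \<or>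
        (FE r (up x x) (up x' y') \<and> FE r (up x y) (up x' x'))"
      using up_eqD[OF p e[unfolded op_def] q] by blast
    have qC: "q \<in> C" and rC: "r \<in> C" using q r below_Cond by blast+
    obtain r1 where r1: "r1 \<in> BL r" "FE r1 x x'" "FE r1 x y' \<or> FE r (up x y) (up x' y')"
      using r(2) up_eqD[OF rC _ below_refl[OF rC], of x x x' x'] up_eqD[OF rC _ below_refl[OF rC], of x x x' y'] by blast
    have r1C: "r1 \<in> C" using r1 below_Cond by blast
    have "FE r (up x y) (up x' y') \<or> FE r (up x y) (up x' x')" using r(2) by blast
    \<comment> \<open>The last alternative is the degenerate case in which the second components are
      {x, y} and {x', x'}. There {x, x} equals {x', y'}, so all four sets coincide.\<close>
    then obtain r2 where r2: "r2 \<in> BL r1" "(FE r2 x x' \<and> FE r2 y y') \<or> (FE r2 x y' \<and> FE r2 y x') \<or> FE r2 y x'"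
      "FE r (up x y) (up x' y') \<longrightarrow> (FE r2 x x' \<and> FE r2 y y') \<or> (FE r2 x y' \<and> FE r2 y x')"
      using up_eqD[OF rC _ r1(1), of x y x' y'] up_eqD[OF rC _ r1(1), of x y x' x'] by metis
    have r2C: "r2 \<in> C" using r2 below_Cond by blast
    have 1: "FE r2 x x'" using FE_mono[OF r1C r2(1)] r1 by blast
    have 2: "FE r2 x y' \<or> FE r (up x y) (up x' y')" using FE_mono[OF r1C r2(1)] r1 by blast
    have "FE r2 y y'" using 1 2 r2(2,3) FE_sym[OF r2C] FE_trans[OF r2C] by meson
    moreover have "r2 \<in> BL q" using below_trans[OF below_trans[OF r2(1) r1(1) rC] r(1) qC] .
    ultimately show ?thesis using 1 by blast
  qed
  then show "FE p x x'" "FE p y y'" using FE_dense[OF p] by blast+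
qed

section \<open>Substitution\<close>

text \<open>Binders are HOL functions, so there is no substitution operation on formulas. Instead,
  \<open>fcong\<close> relates formulas of the same shape whose parameters are forced to be equal,
  and its derivations follow the definition of the notion at hand.\<close>

inductive fcong :: "'a \<Rightarrow> 'a form \<Rightarrow> 'a form \<Rightarrow> bool" for p where
  fc_mem: "FE p x x' \<Longrightarrow> FE p y y' \<Longrightarrow> fcong p (x \<^bold>\<in> y) (x' \<^bold>\<in> y')"
| fc_eq: "FE p x x' \<Longrightarrow> FE p y y' \<Longrightarrow> fcong p (x \<^bold>= y) (x' \<^bold>= y')"
| fc_neg: "fcong p \<phi> \<phi>' \<Longrightarrow> fcong p (\<^bold>\<not> \<phi>) (\<^bold>\<not> \<phi>')"
| fc_and: "fcong p \<phi> \<phi>' \<Longrightarrow> fcong p \<psi> \<psi>' \<Longrightarrow> fcong p (\<phi> \<^bold>\<and> \<psi>) (\<phi>' \<^bold>\<and> \<psi>')"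
| fc_all: "(\<And>x. fcong p (\<chi> x) (\<chi>' x)) \<Longrightarrow> fcong p (FAll \<chi>) (FAll \<chi>')"

lemma fcong_forces:
  assumes "fcong p \<phi> \<psi>" "p \<in> C" shows "\<forall>q\<in>BL p. forces E PP \<phi> q \<longleftrightarrow> forces E PP \<psi> q"
  using assms
proof (induction rule: fcong.induct)
  case (fc_mem x x' y y')
  have "FM q x y \<longleftrightarrow> FM q x' y'" if q: "q \<in> BL p" for q
  proof -
    have "q \<in> C" "FE q x x'" "FE q y y'" using below_Cond[OF q] FE_mono[OF \<open>p \<in> C\<close> q] fc_mem by blast+
    then show ?thesis using FM_eq_left FM_eq_right FE_sym by meson
  qed
  then show ?case by simp
next
  case (fc_eq x x' y y')
  have "FE q x y \<longleftrightarrow> FE q x' y'" if q: "q \<in> BL p" for q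
  proof -
    have "q \<in> C" "FE q x x'" "FE q y y'" using below_Cond[OF q] FE_mono[OF \<open>p \<in> C\<close> q] fc_eq by blast+
    then show ?thesis using FE_trans FE_sym by meson
  qed
  then show ?case by simp
next
  case (fc_neg \<phi> \<phi>')
  then show ?case using below_trans[of _ _ p] by auto
qed auto

lemma fcong_derived:
  "fcong p \<phi> \<phi>' \<Longrightarrow> fcong p \<psi> \<psi>' \<Longrightarrow> fcong p (\<phi> \<^bold>\<longrightarrow> \<psi>) (\<phi>' \<^bold>\<longrightarrow> \<psi>')"
  "(\<And>x. fcong p (\<chi> x) (\<chi>' x)) \<Longrightarrow> fcong p (FEx \<chi>) (FEx \<chi>')"
  "fcong p \<phi> \<phi>' \<Longrightarrow> fcong p \<psi> \<psi>' \<Longrightarrow> fcong p (\<phi> \<^bold>\<or> \<psi>) (\<phi>' \<^bold>\<or> \<psi>')"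
  "fcong p \<phi> \<phi>' \<Longrightarrow> fcong p \<psi> \<psi>' \<Longrightarrow> fcong p (\<phi> \<^bold>\<longleftrightarrow> \<psi>) (\<phi>' \<^bold>\<longleftrightarrow> \<psi>')"
  unfolding FImp_def FEx_def FOr_def FIff_def by (intro fcong.intros; assumption)+

lemma forces_is_inj_cong:
  assumes p: "p \<in> C" and "FE p f f'" "FE p a a'" "FE p b b'"
  shows "forces E PP (is_inj f a b) p \<longleftrightarrow> forces E PP (is_inj f' a' b') p"
proof -
  have "fcong p (is_inj f a b) (is_inj f' a' b')"
    unfolding is_inj_def is_fun_def rel_def is_pair_def is_upair_def
    by (intro fcong.intros fcong_derived FE_refl assms)
  then show ?thesis using fcong_forces p below_refl by blast
qed

lemma forces_smaller_cong:
  assumes p: "p \<in> C" and "FE p a a'" "FE p b b'"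
  shows "forces E PP (smaller a b) p \<longleftrightarrow> forces E PP (smaller a' b') p"
proof -
  have "fcong p (smaller a b) (smaller a' b')"
    unfolding smaller_def is_inj_def is_fun_def rel_def is_pair_def is_upair_def
    by (intro fcong.intros fcong_derived FE_refl assms)
  then show ?thesis using fcong_forces p below_refl by blast
qed

lemma forces_sub: "p \<in> C \<Longrightarrow> forces E PP (x \<^bold>\<subseteq> y) p \<longleftrightarrow> (\<forall>z. \<forall>q\<in>BL p. FM q z x \<longrightarrow> FM q z y)"
  unfolding sub_def by (simp add: forces_imp)

section \<open>Canonical names\<close>

abbreviation "ck \<equiv> check E PP"

lemma check_aux:
  "dfn (\<lambda>e. E (e 0) (e 2) \<and> e 1 \<in> C)" "E z x \<and> c \<in> C \<Longrightarrow> E z (tc x)"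
  "isset {pr z c |z c. E z x \<and> c \<in> C}"
proof -
  have "{pr z c |z c. E z x \<and> c \<in> C} = vprod (els x) C" by (auto simp: vprod_def)
  then show "isset {pr z c |z c. E z x \<and> c \<in> C}" by (simp add: isset_Cond)
qed (auto intro!: dfn_intros mem_tcI)

lemma mem_check: "E u (ck x) \<longleftrightarrow> (\<exists>z c. (E z x \<and> c \<in> C) \<and> u = pr (ck z) c)"
  unfolding check_def by (rule translate_props(1)[OF check_aux])

lemma dft_check [dfn_intros]: "dft t \<Longrightarrow> dft (\<lambda>e. ck (t e))"
  unfolding check_def by (rule translate_props(2)[OF check_aux])

lemma FM_check: "p \<in> C \<Longrightarrow> FM p w (ck x) \<longleftrightarrow> (\<forall>q\<in>BL p. \<exists>r\<in>BL q. \<exists>z. E z x \<and> FE r w (ck z))"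
  unfolding FM_iff
proof (intro ball_cong refl iffI)
  fix q assume "\<exists>r\<in>BL q. \<exists>z. E z x \<and> FE r w (ck z)"
  then obtain r z where r: "r \<in> BL q" "E z x" "FE r w (ck z)" by blast
  then have "r \<in> C" "Leq PP r r" using below_Cond Leq_refl by blast+
  then show "\<exists>r\<in>BL q. \<exists>z s. s \<in> C \<and> E (pr z s) (ck x) \<and> Leq PP r s \<and> FE r w z"
    using r mem_check[of _ x] by blast
next
  fix q assume "\<exists>r\<in>BL q. \<exists>z s. s \<in> C \<and> E (pr z s) (ck x) \<and> Leq PP r s \<and> FE r w z"
  then show "\<exists>r\<in>BL q. \<exists>z. E z x \<and> FE r w (ck z)" unfolding mem_check[of _ x] pr_inject by blast
qed

lemma FM_check_witness: assumes "p \<in> C" "FM p w (ck x)"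
  obtains r z where "r \<in> BL p" "E z x" "FE r w (ck z)"
  using assms FM_check below_refl by blast

lemma FM_checkI: "p \<in> C \<Longrightarrow> E z x \<Longrightarrow> FM p (ck z) (ck x)"
  unfolding FM_check using below_Cond FE_refl below_refl by blast

lemma check_inj: assumes "p \<in> C" "FE p (ck x) (ck y)" shows "x = y"
proof -
  have "\<forall>y. \<forall>p\<in>C. FE p (ck x) (ck y) \<longrightarrow> x = y"
  proof (rule eps_induct[where P = "\<lambda>x. \<forall>y. \<forall>p\<in>C. FE p (ck x) (ck y) \<longrightarrow> x = y"], intro dfn_intros, intro allI ballI impI)
    fix x y p assume IH: "\<And>z. E z x \<Longrightarrow> \<forall>y. \<forall>p\<in>C. FE p (ck z) (ck y) \<longrightarrow> z = y"
      and p: "p \<in> C" and e: "FE p (ck x) (ck y)"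
    show "x = y"
    proof (rule extensionality, rule iffI)
      fix z assume z: "E z x"
      then have "FM p (ck z) (ck y)" using FM_eq_right[OF p e] FM_checkI[OF p] by blast
      then obtain r z' where r: "r \<in> BL p" "E z' y" "FE r (ck z) (ck z')" by (rule FM_check_witness[OF p])
      then have "z = z'" using IH[OF z] below_Cond by blast
      then show "E z y" using r by simp
    next
      fix z assume z: "E z y"
      then have "FM p (ck z) (ck x)" using FM_eq_right[OF p FE_sym[OF p e]] FM_checkI[OF p] by blast
      then obtain r z' where r: "r \<in> BL p" "E z' x" "FE r (ck z) (ck z')" by (rule FM_check_witness[OF p])
      then have "z' = z" using IH[OF r(2)] below_Cond FE_sym by blast
      then show "E z x" using r by simp
    qed
  qed
  then show ?thesis using assms by blast
qed

lemma FM_check_check: "p \<in> C \<Longrightarrow> FM p (ck z) (ck x) \<longleftrightarrow> E z x"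
  using FM_checkI FM_check_witness check_inj below_Cond by metis

lemma check_trans_set: assumes p: "p \<in> C" and x: "Trans x" shows "forces E PP (trans_set (ck x)) p"
proof -
  have "FM q' w (ck x)" if y: "q \<in> BL p" "FM q y (ck x)" "q' \<in> BL q" "FM q' w y" for q q' y w
  proof -
    have qC: "q \<in> C" "q' \<in> C" using y below_Cond by blast+
    show ?thesis
    proof (rule FM_dense[OF qC(2)])
      fix r assume r: "r \<in> BL q'"
      have rC: "r \<in> C" and rq: "r \<in> BL q" using r below_Cond below_trans[OF r y(3) qC(1)] by blast+
      obtain r' z where r': "r' \<in> BL r" "E z x" "FE r' y (ck z)"
        using FM_check_witness[OF rC FM_mono[OF qC(1) rq y(2)]] by blast
      have r'C: "r' \<in> C" using r' below_Cond by blast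
      have "FM r' w (ck z)"
        using FM_eq_right[OF r'C r'(3)] FM_mono[OF rC r'(1)] FM_mono[OF qC(2) r y(4)] by blast
      then obtain r'' v where r'': "r'' \<in> BL r'" "E v z" "FE r'' w (ck v)" by (rule FM_check_witness[OF r'C])
      have r''C: "r'' \<in> C" using r'' below_Cond by blast
      have "E v x" using TransD[OF x r'(2) r''(2)] .
      then have "FM r'' w (ck x)" using FM_eq_left[OF r''C FE_sym[OF r''C r''(3)]] FM_checkI[OF r''C] by blast
      then show "\<exists>r'\<in>BL r. FM r' w (ck x)" using below_trans[OF r''(1) r'(1) rC] by blast
    qed
  qed
  then show ?thesis unfolding trans_set_def forces.simps forces_imp[OF p]
    by (auto simp: forces_sub below_Cond)
qed

lemma check_ordinal: assumes p: "p \<in> C" and x: "Ord x" shows "forces E PP (ordinal (ck x)) p"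
proof -
  have "forces E PP (trans_set y) q" if y: "q \<in> BL p" "FM q y (ck x)" for q y
  proof -
    have qC: "q \<in> C" using y below_Cond by blast
    show ?thesis
    proof (rule forces_dense[OF qC])
      fix r assume r: "r \<in> BL q"
      have rC: "r \<in> C" using r below_Cond by blast
      obtain r' z where r': "r' \<in> BL r" "E z x" "FE r' y (ck z)"
        using FM_check_witness[OF rC FM_mono[OF qC r y(2)]] by blast
      have r'C: "r' \<in> C" using r' below_Cond by blast
      have "fcong r' (trans_set y) (trans_set (ck z))"
        unfolding trans_set_def sub_def by (intro fcong.intros fcong_derived FE_refl r'C r'(3))
      moreover have "forces E PP (trans_set (ck z)) r'"
        using check_trans_set[OF r'C] x r'(2) by (auto simp: Ord_def)
      ultimately have "forces E PP (trans_set y) r'" using fcong_forces r'C below_refl by blast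
      then show "\<exists>r'\<in>BL r. forces E PP (trans_set y) r'" using r'(1) by blast
    qed
  qed
  then show ?thesis unfolding ordinal_def
    using check_trans_set[OF p] x by (auto simp: forces_imp[OF p] Ord_def)
qed

lemma check_sub: assumes p: "p \<in> C" and x: "els x \<subseteq> els y" shows "forces E PP (ck x \<^bold>\<subseteq> ck y) p"
  unfolding forces_sub[OF p]
proof (intro allI ballI impI)
  fix z q assume q: "q \<in> BL p" "FM q z (ck x)"
  then have "q \<in> C" using below_Cond by blast
  then show "FM q z (ck y)" using q(2) x unfolding FM_check[OF \<open>q \<in> C\<close>] subset_iff mem_els by blast
qed

section \<open>Names given by definable families of conditions\<close>

text \<open>With \<open>\<Phi> z\<close> read as the set of conditions that put \<open>z\<close>
  into the set, this names a subset of the values of the names in \<open>X\<close>.\<close>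

definition mkname :: "'a set \<Rightarrow> ('a \<Rightarrow> 'a \<Rightarrow> bool) \<Rightarrow> 'a" where
  "mkname X \<Phi> = code {u \<in> vprod X C. \<exists>z r. u = pr z r \<and> \<Phi> z r}"

lemma mem_mkname:
  assumes X: "isset X" and \<Phi>: "dfn (\<lambda>e. \<Phi> (e 0) (e 1))"
  shows "E (pr z s) (mkname X \<Phi>) \<longleftrightarrow> z \<in> X \<and> s \<in> C \<and> \<Phi> z s"
proof -
  have "isset {u \<in> vprod X C. \<exists>z r. u = pr z r \<and> \<Phi> z r}"
    by (intro isset_sep isset_vprod X isset_Cond dfn_intros dfn_comp2[OF \<Phi>])
  then show ?thesis unfolding mkname_def by auto
qed

lemma FM_mkname:
  assumes X: "isset X" and \<Phi>: "dfn (\<lambda>e. \<Phi> (e 0) (e 1))"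
    and mono: "\<And>z r r'. z \<in> X \<Longrightarrow> r \<in> C \<Longrightarrow> r' \<in> BL r \<Longrightarrow> \<Phi> z r \<Longrightarrow> \<Phi> z r'"
  shows "FM p w (mkname X \<Phi>) \<longleftrightarrow> (\<forall>q\<in>BL p. \<exists>r\<in>BL q. \<exists>z\<in>X. \<Phi> z r \<and> FE r w z)"
  unfolding FM_iff mem_mkname[OF X \<Phi>]
proof (intro ball_cong refl iffI)
  fix q assume "\<exists>r\<in>BL q. \<exists>z s. s \<in> C \<and> (z \<in> X \<and> s \<in> C \<and> \<Phi> z s) \<and> Leq PP r s \<and> FE r w z"
  then show "\<exists>r\<in>BL q. \<exists>z\<in>X. \<Phi> z r \<and> FE r w z" using mono below_Cond mem_below by metis
next
  fix q assume "\<exists>r\<in>BL q. \<exists>z\<in>X. \<Phi> z r \<and> FE r w z"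
  then show "\<exists>r\<in>BL q. \<exists>z s. s \<in> C \<and> (z \<in> X \<and> s \<in> C \<and> \<Phi> z s) \<and> Leq PP r s \<and> FE r w z"
    using below_Cond Leq_refl by blast
qed

end

section \<open>Nontrivial forcing has incompatible conditions\<close>

context forcing begin

definition compat :: "'a \<Rightarrow> 'a \<Rightarrow> bool" where "compat p q \<longleftrightarrow> (\<exists>r. r \<in> BL p \<and> r \<in> BL q)"

lemma dfn_compat [dfn_intros]: "dft t \<Longrightarrow> dft u \<Longrightarrow> dfn (\<lambda>e. compat (t e) (u e))"
  unfolding compat_def by (intro dfn_intros dft_shift)

lemma compat_below: "p' \<in> BL p \<Longrightarrow> p \<in> C \<Longrightarrow> compat p' q \<Longrightarrow> compat p q"
  unfolding compat_def using below_trans by blast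

text \<open>Below an atom every name \<open>x\<close> is forced to be equal to a canonical name, that of the set of
  the values of those elements of \<open>x\<close> whose condition is compatible with the atom.\<close>

lemma adds_new_set_splits:
  assumes new: "adds_new_set E PP" and p: "p \<in> C"
  shows "\<exists>p0\<in>BL p. \<exists>p1\<in>BL p. \<not> compat p0 p1"
proof (rule ccontr)
  assume n: "\<not> ?thesis"
  obtain q x where q: "q \<in> BL p" and x: "\<And>y. forces E PP (\<^bold>\<not> (x \<^bold>= ck y)) q"
    using new p unfolding adds_new_set_def adds_set_outside_def by blast
  have qC: "q \<in> C" using q below_Cond by blast
  \<comment> \<open>This defines the evaluation \<open>v\<close> of names by the conditions
    compatible with \<open>q\<close>, which would form a generic filter if \<open>q\<close> had no
    incompatible extensions.\<close>
  define G where "G x f = code {u. \<exists>z s. s \<in> C \<and> E (pr z s) x \<and> compat s q \<and> u = app f z}" for x f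
  have S: "isset {u. \<exists>z s. s \<in> C \<and> E (pr z s) x \<and> compat s q \<and> u = F z}" if F: "dft (\<lambda>e. F (e 0))" for F x
  proof (rule isset_subset[of "F ` name_dom E PP x"])
    show "isset (F ` name_dom E PP x)" by (intro isset_image isset_name_dom F)
    show "{u. \<exists>z s. s \<in> C \<and> E (pr z s) x \<and> compat s q \<and> u = F z} \<subseteq> F ` name_dom E PP x"
      unfolding image_def Bex_def mem_name_dom by blast
    show "dfn (\<lambda>e. e 0 \<in> {u. \<exists>z s. s \<in> C \<and> E (pr z s) x \<and> compat s q \<and> u = F z})"
      by (intro dfn_intros dft_comp1[OF F])
  qed
  have G: "dft (\<lambda>e. G (e 0) (e 1))" unfolding G_def
    by (rule dft_code, rule S, intro dfn_intros) (intro dfn_intros)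
  define v where "v = vrec G"
  have dv: "dft t \<Longrightarrow> dft (\<lambda>e. v (t e))" for t unfolding v_def by (rule dft_vrec[OF G])
  have dv0: "dft (\<lambda>e. v (e 0))" by (intro dv dfn_intros)
  have v: "E u (v x) \<longleftrightarrow> (\<exists>z s. s \<in> C \<and> E (pr z s) x \<and> compat s q \<and> u = v z)" for u x
  proof -
    have 2: "app (lam (els (tc x)) v) z = v z" if "s \<in> C" "E (pr z s) x" for z s
      by (rule app_lam) (use that name_dom_tc dv0 in \<open>auto simp: mem_name_dom\<close>)
    have "v x = G x (lam (els (tc x)) v)" unfolding v_def by (rule vrec_unfold[OF G])
    also have "\<dots> = code {u. \<exists>z s. s \<in> C \<and> E (pr z s) x \<and> compat s q \<and> u = app (lam (els (tc x)) v) z}"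
      by (simp add: G_def)
    also have "{u. \<exists>z s. s \<in> C \<and> E (pr z s) x \<and> compat s q \<and> u = app (lam (els (tc x)) v) z} =
        {u. \<exists>z s. s \<in> C \<and> E (pr z s) x \<and> compat s q \<and> u = v z}"
      by (intro Collect_cong ex_cong1 conj_cong refl) (simp add: 2)
    finally have 3: "v x = code {u. \<exists>z s. s \<in> C \<and> E (pr z s) x \<and> compat s q \<and> u = v z}" .
    show ?thesis by (subst 3, subst mem_code[OF S[OF dv0, of x]]) simp
  qed
  have "FE q x (ck (v x))" for x
  proof (rule tc_induct[where P = "\<lambda>x. FE q x (ck (v x))"], intro dfn_intros dv)
    fix x assume "\<And>z. E z (tc x) \<Longrightarrow> FE q z (ck (v z))"
    then have IH: "FE q z (ck (v z))" if "s \<in> C" "E (pr z s) x" for z s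
      using that name_dom_tc mem_name_dom by blast
    show "FE q x (ck (v x))"
    proof (rule FE_ext[OF qC], rule iffI)
      fix w q' assume q': "q' \<in> BL q" and m: "FM q' w x"
      have q'C: "q' \<in> C" using q' below_Cond by blast
      show "FM q' w (ck (v x))"
      proof (rule FM_dense[OF q'C])
        fix q'' assume q'': "q'' \<in> BL q'"
        have q''C: "q'' \<in> C" using q'' below_Cond by blast
        obtain r z s where r: "r \<in> BL q''" "s \<in> C" "E (pr z s) x" "Leq PP r s" "FE r w z"
          using FM_witness[OF q''C FM_mono[OF q'C q'' m]] by blast
        have rC: "r \<in> C" and rq: "r \<in> BL q"
          using r below_Cond below_trans[OF below_trans[OF r(1) q'' q'C] q' qC] by blast+
        have "compat s q" unfolding compat_def using rC rq r(4) by (auto simp: mem_below)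
        then have "E (v z) (v x)" using v r(2,3) by blast
        moreover have "FE r w (ck (v z))" using FE_trans[OF rC r(5)] FE_mono[OF qC rq IH[OF r(2,3)]] by blast
        ultimately have "FM r w (ck (v x))" using FM_eq_left[OF rC] FM_checkI[OF rC] FE_sym[OF rC] by blast
        then show "\<exists>r\<in>BL q''. FM r w (ck (v x))" using r by blast
      qed
    next
      fix w q' assume q': "q' \<in> BL q" and m: "FM q' w (ck (v x))"
      have q'C: "q' \<in> C" using q' below_Cond by blast
      show "FM q' w x"
      proof (rule FM_dense[OF q'C])
        fix q'' assume q'': "q'' \<in> BL q'"
        have q''C: "q'' \<in> C" using q'' below_Cond by blast
        obtain r u where r: "r \<in> BL q''" "E u (v x)" "FE r w (ck u)"
          using FM_check_witness[OF q''C FM_mono[OF q'C q'' m]] by blast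
        obtain z s where z: "s \<in> C" "E (pr z s) x" "compat s q" "u = v z" using r(2) v by blast
        obtain u0 where u0: "u0 \<in> BL s" "u0 \<in> BL q" using z(3) by (auto simp: compat_def)
        have rC: "r \<in> C" and rq: "r \<in> BL q"
          using r below_Cond below_trans[OF below_trans[OF r(1) q'' q'C] q' qC] by blast+
        \<comment> \<open>Here the absence of splitting below \<open>p\<close> is used: the
          condition \<open>s\<close>, merely compatible with \<open>q\<close>, becomes compatible
          with the given \<open>r\<close>, and a common extension forces \<open>z\<close> into
          \<open>x\<close>.\<close>
        have "compat r u0" using n below_trans[OF rq q p] below_trans[OF u0(2) q p] by blast
        then obtain r' where r': "r' \<in> BL r" "r' \<in> BL u0" by (auto simp: compat_def)
        have r'C: "r' \<in> C" using r' below_Cond by blast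
        have "r' \<in> BL s" using below_trans[OF r'(2) u0(1) z(1)] .
        then have 1: "FM r' z x" using FM_own[OF r'C z(1,2)] by (simp add: mem_below)
        have "FE r' w (ck (v z))" using FE_mono[OF rC r'(1) r(3)] z(4) by simp
        moreover have "FE r' z (ck (v z))" using FE_mono[OF qC below_trans[OF r'(1) rq qC] IH[OF z(1,2)]] .
        ultimately have "FE r' z w" using FE_sym[OF r'C] FE_trans[OF r'C] by blast
        then have "FM r' w x" using FM_eq_left[OF r'C _ 1] by blast
        then show "\<exists>r\<in>BL q''. FM r w x" using below_trans[OF r'(1) r(1) q''C] by blast
      qed
    qed
  qed
  then show False using x[of "v x"] below_refl[OF qC] unfolding forces.simps by blast
qed

end

section \<open>The iteration\<close>

locale two_step = zfc E for E :: "'a \<Rightarrow> 'a \<Rightarrow> bool" +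
  fixes P leP Q leQ :: 'a
  assumes P_forcing: "holds E (forcing_notion P leP)"
    and Q_forcing: "forced E (ext_poset E P leP) (forcing_notion Q leQ)"
begin

abbreviation "PP \<equiv> ext_poset E P leP"
abbreviation "RR \<equiv> iteration E PP Q leQ"

lemma Cond_PP: "Cond PP = els P" by (auto simp: ext_poset_def)
lemma Leq_PP: "Leq PP p q \<longleftrightarrow> E (pr p q) leP" by (auto simp: ext_poset_def)

sublocale P: forcing E PP
proof
  show "isset (Cond PP)" by (simp add: Cond_PP)
  show "dfn (\<lambda>e. Leq PP (e 0) (e 1))" unfolding Leq_PP by (intro dfn_intros)
  show "p \<in> Cond PP \<Longrightarrow> Leq PP p p" for p
    using P_forcing by (simp add: forcing_notion_def Cond_PP Leq_PP)
  show "\<lbrakk>p \<in> Cond PP; q \<in> Cond PP; r \<in> Cond PP; Leq PP p q; Leq PP q r\<rbrakk> \<Longrightarrow> Leq PP p r" for p q r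
    using P_forcing unfolding forcing_notion_def Cond_PP Leq_PP holds.simps holds_derived holds_rel mem_els
    by blast
qed

abbreviation "inQ p q \<equiv> P.FM p q Q"
abbreviation "qle p q q' \<equiv> P.FM p (P.op q q') leQ"

lemma Q_forced:
  assumes p: "p \<in> P.C"
  shows "forces E PP (nonempty Q) p"
    and "inQ p q \<Longrightarrow> qle p q q"
    and "\<lbrakk>inQ p a; inQ p b; inQ p c; qle p a b; qle p b c\<rbrakk> \<Longrightarrow> qle p a c"
proof -
  have f: "forces E PP (forcing_notion Q leQ) p" using Q_forcing p by (simp add: forced_def)
  then show "forces E PP (nonempty Q) p" by (simp add: forcing_notion_def)
  have pp: "p \<in> P.BL p" using p by simp
  show "inQ p q \<Longrightarrow> qle p q q"
    using f pp unfolding forcing_notion_def forces.simps P.forces_imp[OF p] P.forces_rel[OF p, symmetric]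
    by blast
  have "\<forall>a b c. forces E PP (a \<^bold>\<in> Q \<^bold>\<and> b \<^bold>\<in> Q \<^bold>\<and> c \<^bold>\<in> Q \<^bold>\<and> rel leQ a b \<^bold>\<and> rel leQ b c \<^bold>\<longrightarrow> rel leQ a c) p"
    using f unfolding forcing_notion_def forces.simps by blast
  then show "\<lbrakk>inQ p a; inQ p b; inQ p c; qle p a b; qle p b c\<rbrakk> \<Longrightarrow> qle p a c"
    using pp unfolding P.forces_imp[OF p] P.forces_rel[OF p, symmetric] forces.simps by blast
qed

lemma Cond_RR: "c \<in> Cond RR \<longleftrightarrow> (\<exists>p q. c = pr p q \<and> p \<in> P.C \<and> q \<in> name_dom E PP Q \<and> inQ p q)"
  by (auto simp: iteration_def)

lemma pr_Cond_RR: "pr p q \<in> Cond RR \<longleftrightarrow> p \<in> P.C \<and> q \<in> name_dom E PP Q \<and> inQ p q"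
  by (auto simp: Cond_RR)

lemma Leq_RR_gen: "Leq RR c c' \<longleftrightarrow> (\<exists>p q p' q'. c = pr p q \<and> c' = pr p' q' \<and> Leq PP p p' \<and> forces E PP (rel leQ q q') p)"
  by (auto simp: iteration_def)

lemma Leq_RR: "p \<in> P.C \<Longrightarrow> Leq RR (pr p q) (pr p' q') \<longleftrightarrow> Leq PP p p' \<and> qle p q q'"
  unfolding Leq_RR_gen pr_inject using P.forces_rel by blast

lemma isset_RR: "isset (Cond RR)"
proof (rule isset_subset[of "vprod P.C (name_dom E PP Q)"])
  show "isset (vprod P.C (name_dom E PP Q))" by (intro isset_vprod P.isset_Cond P.isset_name_dom)
  show "Cond RR \<subseteq> vprod P.C (name_dom E PP Q)" by (auto simp: Cond_RR)
  show "dfn (\<lambda>e. e 0 \<in> Cond RR)" unfolding Cond_RR by (intro dfn_intros)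
qed

sublocale R: forcing E RR
proof
  show "isset (Cond RR)" by (rule isset_RR)
  show "dfn (\<lambda>e. Leq RR (e 0) (e 1))"
    unfolding Leq_RR_gen rel_def is_pair_def is_upair_def FEx_def FOr_def FIff_def FImp_def forces.simps
    by (intro dfn_intros)
  show "Leq RR c c" if "c \<in> Cond RR" for c
    using that Q_forced(2) P.Leq_refl by (auto simp: Cond_RR Leq_RR)
  fix c c' c'' assume c: "c \<in> Cond RR" "c' \<in> Cond RR" "c'' \<in> Cond RR" and l: "Leq RR c c'" "Leq RR c' c''"
  obtain p q p' q' p'' q'' where e: "c = pr p q" "c' = pr p' q'" "c'' = pr p'' q''"
    using c unfolding Cond_RR by blast
  have i: "p \<in> P.C" "p' \<in> P.C" "p'' \<in> P.C" "inQ p q" "inQ p' q'" "inQ p'' q''"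
    using c unfolding e pr_Cond_RR by auto
  have l': "Leq PP p p'" "qle p q q'" "Leq PP p' p''" "qle p' q' q''"
    using l i unfolding e by (simp_all add: Leq_RR)
  have pb: "p \<in> P.BL p'" "p \<in> P.BL p''"
    using i l' P.Leq_trans[OF i(1-3)] by (simp_all add: P.mem_below)
  have "inQ p q'" "inQ p q''" "qle p q' q''" using P.FM_mono i l' pb by blast+
  then have "qle p q q''" using Q_forced(3)[OF i(1,4)] l'(2) by blast
  then show "Leq RR c c''" using pb(2) i unfolding e by (simp add: Leq_RR P.mem_below)
qed

lemma R_below: "pr p q \<in> R.C \<Longrightarrow> pr p q \<in> R.BL (pr p' q') \<longleftrightarrow> p \<in> P.BL p' \<and> qle p q q'"
  by (auto simp: R.mem_below Leq_RR pr_Cond_RR P.mem_below)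

lemma R_cases: "c \<in> R.C \<Longrightarrow> (\<And>p q. c = pr p q \<Longrightarrow> p \<in> P.C \<Longrightarrow> q \<in> name_dom E PP Q \<Longrightarrow> inQ p q \<Longrightarrow> thesis) \<Longrightarrow> thesis"
  unfolding Cond_RR by blast

lemma R_restrict: assumes "pr p q \<in> R.C" "p' \<in> P.BL p"
  shows "pr p' q \<in> R.C" "pr p' q \<in> R.BL (pr p q)"
proof -
  have i: "p \<in> P.C" "p' \<in> P.C" "q \<in> name_dom E PP Q" "inQ p q"
    using assms P.below_Cond by (auto simp: pr_Cond_RR)
  then have "inQ p' q" using P.FM_mono assms(2) by blast
  then show "pr p' q \<in> R.C" using i by (simp add: pr_Cond_RR)
  then show "pr p' q \<in> R.BL (pr p q)" using R_below assms(2) Q_forced(2)[OF i(2) \<open>inQ p' q\<close>] by blast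
qed

text \<open>A name forced into \<open>Q\<close> need not lie in the domain of \<open>Q\<close>, as
  the iteration requires. Some extension of \<open>p\<close> forces it to be equal to a name that
  does.\<close>

lemma inQ_realize: assumes p: "p \<in> P.C" and q: "inQ p q"
  shows "\<exists>p'\<in>P.BL p. \<exists>q'. P.FE p' q q' \<and> pr p' q' \<in> R.C"
proof -
  obtain r z s where r: "r \<in> P.BL p" "s \<in> P.C" "E (pr z s) Q" "Leq PP r s" "P.FE r q z"
    by (rule P.FM_witness[OF p q])
  have rC: "r \<in> P.C" using r P.below_Cond by blast
  have "inQ r z" using P.FM_own[OF rC r(2-4)] .
  then have "pr r z \<in> R.C" using rC r(2,3) by (auto simp: pr_Cond_RR P.mem_name_dom)
  then show ?thesis using r by blast
qed

lemma R_nonempty: assumes p: "p \<in> P.C" shows "\<exists>p'\<in>P.BL p. \<exists>q. pr p' q \<in> R.C"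
proof -
  obtain r q where r: "r \<in> P.BL p" "inQ r q"
    using Q_forced(1)[OF p] P.below_refl[OF p] unfolding nonempty_def P.forces_ex forces.simps by blast
  have rC: "r \<in> P.C" using r P.below_Cond by blast
  from inQ_realize[OF rC r(2)] show ?thesis using P.below_trans[OF _ r(1) p] by blast
qed

section \<open>Terms for conditions of the second forcing\<close>

text \<open>A term is a locally constant function, defined on a dense open set of conditions, that
  assigns to \<open>p\<close> some \<open>q\<close> with \<open>(p, q)\<close> in the iteration; it plays the role of a name for a
  condition of the second forcing.\<close>

definition tm :: "'a \<Rightarrow> bool" where
  "tm t \<longleftrightarrow> els t \<subseteq> R.C \<and> (\<forall>p\<in>P.C. \<exists>p'\<in>P.BL p. \<exists>q. E (pr p' q) t) \<and>
     (\<forall>p q. E (pr p q) t \<longrightarrow> (\<forall>p'\<in>P.BL p. E (pr p' q) t)) \<and>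
     (\<forall>p q q'. E (pr p q) t \<longrightarrow> E (pr p q') t \<longrightarrow> q = q')"

definition tle :: "'a \<Rightarrow> 'a \<Rightarrow> bool" where
  "tle t t' \<longleftrightarrow> (\<forall>p q q'. E (pr p q) t \<longrightarrow> E (pr p q') t' \<longrightarrow> qle p q q')"

lemma dfn_tm [dfn_intros]: "dft t \<Longrightarrow> dfn (\<lambda>e. tm (t e))"
  unfolding tm_def by (intro dfn_intros dft_shift)

lemma dfn_tle [dfn_intros]: "dft t \<Longrightarrow> dft u \<Longrightarrow> dfn (\<lambda>e. tle (t e) (u e))"
  unfolding tle_def by (intro dfn_intros dft_shift)

lemma isset_tm: "isset {t. tm t}"
  by (rule isset_subset[of "{t. els t \<subseteq> R.C}"]) (auto simp: tm_def R.isset_Cond intro!: dfn_intros)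

lemma tm_R: "tm t \<Longrightarrow> E (pr p q) t \<Longrightarrow> pr p q \<in> R.C"
  by (auto simp: tm_def subset_iff)

lemma tm_P: "tm t \<Longrightarrow> E (pr p q) t \<Longrightarrow> p \<in> P.C"
  using tm_R by (auto simp: pr_Cond_RR)

lemma tm_dense: "tm t \<Longrightarrow> p \<in> P.C \<Longrightarrow> \<exists>p'\<in>P.BL p. \<exists>q. E (pr p' q) t" by (auto simp: tm_def)

lemma tm_open: "tm t \<Longrightarrow> E (pr p q) t \<Longrightarrow> p' \<in> P.BL p \<Longrightarrow> E (pr p' q) t" by (auto simp: tm_def)

lemma tm_unique: "tm t \<Longrightarrow> E (pr p q) t \<Longrightarrow> E (pr p q') t \<Longrightarrow> q = q'"
  unfolding tm_def by blast

lemma tle_below: assumes "tm t" "tm t'" "tle t t'" "E (pr p q) t" "E (pr p' q') t'" "p \<in> P.BL p'"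
  shows "pr p q \<in> R.BL (pr p' q')"
  using assms tm_open[OF assms(2,5,6)] tm_R[OF assms(1,4)] by (auto simp: R_below tle_def)

lemma tle_refl: "tm t \<Longrightarrow> tle t t"
  unfolding tle_def using tm_unique[of t] tm_R[of t] Q_forced(2) pr_Cond_RR by metis

lemma tle_trans: assumes t: "tm t" "tm t'" "tm t''" "tle t t'" "tle t' t''" shows "tle t t''"
  unfolding tle_def
proof (intro allI impI)
  fix p q q'' assume q: "E (pr p q) t" "E (pr p q'') t''"
  have p: "p \<in> P.C" using tm_P t q by blast
  show "qle p q q''"
  \<comment> \<open>The middle term need not be defined at \<open>p\<close>, so the intermediate
    value is sought on a dense set.\<close>
  proof (rule P.FM_dense[OF p])
    fix r assume r: "r \<in> P.BL p"
    have "r \<in> P.C" using r P.below_Cond by blast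
    then obtain r' q' where r': "r' \<in> P.BL r" "E (pr r' q') t'" using tm_dense[OF t(2)] by blast
    have rp: "r' \<in> P.BL p" using P.below_trans[OF r'(1) r p] .
    have e: "E (pr r' q) t" "E (pr r' q'') t''" using tm_open t q rp by blast+
    have "inQ r' q" "inQ r' q'" "inQ r' q''" "r' \<in> P.C"
      using tm_R[OF t(1) e(1)] tm_R[OF t(2) r'(2)] tm_R[OF t(3) e(2)] by (auto simp: pr_Cond_RR)
    then have "qle r' q q''" using Q_forced(3)[of r' q q' q''] t(4,5) e r'(2) by (auto simp: tle_def)
    then show "\<exists>r'\<in>P.BL r. qle r' q q''" using r'(1) by blast
  qed
qed

text \<open>Local choices are made coherent. Instead of a maximal antichain, a well-ordering of
  \<open>P\<close> is used, with \<open>H\<close> giving positions: below \<open>p'\<close> the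
  choice made at \<open>p'\<close> is adopted by those \<open>p\<close> that are incompatible with
  every earlier member of the domain \<open>D\<close>.\<close>

lemma mixing:
  assumes g: "dfn (\<lambda>e. g (e 0) (e 1))" and gR: "\<And>p q. g p q \<Longrightarrow> pr p q \<in> R.C"
    and op: "\<And>p q p'. g p q \<Longrightarrow> p' \<in> P.BL p \<Longrightarrow> g p' q"
    and de: "\<And>p. p \<in> P.C \<Longrightarrow> \<exists>p'\<in>P.BL p. \<exists>q. g p' q"
  shows "\<exists>t. tm t \<and> (\<forall>p q. E (pr p q) t \<longrightarrow> g p q)"
proof -
  note g' = dfn_comp2[OF g]
  define D where "D = {p \<in> P.C. \<exists>q. g p q}"
  have D: "isset D" unfolding D_def by (intro isset_sep P.isset_Cond dfn_intros g')
  obtain c where c: "\<And>p. p \<in> D \<Longrightarrow> g p (app c p)"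
    using vchoice_class[OF D g] unfolding D_def by blast
  obtain \<theta> F where \<theta>: "Ord \<theta>" "dft (\<lambda>e. F (e 0))" "bij_betw F (els \<theta>) (els P)"
    by (rule well_ordering)
  obtain H where H: "dft (\<lambda>e. H (e 0))" "\<And>x. E x \<theta> \<Longrightarrow> H (F x) = x"
    using dft_inverse[OF \<theta>(2) isset_els, of \<theta>] \<theta>(3) unfolding bij_betw_def by (metis mem_els)
  note dH = dft_comp1[OF H(1)]
  have HO: "Ord (H p)" "F (H p) = p" if "p \<in> P.C" for p
  proof -
    have "p \<in> F ` els \<theta>" using that \<theta>(3) by (simp add: Cond_PP bij_betw_def)
    then obtain x where "E x \<theta>" "p = F x" by auto
    then show "Ord (H p)" "F (H p) = p" using H(2) Ord_mem[OF \<theta>(1)] by auto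
  qed
  define Tp where "Tp p p' \<longleftrightarrow> p' \<in> D \<and> p \<in> P.BL p' \<and> (\<forall>p''\<in>D. E (H p'') (H p') \<longrightarrow> \<not> P.compat p p'')" for p p'
  have dTp: "dft s \<Longrightarrow> dft u \<Longrightarrow> dfn (\<lambda>e. Tp (s e) (u e))" for s u
    unfolding Tp_def by (intro dfn_intros dfn_in_set D dH dft_shift)
  define t where "t = code {u \<in> R.C. \<exists>p p'. u = pr p (app c p') \<and> Tp p p'}"
  have gT: "g p (app c p')" if "Tp p p'" for p p' using that c op by (auto simp: Tp_def)
  have t: "E (pr p q) t \<longleftrightarrow> (\<exists>p'. q = app c p' \<and> Tp p p')" for p q
  proof -
    have "isset {u \<in> R.C. \<exists>p p'. u = pr p (app c p') \<and> Tp p p'}"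
      by (intro isset_sep R.isset_Cond dfn_intros dTp)
    then show ?thesis unfolding t_def using gT gR by auto
  qed
  have DC: "p \<in> D \<Longrightarrow> p \<in> P.C" for p by (auto simp: D_def)
  have uniq: "p1 = p2" if T: "Tp p p1" "Tp p p2" for p p1 p2
  proof -
    have "P.compat p p1" "P.compat p p2" using T P.below_Cond P.below_refl unfolding Tp_def P.compat_def by blast+
    then have "\<not> E (H p1) (H p2)" "\<not> E (H p2) (H p1)" using T unfolding Tp_def by blast+
    moreover have "p1 \<in> P.C" "p2 \<in> P.C" using T DC unfolding Tp_def by blast+
    ultimately show ?thesis using Ord_linear HO by metis
  qed
  have "tm t" unfolding tm_def
  proof (intro conjI ballI allI impI)
    show "els t \<subseteq> R.C"
      unfolding t_def by (subst els_code) (auto intro!: isset_sep R.isset_Cond dfn_intros dTp)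
    show "q = q'" if "E (pr p q) t" "E (pr p q') t" for p q q' using that uniq unfolding t by blast
    show "E (pr p' q) t" if h: "E (pr p q) t" "p' \<in> P.BL p" for p q p'
    proof -
      obtain p1 where p1: "q = app c p1" "Tp p p1" using h(1) unfolding t by blast
      then have "p \<in> P.C" "p1 \<in> P.C" using P.below_Cond DC by (auto simp: Tp_def)
      then have "p' \<in> P.BL p1" "\<And>p''. P.compat p' p'' \<Longrightarrow> P.compat p p''"
        using p1(2) P.below_trans[OF h(2)] P.compat_below[OF h(2)] unfolding Tp_def by blast+
      then have "Tp p' p1" using p1(2) unfolding Tp_def by blast
      then show ?thesis unfolding t using p1 by blast
    qed
    fix p assume p: "p \<in> P.C"
    \<comment> \<open>The earliest member of \<open>D\<close> compatible with \<open>p\<close>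
      provides the extension: below a common extension all still earlier members are
      incompatible.\<close>
    let ?A = "\<lambda>a. \<exists>p'\<in>D. P.compat p p' \<and> H p' = a"
    obtain p' q where "p' \<in> P.BL p" "g p' q" using de[OF p] by blast
    then have "p' \<in> D" "P.compat p p'"
      using P.below_Cond P.below_refl by (auto simp: D_def P.compat_def)
    moreover have "dfn (\<lambda>e. ?A (e 0))" by (intro dfn_intros dfn_in_set D dH)
    ultimately obtain a where a: "?A a" "\<And>b. E b a \<Longrightarrow> \<not> ?A b"
      using least_Ord[of ?A "H p'"] HO DC by blast
    then obtain p1 where p1: "p1 \<in> D" "P.compat p p1" "H p1 = a" by blast
    then obtain r where r: "r \<in> P.BL p" "r \<in> P.BL p1" by (auto simp: P.compat_def)
    have "\<not> P.compat r p''" if "p'' \<in> D" "E (H p'') (H p1)" for p''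
      using a(2) that p1(3) P.compat_below[OF r(1) p] by blast
    then have "Tp r p1" using p1 r by (auto simp: Tp_def)
    then show "\<exists>p'\<in>P.BL p. \<exists>q. E (pr p' q) t" unfolding t using r(1) by blast
  qed
  moreover have "g p q" if "E (pr p q) t" for p q using that gT unfolding t by blast
  ultimately show ?thesis by blast
qed

text \<open>Terms must be defined densely, so the value \<open>q1\<close> below \<open>p1\<close> is
  completed by arbitrary values at the conditions incompatible with \<open>p1\<close>.\<close>

lemma term_below:
  assumes r: "pr p1 q1 \<in> R.C"
  shows "\<exists>t. tm t \<and> (\<forall>p q. E (pr p q) t \<longrightarrow> p \<in> P.BL p1 \<longrightarrow> q = q1)"
proof -
  have p1: "p1 \<in> P.C" using r by (simp add: pr_Cond_RR)
  let ?g = "\<lambda>p q. pr p q \<in> R.C \<and> (p \<in> P.BL p1 \<and> q = q1 \<or> \<not> P.compat p p1)"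
  have "\<exists>t. tm t \<and> (\<forall>p q. E (pr p q) t \<longrightarrow> ?g p q)"
  proof (rule mixing)
    show "dfn (\<lambda>e. ?g (e 0) (e 1))" by (intro dfn_intros)
    show "?g p' q" if "?g p q" "p' \<in> P.BL p" for p q p'
    proof -
      have "p \<in> P.C" using that by (simp add: pr_Cond_RR)
      then show ?thesis
        using that(1) R_restrict(1)[OF _ that(2)] P.below_trans[OF that(2) _ p1] P.compat_below[OF that(2)] by blast
    qed
    show "\<exists>p'\<in>P.BL p. \<exists>q. ?g p' q" if p: "p \<in> P.C" for p
    proof (cases "P.compat p p1")
      case True
      then obtain r where "r \<in> P.BL p" "r \<in> P.BL p1" by (auto simp: P.compat_def)
      then show ?thesis using R_restrict[OF r] by blast
    next
      case False
      then show ?thesis using R_nonempty[OF p] P.compat_below[OF _ p] by blast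
    qed
  qed blast
  moreover have "P.compat p p1" if "p \<in> P.BL p1" for p
    using that P.below_Cond[OF that] P.below_refl unfolding P.compat_def by blast
  ultimately show ?thesis by blast
qed

end

lemma (in forcing) forces_mp:
  "p \<in> C \<Longrightarrow> forces E PP (\<phi> \<^bold>\<longrightarrow> \<psi>) p \<Longrightarrow> forces E PP \<phi> p \<Longrightarrow> forces E PP \<psi> p"
  using forces_imp below_refl by blast

section \<open>Closure and distributivity of the terms\<close>

locale closed_two_step = two_step +
  fixes \<kappa> :: 'a
  assumes kappa: "holds E (cardinal \<kappa>)"
    and Q_closed: "forced E (ext_poset E P leP) (less_closed (check E (ext_poset E P leP) \<kappa>) Q leQ)"
begin

lemma Ord_kappa: "Ord \<kappa>" using kappa by (simp add: holds_cardinal)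

text \<open>The terms are bundled into a name \<open>F\<close> of a descending sequence in
  \<open>Q\<close> of length \<open>a\<close>. Closure of \<open>Q\<close> gives names of lower
  bounds densely often, these are realized by names in the domain of \<open>Q\<close>, and mixing
  joins them into a term.\<close>

lemma tm_closed:
  assumes a: "E a \<kappa>" and f: "\<And>i. E i a \<Longrightarrow> tm (app f i)"
    and dec: "\<And>i j. E i a \<Longrightarrow> E j i \<Longrightarrow> tle (app f i) (app f j)"
  shows "\<exists>t. tm t \<and> (\<forall>i. E i a \<longrightarrow> tle t (app f i))"
proof -
  have Oa: "Ord a" using a Ord_kappa Ord_mem by blast
  \<comment> \<open>The i-th term, rewritten as a name for the i-th entry: a pair
    \<open>(p, q)\<close> of the term says that under \<open>p\<close> the value at \<open>i\<close>
    is \<open>q\<close>.\<close>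
  define X where "X i = (\<lambda>w. pr (P.op (P.ck i) (vsnd w)) (vfst w)) ` els (app f i)" for i
  have X: "isset (X i)" for i unfolding X_def by (intro isset_image isset_els dfn_intros)
  define F where "F = code (\<Union>i\<in>els a. X i)"
  have iU: "isset (\<Union>i\<in>els a. X i)"
    by (intro isset_UN isset_els X) (unfold X_def image_iff, intro dfn_intros)
  have mX: "u \<in> X i \<longleftrightarrow> (\<exists>p q. E (pr p q) (app f i) \<and> u = pr (P.op (P.ck i) q) p)" if i: "E i a" for i u
  proof
    assume "u \<in> X i"
    then obtain w where w: "E w (app f i)" "u = pr (P.op (P.ck i) (vsnd w)) (vfst w)" by (auto simp: X_def)
    then have "w \<in> R.C" using f[OF i] by (auto simp: tm_def subset_iff)
    then obtain p q where "w = pr p q" by (rule R_cases)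
    then show "\<exists>p q. E (pr p q) (app f i) \<and> u = pr (P.op (P.ck i) q) p" using w by auto
  qed (force simp: X_def)
  have mF: "E u F \<longleftrightarrow> (\<exists>i p q. E i a \<and> E (pr p q) (app f i) \<and> u = pr (P.op (P.ck i) q) p)" for u
  proof -
    have "E u F \<longleftrightarrow> (\<exists>i. E i a \<and> u \<in> X i)" unfolding F_def mem_code[OF iU] by auto
    then show ?thesis using mX by blast
  qed
  have FMF: "P.FM p w F \<longleftrightarrow> (\<forall>q\<in>P.BL p. \<exists>r\<in>P.BL q. \<exists>i z. E i a \<and> E (pr r z) (app f i) \<and> P.FE r w (P.op (P.ck i) z))" for p w
    unfolding P.FM_iff mF pr_inject
  proof (intro ball_cong refl iffI)
    fix q
    assume "\<exists>r\<in>P.BL q. \<exists>z s. s \<in> P.C \<and> (\<exists>i p q. E i a \<and> E (pr p q) (app f i) \<and> z = P.op (P.ck i) q \<and> s = p)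
      \<and> Leq PP r s \<and> P.FE r w z"
    then obtain r s i v where r: "r \<in> P.BL q" "E i a" "E (pr s v) (app f i)" "Leq PP r s" "P.FE r w (P.op (P.ck i) v)"
      by blast
    then have "r \<in> P.BL s" using P.below_Cond by (simp add: P.mem_below)
    then have "E (pr r v) (app f i)" using tm_open[OF f] r by blast
    then show "\<exists>r\<in>P.BL q. \<exists>i z. E i a \<and> E (pr r z) (app f i) \<and> P.FE r w (P.op (P.ck i) z)" using r by blast
  next
    fix q assume "\<exists>r\<in>P.BL q. \<exists>i z. E i a \<and> E (pr r z) (app f i) \<and> P.FE r w (P.op (P.ck i) z)"
    then obtain r i z where r: "r \<in> P.BL q" "E i a" "E (pr r z) (app f i)" "P.FE r w (P.op (P.ck i) z)" by blast
    then have "r \<in> P.C" "Leq PP r r" using P.below_Cond P.Leq_refl by blast+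
    then show "\<exists>r\<in>P.BL q. \<exists>z s. s \<in> P.C \<and> (\<exists>i p q. E i a \<and> E (pr p q) (app f i) \<and> z = P.op (P.ck i) q \<and> s = p)
      \<and> Leq PP r s \<and> P.FE r w z" using r by blast
  qed
  have wit: "\<exists>r\<in>P.BL p. \<exists>i z. E i a \<and> E (pr r z) (app f i) \<and> P.FE r x (P.ck i) \<and> P.FE r y z"
    if m: "P.FM p (P.op x y) F" and p: "p \<in> P.C" for p x y
  proof -
    obtain r i z where r: "r \<in> P.BL p" "E i a" "E (pr r z) (app f i)" "P.FE r (P.op x y) (P.op (P.ck i) z)"
      using m p P.below_refl unfolding FMF by blast
    then show ?thesis using P.op_inj[OF P.below_Cond[OF r(1)] r(4)] by blast
  qed
  have own: "P.FM p (P.op (P.ck i) z) F" if "E i a" "E (pr p z) (app f i)" for p i z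
    unfolding FMF
  proof
    fix q assume q: "q \<in> P.BL p"
    then have "E (pr q z) (app f i)" "q \<in> P.C" using tm_open[OF f] that P.below_Cond by blast+
    then show "\<exists>r\<in>P.BL q. \<exists>i' z'. E i' a \<and> E (pr r z') (app f i') \<and> P.FE r (P.op (P.ck i) z) (P.op (P.ck i') z')"
      using that by (intro bexI[of _ q] exI[of _ i] exI[of _ z]) auto
  qed
  have tmC: "r \<in> P.C" "inQ r z" if "E i a" "E (pr r z) (app f i)" for r z i
    using tm_R[OF f that(2)] that(1) by (auto simp: pr_Cond_RR)
  have fun1: "forces E PP (\<^bold>\<exists>x y. x \<^bold>\<in> P.ck a \<^bold>\<and> y \<^bold>\<in> Q \<^bold>\<and> is_pair z x y) q" if h: "q \<in> P.C" "P.FM q z F" for q z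
  proof (rule P.forces_dense[OF h(1)])
    fix q' assume q': "q' \<in> P.BL q"
    then obtain r i w where r: "r \<in> P.BL q'" "E i a" "E (pr r w) (app f i)" "P.FE r z (P.op (P.ck i) w)"
      using h(2) unfolding FMF by blast
    have rC: "r \<in> P.C" using r P.below_Cond by blast
    have "forces E PP (P.ck i \<^bold>\<in> P.ck a \<^bold>\<and> w \<^bold>\<in> Q \<^bold>\<and> is_pair z (P.ck i) w) r"
      using r rC tmC[OF r(2,3)] P.FM_checkI[OF rC r(2)] by (simp add: P.forces_is_pair)
    then have "forces E PP (\<^bold>\<exists>x y. x \<^bold>\<in> P.ck a \<^bold>\<and> y \<^bold>\<in> Q \<^bold>\<and> is_pair z x y) r"
      using rC by (intro P.forces_exI)
    then show "\<exists>r\<in>P.BL q'. forces E PP (\<^bold>\<exists>x y. x \<^bold>\<in> P.ck a \<^bold>\<and> y \<^bold>\<in> Q \<^bold>\<and> is_pair z x y) r" using r by blast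
  qed
  have fun2: "forces E PP (\<^bold>\<exists>y. rel F x y \<^bold>\<and> (\<^bold>\<forall>y'. rel F x y' \<^bold>\<longrightarrow> y' \<^bold>= y)) q" if q: "q \<in> P.C" "P.FM q x (P.ck a)" for q x
  proof (rule P.forces_dense[OF q(1)])
    fix q' assume q': "q' \<in> P.BL q"
    have q'C: "q' \<in> P.C" using q' P.below_Cond by blast
    obtain r i where r: "r \<in> P.BL q'" "E i a" "P.FE r x (P.ck i)"
      by (rule P.FM_check_witness[OF q'C P.FM_mono[OF q(1) q' q(2)]])
    have rC: "r \<in> P.C" using r P.below_Cond by blast
    obtain r' z where r': "r' \<in> P.BL r" "E (pr r' z) (app f i)" using tm_dense[OF f[OF r(2)] rC] by blast
    have r'C: "r' \<in> P.C" using r' P.below_Cond by blast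
    have xi: "P.FE r' x (P.ck i)" using P.FE_mono[OF rC r'(1) r(3)] .
    have "P.FM r' (P.op x z) F"
      by (rule P.FM_eq_left[OF r'C _ own[OF r(2) r'(2)]])
         (rule P.op_cong[OF r'C P.FE_sym[OF r'C xi] P.FE_refl[OF r'C]])
    moreover have "P.FE q1 y' z" if q1: "q1 \<in> P.BL r'" "P.FM q1 (P.op x y') F" for y' q1
    proof -
      have q1C: "q1 \<in> P.C" using q1 P.below_Cond by blast
      show ?thesis
      proof (rule P.FE_dense[OF q1C])
        fix q2 assume q2: "q2 \<in> P.BL q1"
        have q2C: "q2 \<in> P.C" using q2 P.below_Cond by blast
        obtain s j w where s: "s \<in> P.BL q2" "E j a" "E (pr s w) (app f j)" "P.FE s x (P.ck j)" "P.FE s y' w"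
          using wit[OF P.FM_mono[OF q1C q2 q1(2)] q2C] by blast
        have sC: "s \<in> P.C" using s P.below_Cond by blast
        have sr: "s \<in> P.BL r'" using P.below_trans[OF P.below_trans[OF s(1) q2 q1C] q1(1) r'C] .
        have "P.FE s (P.ck i) (P.ck j)" using P.FE_trans[OF sC P.FE_sym[OF sC P.FE_mono[OF r'C sr xi]] s(4)] .
        then have "i = j" using P.check_inj sC by blast
        moreover have "E (pr s z) (app f i)" using tm_open[OF f[OF r(2)] r'(2) sr] .
        ultimately have "w = z" using tm_unique[OF f[OF r(2)]] s(3) by blast
        then show "\<exists>s\<in>P.BL q2. P.FE s y' z" using s by blast
      qed
    qed
    ultimately have "forces E PP (rel F x z \<^bold>\<and> (\<^bold>\<forall>y'. rel F x y' \<^bold>\<longrightarrow> y' \<^bold>= z)) r'"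
      using r'C P.below_Cond by (simp add: P.forces_rel P.forces_imp)
    then have "forces E PP (\<^bold>\<exists>y. rel F x y \<^bold>\<and> (\<^bold>\<forall>y'. rel F x y' \<^bold>\<longrightarrow> y' \<^bold>= y)) r'"
      using r'C by (intro P.forces_exI)
    then show "\<exists>r\<in>P.BL q'. forces E PP (\<^bold>\<exists>y. rel F x y \<^bold>\<and> (\<^bold>\<forall>y'. rel F x y' \<^bold>\<longrightarrow> y' \<^bold>= y)) r"
      using P.below_trans[OF r'(1) r(1) q'C] by blast
  qed
  have desc: "qle q y x" if q: "q \<in> P.C" "P.FM q b c" "P.FM q (P.op b x) F" "P.FM q (P.op c y) F" for q b c x y
  proof (rule P.FM_dense[OF q(1)])
    fix q' assume q': "q' \<in> P.BL q"
    have q'C: "q' \<in> P.C" using q' P.below_Cond by blast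
    obtain r i z where r: "r \<in> P.BL q'" "E i a" "E (pr r z) (app f i)" "P.FE r b (P.ck i)" "P.FE r x z"
      using wit[OF P.FM_mono[OF q(1) q' q(3)] q'C] by blast
    have rC: "r \<in> P.C" and rq: "r \<in> P.BL q" using r P.below_Cond P.below_trans[OF r(1) q' q(1)] by blast+
    obtain s j w where s: "s \<in> P.BL r" "E j a" "E (pr s w) (app f j)" "P.FE s c (P.ck j)" "P.FE s y w"
      using wit[OF P.FM_mono[OF q(1) rq q(4)] rC] by blast
    have sC: "s \<in> P.C" and sq: "s \<in> P.BL q" using s P.below_Cond P.below_trans[OF s(1) rq q(1)] by blast+
    have bi: "P.FE s b (P.ck i)" "P.FE s x z" using P.FE_mono[OF rC s(1)] r by blast+
    have "P.FM s (P.ck i) (P.ck j)"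
      using P.FM_eq_right[OF sC s(4) P.FM_eq_left[OF sC bi(1) P.FM_mono[OF q(1) sq q(2)]]] .
    then have "E i j" using P.FM_check_check[OF sC] by blast
    then have "tle (app f j) (app f i)" using dec s(2) by blast
    moreover have "E (pr s z) (app f i)" using tm_open[OF f[OF r(2)] r(3) s(1)] .
    ultimately have "qle s w z" using s(3) by (auto simp: tle_def)
    then have "qle s y x"
      using P.FM_eq_left[OF sC P.op_cong[OF sC P.FE_sym[OF sC s(5)] P.FE_sym[OF sC bi(2)]]] by blast
    then show "\<exists>r\<in>P.BL q'. qle r y x" using P.below_trans[OF s(1) r(1) q'C] by blast
  qed
  have low: "forces E PP (\<^bold>\<exists>q. q \<^bold>\<in> Q \<^bold>\<and> (\<^bold>\<forall>b x. rel F b x \<^bold>\<longrightarrow> rel leQ q x)) p" if p: "p \<in> P.C" for p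
  proof -
    have "forces E PP (is_fun F (P.ck a) Q) p"
      unfolding is_fun_def using p P.below_Cond fun1 fun2 by (simp add: P.forces_imp)
    moreover have "forces E PP (\<^bold>\<forall>b c x y. b \<^bold>\<in> c \<^bold>\<and> rel F b x \<^bold>\<and> rel F c y \<^bold>\<longrightarrow> rel leQ y x) p"
      using p P.below_Cond by (simp add: P.forces_imp P.forces_rel) (use desc in blast)
    ultimately have h: "forces E PP (P.ck a \<^bold>\<in> P.ck \<kappa> \<^bold>\<and> is_fun F (P.ck a) Q \<^bold>\<and>
       (\<^bold>\<forall>b c x y. b \<^bold>\<in> c \<^bold>\<and> rel F b x \<^bold>\<and> rel F c y \<^bold>\<longrightarrow> rel leQ y x)) p"
      using P.FM_checkI[OF p a] by simp
    have "forces E PP (P.ck a \<^bold>\<in> P.ck \<kappa> \<^bold>\<and> is_fun F (P.ck a) Q \<^bold>\<and>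
       (\<^bold>\<forall>b c x y. b \<^bold>\<in> c \<^bold>\<and> rel F b x \<^bold>\<and> rel F c y \<^bold>\<longrightarrow> rel leQ y x)
     \<^bold>\<longrightarrow> (\<^bold>\<exists>q. q \<^bold>\<in> Q \<^bold>\<and> (\<^bold>\<forall>b x. rel F b x \<^bold>\<longrightarrow> rel leQ q x))) p"
      using Q_closed p unfolding forced_def less_closed_def forces.simps by blast
    then show ?thesis using P.forces_mp[OF p _ h] by blast
  qed
  \<comment> \<open>The bound is demanded at all extensions of \<open>p\<close>, which makes the
    relation open as mixing requires.\<close>
  let ?g = "\<lambda>p q. pr p q \<in> R.C \<and> (\<forall>p'\<in>P.BL p. \<forall>i\<in>els a. \<forall>z. E (pr p' z) (app f i) \<longrightarrow> qle p' q z)"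
  have "\<exists>t. tm t \<and> (\<forall>p q. E (pr p q) t \<longrightarrow> ?g p q)"
  proof (rule mixing)
    show "dfn (\<lambda>e. ?g (e 0) (e 1))" by (intro dfn_intros)
    show "?g p' q" if "?g p q" "p' \<in> P.BL p" for p q p'
    proof -
      have p: "p \<in> P.C" using that by (simp add: pr_Cond_RR)
      show ?thesis using that R_restrict(1)[OF _ that(2)] P.below_trans[OF _ that(2) p] by blast
    qed
    fix p assume p: "p \<in> P.C"
    obtain r q where r: "r \<in> P.BL p" "forces E PP (q \<^bold>\<in> Q \<^bold>\<and> (\<^bold>\<forall>b x. rel F b x \<^bold>\<longrightarrow> rel leQ q x)) r"
      using low[OF p] P.below_refl[OF p] unfolding P.forces_ex by blast
    have rC: "r \<in> P.C" using r P.below_Cond by blast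
    have q: "inQ r q" "\<And>b x q'. q' \<in> P.BL r \<Longrightarrow> P.FM q' (P.op b x) F \<Longrightarrow> qle q' q x"
      using r(2) P.below_Cond by (simp_all add: P.forces_imp[OF rC] P.forces_rel)
    obtain r' z where r': "r' \<in> P.BL r" "P.FE r' q z" "pr r' z \<in> R.C" using inQ_realize[OF rC q(1)] by blast
    have r'C: "r' \<in> P.C" using r' P.below_Cond by blast
    have "qle p' z w" if p': "p' \<in> P.BL r'" and i: "E i a" "E (pr p' w) (app f i)" for p' i w
    proof -
      have p'C: "p' \<in> P.C" using p' P.below_Cond by blast
      have "qle p' q w" using q(2)[OF P.below_trans[OF p' r'(1) rC] own[OF i]] .
      then show ?thesis
        using P.FM_eq_left[OF p'C P.op_cong[OF p'C P.FE_mono[OF r'C p' r'(2)] P.FE_refl[OF p'C]]] by blast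
    qed
    then have "?g r' z" using r'(3) by auto
    then show "\<exists>p'\<in>P.BL p. \<exists>q. ?g p' q" using P.below_trans[OF r'(1) r(1) p] by blast
  qed blast
  then obtain t where t: "tm t" "\<And>p q. E (pr p q) t \<Longrightarrow> ?g p q" by blast
  have "tle t (app f i)" if "E i a" for i
    unfolding tle_def using t(2) that tm_P[OF t(1)] P.below_refl by (meson mem_els)
  then show ?thesis using t(1) by blast
qed

text \<open>By \<open>tm_closed\<close> the terms form a closed forcing in the ground model, so
  fewer than \<kappa> dense open requirements can be met by transfinite descent. The injection
  \<open>H\<close> of \<open>I\<close> into \<open>a\<close> assigns requirements to stages; a stage
  outside its range only takes a lower bound. A choice function fixed in advance selects the next
  term.\<close>

lemma distributivity:
  assumes I: "isset I" and a: "E a \<kappa>" "vinj I (els a)"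
    and dD: "dfn (\<lambda>e. D (e 0) (e 1))"
    and de: "\<And>i t. i \<in> I \<Longrightarrow> tm t \<Longrightarrow> tle t t0 \<Longrightarrow> \<exists>t'. tm t' \<and> tle t' t \<and> D i t'"
    and op: "\<And>i t t'. i \<in> I \<Longrightarrow> tm t \<Longrightarrow> tm t' \<Longrightarrow> tle t' t \<Longrightarrow> D i t \<Longrightarrow> D i t'"
    and t0: "tm t0"
  shows "\<exists>t. tm t \<and> tle t t0 \<and> (\<forall>i\<in>I. D i t)"
proof -
  note D' = dfn_comp2[OF dD]
  obtain H where H: "dft (\<lambda>e. H (e 0))" "H ` I \<subseteq> els a" "inj_on H I" using a(2) by (auto simp: vinj_def)
  note dH = dft_comp1[OF H(1)]
  define S where "S x f = {t. tm t \<and> tle t t0 \<and> (\<forall>y\<in>els x. tle t (app f y)) \<and> (\<forall>i\<in>I. H i = x \<longrightarrow> D i t)}" for x f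
  have S: "isset (S x f)" for x f
    by (rule isset_subset[OF isset_tm]) (auto simp: S_def intro!: dfn_intros dfn_in_set I dH D')
  have "\<exists>c. \<forall>u\<in>{u. els u \<subseteq> {t. tm t}} - {emp}. app c u \<in> {t. tm t} \<and> E (app c u) u"
  proof (rule vchoice)
    show "isset ({u. els u \<subseteq> {t. tm t}} - {emp})" using isset_tm by auto
    show "isset {t. tm t}" by (rule isset_tm)
    show "dfn (\<lambda>e. E (e 1) (e 0))" by (intro dfn_intros)
    show "\<exists>y\<in>{t. tm t}. E y u" if u: "u \<in> {u. els u \<subseteq> {t. tm t}} - {emp}" for u
    proof -
      obtain y where "E y u" using u emp_eq[of u] by (metis DiffE singletonI)
      then show ?thesis using u by (auto simp: subset_iff)
    qed
  qed
  then obtain c where c: "\<And>u. els u \<subseteq> {t. tm t} \<Longrightarrow> u \<noteq> emp \<Longrightarrow> E (app c u) u" by blast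
  define G where "G x f = app c (code (S x f))" for x f
  have G: "dft (\<lambda>e. G (e 0) (e 1))" unfolding G_def
    by (intro dfn_intros dft_code S) (unfold S_def, intro dfn_intros dfn_in_set I dH D')
  define F where "F = vrec G"
  have dF: "dft t \<Longrightarrow> dft (\<lambda>e. F (t e))" for t unfolding F_def by (rule dft_vrec[OF G])
  have dF0: "dft (\<lambda>e. F (e 0))" by (intro dF dfn_intros)
  define SS where "SS x = {t. tm t \<and> tle t t0 \<and> (\<forall>y\<in>els x. tle t (F y)) \<and> (\<forall>i\<in>I. H i = x \<longrightarrow> D i t)}" for x
  have SS: "S x (lam (els (tc x)) F) = SS x" for x
  proof -
    have "app (lam (els (tc x)) F) y = F y" if "E y x" for y
      by (rule app_lam) (use dF0 mem_tcI[OF that] in auto)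
    then show ?thesis unfolding S_def SS_def by auto
  qed
  have F: "F x \<in> SS x" if "SS x \<noteq> {}" for x
  proof -
    have "F x = app c (code (SS x))" unfolding F_def
      by (subst vrec_unfold[OF G]) (simp add: G_def F_def[symmetric] SS)
    moreover have "isset (SS x)" using S[of x "lam (els (tc x)) F"] unfolding SS .
    moreover have "code (SS x) \<noteq> emp"
      using \<open>isset (SS x)\<close> that mem_emp mem_code by (metis all_not_in_conv)
    ultimately show ?thesis using c[of "code (SS x)"] unfolding els_code[OF \<open>isset (SS x)\<close>] mem_code[OF \<open>isset (SS x)\<close>]
      by (auto simp: SS_def)
  qed
  have lower: "\<exists>t. tm t \<and> tle t t0 \<and> (\<forall>y. E y x \<longrightarrow> tle t (F y))"
    if x: "E x \<kappa>" and IH: "\<And>y. E y x \<Longrightarrow> F y \<in> SS y" for x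
  \<comment> \<open>A lower bound of the empty sequence would bear no relation to \<open>t0\<close>,
    so at stage 0 the term \<open>t0\<close> itself is used. At later stages tle-descent from an
    earlier value yields it.\<close>
  proof (cases "x = emp")
    case True
    then show ?thesis using t0 tle_refl by auto
  next
    case False
    then obtain y where y: "E y x" using emp_eq by blast
    have l: "app (lam (els x) F) y = F y" if "E y x" for y
      by (rule app_lam) (use dF0 that in auto)
    have Ox: "Ord x" using x Ord_kappa Ord_mem by blast
    have "\<exists>t. tm t \<and> (\<forall>i. E i x \<longrightarrow> tle t (app (lam (els x) F) i))"
    proof (rule tm_closed[OF x])
      show "tm (app (lam (els x) F) i)" if "E i x" for i using IH[OF that] l[OF that] by (auto simp: SS_def)
      show "tle (app (lam (els x) F) i) (app (lam (els x) F) j)" if "E i x" "E j i" for i j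
        using IH[OF that(1)] l[OF that(1)] l[OF Ord_trans[OF Ox that]] that(2) by (auto simp: SS_def)
    qed
    then obtain t where t: "tm t" "\<And>i. E i x \<Longrightarrow> tle t (F i)" using l by auto
    have "tle t t0" using tle_trans[OF t(1) _ t0 t(2)[OF y]] IH[OF y] by (auto simp: SS_def)
    then show ?thesis using t by blast
  qed
  have Oa: "Ord a" using a Ord_kappa Ord_mem by blast
  have Fin: "E x a \<longrightarrow> F x \<in> SS x" for x
  proof (rule eps_induct[where P = "\<lambda>x. E x a \<longrightarrow> F x \<in> SS x"])
    show "dfn (\<lambda>e. E (e 0) a \<longrightarrow> F (e 0) \<in> SS (e 0))"
      unfolding SS_def by (intro dfn_intros dfn_in_set I dH D' dF)
    fix x assume IH: "\<And>z. E z x \<Longrightarrow> E z a \<longrightarrow> F z \<in> SS z"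
    show "E x a \<longrightarrow> F x \<in> SS x"
    proof
      assume x: "E x a"
      have xk: "E x \<kappa>" using Ord_trans[OF Ord_kappa a(1) x] .
      obtain t where t: "tm t" "tle t t0" "\<And>y. E y x \<Longrightarrow> tle t (F y)"
        using lower[OF xk] IH Ord_trans[OF Oa x] by blast
      have Fy: "tm (F y)" if "E y x" for y using IH[OF that] Ord_trans[OF Oa x that] by (simp add: SS_def)
      have "\<exists>t'. tm t' \<and> tle t' t \<and> (\<forall>i\<in>I. H i = x \<longrightarrow> D i t')"
      proof (cases "\<exists>i\<in>I. H i = x")
        case True
        then obtain i where i: "i \<in> I" "H i = x" by blast
        then have "\<And>j. j \<in> I \<Longrightarrow> H j = x \<Longrightarrow> j = i" using H(3) by (auto dest: inj_onD)
        then show ?thesis using de[OF i(1) t(1,2)] by blast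
      next
        case False
        then show ?thesis using t(1) tle_refl by blast
      qed
      then obtain t' where t': "tm t'" "tle t' t" "\<And>i. i \<in> I \<Longrightarrow> H i = x \<Longrightarrow> D i t'" by blast
      have "t' \<in> SS x" unfolding SS_def
        using t' tle_trans[OF t'(1) t(1) t0 t'(2) t(2)] tle_trans[OF t'(1) t(1) Fy t'(2) t(3)] by auto
      then show "F x \<in> SS x" using F by blast
    qed
  qed
  obtain t where t: "tm t" "tle t t0" "\<And>y. E y a \<Longrightarrow> tle t (F y)"
    using lower[OF a(1)] Fin by blast
  have "D i t" if i: "i \<in> I" for i
  proof -
    have "E (H i) a" using H(2) i by (auto simp: subset_iff)
    then have "tm (F (H i))" "D i (F (H i))" "tle t (F (H i))" using Fin i t(3) by (auto simp: SS_def)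
    then show ?thesis using op[OF i _ t(1)] by blast
  qed
  then show ?thesis using t by blast
qed

end

section \<open>Regular open sets of conditions\<close>

context forcing begin

text \<open>Regular open sets of conditions are the elements of the Boolean completion and serve as
  truth values; \<open>ng\<close> is their negation.\<close>

definition ro :: "('a \<Rightarrow> bool) \<Rightarrow> bool" where
  "ro \<Phi> \<longleftrightarrow> (\<forall>r\<in>C. \<forall>r'\<in>BL r. \<Phi> r \<longrightarrow> \<Phi> r') \<and> (\<forall>r\<in>C. (\<forall>q\<in>BL r. \<exists>r'\<in>BL q. \<Phi> r') \<longrightarrow> \<Phi> r)"

definition ng :: "('a \<Rightarrow> bool) \<Rightarrow> 'a \<Rightarrow> bool" where "ng \<Phi> r \<longleftrightarrow> (\<forall>r'\<in>BL r. \<not> \<Phi> r')"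

lemma ro_mono: "ro \<Phi> \<Longrightarrow> r \<in> C \<Longrightarrow> r' \<in> BL r \<Longrightarrow> \<Phi> r \<Longrightarrow> \<Phi> r'" unfolding ro_def by blast

lemma ro_dense: "ro \<Phi> \<Longrightarrow> r \<in> C \<Longrightarrow> (\<And>q. q \<in> BL r \<Longrightarrow> \<exists>r'\<in>BL q. \<Phi> r') \<Longrightarrow> \<Phi> r" unfolding ro_def by blast

lemma ng_mono: "r \<in> C \<Longrightarrow> r' \<in> BL r \<Longrightarrow> ng \<Phi> r \<Longrightarrow> ng \<Phi> r'"
  unfolding ng_def using below_trans by blast

lemma ng_contra: "r \<in> C \<Longrightarrow> ng \<Phi> r \<Longrightarrow> \<Phi> r \<Longrightarrow> False"
  unfolding ng_def using below_refl by blast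

lemma ro_undecided: "ro \<Phi> \<Longrightarrow> r \<in> C \<Longrightarrow> \<not> \<Phi> r \<Longrightarrow> \<exists>r'\<in>BL r. ng \<Phi> r'"
  unfolding ro_def ng_def by blast

lemma dense_decides: "r \<in> C \<Longrightarrow> \<exists>r'\<in>BL r. \<Phi> r' \<or> ng \<Phi> r'"
  unfolding ng_def using below_refl by blast

lemma roI:
  assumes "\<And>r r'. r \<in> C \<Longrightarrow> r' \<in> BL r \<Longrightarrow> \<Phi> r \<Longrightarrow> \<Phi> r'"
    and "\<And>r. r \<in> C \<Longrightarrow> (\<And>q. q \<in> BL r \<Longrightarrow> \<exists>r'\<in>BL q. \<Phi> r') \<Longrightarrow> \<Phi> r"
  shows "ro \<Phi>"
  unfolding ro_def by (intro conjI ballI impI) (erule (1) assms(1), assumption, erule assms(2), blast)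

lemma ro_FM: "ro (\<lambda>r. FM r x y)"
proof (rule roI)
  show "FM r' x y" if "r \<in> C" "r' \<in> BL r" "FM r x y" for r r' using FM_mono[OF that] .
  show "FM r x y" if "r \<in> C" "\<And>q. q \<in> BL r \<Longrightarrow> \<exists>r'\<in>BL q. FM r' x y" for r using FM_dense[OF that] .
qed

lemma ro_conj: "ro \<Phi> \<Longrightarrow> ro \<Psi> \<Longrightarrow> ro (\<lambda>r. \<Phi> r \<and> \<Psi> r)"
proof (rule roI)
  assume ro: "ro \<Phi>" "ro \<Psi>"
  show "\<Phi> r' \<and> \<Psi> r'" if "r \<in> C" "r' \<in> BL r" "\<Phi> r \<and> \<Psi> r" for r r'
    using ro_mono[OF ro(1) that(1,2)] ro_mono[OF ro(2) that(1,2)] that(3) by blast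
  show "\<Phi> r \<and> \<Psi> r" if r: "r \<in> C" and d: "\<And>q. q \<in> BL r \<Longrightarrow> \<exists>r'\<in>BL q. \<Phi> r' \<and> \<Psi> r'" for r
  proof
    show "\<Phi> r" by (rule ro_dense[OF ro(1) r]) (drule d, blast)
    show "\<Psi> r" by (rule ro_dense[OF ro(2) r]) (drule d, blast)
  qed
qed

lemma isset_below: "isset (BL p)"
  by (rule isset_subset[OF isset_Cond]) (auto simp: mem_below intro!: dfn_intros)

lemma is_inj_app:
  assumes p: "p \<in> C" and f: "forces E PP (is_inj f x (ck a)) p" and w: "FM p w x"
  shows "\<exists>r\<in>BL p. \<exists>i. E i a \<and> FM r (op w (ck i)) f"
proof -
  have 1: "forces E PP (\<^bold>\<forall>z. z \<^bold>\<in> f \<^bold>\<longrightarrow> (\<^bold>\<exists>x' y. x' \<^bold>\<in> x \<^bold>\<and> y \<^bold>\<in> ck a \<^bold>\<and> is_pair z x' y)) p"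
    "forces E PP (\<^bold>\<forall>x'. x' \<^bold>\<in> x \<^bold>\<longrightarrow> (\<^bold>\<exists>y. rel f x' y \<^bold>\<and> (\<^bold>\<forall>y'. rel f x' y' \<^bold>\<longrightarrow> y' \<^bold>= y))) p"
    using f unfolding is_inj_def is_fun_def forces.simps by blast+
  have "forces E PP (\<^bold>\<exists>y. rel f w y \<^bold>\<and> (\<^bold>\<forall>y'. rel f w y' \<^bold>\<longrightarrow> y' \<^bold>= y)) p"
    using 1(2) w p below_refl unfolding forces.simps forces_imp[OF p] by blast
  then obtain r y where r: "r \<in> BL p" "forces E PP (rel f w y) r"
    using p below_refl unfolding forces_ex forces.simps by blast
  have rC: "r \<in> C" using r below_Cond by blast
  have m: "FM r (op w y) f" using r(2) forces_rel[OF rC] by blast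
  have "forces E PP (\<^bold>\<exists>x' y'. x' \<^bold>\<in> x \<^bold>\<and> y' \<^bold>\<in> ck a \<^bold>\<and> is_pair (op w y) x' y') r"
    using 1(1) m r(1) unfolding forces.simps forces_imp[OF p] by blast
  then obtain r1 x' where r1: "r1 \<in> BL r" "forces E PP (\<^bold>\<exists>y'. x' \<^bold>\<in> x \<^bold>\<and> y' \<^bold>\<in> ck a \<^bold>\<and> is_pair (op w y) x' y') r1"
    using rC below_refl unfolding forces_ex[of _ r] by blast
  have r1C: "r1 \<in> C" using r1 below_Cond by blast
  obtain r2 y' where r2: "r2 \<in> BL r1" "FM r2 y' (ck a)" "forces E PP (is_pair (op w y) x' y') r2"
    using r1(2) r1C below_refl unfolding forces_ex[of _ r1] forces.simps by blast
  have r2C: "r2 \<in> C" using r2 below_Cond by blast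
  have e: "FE r2 y y'" using r2(3) op_inj[OF r2C] forces_is_pair[OF r2C] by blast
  obtain r3 i where r3: "r3 \<in> BL r2" "E i a" "FE r3 y' (ck i)" by (rule FM_check_witness[OF r2C r2(2)])
  have r3C: "r3 \<in> C" using r3 below_Cond by blast
  have b: "r3 \<in> BL r" using below_trans[OF below_trans[OF r3(1) r2(1) r1C] r1(1) rC] .
  have "FE r3 y (ck i)" using FE_trans[OF r3C FE_mono[OF r2C r3(1) e] r3(3)] .
  then have "FM r3 (op w (ck i)) f"
    using FM_eq_left[OF r3C op_cong[OF r3C FE_refl[OF r3C]] FM_mono[OF rC b m]] by blast
  then show ?thesis using below_trans[OF b r(1) p] r3(2) by blast
qed

lemma is_inj_inj:
  assumes p: "p \<in> C" and f: "forces E PP (is_inj f x b) p" and "FM p (op w v) f" "FM p (op w' v) f"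
  shows "FE p w w'"
proof -
  have "\<forall>w w' v. forces E PP (rel f w v \<^bold>\<and> rel f w' v \<^bold>\<longrightarrow> w \<^bold>= w') p"
    using f unfolding is_inj_def forces.simps by blast
  then show ?thesis using assms(3,4) below_refl[OF p]
    unfolding forces_imp[OF p] forces.simps forces_rel[OF p, symmetric] by blast
qed

lemma is_injI:
  assumes p: "p \<in> C"
    and 1: "\<And>q z. q \<in> BL p \<Longrightarrow> FM q z f \<Longrightarrow> \<exists>r\<in>BL q. \<exists>x y. FM r x a \<and> FM r y b \<and> FE r z (op x y)"
    and 2: "\<And>q x. q \<in> BL p \<Longrightarrow> FM q x a \<Longrightarrow>
      \<exists>r\<in>BL q. \<exists>y. FM r (op x y) f \<and> (\<forall>y'. \<forall>r'\<in>BL r. FM r' (op x y') f \<longrightarrow> FE r' y' y)"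
    and 3: "\<And>q x x' y. q \<in> BL p \<Longrightarrow> FM q (op x y) f \<Longrightarrow> FM q (op x' y) f \<Longrightarrow> FE q x x'"
  shows "forces E PP (is_inj f a b) p"
proof -
  have f1: "forces E PP (\<^bold>\<exists>x y. x \<^bold>\<in> a \<^bold>\<and> y \<^bold>\<in> b \<^bold>\<and> is_pair z x y) q" if q: "q \<in> BL p" "FM q z f" for q z
  proof (rule forces_dense[OF below_Cond[OF q(1)]])
    fix q' assume q': "q' \<in> BL q"
    have qC: "q \<in> C" using q below_Cond by blast
    obtain r x y where r: "r \<in> BL q'" "FM r x a" "FM r y b" "FE r z (op x y)"
      using 1[OF below_trans[OF q' q(1) p] FM_mono[OF qC q' q(2)]] by blast
    then have "forces E PP (\<^bold>\<exists>x y. x \<^bold>\<in> a \<^bold>\<and> y \<^bold>\<in> b \<^bold>\<and> is_pair z x y) r"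
      using below_Cond[OF r(1)] by (intro forces_exI[of _ _ x] forces_exI[of _ _ y]) (auto simp: forces_is_pair)
    then show "\<exists>r\<in>BL q'. forces E PP (\<^bold>\<exists>x y. x \<^bold>\<in> a \<^bold>\<and> y \<^bold>\<in> b \<^bold>\<and> is_pair z x y) r" using r(1) by blast
  qed
  have f2: "forces E PP (\<^bold>\<exists>y. rel f x y \<^bold>\<and> (\<^bold>\<forall>y'. rel f x y' \<^bold>\<longrightarrow> y' \<^bold>= y)) q" if q: "q \<in> BL p" "FM q x a" for q x
  proof (rule forces_dense[OF below_Cond[OF q(1)]])
    fix q' assume q': "q' \<in> BL q"
    have qC: "q \<in> C" using q below_Cond by blast
    obtain r y where r: "r \<in> BL q'" "FM r (op x y) f" "\<forall>y'. \<forall>r'\<in>BL r. FM r' (op x y') f \<longrightarrow> FE r' y' y"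
      using 2[OF below_trans[OF q' q(1) p] FM_mono[OF qC q' q(2)]] by blast
    have rC: "r \<in> C" using r below_Cond by blast
    have "forces E PP (rel f x y \<^bold>\<and> (\<^bold>\<forall>y'. rel f x y' \<^bold>\<longrightarrow> y' \<^bold>= y)) r"
      using r rC below_Cond by (simp add: forces_rel forces_imp)
    then have "forces E PP (\<^bold>\<exists>y. rel f x y \<^bold>\<and> (\<^bold>\<forall>y'. rel f x y' \<^bold>\<longrightarrow> y' \<^bold>= y)) r" by (rule forces_exI[OF rC])
    then show "\<exists>r\<in>BL q'. forces E PP (\<^bold>\<exists>y. rel f x y \<^bold>\<and> (\<^bold>\<forall>y'. rel f x y' \<^bold>\<longrightarrow> y' \<^bold>= y)) r" using r(1) by blast
  qed
  have f3: "forces E PP (\<^bold>\<forall>x x' y. rel f x y \<^bold>\<and> rel f x' y \<^bold>\<longrightarrow> x \<^bold>= x') p"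
    using p below_Cond by (simp add: forces_imp forces_rel) (use 3 in blast)
  show ?thesis unfolding is_inj_def is_fun_def using f3 f1 f2 by (simp add: forces_imp[OF p])
qed

end

section \<open>The approximation property\<close>

locale splitting_two_step = closed_two_step +
  assumes P_new: "adds_new_set E (ext_poset E P leP)"
    and P_small: "holds E (smaller P \<kappa>)"
begin

lemma split_choice:
  obtains s where "\<And>p. p \<in> P.C \<Longrightarrow> vfst (app s p) \<in> P.BL p \<and> vsnd (app s p) \<in> P.BL p \<and>
    \<not> P.compat (vfst (app s p)) (vsnd (app s p))"
proof -
  let ?R = "\<lambda>p w. vfst w \<in> P.BL p \<and> vsnd w \<in> P.BL p \<and> \<not> P.compat (vfst w) (vsnd w)"
  have "\<exists>s. \<forall>p\<in>P.C. ?R p (app s p)"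
  proof (rule vchoice_class[OF P.isset_Cond])
    show "dfn (\<lambda>e. ?R (e 0) (e 1))" by (intro dfn_intros)
    show "\<exists>w. ?R p w" if "p \<in> P.C" for p
      using P.adds_new_set_splits[OF P_new that] vfst_pr vsnd_pr by metis
  qed
  then show thesis using that by blast
qed

lemma P_bound: obtains a where "E a \<kappa>" "vinj P.C (els a)"
  using P_small by (auto simp: holds_smaller Cond_PP)

text \<open>Terms range over all of \<open>P\<close>, a condition of the iteration sits over one
  \<open>p\<close>. Since \<open>t\<close> lies below a term with value \<open>q1\<close> under
  \<open>p1\<close>, its values there continue the condition \<open>(p1, q1)\<close>.\<close>

lemma term_meets:
  assumes r1: "pr p1 q1 \<in> R.C" and t1: "tm t1" "\<forall>p q. E (pr p q) t1 \<longrightarrow> p \<in> P.BL p1 \<longrightarrow> q = q1"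
    and t: "tm t" "tle t t1" and p: "p \<in> P.BL p1"
  obtains p' q where "p' \<in> P.BL p" "E (pr p' q) t" "pr p' q \<in> R.BL (pr p1 q1)"
proof -
  have p1: "p1 \<in> P.C" and pC: "p \<in> P.C" using r1 p P.below_Cond by (auto simp: pr_Cond_RR)
  obtain p2 q2 where p2: "p2 \<in> P.BL p" "E (pr p2 q2) t" using tm_dense[OF t(1) pC] by blast
  have p2C: "p2 \<in> P.C" using p2 P.below_Cond by blast
  obtain p3 q3 where p3: "p3 \<in> P.BL p2" "E (pr p3 q3) t1" using tm_dense[OF t1(1) p2C] by blast
  have b: "p3 \<in> P.BL p" "p3 \<in> P.BL p1"
    using P.below_trans[OF p3(1) p2(1) pC] P.below_trans[OF _ p p1] by blast+
  have "q3 = q1" using t1(2) p3(2) b(2) by blast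
  have e: "E (pr p3 q2) t" using tm_open[OF t(1) p2(2) p3(1)] .
  have "qle p3 q2 q1" using t(2) e p3(2) \<open>q3 = q1\<close> by (auto simp: tle_def)
  then have "pr p3 q2 \<in> R.BL (pr p1 q1)" using R_below[OF tm_R[OF t(1) e]] b by blast
  then show thesis using that b(1) e by blast
qed

text \<open>Suppose that no extension of \<open>r1\<close> decides all \<open>\<Phi> e\<close>. Then
  for each \<open>p\<close> below \<open>p1\<close> every term can be strengthened so that some
  \<open>e\<close> gets opposite verdicts at two extensions of \<open>p\<close>. Distributivity
  yields one term doing this for all \<open>p\<close>, and choice collects the elements into a
  family \<open>f\<close> over \<open>P\<close>. A condition deciding the whole family contradicts
  itself at its own first component.\<close>

theorem approximation:
  assumes Z: "isset Z" and \<Phi>: "dfn (\<lambda>e. \<Phi> (e 0) (e 1))" and ro: "\<And>e. e \<in> Z \<Longrightarrow> R.ro (\<Phi> e)"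
    and r1: "r1 \<in> R.C"
    and ap: "\<And>f r. (\<And>p. p \<in> P.C \<Longrightarrow> app f p \<in> Z) \<Longrightarrow> r \<in> R.BL r1 \<Longrightarrow>
      \<exists>r'\<in>R.BL r. \<forall>p\<in>P.C. \<Phi> (app f p) r' \<or> R.ng (\<Phi> (app f p)) r'"
  shows "\<exists>r\<in>R.BL r1. \<forall>e\<in>Z. \<Phi> e r \<or> R.ng (\<Phi> e) r"
proof (rule ccontr)
  assume no: "\<not> ?thesis"
  note \<Phi>' = dfn_comp2[OF \<Phi>]
  obtain p1 q1 where r1e: "r1 = pr p1 q1" using r1 by (rule R_cases)
  note r1' = r1[unfolded r1e]
  have p1: "p1 \<in> P.C" using r1' by (simp add: pr_Cond_RR)
  obtain t1 where t1: "tm t1" "\<forall>p q. E (pr p q) t1 \<longrightarrow> p \<in> P.BL p1 \<longrightarrow> q = q1"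
    using term_below[OF r1'] by blast
  note meets = term_meets[OF r1' t1]
  obtain s where s: "\<And>p. p \<in> P.C \<Longrightarrow> vfst (app s p) \<in> P.BL p \<and> vsnd (app s p) \<in> P.BL p \<and>
    \<not> P.compat (vfst (app s p)) (vsnd (app s p))" by (rule split_choice) blast
  define opp where "opp e r r' \<longleftrightarrow> \<Phi> e r \<and> R.ng (\<Phi> e) r' \<or> R.ng (\<Phi> e) r \<and> \<Phi> e r'" for e r r'
  have dopp: "\<lbrakk>dft t; dft u; dft v\<rbrakk> \<Longrightarrow> dfn (\<lambda>e. opp (t e) (u e) (v e))" for t u v
    unfolding opp_def R.ng_def by (intro dfn_intros \<Phi>' dft_shift)
  have opp_mono: "opp e c c'" if "opp e r r'" "e \<in> Z" "r \<in> R.C" "r' \<in> R.C" "c \<in> R.BL r" "c' \<in> R.BL r'" for e r r' c c'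
    using that R.ro_mono[OF ro[OF that(2)]] R.ng_mono unfolding opp_def by blast
  \<comment> \<open>The two conditions lie below the two halves of the splitting of
    \<open>p\<close>, and their second components are values of the term.\<close>
  define W where "W p t e \<longleftrightarrow> e \<in> Z \<and> (\<exists>pa qa pb qb. E (pr pa qa) t \<and> E (pr pb qb) t \<and>
     pa \<in> P.BL (vfst (app s p)) \<and> pb \<in> P.BL (vsnd (app s p)) \<and> opp e (pr pa qa) (pr pb qb))" for p t e
  have dW: "\<lbrakk>dft p; dft t; dft u\<rbrakk> \<Longrightarrow> dfn (\<lambda>e. W (p e) (t e) (u e))" for p t u
    unfolding W_def by (intro dfn_intros dopp dft_shift dfn_in_set Z)
  obtain a where a: "E a \<kappa>" "vinj P.C (els a)" by (rule P_bound)
  have "\<exists>t. tm t \<and> tle t t1 \<and> (\<forall>p\<in>P.C. p \<in> P.BL p1 \<longrightarrow> (\<exists>e. W p t e))"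
  proof (rule distributivity[OF P.isset_Cond a, where D = "\<lambda>p t. p \<in> P.BL p1 \<longrightarrow> (\<exists>e. W p t e)"])
    show "dfn (\<lambda>e. e 0 \<in> P.BL p1 \<longrightarrow> (\<exists>x. W (e 0) (e 1) x))" by (intro dfn_intros dW)
    show "tm t1" by (rule t1)
    show "p \<in> P.BL p1 \<longrightarrow> (\<exists>e. W p t' e)"
      if p: "p \<in> P.C" and t: "tm t" "tm t'" "tle t' t" and D: "p \<in> P.BL p1 \<longrightarrow> (\<exists>e. W p t e)" for p t t'
    proof
      assume "p \<in> P.BL p1"
      then obtain e pa qa pb qb where e: "e \<in> Z" "E (pr pa qa) t" "E (pr pb qb) t"
        "pa \<in> P.BL (vfst (app s p))" "pb \<in> P.BL (vsnd (app s p))" "opp e (pr pa qa) (pr pb qb)"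
        using D unfolding W_def by blast
      have C: "pa \<in> P.C" "pb \<in> P.C" "vfst (app s p) \<in> P.C" "vsnd (app s p) \<in> P.C"
        using e s[OF p] P.below_Cond by blast+
      obtain pa' qa' where a': "pa' \<in> P.BL pa" "E (pr pa' qa') t'" using tm_dense[OF t(2) C(1)] by blast
      obtain pb' qb' where b': "pb' \<in> P.BL pb" "E (pr pb' qb') t'" using tm_dense[OF t(2) C(2)] by blast
      have "opp e (pr pa' qa') (pr pb' qb')"
        by (rule opp_mono[OF e(6,1) tm_R[OF t(1) e(2)] tm_R[OF t(1) e(3)]])
           (intro tle_below[OF t(2,1,3)] a' b' e)+
      then show "\<exists>e. W p t' e" unfolding W_def
        using e(1) a'(2) b'(2) P.below_trans[OF a'(1) e(4) C(3)] P.below_trans[OF b'(1) e(5) C(4)] by blast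
    qed
    fix p t assume p: "p \<in> P.C" and t: "tm t" "tle t t1"
    show "\<exists>t'. tm t' \<and> tle t' t \<and> (p \<in> P.BL p1 \<longrightarrow> (\<exists>e. W p t' e))"
    proof (cases "p \<in> P.BL p1")
      case False
      then show ?thesis using t(1) tle_refl by blast
    next
      case pp: True
      define s0 s1 where "s0 = vfst (app s p)" and "s1 = vsnd (app s p)"
      have s01: "s0 \<in> P.BL p" "s1 \<in> P.BL p" "\<not> P.compat s0 s1" using s[OF p] by (auto simp: s0_def s1_def)
      have sC: "s0 \<in> P.C" "s1 \<in> P.C" using s01 P.below_Cond by blast+
      obtain pa0 qa0 where a0: "pa0 \<in> P.BL s0" "E (pr pa0 qa0) t" "pr pa0 qa0 \<in> R.BL (pr p1 q1)"
        using meets[OF t P.below_trans[OF s01(1) pp p1]] by blast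
      obtain pb0 qb0 where b0: "pb0 \<in> P.BL s1" "E (pr pb0 qb0) t" using tm_dense[OF t(1) sC(2)] by blast
      define ra rb where "ra = pr pa0 qa0" and "rb = pr pb0 qb0"
      have raC: "ra \<in> R.C" and rbC: "rb \<in> R.C" using tm_R[OF t(1)] a0 b0 by (auto simp: ra_def rb_def)
      obtain e where e: "e \<in> Z" "\<not> \<Phi> e ra" "\<not> R.ng (\<Phi> e) ra" using no a0(3) unfolding ra_def r1e by blast
      obtain x where x: "x \<in> R.BL ra" "\<Phi> e x" using e(3) unfolding R.ng_def by blast
      obtain y where y: "y \<in> R.BL ra" "R.ng (\<Phi> e) y" using R.ro_undecided[OF ro[OF e(1)] raC e(2)] by blast
      \<comment> \<open>The side of \<open>s1\<close> decides first. As \<open>ra\<close> leaves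
        \<open>e\<close> open, the side of \<open>s0\<close> can still be extended to give the
        opposite verdict.\<close>
      obtain z where z: "z \<in> R.BL rb" "\<Phi> e z \<or> R.ng (\<Phi> e) z" using R.dense_decides[OF rbC] by blast
      obtain ra' where ra': "ra' \<in> R.BL ra" "opp e ra' z" using x y z(2) unfolding opp_def by blast
      obtain pa qa where rae: "ra' = pr pa qa" using R.below_Cond[OF ra'(1)] by (rule R_cases)
      obtain pb qb where rbe: "z = pr pb qb" using R.below_Cond[OF z(1)] by (rule R_cases)
      have raC': "pr pa qa \<in> R.C" and rbC': "pr pb qb \<in> R.C" using ra'(1) z(1) R.below_Cond unfolding rae rbe by blast+
      have pC: "pa \<in> P.C" "pb \<in> P.C" using raC' rbC' by (auto simp: pr_Cond_RR)
      have la: "pa \<in> P.BL pa0" "qle pa qa qa0" using ra'(1) R_below[OF raC'] unfolding rae ra_def by blast+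
      have lb: "pb \<in> P.BL pb0" "qle pb qb qb0" using z(1) R_below[OF rbC'] unfolding rbe rb_def by blast+
      have sa: "pa \<in> P.BL s0" using P.below_trans[OF la(1) a0(1) sC(1)] .
      have sb: "pb \<in> P.BL s1" using P.below_trans[OF lb(1) b0(1) sC(2)] .
      have inc: "\<not> P.compat pa pb"
        using s01(3) sa sb P.below_trans[OF _ sa sC(1)] P.below_trans[OF _ sb sC(2)] unfolding P.compat_def by blast
      let ?g = "\<lambda>p q. pr p q \<in> R.C \<and> (p \<in> P.BL pa \<and> q = qa \<or> p \<in> P.BL pb \<and> q = qb \<or>
         \<not> P.compat p pa \<and> \<not> P.compat p pb \<and> E (pr p q) t)"
      have "\<exists>t'. tm t' \<and> (\<forall>p q. E (pr p q) t' \<longrightarrow> ?g p q)"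
      proof (rule mixing)
        show "dfn (\<lambda>e. ?g (e 0) (e 1))" by (intro dfn_intros)
        show "?g p' q" if h: "?g p q" "p' \<in> P.BL p" for p q p'
        proof -
          have "p \<in> P.C" using h by (simp add: pr_Cond_RR)
          then show ?thesis
            using h(1) R_restrict(1)[OF _ h(2)] P.below_trans[OF h(2) _ pC(1)] P.below_trans[OF h(2) _ pC(2)]
              P.compat_below[OF h(2)] tm_open[OF t(1) _ h(2)] by blast
        qed
        fix p assume p: "p \<in> P.C"
        consider "P.compat p pa" | "P.compat p pb" | "\<not> P.compat p pa" "\<not> P.compat p pb" by blast
        then show "\<exists>p'\<in>P.BL p. \<exists>q. ?g p' q"
        proof cases
          case 1
          then show ?thesis using R_restrict(1)[OF raC'] unfolding P.compat_def by blast
        next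
          case 2
          then show ?thesis using R_restrict(1)[OF rbC'] unfolding P.compat_def by blast
        next
          case 3
          obtain p' q where "p' \<in> P.BL p" "E (pr p' q) t" using tm_dense[OF t(1) p] by blast
          then show ?thesis using 3 P.compat_below[OF _ p] tm_R[OF t(1)] by blast
        qed
      qed blast
      then obtain t' where t': "tm t'" "\<And>p q. E (pr p q) t' \<Longrightarrow> ?g p q" by blast
      have "tle t' t" unfolding tle_def
      proof (intro allI impI)
        fix p q q' assume q: "E (pr p q) t'" "E (pr p q') t"
        have pp: "p \<in> P.C" "inQ p q" using tm_R[OF t'(1) q(1)] by (auto simp: pr_Cond_RR)
        have *: "qle p x q'" if x: "p \<in> P.BL p0" "qle p0 x x0" "p0 \<in> P.BL p00" "E (pr p00 x0) t" "p00 \<in> P.C" for p0 p00 x x0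
        proof -
          have "p0 \<in> P.C" using x P.below_Cond by blast
          have "E (pr p x0) t" using tm_open[OF t(1) x(4) P.below_trans[OF x(1,3,5)]] .
          then have "x0 = q'" using tm_unique[OF t(1)] q(2) by blast
          then show ?thesis using P.FM_mono[OF \<open>p0 \<in> P.C\<close> x(1,2)] by blast
        qed
        consider "p \<in> P.BL pa" "q = qa" | "p \<in> P.BL pb" "q = qb" | "E (pr p q) t" using t'(2)[OF q(1)] by blast
        then show "qle p q q'"
        proof cases
          case 1
          then show ?thesis using *[OF _ la(2,1) a0(2)] tm_P[OF t(1) a0(2)] by blast
        next
          case 2
          then show ?thesis using *[OF _ lb(2,1) b0(2)] tm_P[OF t(1) b0(2)] by blast
        next
          case 3
          then have "q = q'" using tm_unique[OF t(1)] q(2) by blast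
          then show ?thesis using Q_forced(2)[OF pp] by blast
        qed
      qed
      moreover have "W p t' e"
      proof -
        obtain pa' qa' where a': "pa' \<in> P.BL pa" "E (pr pa' qa') t'" using tm_dense[OF t'(1) pC(1)] by blast
        obtain pb' qb' where b': "pb' \<in> P.BL pb" "E (pr pb' qb') t'" using tm_dense[OF t'(1) pC(2)] by blast
        have ca: "P.compat pa' pa" "P.compat pb' pb"
          using a'(1) b'(1) P.below_refl P.below_Cond unfolding P.compat_def by blast+
        have "\<not> pa' \<in> P.BL pb" "\<not> pb' \<in> P.BL pa" using inc a'(1) b'(1) unfolding P.compat_def by blast+
        then have "qa' = qa" "qb' = qb" using t'(2)[OF a'(2)] t'(2)[OF b'(2)] ca by blast+
        then have "opp e (pr pa' qa') (pr pb' qb')"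
          using opp_mono[OF ra'(2)[unfolded rae rbe] e(1) raC' rbC'] R_restrict(2)[OF raC' a'(1)] R_restrict(2)[OF rbC' b'(1)] by blast
        then show ?thesis unfolding W_def s0_def[symmetric] s1_def[symmetric]
          using e(1) a'(2) b'(2) P.below_trans[OF a'(1) sa sC(1)] P.below_trans[OF b'(1) sb sC(2)] by blast
      qed
      ultimately show ?thesis using t'(1) by blast
    qed
  qed
  then obtain t where t: "tm t" "tle t t1" and D: "\<And>p. p \<in> P.BL p1 \<Longrightarrow> \<exists>e. W p t e"
    using P.below_Cond by blast
  have "\<exists>f. \<forall>p\<in>P.C. app f p \<in> Z \<and> (p \<in> P.BL p1 \<longrightarrow> W p t (app f p))"
  proof (rule vchoice[OF P.isset_Cond Z])
    show "dfn (\<lambda>e. e 0 \<in> P.BL p1 \<longrightarrow> W (e 0) t (e 1))" by (intro dfn_intros dW)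
    \<comment> \<open>The family is indexed by all of \<open>P\<close>; at conditions not below
      \<open>p1\<close> any element of \<open>Z\<close> serves.\<close>
    have "\<exists>e. e \<in> Z" using D[OF P.below_refl[OF p1]] unfolding W_def by blast
    then show "\<exists>e\<in>Z. p \<in> P.BL p1 \<longrightarrow> W p t e" for p using D[of p] unfolding W_def by blast
  qed
  then obtain f where f: "\<And>p. p \<in> P.C \<Longrightarrow> app f p \<in> Z" "\<And>p. p \<in> P.BL p1 \<Longrightarrow> W p t (app f p)"
    using P.below_Cond by blast
  obtain p q where p: "p \<in> P.BL p1" "E (pr p q) t" "pr p q \<in> R.BL (pr p1 q1)"
    using meets[OF t P.below_refl[OF p1]] by blast
  obtain r' where r': "r' \<in> R.BL (pr p q)" "\<forall>p\<in>P.C. \<Phi> (app f p) r' \<or> R.ng (\<Phi> (app f p)) r'"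
    using ap[OF f(1)] p(3) unfolding r1e by blast
  obtain p' q' where re: "r' = pr p' q'" using R.below_Cond[OF r'(1)] by (rule R_cases)
  have rC': "pr p' q' \<in> R.C" using r'(1) R.below_Cond unfolding re by blast
  have p'C: "p' \<in> P.C" using rC' by (simp add: pr_Cond_RR)
  have l': "p' \<in> P.BL p" "qle p' q' q" using r'(1) R_below[OF rC'] unfolding re by blast+
  have pC: "p \<in> P.C" using p P.below_Cond by blast
  have p'1: "p' \<in> P.BL p1" using P.below_trans[OF l'(1) p(1) p1] .
  \<comment> \<open>The diagonal step: the element prepared for the first component of the deciding
    condition \<open>r'\<close>.\<close>
  define e where "e = app f p'"
  obtain pa qa pb qb where w: "e \<in> Z" "E (pr pa qa) t" "E (pr pb qb) t"
     "pa \<in> P.BL (vfst (app s p'))" "pb \<in> P.BL (vsnd (app s p'))" "opp e (pr pa qa) (pr pb qb)"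
    using f(2)[OF p'1] unfolding W_def e_def by blast
  have bel: "x \<in> P.BL p'" if "x \<in> P.BL (vfst (app s p')) \<or> x \<in> P.BL (vsnd (app s p'))" for x
    using that s[OF p'C] P.below_trans[OF _ _ p'C] by blast
  have key: "pr x q' \<in> R.BL (pr x y)" "pr x q' \<in> R.BL r'" if x: "x \<in> P.BL p'" "E (pr x y) t" for x y
  proof -
    have xC: "x \<in> P.C" using x P.below_Cond by blast
    \<comment> \<open>As \<open>t\<close> is locally constant, its value at any \<open>x\<close>
      below \<open>p'\<close> is still \<open>q\<close>, which \<open>q'\<close> extends. Hence
      \<open>(x, q')\<close> lies below both the prepared condition at \<open>x\<close> and
      \<open>r'\<close>.\<close>
    have "E (pr x q) t" using tm_open[OF t(1) p(2) P.below_trans[OF x(1) l'(1) pC]] .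
    then have "y = q" using tm_unique[OF t(1)] x(2) by blast
    moreover have "qle x q' q" using P.FM_mono[OF p'C x(1) l'(2)] .
    ultimately show "pr x q' \<in> R.BL (pr x y)" using R_below[OF R_restrict(1)[OF rC' x(1)]] xC P.below_refl by blast
    show "pr x q' \<in> R.BL r'" unfolding re using R_restrict(2)[OF rC' x(1)] .
  qed
  have ka: "pr pa q' \<in> R.BL (pr pa qa)" "pr pa q' \<in> R.BL r'" using key w(2,4) bel by blast+
  have kb: "pr pb q' \<in> R.BL (pr pb qb)" "pr pb q' \<in> R.BL r'" using key w(3,5) bel by blast+
  have o: "opp e (pr pa q') (pr pb q')"
    by (rule opp_mono[OF w(6,1) tm_R[OF t(1) w(2)] tm_R[OF t(1) w(3)] ka(1) kb(1)])
  have C: "pr pa q' \<in> R.C" "pr pb q' \<in> R.C" "r' \<in> R.C" using ka kb r'(1) R.below_Cond by blast+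
  have "\<Phi> e r' \<or> R.ng (\<Phi> e) r'" using r'(2) p'C unfolding e_def by blast
  then show False
  proof
    assume "\<Phi> e r'"
    then have "\<Phi> e (pr pa q')" "\<Phi> e (pr pb q')" using R.ro_mono[OF ro[OF w(1)] C(3)] ka(2) kb(2) by blast+
    then show False using o R.ng_contra C(1,2) unfolding opp_def by blast
  next
    assume "R.ng (\<Phi> e) r'"
    then have "R.ng (\<Phi> e) (pr pa q')" "R.ng (\<Phi> e) (pr pb q')" using R.ng_mono[OF C(3)] ka(2) kb(2) by blast+
    then show False using o R.ng_contra C(1,2) unfolding opp_def by blast
  qed
qed

end

section \<open>Canonical names and cardinalities in the extension\<close>

context forcing begin

lemma dft_mkname:
  assumes X: "isset X" and \<Theta>: "dfn (\<lambda>e. \<Theta> (e 0) (e 1) (e 2))" and t: "dft t"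
  shows "dft (\<lambda>e. mkname X (\<Theta> (t e)))"
proof (rule dft_comp1[OF _ t])
  note \<Theta>' = dfn_comp3[OF \<Theta>]
  show "dft (\<lambda>e. mkname X (\<Theta> (e 0)))" unfolding mkname_def
    by (rule dft_code, intro isset_sep isset_vprod X isset_Cond dfn_intros \<Theta>')
       (intro dfn_intros \<Theta>' dfn_in_set X isset_vprod isset_Cond)
qed

lemma dfn_forces_smaller [dfn_intros]:
  "dft x \<Longrightarrow> dft y \<Longrightarrow> dft p \<Longrightarrow> dfn (\<lambda>e. forces E PP (smaller (x e) (y e)) (p e))"
  unfolding smaller_def is_inj_def is_fun_def rel_def is_pair_def is_upair_def FEx_def FOr_def FIff_def FImp_def forces.simps
  by (intro dfn_intros dft_shift)

lemma dfn_forces_sub [dfn_intros]: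
  "dft x \<Longrightarrow> dft y \<Longrightarrow> dft p \<Longrightarrow> dfn (\<lambda>e. forces E PP (x e \<^bold>\<subseteq> y e) (p e))"
  unfolding sub_def FImp_def forces.simps by (intro dfn_intros dft_shift)

lemma forces_sub_cong:
  assumes p: "p \<in> C" and "FE p a a'" shows "forces E PP (a \<^bold>\<subseteq> b) p \<longleftrightarrow> forces E PP (a' \<^bold>\<subseteq> b) p"
proof -
  have "fcong p (a \<^bold>\<subseteq> b) (a' \<^bold>\<subseteq> b)"
    unfolding sub_def by (intro fcong.intros fcong_derived FE_refl assms)
  then show ?thesis using fcong_forces p below_refl by blast
qed

text \<open>All names form a proper class, but each name for a subset of \<open>l\<close> is forced
  equal to a nice name, that is, a subset of the product of the canonical names of elements of
  \<open>l\<close> with the conditions. These form a set \<open>X\<close>, from which the name of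
  the whole family is built.\<close>

lemma obtain_Pk:
  obtains s where "\<And>q x. q \<in> C \<Longrightarrow> FM q x s \<longleftrightarrow> forces E PP (x \<^bold>\<subseteq> ck l \<^bold>\<and> smaller x k) q"
proof -
  define N where "N = ck ` els l"
  have N: "isset N" unfolding N_def by (intro isset_image isset_els dfn_intros)
  define X where "X = {u. els u \<subseteq> vprod N C}"
  have X: "isset X" unfolding X_def by (intro isset_Pow isset_vprod N isset_Cond)
  define \<Phi> where "\<Phi> x r \<longleftrightarrow> forces E PP (x \<^bold>\<subseteq> ck l \<^bold>\<and> smaller x k) r" for x r
  have d\<Phi>: "dfn (\<lambda>e. \<Phi> (e 0) (e 1))" unfolding \<Phi>_def forces.simps by (intro dfn_intros)
  have mono: "\<Phi> z r'" if "r \<in> C" "r' \<in> BL r" "\<Phi> z r" for z r r'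
    using forces_mono[OF that(1,2)] that(3) unfolding \<Phi>_def by blast
  have cong: "\<Phi> w r" if "r \<in> C" "\<Phi> z r" "FE r w z" for z w r
    using that forces_sub_cong[OF that(1,3)] forces_smaller_cong[OF that(1,3) FE_refl[OF that(1)]]
    unfolding \<Phi>_def forces.simps by blast
  have "FM q x (mkname X \<Phi>) \<longleftrightarrow> \<Phi> x q" if q: "q \<in> C" for q x
  proof
    assume m: "FM q x (mkname X \<Phi>)"
    have m': "\<forall>q'\<in>BL q. \<exists>r\<in>BL q'. \<exists>z\<in>X. \<Phi> z r \<and> FE r x z"
      by (rule FM_mkname[OF X d\<Phi>, THEN iffD1, OF _ m]) (rule mono)
    show "\<Phi> x q" unfolding \<Phi>_def
      by (rule forces_dense[OF q], fold \<Phi>_def) (use m' cong below_Cond in blast)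
  next
    assume x: "\<Phi> x q"
    \<comment> \<open>The nice name of \<open>x\<close>: each canonical name is paired with the
      conditions forcing it into \<open>x\<close>.\<close>
    define x' where "x' = mkname N (\<lambda>z r. FM r z x)"
    have dx: "dfn (\<lambda>e. FM (e 1) (e 0) x)" by (intro dfn_intros)
    have mx: "E (pr z r) x' \<longleftrightarrow> z \<in> N \<and> r \<in> C \<and> FM r z x" for z r
      unfolding x'_def by (rule mem_mkname[OF N dx])
    have "isset {u \<in> vprod N C. \<exists>z r. u = pr z r \<and> FM r z x}"
      by (intro isset_sep isset_vprod N isset_Cond dfn_intros)
    then have xX: "x' \<in> X" unfolding X_def x'_def mkname_def by auto
    have FMx': "FM r w x' \<longleftrightarrow> (\<forall>q\<in>BL r. \<exists>r\<in>BL q. \<exists>z\<in>N. FM r z x \<and> FE r w z)" for r w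
      unfolding x'_def by (rule FM_mkname[OF N dx]) (rule FM_mono)
    have sub: "\<And>z q'. q' \<in> BL q \<Longrightarrow> FM q' z x \<Longrightarrow> FM q' z (ck l)"
      using x unfolding \<Phi>_def forces.simps forces_sub[OF q] by blast
    have "FE q x x'"
    proof (rule FE_ext[OF q], rule iffI)
      fix w q' assume q': "q' \<in> BL q" and m: "FM q' w x"
      have q'C: "q' \<in> C" using q' below_Cond by blast
      show "FM q' w x'" unfolding FMx'
      proof
        fix q2 assume q2: "q2 \<in> BL q'"
        then obtain r z where r: "r \<in> BL q2" "E z l" "FE r w (ck z)"
          using sub[OF q' m] unfolding FM_check[OF q'C] by blast
        have rC: "r \<in> C" and rq: "r \<in> BL q'" using r below_Cond below_trans[OF r(1) q2 q'C] by blast+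
        have "FM r (ck z) x" using FM_eq_left[OF rC r(3) FM_mono[OF q'C rq m]] .
        moreover have "ck z \<in> N" using r(2) by (simp add: N_def)
        ultimately show "\<exists>r\<in>BL q2. \<exists>z\<in>N. FM r z x \<and> FE r w z" using r by blast
      qed
    next
      fix w q' assume q': "q' \<in> BL q" and m: "FM q' w x'"
      have q'C: "q' \<in> C" using q' below_Cond by blast
      show "FM q' w x"
      proof (rule FM_dense[OF q'C])
        fix q2 assume "q2 \<in> BL q'"
        then obtain r z where r: "r \<in> BL q2" "FM r z x" "FE r w z" using m unfolding FMx' by blast
        have rC: "r \<in> C" using r below_Cond by blast
        then show "\<exists>r\<in>BL q2. FM r w x" using r FM_eq_left[OF rC FE_sym[OF rC r(3)] r(2)] by blast
      qed
    qed
    then have e: "FE q x' x" using FE_sym[OF q] by blast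
    then have "\<Phi> x' q" using cong[OF q x] by blast
    then have "FM q x' (mkname X \<Phi>)"
      using FM_own[OF q q] mem_mkname[OF X d\<Phi>] xX q Leq_refl by blast
    then show "FM q x (mkname X \<Phi>)" using FM_eq_left[OF q e] by blast
  qed
  then show thesis using that unfolding \<Phi>_def by blast
qed

text \<open>A chain-condition argument: in the extension, an injection of \<open>l\<close> into some \<open>a < l\<close> would
  give an injection of \<open>l\<close> into \<open>C \<times> a\<close> in the ground model.\<close>

lemma check_cardinal:
  assumes l: "Ord l" "\<And>a. E a l \<Longrightarrow> \<not> vinj (els l) (vprod C (els a))" and p: "p \<in> C"
  shows "forces E PP (cardinal (ck l)) p"
proof -
  have no: False if q: "q \<in> C" "FM q a (ck l)" "forces E PP (\<^bold>\<exists>f. is_inj f (ck l) a) q" for q a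
  proof -
    obtain r b where r: "r \<in> BL q" "E b l" "FE r a (ck b)" by (rule FM_check_witness[OF q(1,2)])
    have rC: "r \<in> C" using r below_Cond by blast
    obtain r1 f where r1: "r1 \<in> BL r" "forces E PP (is_inj f (ck l) a) r1"
      using forces_mono[OF q(1) r(1) q(3)] rC below_refl unfolding forces_ex by blast
    have r1C: "r1 \<in> C" using r1 below_Cond by blast
    have inj: "forces E PP (is_inj f (ck l) (ck b)) r1"
      using forces_is_inj_cong[OF r1C FE_refl[OF r1C] FE_refl[OF r1C] FE_mono[OF rC r1(1) r(3)]] r1(2) by blast
    \<comment> \<open>A condition \<open>c\<close> below \<open>r1\<close> that decides the value at
      \<open>x\<close> to be \<open>i\<close> determines \<open>x\<close> together with
      \<open>i\<close>, since the function is forced to be injective.\<close>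
    let ?R = "\<lambda>x w. \<exists>c i. w = pr c i \<and> c \<in> BL r1 \<and> FM c (op (ck x) (ck i)) f"
    have "\<exists>g. \<forall>x\<in>els l. app g x \<in> vprod C (els b) \<and> ?R x (app g x)"
    proof (rule vchoice)
      show "dfn (\<lambda>e. ?R (e 0) (e 1))" by (intro dfn_intros)
      show "\<exists>y\<in>vprod C (els b). ?R x y" if x: "x \<in> els l" for x
      proof -
        obtain c i where "c \<in> BL r1" "E i b" "FM c (op (ck x) (ck i)) f"
          using is_inj_app[OF r1C inj FM_checkI[OF r1C, of x]] x by auto
        then show ?thesis using below_Cond by (intro bexI[of _ "pr c i"]) auto
      qed
    qed (auto simp: isset_Cond)
    then obtain g where g: "\<And>x. E x l \<Longrightarrow> app g x \<in> vprod C (els b) \<and> ?R x (app g x)"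
      unfolding Ball_def mem_els by blast
    have "vinj (els l) (vprod C (els b))" unfolding vinj_def
    proof (intro exI[of _ "app g"] conjI)
      show "dft (\<lambda>e. app g (e 0))" by (intro dfn_intros)
      show "app g ` els l \<subseteq> vprod C (els b)" using g by auto
      show "inj_on (app g) (els l)"
      proof (rule inj_onI)
        fix x y assume xy: "x \<in> els l" "y \<in> els l" and e: "app g x = app g y"
        obtain c i where x: "app g x = pr c i" "c \<in> BL r1" "FM c (op (ck x) (ck i)) f" using g xy(1) by fastforce
        obtain c' i' where y: "app g y = pr c' i'" "FM c' (op (ck y) (ck i')) f" using g xy(2) by fastforce
        have "c' = c" "i' = i" using x(1) y(1) e by auto
        then have "FM c (op (ck y) (ck i)) f" using y(2) by simp
        then have "FE c (ck x) (ck y)"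
          using is_inj_inj[OF below_Cond[OF x(2)] forces_mono[OF r1C x(2) inj] x(3)] by blast
        then show "x = y" using check_inj below_Cond[OF x(2)] by blast
      qed
    qed
    then show False using l(2)[OF r(2)] by blast
  qed
  have "forces E PP (a \<^bold>\<in> ck l \<^bold>\<longrightarrow> \<^bold>\<not> (\<^bold>\<exists>f. is_inj f (ck l) a)) p" for a
    unfolding forces_imp[OF p] forces.simps
    using no FM_mono below_Cond by blast
  then show ?thesis unfolding cardinal_def using check_ordinal[OF p l(1)] by simp
qed

text \<open>A family indexed by a set \<open>I\<close> of the ground model has size less than \<open>\<kappa>\<close> in the extension if
  \<open>I\<close> has this property in the ground model: map each member to its least index.\<close>

lemma check_smaller:
  assumes I: "isset I" and a: "E a k" "Ord a" "vinj I (els a)" and p: "p \<in> C"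
    and A: "\<And>q x. q \<in> BL p \<Longrightarrow> FM q x A \<longleftrightarrow> (\<forall>q'\<in>BL q. \<exists>r\<in>BL q'. \<exists>i\<in>I. FE r x (app d i))"
  shows "forces E PP (smaller A (ck k)) p"
proof -
  obtain H where H: "dft (\<lambda>e. H (e 0))" "H ` I \<subseteq> els a" "inj_on H I" using a(3) by (auto simp: vinj_def)
  note dH = dft_comp1[OF H(1)]
  \<comment> \<open>Different indices may name the same member, so the index of a member is made
    unique: \<open>c\<close> excludes equality with every member of smaller index.\<close>
  define lst where "lst i c \<longleftrightarrow> (\<forall>j\<in>I. E (H j) (H i) \<longrightarrow> (\<forall>c'\<in>BL c. \<not> FE c' (app d j) (app d i)))" for i c
  have dl: "dft t \<Longrightarrow> dft u \<Longrightarrow> dfn (\<lambda>e. lst (t e) (u e))" for t u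
    unfolding lst_def by (intro dfn_intros dfn_in_set I dH dft_shift)
  have lst_mono: "lst i c'" if "c \<in> C" "c' \<in> BL c" "lst i c" for i c c'
    using that below_trans[OF _ that(2,1)] unfolding lst_def by blast
  define nm where "nm i = op (app d i) (ck (H i))" for i
  have dn: "dft t \<Longrightarrow> dft (\<lambda>e. nm (t e))" for t unfolding nm_def by (intro dfn_intros dH)
  define f where "f = mkname (nm ` I) (\<lambda>z c. \<exists>i\<in>I. z = nm i \<and> lst i c)"
  have X: "isset (nm ` I)" by (intro isset_image I dn dfn_intros)
  have d\<Phi>: "dfn (\<lambda>e. \<exists>i\<in>I. e 0 = nm i \<and> lst i (e 1))" by (intro dfn_intros dfn_in_set I dn dl)
  have FMf0: "FM q w f \<longleftrightarrow> (\<forall>q'\<in>BL q. \<exists>r\<in>BL q'. \<exists>z\<in>nm ` I. (\<exists>i\<in>I. z = nm i \<and> lst i r) \<and> FE r w z)" for q w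
    unfolding f_def
  proof (rule FM_mkname[OF X d\<Phi>])
    fix z r r' assume "r \<in> C" "r' \<in> BL r" "\<exists>i\<in>I. z = nm i \<and> lst i r"
    then show "\<exists>i\<in>I. z = nm i \<and> lst i r'" using lst_mono by blast
  qed
  have FMf: "FM q w f \<longleftrightarrow> (\<forall>q'\<in>BL q. \<exists>r\<in>BL q'. \<exists>i\<in>I. lst i r \<and> FE r w (nm i))" for q w
  proof -
    have "(\<exists>z\<in>nm ` I. (\<exists>i\<in>I. z = nm i \<and> lst i r) \<and> FE r w z) \<longleftrightarrow> (\<exists>i\<in>I. lst i r \<and> FE r w (nm i))" for r
      by auto
    then show ?thesis unfolding FMf0 by simp
  qed
  have Ha: "E (H i) a" if "i \<in> I" for i using H(2) that by (auto simp: subset_iff)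
  have wit: "\<exists>r\<in>BL q. \<exists>i\<in>I. lst i r \<and> FE r x (app d i) \<and> FE r y (ck (H i))" if m: "FM q (op x y) f" "q \<in> C" for q x y
  proof -
    obtain r i where r: "r \<in> BL q" "i \<in> I" "lst i r" "FE r (op x y) (nm i)"
      using m below_refl unfolding FMf by blast
    then show ?thesis using op_inj[OF below_Cond[OF r(1)] r(4)[unfolded nm_def]] by blast
  qed
  have lst_eq: "i = j" if "i \<in> I" "j \<in> I" "lst i c" "lst j c" "FE c (app d i) (app d j)" "c \<in> C" for i j c
  proof -
    have "\<not> E (H i) (H j)" "\<not> E (H j) (H i)"
      using that below_refl[OF that(6)] FE_sym[OF that(6)] unfolding lst_def by blast+
    then have "H i = H j" using Ord_linear Ord_mem[OF a(2)] Ha that(1,2) by blast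
    then show ?thesis using H(3) that(1,2) by (auto dest: inj_onD)
  qed
  have "forces E PP (is_inj f A (ck a)) p"
  proof (rule is_injI[OF p])
    fix q z assume q: "q \<in> BL p" "FM q z f"
    have qC: "q \<in> C" using q below_Cond by blast
    then obtain r i where r: "r \<in> BL q" "i \<in> I" "FE r z (nm i)" using q(2) below_refl unfolding FMf by blast
    have rC: "r \<in> C" using r below_Cond by blast
    have "FM r (app d i) A" unfolding A[OF below_trans[OF r(1) q(1) p]]
      using r(2) below_Cond below_refl FE_refl by blast
    moreover have "FM r (ck (H i)) (ck a)" using FM_checkI[OF rC Ha[OF r(2)]] .
    ultimately show "\<exists>r\<in>BL q. \<exists>x y. FM r x A \<and> FM r y (ck a) \<and> FE r z (op x y)"
      using r unfolding nm_def by blast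
  next
    fix q x assume q: "q \<in> BL p" "FM q x A"
    have qC: "q \<in> C" using q below_Cond by blast
    \<comment> \<open>The least index that some extension of \<open>q\<close> assigns to
      \<open>x\<close>. The condition assigning it excludes all smaller indices, because these would
      be assigned below \<open>q\<close> too.\<close>
    let ?L = "\<lambda>b. \<exists>i\<in>I. H i = b \<and> (\<exists>c\<in>BL q. FE c x (app d i))"
    obtain r i where r: "r \<in> BL q" "i \<in> I" "FE r x (app d i)"
      using q(2) qC below_refl unfolding A[OF q(1)] by blast
    have "dfn (\<lambda>e. ?L (e 0))" by (intro dfn_intros dfn_in_set I dH)
    moreover have "Ord (H i)" "?L (H i)" using Ord_mem[OF a(2) Ha] r by blast+
    ultimately obtain b where b: "?L b" "\<And>b'. E b' b \<Longrightarrow> \<not> ?L b'" using least_Ord[of ?L "H i"] by blast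
    then obtain j c where j: "j \<in> I" "H j = b" "c \<in> BL q" "FE c x (app d j)" by blast
    have cC: "c \<in> C" using j below_Cond by blast
    have l: "lst j c" unfolding lst_def
    proof (intro ballI impI notI)
      fix k c' assume k: "k \<in> I" "E (H k) (H j)" "c' \<in> BL c" "FE c' (app d k) (app d j)"
      have c'C: "c' \<in> C" using k below_Cond by blast
      have "FE c' x (app d k)" using FE_trans[OF c'C FE_mono[OF cC k(3) j(4)] FE_sym[OF c'C k(4)]] .
      then have "?L (H k)" using k(1) below_trans[OF k(3) j(3) qC] by blast
      then show False using b(2) k(2) j(2) by blast
    qed
    have "FM c (op x (ck (H j))) f" unfolding FMf
    proof
      fix c' assume c': "c' \<in> BL c"
      have c'C: "c' \<in> C" using c' below_Cond by blast
      have "FE c' (op x (ck (H j))) (nm j)" unfolding nm_def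
        using op_cong[OF c'C FE_mono[OF cC c' j(4)] FE_refl[OF c'C]] .
      then show "\<exists>r\<in>BL c'. \<exists>i\<in>I. lst i r \<and> FE r (op x (ck (H j))) (nm i)"
        using j(1) lst_mono[OF cC c' l] below_refl[OF c'C] by blast
    qed
    moreover have "FE r' y' (ck (H j))" if r': "r' \<in> BL c" "FM r' (op x y') f" for y' r'
    proof -
      have r'C: "r' \<in> C" using r' below_Cond by blast
      show ?thesis
      proof (rule FE_dense[OF r'C])
        fix q' assume q': "q' \<in> BL r'"
        have q'C: "q' \<in> C" using q' below_Cond by blast
        obtain r2 k where r2: "r2 \<in> BL q'" "k \<in> I" "lst k r2" "FE r2 x (app d k)" "FE r2 y' (ck (H k))"
          using wit[OF FM_mono[OF r'C q' r'(2)] q'C] by blast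
        have r2C: "r2 \<in> C" using r2 below_Cond by blast
        have r2c: "r2 \<in> BL c" using below_trans[OF below_trans[OF r2(1) q' r'C] r'(1) cC] .
        have "FE r2 (app d k) (app d j)"
          using FE_trans[OF r2C FE_sym[OF r2C r2(4)] FE_mono[OF cC r2c j(4)]] .
        then have "k = j" using lst_eq[OF r2(2) j(1) r2(3) lst_mono[OF cC r2c l] _ r2C] by blast
        then show "\<exists>r2\<in>BL q'. FE r2 y' (ck (H j))" using r2 by blast
      qed
    qed
    ultimately show "\<exists>r\<in>BL q. \<exists>y. FM r (op x y) f \<and> (\<forall>y'. \<forall>r'\<in>BL r. FM r' (op x y') f \<longrightarrow> FE r' y' y)"
      using j(3) by blast
  next
    fix q x x' y assume q: "q \<in> BL p" "FM q (op x y) f" "FM q (op x' y) f"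
    have qC: "q \<in> C" using q below_Cond by blast
    show "FE q x x'"
    proof (rule FE_dense[OF qC])
      fix q' assume q': "q' \<in> BL q"
      have q'C: "q' \<in> C" using q' below_Cond by blast
      obtain r i where r: "r \<in> BL q'" "i \<in> I" "FE r x (app d i)" "FE r y (ck (H i))"
        using wit[OF FM_mono[OF qC q' q(2)] q'C] by blast
      have rC: "r \<in> C" and rq: "r \<in> BL q" using r below_Cond below_trans[OF r(1) q' qC] by blast+
      obtain r2 j where r2: "r2 \<in> BL r" "j \<in> I" "FE r2 x' (app d j)" "FE r2 y (ck (H j))"
        using wit[OF FM_mono[OF qC rq q(3)] rC] by blast
      have r2C: "r2 \<in> C" using r2 below_Cond by blast
      have "FE r2 (ck (H i)) (ck (H j))"
        using FE_trans[OF r2C FE_sym[OF r2C FE_mono[OF rC r2(1) r(4)]] r2(4)] .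
      then have "H i = H j" using check_inj[OF r2C] by blast
      then have "i = j" using H(3) r(2) r2(2) by (auto dest: inj_onD)
      then have "FE r2 x x'"
        using FE_trans[OF r2C FE_mono[OF rC r2(1) r(3)]] FE_sym[OF r2C r2(3)] by blast
      then show "\<exists>r\<in>BL q'. FE r x x'" using below_trans[OF r2(1) r(1) q'C] by blast
    qed
  qed
  then have "forces E PP (ck a \<^bold>\<in> ck k \<^bold>\<and> is_inj f A (ck a)) p" using FM_checkI[OF p a(1)] by simp
  then show ?thesis unfolding smaller_def
    using p by (intro forces_exI[where x = "ck a"] forces_exI[where x = f])
qed

end

section \<open>Sets of the intermediate model\<close>

context splitting_two_step begin

abbreviation "lft \<equiv> lift_name E PP Q leQ"

lemma lift_aux:
  "dfn (\<lambda>e. e 1 \<in> Cond RR \<and> (\<exists>s p q. name_elem E PP (e 0) s (e 2) \<and> holds E (is_pair (e 1) p q) \<and> Leq PP p s))"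
  "c \<in> Cond RR \<and> (\<exists>s p q. name_elem E PP z s x \<and> holds E (is_pair c p q) \<and> Leq PP p s) \<Longrightarrow> E z (tc x)"
  "isset {pr z c |z c. c \<in> Cond RR \<and> (\<exists>s p q. name_elem E PP z s x \<and> holds E (is_pair c p q) \<and> Leq PP p s)}"
proof -
  show 1: "dfn (\<lambda>e. e 1 \<in> Cond RR \<and> (\<exists>s p q. name_elem E PP (e 0) s (e 2) \<and> holds E (is_pair (e 1) p q) \<and> Leq PP p s))"
    unfolding holds_is_pair by (intro dfn_intros)
  show "E z (tc x)" if "c \<in> Cond RR \<and> (\<exists>s p q. name_elem E PP z s x \<and> holds E (is_pair c p q) \<and> Leq PP p s)"
    using that P.name_dom_tc unfolding name_dom_def by blast
  show "isset {pr z c |z c. c \<in> Cond RR \<and> (\<exists>s p q. name_elem E PP z s x \<and> holds E (is_pair c p q) \<and> Leq PP p s)}"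
  proof (rule isset_subset[of "vprod (name_dom E PP x) R.C"])
    show "isset (vprod (name_dom E PP x) R.C)" by (intro isset_vprod P.isset_name_dom R.isset_Cond)
    show "{pr z c |z c. c \<in> Cond RR \<and> (\<exists>s p q. name_elem E PP z s x \<and> holds E (is_pair c p q) \<and> Leq PP p s)}
      \<subseteq> vprod (name_dom E PP x) R.C" unfolding name_dom_def by auto
    show "dfn (\<lambda>e. e 0 \<in> {pr z c |z c. c \<in> Cond RR \<and> (\<exists>s p q. name_elem E PP z s x \<and> holds E (is_pair c p q) \<and> Leq PP p s)})"
      unfolding holds_is_pair by (intro dfn_intros)
  qed
qed

lemma mem_lift: "E u (lft x) \<longleftrightarrow> (\<exists>z c. (c \<in> Cond RR \<and>
    (\<exists>s p q. name_elem E PP z s x \<and> holds E (is_pair c p q) \<and> Leq PP p s)) \<and> u = pr (lft z) c)"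
  unfolding lift_name_def by (rule translate_props(1)[OF lift_aux])

lemma dft_lift [dfn_intros]: "dft t \<Longrightarrow> dft (\<lambda>e. lft (t e))"
  unfolding lift_name_def by (rule translate_props(2)[OF lift_aux])

lemma R_fst: "r \<in> R.C \<Longrightarrow> vfst r \<in> P.C" by (auto elim!: R_cases)

lemma R_fst_below: assumes "r' \<in> R.BL r" "r \<in> R.C" shows "vfst r' \<in> P.BL (vfst r)"
proof -
  obtain p q where r: "r = pr p q" using assms(2) by (rule R_cases)
  have C: "r' \<in> R.C" using assms(1) R.below_Cond by blast
  then obtain p' q' where r': "r' = pr p' q'" by (rule R_cases)
  show ?thesis using assms(1) R_below[OF C[unfolded r']] unfolding r r' by simp
qed

text \<open>Only the first component of a condition matters for the elements of a lifted name, as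
  befits a set of the intermediate model.\<close>

lemma FM_lift: assumes r: "r \<in> R.C"
  shows "R.FM r w (lft y) \<longleftrightarrow> (\<forall>r'\<in>R.BL r. \<exists>r''\<in>R.BL r'. \<exists>z s. s \<in> P.C \<and> E (pr z s) y \<and>
     vfst r'' \<in> P.BL s \<and> R.FE r'' w (lft z))"
  unfolding R.FM_iff
proof (intro ball_cong refl iffI)
  fix r' assume "\<exists>r''\<in>R.BL r'. \<exists>z s. s \<in> R.C \<and> E (pr z s) (lft y) \<and> Leq RR r'' s \<and> R.FE r'' w z"
  then obtain r'' c z s p q where h: "r'' \<in> R.BL r'" "c \<in> R.C" "Leq RR r'' c" "R.FE r'' w (lft z)"
    "name_elem E PP z s y" "c = pr p q" "Leq PP p s"
    unfolding mem_lift[of _ y] pr_inject holds_is_pair by blast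
  have s: "s \<in> P.C" "E (pr z s) y" using h(5) by (auto simp: P.name_elem_iff)
  have "p \<in> P.C" using h(2) unfolding h(6) pr_Cond_RR by blast
  then have "p \<in> P.BL s" using h(7) by (simp add: P.mem_below)
  moreover have "r'' \<in> R.BL c" using h(1,3) R.below_Cond by (auto simp: R.mem_below)
  ultimately have "vfst r'' \<in> P.BL s"
    using R_fst_below[OF _ h(2)] P.below_trans[OF _ _ s(1)] h(6) by fastforce
  then show "\<exists>r''\<in>R.BL r'. \<exists>z s. s \<in> P.C \<and> E (pr z s) y \<and> vfst r'' \<in> P.BL s \<and> R.FE r'' w (lft z)"
    using h(1,4) s by blast
next
  fix r' assume "\<exists>r''\<in>R.BL r'. \<exists>z s. s \<in> P.C \<and> E (pr z s) y \<and> vfst r'' \<in> P.BL s \<and> R.FE r'' w (lft z)"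
  then obtain r'' z s where h: "r'' \<in> R.BL r'" "s \<in> P.C" "E (pr z s) y" "vfst r'' \<in> P.BL s" "R.FE r'' w (lft z)"
    by blast
  have C: "r'' \<in> R.C" using h(1) R.below_Cond by blast
  then obtain p q where e: "r'' = pr p q" by (rule R_cases)
  have "name_elem E PP z s y" "Leq PP p s" using h(2-4) unfolding e by (auto simp: P.name_elem_iff P.mem_below)
  then have "E (pr (lft z) r'') (lft y)" unfolding mem_lift[of _ y] pr_inject holds_is_pair using C e by blast
  then show "\<exists>r''\<in>R.BL r'. \<exists>z s. s \<in> R.C \<and> E (pr z s) (lft y) \<and> Leq RR r'' s \<and> R.FE r'' w z"
    using h(1,5) C R.Leq_refl[OF C] by blast
qed

text \<open>\<open>Gd \<tau> x r\<close> expresses that \<open>r\<close> forces \<open>x\<close> to be in the set \<open>{x. \<exists>s \<in> G. (s, x) \<in> \<tau>}\<close>, where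
  \<open>G\<close> is the generic filter of the first forcing.\<close>

definition Gd :: "'a \<Rightarrow> 'a \<Rightarrow> 'a \<Rightarrow> bool" where
  "Gd \<tau> x r \<longleftrightarrow> (\<forall>r'\<in>R.BL r. \<exists>r''\<in>R.BL r'. \<exists>s. s \<in> P.C \<and> E (pr s x) \<tau> \<and> vfst r'' \<in> P.BL s)"

lemma dfn_Gd [dfn_intros]: "\<lbrakk>dft t; dft x; dft r\<rbrakk> \<Longrightarrow> dfn (\<lambda>e. Gd (t e) (x e) (r e))"
  unfolding Gd_def by (intro dfn_intros dft_shift)

lemma ro_Gd: "R.ro (Gd \<tau> x)"
proof (rule R.roI)
  show "Gd \<tau> x r'" if "r \<in> R.C" "r' \<in> R.BL r" "Gd \<tau> x r" for r r'
    using that(3) R.below_trans[OF _ that(2,1)] unfolding Gd_def by blast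
  show "Gd \<tau> x r" if r: "r \<in> R.C" and d: "\<And>q. q \<in> R.BL r \<Longrightarrow> \<exists>r'\<in>R.BL q. Gd \<tau> x r'" for r
    unfolding Gd_def
  proof
    fix q assume q: "q \<in> R.BL r"
    have qC: "q \<in> R.C" using q R.below_Cond by blast
    obtain r' where r': "r' \<in> R.BL q" "Gd \<tau> x r'" using d[OF q] by blast
    obtain r'' s where "r'' \<in> R.BL r'" "s \<in> P.C" "E (pr s x) \<tau>" "vfst r'' \<in> P.BL s"
      using r'(2) R.below_refl[OF R.below_Cond[OF r'(1)]] unfolding Gd_def by blast
    then show "\<exists>r''\<in>R.BL q. \<exists>s. s \<in> P.C \<and> E (pr s x) \<tau> \<and> vfst r'' \<in> P.BL s"
      using R.below_trans[OF _ r'(1) qC] by blast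
  qed
qed

lemma GdI: assumes "s \<in> P.C" "E (pr s x) \<tau>" "r \<in> R.C" "vfst r \<in> P.BL s" shows "Gd \<tau> x r"
  unfolding Gd_def
proof
  fix r' assume r': "r' \<in> R.BL r"
  have "r' \<in> R.C" using r' R.below_Cond by blast
  moreover have "vfst r' \<in> P.BL s" using P.below_trans[OF R_fst_below[OF r' assms(3)] assms(4,1)] .
  ultimately show "\<exists>r''\<in>R.BL r'. \<exists>s. s \<in> P.C \<and> E (pr s x) \<tau> \<and> vfst r'' \<in> P.BL s" using assms(1,2) by auto
qed

text \<open>Minimality is taken among names, along \<open>tc\<close>: every name in the domain of a
  minimal \<open>x\<close> is densely equal to a lifted one. The witnesses range over a proper class
  of \<open>P\<close>-names, and collection confines them to a set \<open>Y\<close>.\<close>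

lemma minimal_new_name:
  assumes new: "second_adds_new_set E PP Q leQ" and r0: "r0 \<in> R.C"
  obtains r x Y where "r \<in> R.BL r0" "isset Y"
    "\<And>z q. z \<in> name_dom E RR x \<Longrightarrow> q \<in> R.BL r \<Longrightarrow> \<exists>q'\<in>R.BL q. \<exists>y\<in>Y. R.FE q' z (lft y)"
    "\<And>y q. q \<in> R.BL r \<Longrightarrow> \<not> R.FE q x (lft y)"
proof -
  define N where "N x \<longleftrightarrow> (\<exists>r\<in>R.BL r0. \<forall>y. \<forall>q\<in>R.BL r. \<not> R.FE q x (lft y))" for x
  have dN: "dft t \<Longrightarrow> dfn (\<lambda>e. N (t e))" for t unfolding N_def by (intro dfn_intros dft_shift)
  obtain x1 where x1: "N x1"
  proof -
    obtain r x where "r \<in> R.BL r0" "\<forall>y\<in>range lft. forces E RR (\<^bold>\<not> (x \<^bold>= y)) r"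
      using new r0 unfolding second_adds_new_set_def adds_set_outside_def by blast
    then have "N x" unfolding N_def forces.simps by blast
    then show thesis by (rule that)
  qed
  have "\<exists>x. N x \<and> (\<forall>z. E z (tc x) \<longrightarrow> \<not> N z)"
  proof (rule ccontr)
    assume n: "\<not> ?thesis"
    have "\<not> N x1" by (rule tc_induct[where P = "\<lambda>x. \<not> N x"], intro dfn_intros dN) (use n in blast)
    then show False using x1 by blast
  qed
  then obtain x where x: "N x" "\<And>z. E z (tc x) \<Longrightarrow> \<not> N z" by blast
  obtain r where r: "r \<in> R.BL r0" "\<forall>y. \<forall>q\<in>R.BL r. \<not> R.FE q x (lft y)" using x(1) unfolding N_def by blast
  let ?R = "\<lambda>w y. \<exists>q'\<in>R.BL (vsnd w). R.FE q' (vfst w) (lft y)"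
  have "\<exists>Y. isset Y \<and> (\<forall>w\<in>vprod (name_dom E RR x) (R.BL r0). \<exists>y\<in>Y. ?R w y)"
  proof (rule vcollect)
    show "isset (vprod (name_dom E RR x) (R.BL r0))" by (intro isset_vprod R.isset_name_dom R.isset_below)
    show "dfn (\<lambda>e. ?R (e 0) (e 1))" by (intro dfn_intros)
    fix w assume "w \<in> vprod (name_dom E RR x) (R.BL r0)"
    then obtain z q where w: "w = pr z q" "z \<in> name_dom E RR x" "q \<in> R.BL r0" by blast
    have "\<not> N z" using x(2) R.name_dom_tc[OF w(2)] by blast
    then show "\<exists>y. ?R w y" using w unfolding N_def by auto
  qed
  then obtain Y where Y: "isset Y" "\<forall>w\<in>vprod (name_dom E RR x) (R.BL r0). \<exists>y\<in>Y. ?R w y" by (elim exE conjE)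
  show thesis
  proof (rule that[OF r(1) Y(1)])
    fix z q assume z: "z \<in> name_dom E RR x" "q \<in> R.BL r"
    have "q \<in> R.BL r0" using R.below_trans[OF z(2) r(1) r0] .
    then show "\<exists>q'\<in>R.BL q. \<exists>y\<in>Y. R.FE q' z (lft y)" using bspec[OF Y(2), of "pr z q"] z(1) by auto
  next
    show "\<not> R.FE q x (lft y)" if "q \<in> R.BL r" for y q using r(2) that by blast
  qed
qed

text \<open>A new set of sets of the intermediate model yields a new set of ordinals.\<close>

lemma new_trace:
  assumes r: "r \<in> R.C" and Y: "isset Y"
    and cov: "\<And>z q. z \<in> name_dom E RR x \<Longrightarrow> q \<in> R.BL r \<Longrightarrow> \<exists>q'\<in>R.BL q. \<exists>y\<in>Y. R.FE q' z (lft y)"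
    and h: "dft (\<lambda>e. h (e 0))" "inj_on h Y" "h ` Y \<subseteq> els l"
    and tr: "\<And>v q. E v l \<Longrightarrow> q \<in> R.BL r \<Longrightarrow> (\<exists>y\<in>Y. h y = v \<and> R.FM q (lft y) x) \<longleftrightarrow> Gd \<tau> v q"
  shows "\<exists>y. R.FE r x (lft y)"
proof -
  note dh = dft_comp1[OF h(1)]
  \<comment> \<open>The trace is decoded into a \<open>P\<close>-name: \<open>y\<close> is put in by
    \<open>s\<close> exactly when \<tau> lets \<open>s\<close> put in the code
    \<open>h y\<close>.\<close>
  define ys where "ys = code {u \<in> vprod Y P.C. \<exists>y s. u = pr y s \<and> E (pr s (h y)) \<tau>}"
  have ys: "E (pr y s) ys \<longleftrightarrow> y \<in> Y \<and> s \<in> P.C \<and> E (pr s (h y)) \<tau>" for y s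
  proof -
    have "isset {u \<in> vprod Y P.C. \<exists>y s. u = pr y s \<and> E (pr s (h y)) \<tau>}"
      by (intro isset_sep isset_vprod Y P.isset_Cond dfn_intros dh)
    then show ?thesis unfolding ys_def by auto
  qed
  have hl: "E (h y) l" if "y \<in> Y" for y using h(3) that by (auto simp: subset_iff)
  have lys: "R.FM q (lft y) (lft ys)" if y: "y \<in> Y" "s \<in> P.C" "E (pr s (h y)) \<tau>" and q: "q \<in> R.C" "vfst q \<in> P.BL s" for y s q
    unfolding FM_lift[OF q(1)]
  proof
    fix r' assume r': "r' \<in> R.BL q"
    have r'C: "r' \<in> R.C" using r' R.below_Cond by blast
    have "vfst r' \<in> P.BL s" using P.below_trans[OF R_fst_below[OF r' q(1)] q(2) y(2)] .
    then show "\<exists>r''\<in>R.BL r'. \<exists>z s. s \<in> P.C \<and> E (pr z s) ys \<and> vfst r'' \<in> P.BL s \<and> R.FE r'' (lft y) (lft z)"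
      using ys y R.below_refl[OF r'C] R.FE_refl[OF r'C] by blast
  qed
  have "R.FE r x (lft ys)"
  proof (rule R.FE_ext[OF r], rule iffI)
    fix w q assume q: "q \<in> R.BL r" and m: "R.FM q w x"
    have qC: "q \<in> R.C" using q R.below_Cond by blast
    show "R.FM q w (lft ys)"
    proof (rule R.FM_dense[OF qC])
      fix q' assume q': "q' \<in> R.BL q"
      have q'C: "q' \<in> R.C" using q' R.below_Cond by blast
      obtain r3 z s where r3: "r3 \<in> R.BL q'" "s \<in> R.C" "E (pr z s) x" "Leq RR r3 s" "R.FE r3 w z"
        using R.FM_witness[OF q'C R.FM_mono[OF qC q' m]] by blast
      have r3C: "r3 \<in> R.C" and r3r: "r3 \<in> R.BL r"
        using r3 R.below_Cond R.below_trans[OF R.below_trans[OF r3(1) q' qC] q r] by blast+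
      have zx: "R.FM r3 z x" using R.FM_own[OF r3C r3(2-4)] .
      have "z \<in> name_dom E RR x" using r3(2,3) R.mem_name_dom by blast
      then obtain r4 y where r4: "r4 \<in> R.BL r3" "y \<in> Y" "R.FE r4 z (lft y)" using cov[OF _ r3r] by blast
      have r4C: "r4 \<in> R.C" and r4r: "r4 \<in> R.BL r" using r4 R.below_Cond R.below_trans[OF r4(1) r3r r] by blast+
      have "R.FM r4 (lft y) x" using R.FM_eq_left[OF r4C r4(3) R.FM_mono[OF r3C r4(1) zx]] .
      then have "Gd \<tau> (h y) r4" using tr[OF hl[OF r4(2)] r4r] r4(2) by blast
      then obtain r5 s' where r5: "r5 \<in> R.BL r4" "s' \<in> P.C" "E (pr s' (h y)) \<tau>" "vfst r5 \<in> P.BL s'"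
        using R.below_refl[OF r4C] unfolding Gd_def by blast
      have r5C: "r5 \<in> R.C" using r5 R.below_Cond by blast
      have "R.FE r5 w z" using R.FE_mono[OF r3C R.below_trans[OF r5(1) r4(1) r3C] r3(5)] .
      then have "R.FE r5 (lft y) w"
        using R.FE_sym[OF r5C] R.FE_trans[OF r5C] R.FE_mono[OF r4C r5(1) r4(3)] by blast
      then have "R.FM r5 w (lft ys)" using R.FM_eq_left[OF r5C _ lys[OF r4(2) r5(2,3) r5C r5(4)]] by blast
      then show "\<exists>r\<in>R.BL q'. R.FM r w (lft ys)"
        using R.below_trans[OF R.below_trans[OF r5(1) r4(1) r3C] r3(1) q'C] by blast
    qed
  next
    fix w q assume q: "q \<in> R.BL r" and m: "R.FM q w (lft ys)"
    have qC: "q \<in> R.C" using q R.below_Cond by blast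
    show "R.FM q w x"
    proof (rule R.FM_dense[OF qC])
      fix q' assume q': "q' \<in> R.BL q"
      then obtain r3 z s where r3: "r3 \<in> R.BL q'" "s \<in> P.C" "E (pr z s) ys" "vfst r3 \<in> P.BL s" "R.FE r3 w (lft z)"
        using m unfolding FM_lift[OF qC] by blast
      have r3C: "r3 \<in> R.C" and r3r: "r3 \<in> R.BL r"
        using r3 R.below_Cond R.below_trans[OF R.below_trans[OF r3(1) q' qC] q r] by blast+
      have z: "z \<in> Y" "E (pr s (h z)) \<tau>" using r3(3) ys by blast+
      have "Gd \<tau> (h z) r3" using GdI[OF r3(2) z(2) r3C r3(4)] .
      then obtain y where y: "y \<in> Y" "h y = h z" "R.FM r3 (lft y) x" using tr[OF hl[OF z(1)] r3r] by blast
      then have "y = z" using h(2) z(1) by (auto dest: inj_onD)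
      then have "R.FM r3 w x" using y(3) R.FM_eq_left[OF r3C R.FE_sym[OF r3C r3(5)]] by blast
      then show "\<exists>r\<in>R.BL q'. R.FM r w x" using r3(1) by blast
    qed
  qed
  then show ?thesis by blast
qed

section \<open>Small sets of ordinals have names in the ground model\<close>

text \<open>Let \<open>f\<close> inject \<open>x\<close> into some \<alpha> below \<kappa>, and let
  \<open>V i v c\<close> say that \<open>c\<close> puts \<open>v\<close> into \<open>A\<close> and
  \<open>x\<close>, with index \<open>i\<close>. By distributivity one term decides for every
  \<open>i\<close> which \<open>v\<close> has this property, if any. Once a value of this term is
  fixed as second component, the trace depends on the first components alone and is given by a set
  \<tau> of the ground model.\<close>

lemma small_trace:
  assumes A: "dfn (\<lambda>e. A (e 0) (e 1))" and ro: "\<And>v. E v l \<Longrightarrow> R.ro (A v)"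
    and r: "r \<in> R.C" and sm: "forces E RR (smaller x (R.ck \<kappa>)) r"
  shows "\<exists>r'\<in>R.BL r. \<exists>\<tau>. els \<tau> \<subseteq> vprod P.C (els l) \<and>
    (\<forall>v\<in>els l. \<forall>c\<in>R.BL r'. A v c \<and> R.FM c (R.ck v) x \<longleftrightarrow> Gd \<tau> v c)"
proof -
  note A' = dfn_comp2[OF A]
  obtain ra a where ra: "ra \<in> R.BL r" "forces E RR (\<^bold>\<exists>f. a \<^bold>\<in> R.ck \<kappa> \<^bold>\<and> is_inj f x a) ra"
    using sm R.below_refl[OF r] unfolding smaller_def R.forces_ex[of _ r] by blast
  have raC: "ra \<in> R.C" using ra R.below_Cond by blast
  obtain rb f where rb: "rb \<in> R.BL ra" "R.FM rb a (R.ck \<kappa>)" "forces E RR (is_inj f x a) rb"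
    using ra(2) R.below_refl[OF raC] unfolding R.forces_ex[of _ ra] forces.simps by blast
  have rbC: "rb \<in> R.C" using rb R.below_Cond by blast
  obtain r1 \<alpha> where r1: "r1 \<in> R.BL rb" "E \<alpha> \<kappa>" "R.FE r1 a (R.ck \<alpha>)" by (rule R.FM_check_witness[OF rbC rb(2)])
  have r1C: "r1 \<in> R.C" using r1 R.below_Cond by blast
  have r1r: "r1 \<in> R.BL r" using R.below_trans[OF R.below_trans[OF r1(1) rb(1) raC] ra(1) r] .
  have inj: "forces E RR (is_inj f x (R.ck \<alpha>)) r1"
    using R.forces_is_inj_cong[OF r1C R.FE_refl[OF r1C] R.FE_refl[OF r1C] r1(3)]
      R.forces_mono[OF rbC r1(1) rb(3)] by blast
  obtain p1 q1 where r1e: "r1 = pr p1 q1" using r1C by (rule R_cases)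
  note r1' = r1C[unfolded r1e]
  have p1: "p1 \<in> P.C" using r1' by (simp add: pr_Cond_RR)
  obtain t1 where t1: "tm t1" "\<forall>p q. E (pr p q) t1 \<longrightarrow> p \<in> P.BL p1 \<longrightarrow> q = q1"
    using term_below[OF r1'] by blast
  define V where "V i v c \<longleftrightarrow> A v c \<and> R.FM c (R.ck v) x \<and> R.FM c (R.op (R.ck v) (R.ck i)) f" for i v c
  have dV: "\<lbrakk>dft t; dft u; dft w\<rbrakk> \<Longrightarrow> dfn (\<lambda>e. V (t e) (u e) (w e))" for t u w
    unfolding V_def by (intro dfn_intros A')
  have V_mono: "V i v c'" if "E v l" "c \<in> R.C" "c' \<in> R.BL c" "V i v c" for i v c c'
    using that(4) R.ro_mono[OF ro[OF that(1)] that(2,3)] R.FM_mono[OF that(2,3)] unfolding V_def by blast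
  \<comment> \<open>Either an element with index \<open>i\<close> is known or it is excluded for
    good. Both alternatives persist to stronger conditions.\<close>
  define dec where "dec i c \<longleftrightarrow> (\<exists>v\<in>els l. V i v c) \<or> (\<forall>v\<in>els l. \<forall>c'\<in>R.BL c. \<not> V i v c')" for i c
  have dd: "dft t \<Longrightarrow> dft u \<Longrightarrow> dfn (\<lambda>e. dec (t e) (u e))" for t u
    unfolding dec_def by (intro dfn_intros dV dft_shift)
  have dec_mono: "dec i c'" if "c \<in> R.C" "c' \<in> R.BL c" "dec i c" for i c c'
    using that(3) V_mono[OF _ that(1,2)] R.below_trans[OF _ that(2,1)]
    unfolding dec_def Ball_def Bex_def mem_els by blast
  let ?D = "\<lambda>i t. \<forall>p\<in>P.C. \<exists>p'\<in>P.BL p. \<exists>q. E (pr p' q) t \<and> dec i (pr p' q)"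
  have "\<exists>t. tm t \<and> tle t t1 \<and> (\<forall>i\<in>els \<alpha>. ?D i t)"
  proof (rule distributivity[OF isset_els r1(2) vinj_subset[OF subset_refl], where D = ?D])
    show "dfn (\<lambda>e. ?D (e 0) (e 1))" by (intro dfn_intros dd)
    show "tm t1" by (rule t1)
    show "?D i t'" if t: "tm t" "tm t'" "tle t' t" and D: "?D i t" for i t t'
    proof
      fix p assume p: "p \<in> P.C"
      obtain p' q where p': "p' \<in> P.BL p" "E (pr p' q) t" "dec i (pr p' q)" using D p by blast
      have "p' \<in> P.C" using p' P.below_Cond by blast
      then obtain p'' q' where p'': "p'' \<in> P.BL p'" "E (pr p'' q') t'" using tm_dense[OF t(2)] by blast
      have "dec i (pr p'' q')"
        using dec_mono[OF tm_R[OF t(1) p'(2)] tle_below[OF t(2,1,3) p''(2) p'(2) p''(1)] p'(3)] .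
      then show "\<exists>p'\<in>P.BL p. \<exists>q. E (pr p' q) t' \<and> dec i (pr p' q)"
        using p''(2) P.below_trans[OF p''(1) p'(1) p] by blast
    qed
    fix i t assume t: "tm t"
    let ?g = "\<lambda>p q'. pr p q' \<in> R.C \<and> (\<exists>q. E (pr p q) t \<and> qle p q' q) \<and> dec i (pr p q')"
    have "\<exists>t'. tm t' \<and> (\<forall>p q. E (pr p q) t' \<longrightarrow> ?g p q)"
    proof (rule mixing)
      show "dfn (\<lambda>e. ?g (e 0) (e 1))" by (intro dfn_intros dd)
      show "?g p' q" if h: "?g p q" "p' \<in> P.BL p" for p q p'
      proof -
        have "p \<in> P.C" using h by (simp add: pr_Cond_RR)
        then show ?thesis
          using h R_restrict[OF _ h(2)] tm_open[OF t _ h(2)] P.FM_mono[OF _ h(2)] dec_mono by blast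
      qed
      fix p assume p: "p \<in> P.C"
      obtain p' q where p': "p' \<in> P.BL p" "E (pr p' q) t" using tm_dense[OF t p] by blast
      have c: "pr p' q \<in> R.C" using tm_R[OF t p'(2)] .
      have "\<exists>c'\<in>R.BL (pr p' q). dec i c'"
      \<comment> \<open>If some extension supplies an element with index \<open>i\<close>, it
        decides positively; otherwise the given condition already decides negatively.\<close>
      proof (cases "\<exists>v\<in>els l. \<exists>c'\<in>R.BL (pr p' q). V i v c'")
        case False
        then have "dec i (pr p' q)" unfolding dec_def by blast
        then show ?thesis using R.below_refl[OF c] by blast
      qed (auto simp: dec_def)
      then obtain c' where c': "c' \<in> R.BL (pr p' q)" "dec i c'" by blast
      obtain p'' q' where e: "c' = pr p'' q'" using R.below_Cond[OF c'(1)] by (rule R_cases)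
      have C: "pr p'' q' \<in> R.C" using c'(1) R.below_Cond unfolding e by blast
      have l: "p'' \<in> P.BL p'" "qle p'' q' q" using c'(1) R_below[OF C] unfolding e by blast+
      then have "?g p'' q'" using C c'(2) tm_open[OF t p'(2)] unfolding e by blast
      then show "\<exists>p'\<in>P.BL p. \<exists>q. ?g p' q" using P.below_trans[OF l(1) p'(1) p] by blast
    qed blast
    then obtain t' where t': "tm t'" "\<And>p q. E (pr p q) t' \<Longrightarrow> ?g p q" by blast
    have "tle t' t" unfolding tle_def using t'(2) tm_unique[OF t] by blast
    moreover have "?D i t'" using tm_dense[OF t'(1)] t'(2) by blast
    ultimately show "\<exists>t'. tm t' \<and> tle t' t \<and> ?D i t'" using t'(1) by blast
  qed
  then obtain t where t: "tm t" "tle t t1" and D: "\<And>i p. E i \<alpha> \<Longrightarrow> p \<in> P.C \<Longrightarrow>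
      \<exists>p'\<in>P.BL p. \<exists>q. E (pr p' q) t \<and> dec i (pr p' q)" by auto
  \<comment> \<open>A pair \<open>(p, v)\<close> is recorded when \<open>p\<close> together with the
    value of the term at \<open>p\<close> forces \<open>v\<close> to have some index.\<close>
  define \<tau> where "\<tau> = code {u \<in> vprod P.C (els l). \<exists>p v. u = pr p v \<and> (\<exists>i\<in>els \<alpha>. \<exists>q. E (pr p q) t \<and> V i v (pr p q))}"
  have it: "isset {u \<in> vprod P.C (els l). \<exists>p v. u = pr p v \<and> (\<exists>i\<in>els \<alpha>. \<exists>q. E (pr p q) t \<and> V i v (pr p q))}"
    by (intro isset_sep isset_vprod P.isset_Cond isset_els dfn_intros dV)
  have \<tau>: "E (pr p v) \<tau> \<longleftrightarrow> p \<in> P.C \<and> E v l \<and> (\<exists>i\<in>els \<alpha>. \<exists>q. E (pr p q) t \<and> V i v (pr p q))" for p v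
    unfolding \<tau>_def mem_code[OF it] by auto
  obtain p q where p: "p \<in> P.BL p1" "E (pr p q) t" "pr p q \<in> R.BL (pr p1 q1)"
    by (rule term_meets[OF r1' t1 t P.below_refl[OF p1]])
  have pC: "p \<in> P.C" and c0: "pr p q \<in> R.C" using p P.below_Cond R.below_Cond by blast+
  have b0: "pr p q \<in> R.BL r1" using p(3) unfolding r1e .
  have tr: "A v c \<and> R.FM c (R.ck v) x \<longleftrightarrow> Gd \<tau> v c" if v: "E v l" and c: "c \<in> R.BL (pr p q)" for v c
  proof
    have cC: "c \<in> R.C" using c R.below_Cond by blast
    assume m: "A v c \<and> R.FM c (R.ck v) x"
    show "Gd \<tau> v c" unfolding Gd_def
    proof
      fix c3 assume c3: "c3 \<in> R.BL c"
      have c3C: "c3 \<in> R.C" using c3 R.below_Cond by blast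
      have c30: "c3 \<in> R.BL r1" using R.below_trans[OF R.below_trans[OF c3 c c0] b0 r1C] .
      obtain c4 i where c4: "c4 \<in> R.BL c3" "E i \<alpha>" "R.FM c4 (R.op (R.ck v) (R.ck i)) f"
        using R.is_inj_app[OF c3C R.forces_mono[OF r1C c30 inj]] R.FM_mono[OF cC c3] m by blast
      have c4C: "c4 \<in> R.C" and c4c: "c4 \<in> R.BL c" using c4 R.below_Cond R.below_trans[OF c4(1) c3 cC] by blast+
      obtain p4 q4 where c4e: "c4 = pr p4 q4" using c4C by (rule R_cases)
      note c4C' = c4C[unfolded c4e]
      have l4: "p4 \<in> P.BL p" "qle p4 q4 q"
        using R.below_trans[OF c4c c c0] R_below[OF c4C'] unfolding c4e by blast+
      have p4C: "p4 \<in> P.C" using l4 P.below_Cond by blast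
      obtain p5 q5 where p5: "p5 \<in> P.BL p4" "E (pr p5 q5) t" "dec i (pr p5 q5)" using D[OF c4(2) p4C] by blast
      have "E (pr p5 q) t" using tm_open[OF t(1) p(2) P.below_trans[OF p5(1) l4(1) pC]] .
      then have qq: "q5 = q" using tm_unique[OF t(1)] p5(2) by blast
      have c5C: "pr p5 q4 \<in> R.C" and c54: "pr p5 q4 \<in> R.BL c4"
        using R_restrict[OF c4C' p5(1)] unfolding c4e by blast+
      have p5C: "p5 \<in> P.C" using p5 P.below_Cond by blast
      have c5: "pr p5 q4 \<in> R.BL (pr p5 q)"
        using R_below[OF c5C] P.below_refl[OF p5C] P.FM_mono[OF p4C p5(1) l4(2)] by blast
      have "V i v c4" unfolding V_def using c4(3) m R.ro_mono[OF ro[OF v] cC c4c] R.FM_mono[OF cC c4c] by blast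
      then have V5: "V i v (pr p5 q4)" using V_mono[OF v c4C c54] by blast
      moreover have "v \<in> els l" using v by simp
      \<comment> \<open>The negative alternative of \<open>dec\<close> fails, since an extension
        gives index \<open>i\<close> to \<open>v\<close>. The positive one yields some
        \<open>v'\<close> with the same index, which is \<open>v\<close> by injectivity.\<close>
      ultimately have "\<exists>v'\<in>els l. V i v' (pr p5 q)" using p5(3) c5 unfolding qq dec_def by blast
      then obtain v' where v': "E v' l" "V i v' (pr p5 q)" by auto
      have "V i v' (pr p5 q4)" using V_mono[OF v'(1) tm_R[OF t(1) \<open>E (pr p5 q) t\<close>] c5 v'(2)] .
      then have "R.FE (pr p5 q4) (R.ck v) (R.ck v')"
        using R.is_inj_inj[OF c5C R.forces_mono[OF r1C _ inj]] V5
          R.below_trans[OF R.below_trans[OF c54 c4(1) c3C] c30 r1C] unfolding V_def by blast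
      then have "v = v'" using R.check_inj[OF c5C] by blast
      then have "E (pr p5 v) \<tau>" unfolding \<tau> using p5C v v'(2) c4(2) \<open>E (pr p5 q) t\<close> by auto
      moreover have "vfst (pr p5 q4) \<in> P.BL p5" using P.below_refl[OF p5C] by simp
      ultimately show "\<exists>r''\<in>R.BL c3. \<exists>s. s \<in> P.C \<and> E (pr s v) \<tau> \<and> vfst r'' \<in> P.BL s"
        using p5C R.below_trans[OF c54 c4(1) c3C] by blast
    qed
  next
    have cC: "c \<in> R.C" using c R.below_Cond by blast
    assume g: "Gd \<tau> v c"
    have roV: "R.ro (\<lambda>c. A v c \<and> R.FM c (R.ck v) x)" by (intro R.ro_conj ro[OF v] R.ro_FM)
    show "A v c \<and> R.FM c (R.ck v) x"
    proof (rule R.ro_dense[OF roV cC])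
      fix c3 assume c3: "c3 \<in> R.BL c"
      obtain c4 s where c4: "c4 \<in> R.BL c3" "s \<in> P.C" "E (pr s v) \<tau>" "vfst c4 \<in> P.BL s"
        using g c3 unfolding Gd_def by blast
      have c4C: "c4 \<in> R.C" and c4c: "c4 \<in> R.BL c" using c4 R.below_Cond R.below_trans[OF c4(1) c3 cC] by blast+
      obtain p4 q4 where c4e: "c4 = pr p4 q4" using c4C by (rule R_cases)
      note c4C' = c4C[unfolded c4e]
      have l4: "p4 \<in> P.BL p" "qle p4 q4 q"
        using R.below_trans[OF c4c c c0] R_below[OF c4C'] unfolding c4e by blast+
      have p4s: "p4 \<in> P.BL s" using c4(4) unfolding c4e by simp
      obtain i q5 where i: "E (pr s q5) t" "V i v (pr s q5)" using c4(3) unfolding \<tau> by blast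
      have "E (pr p4 q5) t" "E (pr p4 q) t" using tm_open[OF t(1)] i(1) p4s p(2) l4(1) by blast+
      then have "q5 = q" using tm_unique[OF t(1)] by blast
      then have "c4 \<in> R.BL (pr s q5)" unfolding c4e using R_below[OF c4C'] p4s l4(2) by blast
      then have "V i v c4" using V_mono[OF v tm_R[OF t(1) i(1)] _ i(2)] by blast
      then show "\<exists>c4\<in>R.BL c3. A v c4 \<and> R.FM c4 (R.ck v) x" using c4(1) unfolding V_def by blast
    qed
  qed
  have "els \<tau> \<subseteq> vprod P.C (els l)" unfolding \<tau>_def els_code[OF it] by blast
  then show ?thesis using tr R.below_trans[OF b0 r1r r] by (intro bexI[of _ "pr p q"] exI[of _ \<tau>]) auto
qed

end

section \<open>Traces along a fine ultrafilter\<close>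

text \<open>\<open>A v\<close> is the truth value of \<open>v\<close> belonging to the set of
  ordinals to be captured, \<open>s\<close> names the set of its small pieces and \<open>r3\<close>
  is a condition at which the ultrafilter \<open>U\<close> has been chosen.\<close>

locale fine_extension = splitting_two_step +
  fixes l s U r3 :: 'a and A :: "'a \<Rightarrow> 'a \<Rightarrow> bool"
  assumes l_ne: "\<exists>v. E v l"
    and dfn_A: "dfn (\<lambda>e. A (e 0) (e 1))"
    and ro_A: "\<And>v. E v l \<Longrightarrow> R.ro (A v)"
    and r3: "r3 \<in> R.C"
    and s: "\<And>q x. q \<in> R.C \<Longrightarrow> R.FM q x s \<longleftrightarrow> forces E RR (x \<^bold>\<subseteq> R.ck l \<^bold>\<and> smaller x (R.ck \<kappa>)) q"
    and U_uf: "forces E RR (ultrafilter U s) r3"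
    and U_complete: "forces E RR (complete_for (R.ck \<kappa>) U) r3"
    and U_fine: "forces E RR (fine U s (R.ck l)) r3"
begin

lemma below_r3: assumes "q \<in> R.BL r3" shows "q \<in> R.C" "forces E RR \<phi> r3 \<Longrightarrow> forces E RR \<phi> q"
  using assms R.below_Cond R.forces_mono[OF r3 assms] by blast+

lemma U_elem: assumes q: "q \<in> R.BL r3" and x: "R.FM q x U"
  shows "\<And>q' z. q' \<in> R.BL q \<Longrightarrow> R.FM q' z x \<Longrightarrow> R.FM q' z s" and "\<exists>r\<in>R.BL q. \<exists>z. R.FM r z x"
proof -
  have qC: "q \<in> R.C" using below_r3[OF q] by blast
  have "forces E RR (x \<^bold>\<in> U \<^bold>\<longrightarrow> x \<^bold>\<subseteq> s \<^bold>\<and> nonempty x) q"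
    using below_r3(2)[OF q U_uf] unfolding ultrafilter_def forces.simps by blast
  then have "forces E RR (x \<^bold>\<subseteq> s \<^bold>\<and> nonempty x) q"
    by (rule R.forces_mp[OF qC]) (simp add: x)
  then have 1: "forces E RR (x \<^bold>\<subseteq> s) q" "forces E RR (nonempty x) q" by simp_all
  show "R.FM q' z s" if "q' \<in> R.BL q" "R.FM q' z x" for q' z
    using 1(1) that unfolding R.forces_sub[OF qC] by blast
  show "\<exists>r\<in>R.BL q. \<exists>z. R.FM r z x"
    using 1(2) R.below_refl[OF qC] unfolding nonempty_def R.forces_ex forces.simps by blast
qed

lemma U_inter:
  assumes q: "q \<in> R.BL r3" and x: "R.FM q x U" "R.FM q y U"
    and z: "\<And>u q'. q' \<in> R.BL q \<Longrightarrow> R.FM q' u z \<longleftrightarrow> R.FM q' u x \<and> R.FM q' u y"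
  shows "R.FM q z U"
proof -
  have qC: "q \<in> R.C" using below_r3[OF q] by blast
  have "forces E RR (x \<^bold>\<in> U \<^bold>\<and> y \<^bold>\<in> U \<^bold>\<and> (\<^bold>\<forall>u. u \<^bold>\<in> z \<^bold>\<longleftrightarrow> u \<^bold>\<in> x \<^bold>\<and> u \<^bold>\<in> y) \<^bold>\<longrightarrow> z \<^bold>\<in> U) q"
    using below_r3(2)[OF q U_uf] unfolding ultrafilter_def forces.simps by blast
  then have "forces E RR (z \<^bold>\<in> U) q"
    by (rule R.forces_mp[OF qC]) (use x z in \<open>simp add: R.forces_iff[OF qC]\<close>)
  then show ?thesis by simp
qed

lemma U_compl:
  assumes q: "q \<in> R.BL r3" and x: "\<And>q' z. q' \<in> R.BL q \<Longrightarrow> R.FM q' z x \<Longrightarrow> R.FM q' z s"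
    and y: "\<And>u q'. q' \<in> R.BL q \<Longrightarrow> R.FM q' u y \<longleftrightarrow> R.FM q' u s \<and> (\<forall>r\<in>R.BL q'. \<not> R.FM r u x)"
  shows "\<exists>r\<in>R.BL q. R.FM r x U \<or> R.FM r y U"
proof -
  have qC: "q \<in> R.C" using below_r3[OF q] by blast
  have "forces E RR (x \<^bold>\<subseteq> s \<^bold>\<and> (\<^bold>\<forall>u. u \<^bold>\<in> y \<^bold>\<longleftrightarrow> u \<^bold>\<in> s \<^bold>\<and> \<^bold>\<not> (u \<^bold>\<in> x)) \<^bold>\<longrightarrow> x \<^bold>\<in> U \<^bold>\<or> y \<^bold>\<in> U) q"
    using below_r3(2)[OF q U_uf] unfolding ultrafilter_def forces.simps by blast
  then have "forces E RR (x \<^bold>\<in> U \<^bold>\<or> y \<^bold>\<in> U) q"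
    by (rule R.forces_mp[OF qC]) (use x y in \<open>simp add: R.forces_iff[OF qC] R.forces_sub[OF qC]\<close>)
  then show ?thesis using R.below_refl[OF qC] unfolding R.forces_or[OF qC] forces.simps by blast
qed

lemma U_fine_elem:
  assumes q: "q \<in> R.BL r3" and v: "E v l"
    and z: "\<And>x q'. q' \<in> R.BL q \<Longrightarrow> R.FM q' x z \<longleftrightarrow> R.FM q' x s \<and> R.FM q' (R.ck v) x"
  shows "R.FM q z U"
proof -
  have qC: "q \<in> R.C" using below_r3[OF q] by blast
  have "forces E RR (R.ck v \<^bold>\<in> R.ck l \<^bold>\<and> (\<^bold>\<forall>x. x \<^bold>\<in> z \<^bold>\<longleftrightarrow> x \<^bold>\<in> s \<^bold>\<and> R.ck v \<^bold>\<in> x) \<^bold>\<longrightarrow> z \<^bold>\<in> U) q"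
    using below_r3(2)[OF q U_fine] unfolding fine_def forces.simps by blast
  then have "forces E RR (z \<^bold>\<in> U) q"
    by (rule R.forces_mp[OF qC]) (use z R.FM_checkI[OF qC v] in \<open>simp add: R.forces_iff[OF qC]\<close>)
  then show ?thesis by simp
qed

definition subname :: "('a \<Rightarrow> 'a \<Rightarrow> bool) \<Rightarrow> 'a" where
  "subname \<Theta> = R.mkname (name_dom E RR s) \<Theta>"

text \<open>Every element of \<open>s\<close> is densely equal to a name in the domain of
  \<open>s\<close>, and \<open>\<Theta>\<close> respects forced equality; so the restriction to
  these names does not affect the set.\<close>

lemma FM_subname:
  assumes d: "dfn (\<lambda>e. \<Theta> (e 0) (e 1))"
    and mono: "\<And>x r r'. r \<in> R.C \<Longrightarrow> r' \<in> R.BL r \<Longrightarrow> \<Theta> x r \<Longrightarrow> \<Theta> x r'"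
    and cong: "\<And>x x' r. r \<in> R.C \<Longrightarrow> R.FE r x x' \<Longrightarrow> \<Theta> x r \<Longrightarrow> \<Theta> x' r"
    and sub: "\<And>x r. r \<in> R.C \<Longrightarrow> \<Theta> x r \<Longrightarrow> R.FM r x s"
  shows "R.FM q u (subname \<Theta>) \<longleftrightarrow> (\<forall>q'\<in>R.BL q. \<exists>r\<in>R.BL q'. \<Theta> u r)"
proof -
  have 1: "R.FM q u (subname \<Theta>) \<longleftrightarrow> (\<forall>q'\<in>R.BL q. \<exists>r\<in>R.BL q'. \<exists>z\<in>name_dom E RR s. \<Theta> z r \<and> R.FE r u z)"
    unfolding subname_def by (rule R.FM_mkname[OF R.isset_name_dom d]) (rule mono)
  show ?thesis unfolding 1
  proof (intro ball_cong refl iffI)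
    fix q' assume "\<exists>r\<in>R.BL q'. \<exists>z\<in>name_dom E RR s. \<Theta> z r \<and> R.FE r u z"
    then obtain r z where r: "r \<in> R.BL q'" "\<Theta> z r" "R.FE r u z" by blast
    have rC: "r \<in> R.C" using r R.below_Cond by blast
    show "\<exists>r\<in>R.BL q'. \<Theta> u r" using r cong[OF rC R.FE_sym[OF rC r(3)] r(2)] by blast
  next
    fix q' assume "q' \<in> R.BL q" and ex: "\<exists>r\<in>R.BL q'. \<Theta> u r"
    then have q'C: "q' \<in> R.C" using R.below_Cond by blast
    obtain r where r: "r \<in> R.BL q'" "\<Theta> u r" using ex by blast
    have rC: "r \<in> R.C" using r R.below_Cond by blast
    obtain r' z c where r': "r' \<in> R.BL r" "c \<in> R.C" "E (pr z c) s" "R.FE r' u z"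
      using R.FM_witness[OF rC sub[OF rC r(2)]] by blast
    have r'C: "r' \<in> R.C" using r' R.below_Cond by blast
    have "\<Theta> z r'" using cong[OF r'C r'(4) mono[OF rC r'(1) r(2)]] .
    moreover have "z \<in> name_dom E RR s" using r'(2,3) R.mem_name_dom by blast
    moreover have "r' \<in> R.BL q'" using R.below_trans[OF r'(1) r(1) q'C] .
    ultimately show "\<exists>r\<in>R.BL q'. \<exists>z\<in>name_dom E RR s. \<Theta> z r \<and> R.FE r u z" using r'(4) by blast
  qed
qed

text \<open>The family is indexed by \<open>P\<close> in the ground model, so
  \<open>check_smaller\<close> bounds its size in the extension. Completeness puts its intersection
  into \<open>U\<close>, and members of \<open>U\<close> are nonempty.\<close>

lemma complete_point:
  assumes q: "q \<in> R.BL r3" and d: "\<And>p. p \<in> P.C \<Longrightarrow> R.FM q (app d p) U"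
  shows "\<exists>r\<in>R.BL q. \<exists>x. \<forall>p\<in>P.C. R.FM r x (app d p)"
proof -
  have qC: "q \<in> R.C" using below_r3[OF q] by blast
  \<comment> \<open>Some member of the family is needed to see that the family is nonempty and that
    its intersection consists of elements of \<open>s\<close>.\<close>
  obtain p0 where p0: "p0 \<in> P.C" using R_fst[OF r3] by blast
  have ds: "R.FM q' z s" if "p \<in> P.C" "q' \<in> R.BL q" "R.FM q' z (app d p)" for p q' z
    using U_elem(1)[OF q d[OF that(1)] that(2,3)] .
  define F where "F = R.mkname (app d ` P.C) (\<lambda>z c. True)"
  have X: "isset (app d ` P.C)" by (intro isset_image P.isset_Cond dfn_intros)
  have F: "R.FM r x F \<longleftrightarrow> (\<forall>q'\<in>R.BL r. \<exists>r\<in>R.BL q'. \<exists>p\<in>P.C. R.FE r x (app d p))" for r x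
  proof -
    have "R.FM r x F \<longleftrightarrow> (\<forall>q'\<in>R.BL r. \<exists>r\<in>R.BL q'. \<exists>z\<in>app d ` P.C. True \<and> R.FE r x z)"
      unfolding F_def by (rule R.FM_mkname[OF X]) (intro dfn_intros, blast)
    then show ?thesis by simp
  qed
  have Fd: "R.FM r (app d p) F" if "r \<in> R.C" "p \<in> P.C" for r p
    unfolding F using that R.below_refl R.below_Cond R.FE_refl by blast
  define \<Theta> where "\<Theta> x r \<longleftrightarrow> R.FM r x s \<and> (\<forall>p\<in>P.C. R.FM r x (app d p))" for x r
  have \<Theta>: "R.FM r x (subname \<Theta>) \<longleftrightarrow> (\<forall>q'\<in>R.BL r. \<exists>r\<in>R.BL q'. \<Theta> x r)" for r x
  proof (rule FM_subname)
    show "dfn (\<lambda>e. \<Theta> (e 0) (e 1))" unfolding \<Theta>_def by (intro dfn_intros)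
    show "\<Theta> x r'" if "r \<in> R.C" "r' \<in> R.BL r" "\<Theta> x r" for x r r'
      using that(3) R.FM_mono[OF that(1,2)] unfolding \<Theta>_def by blast
    show "\<Theta> x' r" if "r \<in> R.C" "R.FE r x x'" "\<Theta> x r" for x x' r
      using that(3) R.FM_eq_left[OF that(1,2)] unfolding \<Theta>_def by blast
  qed (simp add: \<Theta>_def)
  have inter: "R.FM r x (subname \<Theta>) \<longleftrightarrow> forces E RR (\<^bold>\<forall>a. a \<^bold>\<in> F \<^bold>\<longrightarrow> x \<^bold>\<in> a) r" if r: "r \<in> R.BL q" for r x
  proof
    have rC: "r \<in> R.C" using r R.below_Cond by blast
    assume "R.FM r x (subname \<Theta>)"
    then have m: "\<forall>q'\<in>R.BL r. \<exists>r\<in>R.BL q'. \<Theta> x r" unfolding \<Theta> .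
    have "R.FM q' x a" if q': "q' \<in> R.BL r" "R.FM q' a F" for q' a
    proof (rule R.FM_dense[OF R.below_Cond[OF q'(1)]])
      fix c assume c: "c \<in> R.BL q'"
      have q'C: "q' \<in> R.C" using q' R.below_Cond by blast
      obtain c1 p where c1: "c1 \<in> R.BL c" "p \<in> P.C" "R.FE c1 a (app d p)" using q'(2) c unfolding F by blast
      have cC: "c \<in> R.C" and c1C: "c1 \<in> R.C" using c c1 R.below_Cond by blast+
      have c1r: "c1 \<in> R.BL r" using R.below_trans[OF R.below_trans[OF c1(1) c q'C] q'(1) rC] .
      obtain c2 where c2: "c2 \<in> R.BL c1" "\<Theta> x c2" using m c1r by blast
      have c2C: "c2 \<in> R.C" using c2 R.below_Cond by blast
      have "R.FM c2 x a"
        using R.FM_eq_right[OF c2C R.FE_sym[OF c2C R.FE_mono[OF c1C c2(1) c1(3)]]] c2(2) c1(2) unfolding \<Theta>_def by blast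
      then show "\<exists>c2\<in>R.BL c. R.FM c2 x a" using R.below_trans[OF c2(1) c1(1) cC] by blast
    qed
    then show "forces E RR (\<^bold>\<forall>a. a \<^bold>\<in> F \<^bold>\<longrightarrow> x \<^bold>\<in> a) r" by (simp add: R.forces_imp[OF rC])
  next
    have rC: "r \<in> R.C" using r R.below_Cond by blast
    assume f: "forces E RR (\<^bold>\<forall>a. a \<^bold>\<in> F \<^bold>\<longrightarrow> x \<^bold>\<in> a) r"
    then have m: "R.FM c x (app d p)" if "c \<in> R.BL r" "p \<in> P.C" for c p
      using that Fd[OF R.below_Cond[OF that(1)] that(2)] unfolding forces.simps R.forces_imp[OF rC] by blast
    show "R.FM r x (subname \<Theta>)" unfolding \<Theta>
    proof
      fix c assume c: "c \<in> R.BL r"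
      have "\<Theta> x c" unfolding \<Theta>_def using m[OF c] ds[OF p0 R.below_trans[OF c r qC] m[OF c p0]] by blast
      then show "\<exists>c\<in>R.BL c. \<Theta> x c" using R.below_refl[OF R.below_Cond[OF c]] by blast
    qed
  qed
  have "forces E RR (F \<^bold>\<subseteq> U) q" unfolding R.forces_sub[OF qC]
  proof (intro allI ballI impI)
    fix z c assume c: "c \<in> R.BL q" "R.FM c z F"
    have cC: "c \<in> R.C" using c R.below_Cond by blast
    show "R.FM c z U"
    proof (rule R.FM_dense[OF cC])
      fix c' assume c': "c' \<in> R.BL c"
      then obtain c1 p where c1: "c1 \<in> R.BL c'" "p \<in> P.C" "R.FE c1 z (app d p)" using c(2) unfolding F by blast
      have c1C: "c1 \<in> R.C" using c1 R.below_Cond by blast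
      have "R.FM c1 (app d p) U"
        using R.FM_mono[OF qC R.below_trans[OF R.below_trans[OF c1(1) c' cC] c(1) qC] d[OF c1(2)]] .
      then show "\<exists>c1\<in>R.BL c'. R.FM c1 z U" using c1(1) R.FM_eq_left[OF c1C R.FE_sym[OF c1C c1(3)]] by blast
    qed
  qed
  moreover have "forces E RR (nonempty F) q" unfolding nonempty_def
    by (rule R.forces_exI[OF qC, where x = "app d p0"]) (simp add: Fd[OF qC p0])
  moreover have "forces E RR (smaller F (R.ck \<kappa>)) q"
  proof -
    obtain a where a: "E a \<kappa>" "vinj P.C (els a)" by (rule P_bound)
    show ?thesis by (rule R.check_smaller[OF P.isset_Cond a(1) Ord_mem[OF Ord_kappa a(1)] a(2) qC]) (rule F)
  qed
  moreover have "forces E RR (\<^bold>\<forall>x. x \<^bold>\<in> subname \<Theta> \<^bold>\<longleftrightarrow> (\<^bold>\<forall>a. a \<^bold>\<in> F \<^bold>\<longrightarrow> x \<^bold>\<in> a)) q"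
    unfolding forces.simps(5) R.forces_iff[OF qC] using inter by simp
  ultimately have h: "forces E RR (F \<^bold>\<subseteq> U \<^bold>\<and> nonempty F \<^bold>\<and> smaller F (R.ck \<kappa>) \<^bold>\<and>
      (\<^bold>\<forall>x. x \<^bold>\<in> subname \<Theta> \<^bold>\<longleftrightarrow> (\<^bold>\<forall>a. a \<^bold>\<in> F \<^bold>\<longrightarrow> x \<^bold>\<in> a))) q" by simp
  have "forces E RR (F \<^bold>\<subseteq> U \<^bold>\<and> nonempty F \<^bold>\<and> smaller F (R.ck \<kappa>) \<^bold>\<and>
      (\<^bold>\<forall>x. x \<^bold>\<in> subname \<Theta> \<^bold>\<longleftrightarrow> (\<^bold>\<forall>a. a \<^bold>\<in> F \<^bold>\<longrightarrow> x \<^bold>\<in> a)) \<^bold>\<longrightarrow> subname \<Theta> \<^bold>\<in> U) q"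
    using below_r3(2)[OF q U_complete] unfolding complete_for_def forces.simps by blast
  from R.forces_mp[OF qC this h] have "R.FM q (subname \<Theta>) U" by simp
  then obtain r x where r: "r \<in> R.BL q" "R.FM r x (subname \<Theta>)" using U_elem(2)[OF q] by blast
  then obtain r' where r': "r' \<in> R.BL r" "\<Theta> x r'" using R.below_refl[OF R.below_Cond[OF r(1)]] unfolding \<Theta> by blast
  then show ?thesis using R.below_trans[OF r'(1) r(1) qC] unfolding \<Theta>_def by blast
qed

definition TT :: "'a set" where "TT = {\<tau>. els \<tau> \<subseteq> vprod P.C (els l)}"

definition psi :: "'a \<Rightarrow> 'a \<Rightarrow> 'a \<Rightarrow> bool" where
  "psi x \<tau> r \<longleftrightarrow> (\<forall>v\<in>els l. \<forall>c\<in>R.BL r. A v c \<and> R.FM c (R.ck v) x \<longleftrightarrow> Gd \<tau> v c)"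

lemma isset_TT: "isset TT" unfolding TT_def by (intro isset_Pow isset_vprod P.isset_Cond isset_els)

lemma psi_mono: "r \<in> R.C \<Longrightarrow> r' \<in> R.BL r \<Longrightarrow> psi x \<tau> r \<Longrightarrow> psi x \<tau> r'"
  unfolding psi_def using R.below_trans[of _ r' r] by blast

lemma psi_cong: assumes r: "r \<in> R.C" and e: "R.FE r x x'" and p: "psi x \<tau> r" shows "psi x' \<tau> r"
  unfolding psi_def
proof (intro ballI)
  fix v c assume vc: "v \<in> els l" "c \<in> R.BL r"
  have cC: "c \<in> R.C" using vc R.below_Cond by blast
  have "R.FE c x x'" using R.FE_mono[OF r vc(2) e] .
  then have "R.FM c (R.ck v) x \<longleftrightarrow> R.FM c (R.ck v) x'" using R.FM_eq_right[OF cC] R.FE_sym[OF cC] by blast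
  then show "A v c \<and> R.FM c (R.ck v) x' \<longleftrightarrow> Gd \<tau> v c" using p vc unfolding psi_def by blast
qed

text \<open>For \<open>x\<close> in \<open>P\<^sub>\<kappa>(l)\<close> some \<open>\<tau>\<close> satisfies \<open>A \<inter> x = {v. \<exists>s \<in> G. (s, v) \<in> \<tau>}\<close>. Choosing the
  least one in a well-ordering that belongs to the ground model makes \<open>x \<mapsto> \<tau>\<close> definable
  in the extension without appeal to choice there.\<close>

lemma obtain_selector:
  obtains sel where "\<And>t u w. \<lbrakk>dft t; dft u; dft w\<rbrakk> \<Longrightarrow> dfn (\<lambda>e. sel (t e) (u e) (w e))"
    "\<And>x \<tau> r. sel x \<tau> r \<Longrightarrow> psi x \<tau> r"
    "\<And>x \<tau> r r'. r \<in> R.C \<Longrightarrow> r' \<in> R.BL r \<Longrightarrow> sel x \<tau> r \<Longrightarrow> sel x \<tau> r'"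
    "\<And>x x' \<tau> r. r \<in> R.C \<Longrightarrow> R.FE r x x' \<Longrightarrow> sel x \<tau> r \<Longrightarrow> sel x' \<tau> r"
    "\<And>x \<tau> \<tau>' r. r \<in> R.C \<Longrightarrow> \<tau> \<in> TT \<Longrightarrow> \<tau>' \<in> TT \<Longrightarrow> sel x \<tau> r \<Longrightarrow> sel x \<tau>' r \<Longrightarrow> \<tau> = \<tau>'"
    "\<And>x r. r \<in> R.C \<Longrightarrow> R.FM r x s \<Longrightarrow> \<exists>r'\<in>R.BL r. \<exists>\<tau>\<in>TT. sel x \<tau> r'"
proof -
  obtain \<theta> F where \<theta>: "Ord \<theta>" "dft (\<lambda>e. F (e 0))" "bij_betw F (els \<theta>) (els (code TT))"
    by (rule well_ordering)
  obtain K where K: "dft (\<lambda>e. K (e 0))" "\<And>x. x \<in> els \<theta> \<Longrightarrow> K (F x) = x"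
    using dft_inverse[OF \<theta>(2) isset_els, of \<theta>] \<theta>(3) unfolding bij_betw_def by blast
  note dK = dft_comp1[OF K(1)]
  have KO: "Ord (K \<tau>)" "F (K \<tau>) = \<tau>" if "\<tau> \<in> TT" for \<tau>
  proof -
    have "\<tau> \<in> F ` els \<theta>" using that \<theta>(3) isset_TT unfolding bij_betw_def by simp
    then obtain x where "x \<in> els \<theta>" "\<tau> = F x" by blast
    then show "Ord (K \<tau>)" "F (K \<tau>) = \<tau>" using K(2) Ord_mem[OF \<theta>(1)] by auto
  qed
  note A' = dfn_comp2[OF dfn_A]
  have dpsi: "\<lbrakk>dft t; dft u; dft w\<rbrakk> \<Longrightarrow> dfn (\<lambda>e. psi (t e) (u e) (w e))" for t u w
    unfolding psi_def by (intro dfn_intros A' dft_shift)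
  define sel where "sel x \<tau> r \<longleftrightarrow> psi x \<tau> r \<and> (\<forall>\<tau>'\<in>TT. E (K \<tau>') (K \<tau>) \<longrightarrow> (\<forall>c\<in>R.BL r. \<not> psi x \<tau>' c))" for x \<tau> r
  show thesis
  proof (rule that[of sel])
    show "\<lbrakk>dft t; dft u; dft w\<rbrakk> \<Longrightarrow> dfn (\<lambda>e. sel (t e) (u e) (w e))" for t u w
      unfolding sel_def by (intro dfn_intros dpsi dK dfn_in_set isset_TT dft_shift)
    show "sel x \<tau> r \<Longrightarrow> psi x \<tau> r" for x \<tau> r unfolding sel_def by blast
    show "sel x \<tau> r'" if "r \<in> R.C" "r' \<in> R.BL r" "sel x \<tau> r" for x \<tau> r r'
      using that(3) psi_mono[OF that(1,2)] R.below_trans[OF _ that(2,1)] unfolding sel_def by blast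
    show "sel x' \<tau> r" if h: "r \<in> R.C" "R.FE r x x'" "sel x \<tau> r" for x x' \<tau> r
    proof -
      have "psi x \<tau>' c" if "c \<in> R.BL r" "psi x' \<tau>' c" for \<tau>' c
        using psi_cong[OF R.below_Cond[OF that(1)] R.FE_sym[OF R.below_Cond[OF that(1)] R.FE_mono[OF h(1) that(1) h(2)]] that(2)] .
      then show ?thesis using h(3) psi_cong[OF h(1,2)] unfolding sel_def by blast
    qed
    show "\<tau> = \<tau>'" if "r \<in> R.C" "\<tau> \<in> TT" "\<tau>' \<in> TT" "sel x \<tau> r" "sel x \<tau>' r" for x \<tau> \<tau>' r
    proof -
      have "\<not> E (K \<tau>) (K \<tau>')" "\<not> E (K \<tau>') (K \<tau>)"
        using that R.below_refl[OF that(1)] unfolding sel_def by blast+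
      then have "K \<tau> = K \<tau>'" using Ord_linear KO(1) that(2,3) by blast
      then show ?thesis using KO(2) that(2,3) by metis
    qed
    fix x r assume r: "r \<in> R.C" and x: "R.FM r x s"
    have "forces E RR (smaller x (R.ck \<kappa>)) r" using x unfolding s[OF r] by simp
    then obtain r' \<tau> where r': "r' \<in> R.BL r" "\<tau> \<in> TT" "psi x \<tau> r'"
      using small_trace[OF dfn_A ro_A r] unfolding TT_def psi_def by blast
    let ?L = "\<lambda>a. \<exists>\<tau>\<in>TT. K \<tau> = a \<and> (\<exists>c\<in>R.BL r. psi x \<tau> c)"
    have "dfn (\<lambda>e. ?L (e 0))" by (intro dfn_intros dfn_in_set isset_TT dK dpsi)
    moreover have "?L (K \<tau>)" using r' by blast
    ultimately obtain a where a: "?L a" "\<And>b. E b a \<Longrightarrow> \<not> ?L b" using least_Ord[of ?L "K \<tau>"] KO(1)[OF r'(2)] by blast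
    then obtain \<sigma> c where \<sigma>: "\<sigma> \<in> TT" "K \<sigma> = a" "c \<in> R.BL r" "psi x \<sigma> c" by blast
    have "sel x \<sigma> c" unfolding sel_def using \<sigma> a(2) R.below_trans[OF _ \<sigma>(3) r] by blast
    then show "\<exists>r'\<in>R.BL r. \<exists>\<tau>\<in>TT. sel x \<tau> r'" using \<sigma> by blast
  qed
qed

text \<open>With \<tau>(x) the selected code of the trace of \<open>A\<close> on \<open>x\<close>,
  the limit \<open>B\<close> contains \<open>e\<close> if \<tau>(x) does for almost all
  \<open>x\<close>. For |P| many elements \<open>e\<close> and one ordinal \<open>v\<close>,
  completeness and fineness give a single \<open>x\<close> that contains \<open>v\<close> and whose
  \<tau>(x) agrees with \<open>B\<close> on these elements. This one fact serves twice: it verifies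
  the hypothesis of \<open>approximation\<close>, and it compares \<open>B\<close> with
  \<open>A\<close> at \<open>v\<close>.\<close>

theorem fine_trace:
  "\<exists>r4\<in>R.BL r3. \<exists>\<tau>. \<forall>v\<in>els l. \<forall>c\<in>R.BL r4. A v c \<longleftrightarrow> Gd \<tau> v c"
proof -
  obtain sel where dsel: "\<And>t u w. \<lbrakk>dft t; dft u; dft w\<rbrakk> \<Longrightarrow> dfn (\<lambda>e. sel (t e) (u e) (w e))"
    and sel_psi: "\<And>x \<tau> r. sel x \<tau> r \<Longrightarrow> psi x \<tau> r"
    and sel_mono: "\<And>x \<tau> r r'. r \<in> R.C \<Longrightarrow> r' \<in> R.BL r \<Longrightarrow> sel x \<tau> r \<Longrightarrow> sel x \<tau> r'"
    and sel_cong: "\<And>x x' \<tau> r. r \<in> R.C \<Longrightarrow> R.FE r x x' \<Longrightarrow> sel x \<tau> r \<Longrightarrow> sel x' \<tau> r"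
    and sel_unique: "\<And>x \<tau> \<tau>' r. r \<in> R.C \<Longrightarrow> \<tau> \<in> TT \<Longrightarrow> \<tau>' \<in> TT \<Longrightarrow> sel x \<tau> r \<Longrightarrow> sel x \<tau>' r \<Longrightarrow> \<tau> = \<tau>'"
    and sel_ex: "\<And>x r. r \<in> R.C \<Longrightarrow> R.FM r x s \<Longrightarrow> \<exists>r'\<in>R.BL r. \<exists>\<tau>\<in>TT. sel x \<tau> r'"
    by (rule obtain_selector) blast
  \<comment> \<open>\<open>\<Theta> e x\<close> is the truth value of \<open>e\<close> belonging to
    \<tau>(x), and \<open>D e\<close> names the set of all \<open>x\<close> for which this
    holds.\<close>
  define \<Theta> where "\<Theta> e x r \<longleftrightarrow> R.FM r x s \<and> (\<exists>\<tau>\<in>TT. sel x \<tau> r \<and> E e \<tau>)" for e x r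
  define D where "D e = subname (\<Theta> e)" for e
  have d\<Theta>: "\<lbrakk>dft t; dft u; dft w\<rbrakk> \<Longrightarrow> dfn (\<lambda>e. \<Theta> (t e) (u e) (w e))" for t u w
    unfolding \<Theta>_def by (intro dfn_intros dsel dfn_in_set isset_TT dft_shift)
  have dD: "dft t \<Longrightarrow> dft (\<lambda>e. D (t e))" for t unfolding D_def subname_def
    by (rule R.dft_mkname[OF R.isset_name_dom]) (intro d\<Theta> dfn_intros)
  have FMD: "R.FM q u (D e) \<longleftrightarrow> (\<forall>q'\<in>R.BL q. \<exists>r\<in>R.BL q'. \<Theta> e u r)" for q u e
    unfolding D_def
  proof (rule FM_subname)
    show "dfn (\<lambda>e'. \<Theta> e (e' 0) (e' 1))" by (intro d\<Theta> dfn_intros)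
    show "\<Theta> e x r'" if "r \<in> R.C" "r' \<in> R.BL r" "\<Theta> e x r" for x r r'
      using that(3) R.FM_mono[OF that(1,2)] sel_mono[OF that(1,2)] unfolding \<Theta>_def by blast
    show "\<Theta> e x' r" if "r \<in> R.C" "R.FE r x x'" "\<Theta> e x r" for x x' r
      using that(3) R.FM_eq_left[OF that(1,2)] sel_cong[OF that(1,2)] unfolding \<Theta>_def by blast
  qed (simp add: \<Theta>_def)
  have D_iff: "R.FM r x (D e) \<longleftrightarrow> E e \<tau>" if r: "r \<in> R.C" "R.FM r x s" "\<tau> \<in> TT" "sel x \<tau> r" for r x e \<tau>
  proof
    assume "R.FM r x (D e)"
    then obtain r' \<tau>' where r': "r' \<in> R.BL r" "\<tau>' \<in> TT" "sel x \<tau>' r'" "E e \<tau>'"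
      using R.below_refl[OF r(1)] unfolding FMD \<Theta>_def by blast
    then have "\<tau>' = \<tau>" using sel_unique[OF R.below_Cond[OF r'(1)] r'(2) r(3) r'(3) sel_mono[OF r(1) r'(1) r(4)]] by blast
    then show "E e \<tau>" using r'(4) by simp
  next
    assume e: "E e \<tau>"
    show "R.FM r x (D e)" unfolding FMD
    proof
      fix q assume q: "q \<in> R.BL r"
      have "\<Theta> e x q" unfolding \<Theta>_def using e r(3) R.FM_mono[OF r(1) q r(2)] sel_mono[OF r(1) q r(4)] by blast
      then show "\<exists>r\<in>R.BL q. \<Theta> e x r" using R.below_refl[OF R.below_Cond[OF q]] by blast
    qed
  qed
  have Ds: "R.FM q x s" if q: "q \<in> R.C" and m: "R.FM q x (D e)" for q x e
    by (rule R.FM_dense[OF q]) (use m in \<open>unfold FMD \<Theta>_def, blast\<close>)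
  \<comment> \<open>The truth value of \<open>e\<close> belonging to the limit set
    \<open>B\<close>.\<close>
  define \<Phi> where "\<Phi> e r \<longleftrightarrow> R.FM r (D e) U" for e r
  have d\<Phi>: "dft t \<Longrightarrow> dft u \<Longrightarrow> dfn (\<lambda>e. \<Phi> (t e) (u e))" for t u unfolding \<Phi>_def by (intro dfn_intros dD)
  have ro\<Phi>: "R.ro (\<Phi> e)" for e unfolding \<Phi>_def by (rule R.ro_FM)
  \<comment> \<open>The set \<open>DS e\<close> consists of the \<open>x\<close> whose verdict on
    \<open>e\<close> agrees with that of \<open>U\<close>. It is \<open>D e\<close> or its
    complement, whichever is large, and can be named before it is known which.\<close>
  define \<Psi> where "\<Psi> e x r \<longleftrightarrow> R.FM r x s \<and> (\<Phi> e r \<and> R.FM r x (D e) \<or> R.ng (\<Phi> e) r \<and> R.ng (\<lambda>r. R.FM r x (D e)) r)" for e x r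
  define DS where "DS e = subname (\<Psi> e)" for e
  have d\<Psi>: "\<lbrakk>dft t; dft u; dft w\<rbrakk> \<Longrightarrow> dfn (\<lambda>e. \<Psi> (t e) (u e) (w e))" for t u w
    unfolding \<Psi>_def R.ng_def by (intro dfn_intros d\<Phi> dD dft_shift)
  have \<Psi>_mono: "\<Psi> e x r'" if "r \<in> R.C" "r' \<in> R.BL r" "\<Psi> e x r" for e x r r'
    using that(3) R.FM_mono[OF that(1,2)] R.ro_mono[OF ro\<Phi> that(1,2)] R.ng_mono[OF that(1,2)] unfolding \<Psi>_def by blast
  have \<Psi>_cong: "\<Psi> e x' r" if h: "r \<in> R.C" "R.FE r x x'" "\<Psi> e x r" for e x x' r
  proof -
    have "R.ng (\<lambda>r. R.FM r x' (D e)) r" if "R.ng (\<lambda>r. R.FM r x (D e)) r"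
      unfolding R.ng_def
    proof (intro ballI notI)
      fix c assume c: "c \<in> R.BL r" "R.FM c x' (D e)"
      have "R.FM c x (D e)"
        using R.FM_eq_left[OF R.below_Cond[OF c(1)] R.FE_sym[OF R.below_Cond[OF c(1)] R.FE_mono[OF h(1) c(1) h(2)]] c(2)] .
      then show False using that c(1) unfolding R.ng_def by blast
    qed
    then show ?thesis using h(3) R.FM_eq_left[OF h(1,2)] unfolding \<Psi>_def by blast
  qed
  have FMDS: "R.FM q u (DS e) \<longleftrightarrow> (\<forall>q'\<in>R.BL q. \<exists>r\<in>R.BL q'. \<Psi> e u r)" for q u e
    unfolding DS_def
  proof (rule FM_subname)
    show "dfn (\<lambda>e'. \<Psi> e (e' 0) (e' 1))" by (intro d\<Psi> dfn_intros)
    show "\<Psi> e x r'" if "r \<in> R.C" "r' \<in> R.BL r" "\<Psi> e x r" for x r r' using \<Psi>_mono[OF that] .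
    show "\<Psi> e x' r" if "r \<in> R.C" "R.FE r x x'" "\<Psi> e x r" for x x' r using \<Psi>_cong[OF that] .
  qed (simp add: \<Psi>_def)
  have DSs: "R.FM q x s" if q: "q \<in> R.C" and m: "R.FM q x (DS e)" for q x e
    by (rule R.FM_dense[OF q]) (use m in \<open>unfold FMDS \<Psi>_def, blast\<close>)
  have DSU: "R.FM q (DS e) U" if q: "q \<in> R.BL r3" for q e
  proof (rule R.FM_dense)
    show qC: "q \<in> R.C" using q R.below_Cond by blast
    fix q' assume q': "q' \<in> R.BL q"
    have q'C: "q' \<in> R.C" using q' R.below_Cond by blast
    \<comment> \<open>Once \<open>c\<close> decides whether \<open>D e\<close> is in
      \<open>U\<close>, \<open>DS e\<close> coincides below \<open>c\<close> with
      \<open>D e\<close>, or is its complement and is put into \<open>U\<close> by the ultrafilter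
      property.\<close>
    obtain c where c: "c \<in> R.BL q'" "\<Phi> e c \<or> R.ng (\<Phi> e) c" using R.dense_decides[OF q'C] by blast
    have cC: "c \<in> R.C" using c R.below_Cond by blast
    have c3: "c \<in> R.BL r3" using R.below_trans[OF R.below_trans[OF c(1) q' qC] q r3] .
    show "\<exists>c\<in>R.BL q'. R.FM c (DS e) U"
    proof (cases "\<Phi> e c")
      case True
      have "R.FE c (D e) (DS e)"
      proof (rule R.FE_ext[OF cC], rule iffI)
        fix w c1 assume c1: "c1 \<in> R.BL c" "R.FM c1 w (D e)"
        have c1C: "c1 \<in> R.C" using c1 R.below_Cond by blast
        show "R.FM c1 w (DS e)" unfolding FMDS
        proof
          fix c2 assume c2: "c2 \<in> R.BL c1"
          have "\<Psi> e w c2" unfolding \<Psi>_def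
            using R.ro_mono[OF ro\<Phi> cC R.below_trans[OF c2 c1(1) cC] True] R.FM_mono[OF c1C c2 c1(2)]
              Ds[OF R.below_Cond[OF c2]] by blast
          then show "\<exists>c\<in>R.BL c2. \<Psi> e w c" using R.below_refl[OF R.below_Cond[OF c2]] by blast
        qed
      next
        fix w c1 assume c1: "c1 \<in> R.BL c" "R.FM c1 w (DS e)"
        have c1C: "c1 \<in> R.C" using c1 R.below_Cond by blast
        show "R.FM c1 w (D e)"
        proof (rule R.FM_dense[OF c1C])
          fix c2 assume c2: "c2 \<in> R.BL c1"
          obtain c4 where c4: "c4 \<in> R.BL c2" "\<Psi> e w c4" using c1(2) c2 unfolding FMDS by blast
          have c4C: "c4 \<in> R.C" using c4 R.below_Cond by blast
          have "\<Phi> e c4"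
            using R.ro_mono[OF ro\<Phi> cC R.below_trans[OF R.below_trans[OF c4(1) c2 c1C] c1(1) cC] True] .
          then have "R.FM c4 w (D e)" using c4(2) R.ng_contra[OF c4C, of "\<Phi> e"] unfolding \<Psi>_def by blast
          then show "\<exists>c4\<in>R.BL c2. R.FM c4 w (D e)" using c4(1) by blast
        qed
      qed
      then have "R.FM c (DS e) U" using R.FM_eq_left[OF cC] True unfolding \<Phi>_def by blast
      then show ?thesis using c(1) by blast
    next
      case False
      then have ng: "R.ng (\<Phi> e) c" using c(2) by blast
      have "\<exists>r\<in>R.BL c. R.FM r (D e) U \<or> R.FM r (DS e) U"
      proof (rule U_compl[OF c3])
        show "R.FM q' z s" if "q' \<in> R.BL c" "R.FM q' z (D e)" for q' z
          using Ds[OF R.below_Cond[OF that(1)] that(2)] .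
        fix w c1 assume c1: "c1 \<in> R.BL c"
        have c1C: "c1 \<in> R.C" using c1 R.below_Cond by blast
        show "R.FM c1 w (DS e) \<longleftrightarrow> R.FM c1 w s \<and> (\<forall>r\<in>R.BL c1. \<not> R.FM r w (D e))"
        proof
          assume m: "R.FM c1 w (DS e)"
          have "\<not> R.FM c2 w (D e)" if c2: "c2 \<in> R.BL c1" for c2
          proof
            assume m2: "R.FM c2 w (D e)"
            obtain c4 where c4: "c4 \<in> R.BL c2" "\<Psi> e w c4" using m c2 unfolding FMDS by blast
            have c4C: "c4 \<in> R.C" and c2C: "c2 \<in> R.C" using c4 c2 R.below_Cond by blast+
            have n4: "R.ng (\<Phi> e) c4" using R.ng_mono[OF cC R.below_trans[OF R.below_trans[OF c4(1) c2 c1C] c1 cC] ng] .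
            have "R.FM c4 w (D e)" using R.FM_mono[OF c2C c4(1) m2] .
            then show False
              using c4(2) R.ng_contra[OF c4C n4] R.ng_contra[OF c4C, of "\<lambda>r. R.FM r w (D e)"] unfolding \<Psi>_def by blast
          qed
          then show "R.FM c1 w s \<and> (\<forall>r\<in>R.BL c1. \<not> R.FM r w (D e))" using DSs[OF c1C m] by blast
        next
          assume m: "R.FM c1 w s \<and> (\<forall>r\<in>R.BL c1. \<not> R.FM r w (D e))"
          then have n: "R.ng (\<lambda>r. R.FM r w (D e)) c1" unfolding R.ng_def by blast
          show "R.FM c1 w (DS e)" unfolding FMDS
          proof
            fix c2 assume c2: "c2 \<in> R.BL c1"
            have "\<Psi> e w c2" unfolding \<Psi>_def
              using R.ng_mono[OF cC R.below_trans[OF c2 c1 cC] ng] R.ng_mono[OF c1C c2 n] R.FM_mono[OF c1C c2] m by blast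
            then show "\<exists>c\<in>R.BL c2. \<Psi> e w c" using R.below_refl[OF R.below_Cond[OF c2]] by blast
          qed
        qed
      qed
      then obtain c1 where c1: "c1 \<in> R.BL c" "R.FM c1 (D e) U \<or> R.FM c1 (DS e) U" by blast
      have "\<not> R.FM c1 (D e) U" using ng c1(1) unfolding R.ng_def \<Phi>_def by blast
      then show ?thesis using c1 R.below_trans[OF c1(1) c(1) q'C] by blast
    qed
  qed
  have point: "\<exists>r'\<in>R.BL r. \<exists>x. \<exists>\<tau>\<in>TT. sel x \<tau> r' \<and> R.FM r' (R.ck v) x \<and>
      (\<forall>p\<in>P.C. (E (app f p) \<tau> \<longrightarrow> \<Phi> (app f p) r') \<and> (\<not> E (app f p) \<tau> \<longrightarrow> R.ng (\<Phi> (app f p)) r'))"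
    if r: "r \<in> R.BL r3" and v: "E v l" for r v f
  proof -
    have rC: "r \<in> R.C" using r R.below_Cond by blast
    define Fv where "Fv = subname (\<lambda>x r. R.FM r x s \<and> R.FM r (R.ck v) x)"
    \<comment> \<open>The requirement that \<open>x\<close> contain \<open>v\<close> is built into
      every member of the family, so that completeness handles it along with the agreement on
      \<open>e\<close>.\<close>
    define dd where "dd e = subname (\<lambda>x r. R.FM r x (DS e) \<and> R.FM r (R.ck v) x)" for e
    have dDS: "dft t \<Longrightarrow> dft (\<lambda>e. DS (t e))" for t unfolding DS_def subname_def
      by (rule R.dft_mkname[OF R.isset_name_dom]) (intro d\<Psi> dfn_intros)
    have ddd: "dft t \<Longrightarrow> dft (\<lambda>e. dd (t e))" for t unfolding dd_def subname_def
      by (rule R.dft_mkname[OF R.isset_name_dom, of "\<lambda>e x r. R.FM r x (DS e) \<and> R.FM r (R.ck v) x"]) (intro dDS dfn_intros)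
    have gen: "R.FM q x (subname (\<lambda>x r. R.FM r x S \<and> R.FM r (R.ck v) x)) \<longleftrightarrow> R.FM q x S \<and> R.FM q (R.ck v) x"
      if S: "\<And>x r. r \<in> R.C \<Longrightarrow> R.FM r x S \<Longrightarrow> R.FM r x s" and q: "q \<in> R.C" for S q x
    proof -
      have "R.FM q x (subname (\<lambda>x r. R.FM r x S \<and> R.FM r (R.ck v) x)) \<longleftrightarrow>
          (\<forall>q'\<in>R.BL q. \<exists>r\<in>R.BL q'. R.FM r x S \<and> R.FM r (R.ck v) x)"
      proof (rule FM_subname)
        show "dfn (\<lambda>e. R.FM (e 1) (e 0) S \<and> R.FM (e 1) (R.ck v) (e 0))" by (intro dfn_intros)
        show "R.FM r' x S \<and> R.FM r' (R.ck v) x" if "r \<in> R.C" "r' \<in> R.BL r" "R.FM r x S \<and> R.FM r (R.ck v) x" for x r r'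
          using that(3) R.FM_mono[OF that(1,2)] by blast
        show "R.FM r x' S \<and> R.FM r (R.ck v) x'" if "r \<in> R.C" "R.FE r x x'" "R.FM r x S \<and> R.FM r (R.ck v) x" for x x' r
          using that(3) R.FM_eq_left[OF that(1,2)] R.FM_eq_right[OF that(1,2)] by blast
        show "R.FM r x s" if "r \<in> R.C" "R.FM r x S \<and> R.FM r (R.ck v) x" for x r using S that by blast
      qed
      moreover have "R.ro (\<lambda>r. R.FM r x S \<and> R.FM r (R.ck v) x)" by (intro R.ro_conj R.ro_FM)
      ultimately show ?thesis
        using R.ro_dense[of "\<lambda>r. R.FM r x S \<and> R.FM r (R.ck v) x" q, OF _ q]
          R.FM_mono[OF q] R.below_refl R.below_Cond by blast
    qed
    have Fv: "R.FM q x Fv \<longleftrightarrow> R.FM q x s \<and> R.FM q (R.ck v) x" if "q \<in> R.C" for q x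
      unfolding Fv_def by (rule gen[OF _ that])
    have dd: "R.FM q x (dd e) \<longleftrightarrow> R.FM q x (DS e) \<and> R.FM q (R.ck v) x" if "q \<in> R.C" for q x e
      unfolding dd_def by (rule gen[OF _ that]) (rule DSs)
    have FvU: "R.FM r Fv U"
      by (rule U_fine_elem[OF r v]) (rule Fv, erule R.below_Cond)
    have "R.FM r (dd e) U" for e
    proof (rule U_inter[OF r DSU[OF r, of e] FvU])
      fix u q' assume "q' \<in> R.BL r"
      then have q': "q' \<in> R.C" using R.below_Cond by blast
      show "R.FM q' u (dd e) \<longleftrightarrow> R.FM q' u (DS e) \<and> R.FM q' u Fv"
        unfolding dd[OF q'] Fv[OF q'] using DSs[OF q'] by blast
    qed
    moreover have "app (lam P.C (\<lambda>p. dd (app f p))) p = dd (app f p)" if "p \<in> P.C" for p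
      by (rule app_lam[OF P.isset_Cond _ that]) (intro ddd dfn_intros)
    ultimately have "\<exists>r'\<in>R.BL r. \<exists>x. \<forall>p\<in>P.C. R.FM r' x (app (lam P.C (\<lambda>p. dd (app f p))) p)"
      using complete_point[OF r, of "lam P.C (\<lambda>p. dd (app f p))"] by simp
    then obtain r1 x where r1: "r1 \<in> R.BL r" "\<And>p. p \<in> P.C \<Longrightarrow> R.FM r1 x (dd (app f p))"
      using \<open>\<And>p. p \<in> P.C \<Longrightarrow> app (lam P.C (\<lambda>p. dd (app f p))) p = dd (app f p)\<close> by auto
    have r1C: "r1 \<in> R.C" using r1 R.below_Cond by blast
    have x1: "R.FM r1 x (DS (app f p))" "R.FM r1 (R.ck v) x" if "p \<in> P.C" for p
      using r1(2)[OF that] unfolding dd[OF r1C] by blast+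
    have p0: "vfst r3 \<in> P.C" using R_fst[OF r3] .
    have xs: "R.FM r1 x s" using DSs[OF r1C x1(1)[OF p0]] .
    obtain r2 \<tau> where r2: "r2 \<in> R.BL r1" "\<tau> \<in> TT" "sel x \<tau> r2" using sel_ex[OF r1C xs] by blast
    have r2C: "r2 \<in> R.C" using r2 R.below_Cond by blast
    have Dc: "R.FM c x (D e) \<longleftrightarrow> E e \<tau>" if "c \<in> R.BL r2" for c e
      using D_iff[OF R.below_Cond[OF that] R.FM_mono[OF r1C R.below_trans[OF that r2(1) r1C] xs] r2(2) sel_mono[OF r2C that r2(3)]] .
    have dn: "\<exists>c'\<in>R.BL c. \<Psi> (app f p) x c'" if "c \<in> R.BL r2" "p \<in> P.C" for c p
      using x1(1)[OF that(2)] R.below_trans[OF that(1) r2(1) r1C] unfolding FMDS by blast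
    \<comment> \<open>Below \<open>r2\<close> membership of \<open>x\<close> in \<open>D e\<close>
      is settled by \<tau>, and \<open>x\<close> in \<open>DS e\<close> says that \<open>U\<close>
      gives the same verdict on \<open>e\<close>. Thus \<open>r2\<close> decides
      \<open>\<Phi> e\<close> as \<tau> does.\<close>
    have "(E (app f p) \<tau> \<longrightarrow> \<Phi> (app f p) r2) \<and> (\<not> E (app f p) \<tau> \<longrightarrow> R.ng (\<Phi> (app f p)) r2)" if p: "p \<in> P.C" for p
    proof (intro conjI impI)
      assume e: "E (app f p) \<tau>"
      show "\<Phi> (app f p) r2"
      proof (rule R.ro_dense[OF ro\<Phi> r2C])
        fix c assume c: "c \<in> R.BL r2"
        obtain c' where c': "c' \<in> R.BL c" "\<Psi> (app f p) x c'" using dn[OF c p] by blast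
        have "R.FM c' x (D (app f p))" using Dc[OF R.below_trans[OF c'(1) c r2C]] e by blast
        then have "\<Phi> (app f p) c'"
          using c'(2) R.ng_contra[OF R.below_Cond[OF c'(1)], of "\<lambda>r. R.FM r x (D (app f p))"] unfolding \<Psi>_def by blast
        then show "\<exists>c'\<in>R.BL c. \<Phi> (app f p) c'" using c'(1) by blast
      qed
    next
      assume e: "\<not> E (app f p) \<tau>"
      show "R.ng (\<Phi> (app f p)) r2" unfolding R.ng_def
      proof (intro ballI notI)
        fix c assume c: "c \<in> R.BL r2" "\<Phi> (app f p) c"
        have cC: "c \<in> R.C" using c R.below_Cond by blast
        obtain c' where c': "c' \<in> R.BL c" "\<Psi> (app f p) x c'" using dn[OF c(1) p] by blast
        have "\<Phi> (app f p) c'" using R.ro_mono[OF ro\<Phi> cC c'(1) c(2)] .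
        then have "R.FM c' x (D (app f p))"
          using c'(2) R.ng_contra[OF R.below_Cond[OF c'(1)], of "\<Phi> (app f p)"] unfolding \<Psi>_def by blast
        then show False using Dc[OF R.below_trans[OF c'(1) c(1) r2C]] e by blast
      qed
    qed
    moreover have "R.FM r2 (R.ck v) x" using R.FM_mono[OF r1C r2(1) x1(2)[OF p0]] .
    ultimately show ?thesis using r2 R.below_trans[OF r2(1) r1(1) rC] by blast
  qed
  \<comment> \<open>For the hypothesis of \<open>approximation\<close> the fact \<open>point\<close>
    is applied at an arbitrary ordinal; what is taken from it is the decision of
    \<open>\<Phi>\<close>.\<close>
  obtain v0 where v0: "E v0 l" using l_ne by blast
  have "\<exists>r\<in>R.BL r3. \<forall>e\<in>vprod P.C (els l). \<Phi> e r \<or> R.ng (\<Phi> e) r"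
  proof (rule approximation)
    show "isset (vprod P.C (els l))" by (intro isset_vprod P.isset_Cond isset_els)
    show "dfn (\<lambda>e. \<Phi> (e 0) (e 1))" by (intro d\<Phi> dfn_intros)
    show "\<exists>r'\<in>R.BL r. \<forall>p\<in>P.C. \<Phi> (app f p) r' \<or> R.ng (\<Phi> (app f p)) r'" if "r \<in> R.BL r3" for f r
      using point[OF that v0, of f] by blast
  qed (use ro\<Phi> r3 in auto)
  then obtain r4 where r4: "r4 \<in> R.BL r3" "\<forall>e\<in>vprod P.C (els l). \<Phi> e r4 \<or> R.ng (\<Phi> e) r4" by (elim bexE)
  have r4C: "r4 \<in> R.C" using r4 R.below_Cond by blast
  \<comment> \<open>As \<open>r4\<close> decides every \<open>\<Phi> e\<close>, the limit set is a
    set of the ground model.\<close>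
  define B where "B = code {e \<in> vprod P.C (els l). \<Phi> e r4}"
  have B: "E e B \<longleftrightarrow> e \<in> vprod P.C (els l) \<and> \<Phi> e r4" for e
    unfolding B_def by (subst mem_code[OF isset_sep]) (auto intro!: d\<Phi> dfn_intros P.isset_Cond)
  \<comment> \<open>The elements to be compared are now the pairs \<open>(p, v)\<close> for all
    \<open>p\<close>: they alone determine whether \<open>Gd\<close> holds at \<open>v\<close>, and
    the trace on an \<open>x\<close> containing \<open>v\<close> is correct about
    \<open>v\<close>.\<close>
  have loc: "\<exists>r'\<in>R.BL r. \<forall>c\<in>R.BL r'. A v c \<longleftrightarrow> Gd B v c" if v: "E v l" and r: "r \<in> R.BL r4" for v r
  proof -
    have fp: "app (lam P.C (\<lambda>p. pr p v)) p = pr p v" if "p \<in> P.C" for p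
      by (rule app_lam[OF P.isset_Cond _ that]) (intro dfn_intros)
    obtain r' x \<tau> where r': "r' \<in> R.BL r" "\<tau> \<in> TT" "sel x \<tau> r'" "R.FM r' (R.ck v) x"
      and f: "\<And>p. p \<in> P.C \<Longrightarrow> (E (pr p v) \<tau> \<longrightarrow> \<Phi> (pr p v) r') \<and> (\<not> E (pr p v) \<tau> \<longrightarrow> R.ng (\<Phi> (pr p v)) r')"
      using point[OF R.below_trans[OF r r4(1) r3] v, of "lam P.C (\<lambda>p. pr p v)"] fp by auto
    have r'C: "r' \<in> R.C" and r'4: "r' \<in> R.BL r4" using r' R.below_Cond R.below_trans[OF r'(1) r r4C] by blast+
    have same: "E (pr p v) \<tau> \<longleftrightarrow> E (pr p v) B" if p: "p \<in> P.C" for p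
    proof -
      have vp: "pr p v \<in> vprod P.C (els l)" using p v by simp
      show ?thesis
      proof
        assume "E (pr p v) \<tau>"
        then have "\<Phi> (pr p v) r'" using f[OF p] by blast
        then have "\<not> R.ng (\<Phi> (pr p v)) r4" using r'4 unfolding R.ng_def by blast
        then show "E (pr p v) B" unfolding B using bspec[OF r4(2) vp] vp by blast
      next
        assume "E (pr p v) B"
        then have "\<Phi> (pr p v) r'" using R.ro_mono[OF ro\<Phi> r4C r'4] unfolding B by blast
        then show "E (pr p v) \<tau>" using f[OF p] R.ng_contra[OF r'C, of "\<Phi> (pr p v)"] by blast
      qed
    qed
    have G: "Gd \<tau> v c \<longleftrightarrow> Gd B v c" for c unfolding Gd_def using same by blast
    have "A v c \<longleftrightarrow> Gd B v c" if c: "c \<in> R.BL r'" for c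
    proof -
      have "A v c \<and> R.FM c (R.ck v) x \<longleftrightarrow> Gd \<tau> v c" using sel_psi[OF r'(3)] v c unfolding psi_def by simp
      then show ?thesis using R.FM_mono[OF r'C c r'(4)] G by blast
    qed
    then show ?thesis using r'(1) by blast
  qed
  have "A v c \<longleftrightarrow> Gd B v c" if v: "E v l" and c: "c \<in> R.BL r4" for v c
  proof
    have cC: "c \<in> R.C" using c R.below_Cond by blast
    \<comment> \<open>The agreement is known on a dense set of conditions. Both sides are regular
      open, which extends it to all conditions below \<open>r4\<close>.\<close>
    have dn: "\<exists>c''\<in>R.BL c'. c'' \<in> R.BL c \<and> (A v c'' \<longleftrightarrow> Gd B v c'')" if c': "c' \<in> R.BL c" for c'
    proof -
      obtain c'' where c'': "c'' \<in> R.BL c'" "\<forall>d\<in>R.BL c''. A v d \<longleftrightarrow> Gd B v d"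
        using loc[OF v R.below_trans[OF c' c r4C]] by blast
      then show ?thesis using R.below_trans[OF c''(1) c' cC] R.below_refl[OF R.below_Cond[OF c''(1)]] by blast
    qed
    show "Gd B v c" if "A v c"
      by (rule R.ro_dense[OF ro_Gd cC]) (use dn R.ro_mono[OF ro_A[OF v] cC _ that] in blast)
    show "A v c" if "Gd B v c"
      by (rule R.ro_dense[OF ro_A[OF v] cC]) (use dn R.ro_mono[OF ro_Gd cC _ that] in blast)
  qed
  then show ?thesis using r4(1) by (intro bexI[of _ r4] exI[of _ B]) auto
qed

end

section \<open>The contradiction with strong compactness\<close>

lemma (in splitting_two_step) not_strongly_compact:
  assumes new: "second_adds_new_set E PP Q leQ" and r0: "r0 \<in> R.C"
  shows "\<not> forces E RR (strongly_compact (R.ck \<kappa>)) r0"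
proof
  assume sc: "forces E RR (strongly_compact (R.ck \<kappa>)) r0"
  obtain r x Y where r: "r \<in> R.BL r0" and Y: "isset Y"
    and cov: "\<And>z q. z \<in> name_dom E RR x \<Longrightarrow> q \<in> R.BL r \<Longrightarrow> \<exists>q'\<in>R.BL q. \<exists>y\<in>Y. R.FE q' z (lft y)"
    and nw: "\<And>y q. q \<in> R.BL r \<Longrightarrow> \<not> R.FE q x (lft y)"
    by (rule minimal_new_name[OF new r0]) blast
  have rC: "r \<in> R.C" using r R.below_Cond by blast
  \<comment> \<open>The cardinal \<open>l\<close> must stay a cardinal under the iteration, have
    room for codes of the elements of \<open>Y\<close>, and exceed \<kappa>; the three parts of
    \<open>C\<close> ensure this in turn.\<close>
  define C where "C = R.C \<union> Y \<union> els \<kappa>"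
  have "isset C" unfolding C_def by (intro isset_Un R.isset_Cond Y isset_els)
  then obtain l where l: "Ord l" "\<And>a. E a l \<Longrightarrow> \<not> vinj (els l) (vprod C (els a))"
    "\<And>a. E a l \<Longrightarrow> \<not> vinj (els l) (els a)" "vinj C (els l)"
    "\<And>\<theta>. Ord \<theta> \<Longrightarrow> vinj (els \<theta>) C \<Longrightarrow> E \<theta> l"
    by (rule big_cardinal) blast
  have kl: "E \<kappa> l" by (rule l(5)[OF Ord_kappa vinj_subset]) (auto simp: C_def)
  have "vinj Y (els l)" by (rule vinj_trans[OF vinj_subset l(4)]) (auto simp: C_def)
  then obtain h where h: "dft (\<lambda>e. h (e 0))" "h ` Y \<subseteq> els l" "inj_on h Y" by (auto simp: vinj_def)
  note dh = dft_comp1[OF h(1)]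
  \<comment> \<open>The new set \<open>x\<close>, transported to ordinals along \<open>h\<close>:
    \<open>v\<close> stands for the element of \<open>Y\<close> that it codes.\<close>
  define A where "A v q \<longleftrightarrow> (\<exists>y\<in>Y. h y = v \<and> R.FM q (lft y) x)" for v q
  have dA: "dfn (\<lambda>e. A (e 0) (e 1))" unfolding A_def by (intro dfn_intros dfn_in_set Y dh)
  have roA: "R.ro (A v)" for v
  proof (cases "\<exists>y\<in>Y. h y = v")
    case True
    then obtain y where y: "y \<in> Y" "h y = v" by blast
    \<comment> \<open>Injectivity of \<open>h\<close> leaves a single candidate for
      \<open>y\<close>. A genuine disjunction of membership values need not be regular open.\<close>
    then have "A v = (\<lambda>q. R.FM q (lft y) x)" unfolding A_def using inj_onD[OF h(3)] by blast
    then show ?thesis using R.ro_FM by simp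
  next
    case False
    then have "A v = (\<lambda>q. False)" unfolding A_def by blast
    then show ?thesis by (auto intro!: R.roI dest: R.below_refl)
  qed
  obtain s where s: "\<And>q x. q \<in> R.C \<Longrightarrow> R.FM q x s \<longleftrightarrow> forces E RR (x \<^bold>\<subseteq> R.ck l \<^bold>\<and> smaller x (R.ck \<kappa>)) q"
    by (rule R.obtain_Pk) blast
  have "forces E RR (cardinal (R.ck l)) r"
  proof (rule R.check_cardinal[OF l(1) _ rC])
    fix a assume a: "E a l"
    have "vprod R.C (els a) \<subseteq> vprod C (els a)" by (auto simp: C_def)
    then show "\<not> vinj (els l) (vprod R.C (els a))" using l(2)[OF a] vinj_trans[OF _ vinj_subset] by blast
  qed
  moreover have "els \<kappa> \<subseteq> els l" using Ord_trans[OF l(1) kl] by auto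
  then have "forces E RR (R.ck \<kappa> \<^bold>\<subseteq> R.ck l) r" by (rule R.check_sub[OF rC])
  moreover have "forces E RR (is_Pk s (R.ck \<kappa>) (R.ck l)) r"
    unfolding is_Pk_def forces.simps(5) R.forces_iff[OF rC] using s R.below_Cond by simp
  ultimately have hyp: "forces E RR (cardinal (R.ck l) \<^bold>\<and> R.ck \<kappa> \<^bold>\<subseteq> R.ck l \<^bold>\<and> is_Pk s (R.ck \<kappa>) (R.ck l)) r" by simp
  have "forces E RR (cardinal (R.ck l) \<^bold>\<and> R.ck \<kappa> \<^bold>\<subseteq> R.ck l \<^bold>\<and> is_Pk s (R.ck \<kappa>) (R.ck l) \<^bold>\<longrightarrow>
     (\<^bold>\<exists>U. ultrafilter U s \<^bold>\<and> complete_for (R.ck \<kappa>) U \<^bold>\<and> fine U s (R.ck l))) r"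
    using R.forces_mono[OF r0 r sc] unfolding strongly_compact_def forces.simps by blast
  from R.forces_mp[OF rC this hyp] obtain r3 U where rU: "r3 \<in> R.BL r"
    "forces E RR (ultrafilter U s \<^bold>\<and> complete_for (R.ck \<kappa>) U \<^bold>\<and> fine U s (R.ck l)) r3"
    using R.below_refl[OF rC] unfolding R.forces_ex by blast
  interpret fine_extension E P leP Q leQ \<kappa> l s U r3 A
  proof
    show "\<exists>v. E v l" using kl by blast
    show "r3 \<in> R.C" using rU R.below_Cond by blast
  qed (use dA roA s rU(2) in auto)
  obtain r4 \<tau> where r4: "r4 \<in> R.BL r3" "\<And>v c. E v l \<Longrightarrow> c \<in> R.BL r4 \<Longrightarrow> A v c \<longleftrightarrow> Gd \<tau> v c"
    using fine_trace by auto
  have r4C: "r4 \<in> R.C" and r4r: "r4 \<in> R.BL r" using r4 R.below_Cond R.below_trans[OF r4(1) rU(1) rC] by blast+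
  have "\<exists>y. R.FE r4 x (lft y)"
  proof (rule new_trace[OF r4C Y _ h(1,3,2)])
    show "\<exists>q'\<in>R.BL q. \<exists>y\<in>Y. R.FE q' z (lft y)" if "z \<in> name_dom E RR x" "q \<in> R.BL r4" for z q
      using cov[OF that(1) R.below_trans[OF that(2) r4r rC]] .
    show "(\<exists>y\<in>Y. h y = v \<and> R.FM q (lft y) x) \<longleftrightarrow> Gd \<tau> v q" if "E v l" "q \<in> R.BL r4" for v q
      using r4(2)[OF that] unfolding A_def .
  qed
  then show False using nw[OF r4r] by blast
qed

lemma (in forcing) supercompact_strongly_compact:
  assumes p: "p \<in> C" and f: "forces E PP (supercompact k) p"
  shows "forces E PP (strongly_compact k) p"
proof -
  have "forces E PP (cardinal l \<^bold>\<and> k \<^bold>\<subseteq> l \<^bold>\<and> is_Pk s k l \<^bold>\<longrightarrow>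
       (\<^bold>\<exists>U. ultrafilter U s \<^bold>\<and> complete_for k U \<^bold>\<and> fine U s l)) p" for l s
  proof -
    have "forces E PP (cardinal l \<^bold>\<and> k \<^bold>\<subseteq> l \<^bold>\<and> is_Pk s k l \<^bold>\<longrightarrow>
       (\<^bold>\<exists>U. ultrafilter U s \<^bold>\<and> complete_for k U \<^bold>\<and> fine U s l \<^bold>\<and> normal U s l)) p"
      using f unfolding supercompact_def forces.simps by blast
    then show ?thesis unfolding forces_imp[OF p] forces_ex forces.simps by blast
  qed
  moreover have "forces E PP (uncountable_cardinal k) p" using f unfolding supercompact_def forces.simps by blast
  ultimately show ?thesis unfolding strongly_compact_def by simp
qed

theorem mainTheorem1:
  fixes E :: "'a \<Rightarrow> 'a \<Rightarrow> bool"
    and \<kappa> P leP Q leQ :: 'a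
  assumes "ZFC E"
    and "holds E (cardinal \<kappa>)"
    and "holds E (forcing_notion P leP)"
    and "adds_new_set E (ext_poset E P leP)"
    and "holds E (smaller P \<kappa>)"
    and "forced E (ext_poset E P leP) (forcing_notion Q leQ)"
    and "forced E (ext_poset E P leP) (less_closed (check E (ext_poset E P leP) \<kappa>) Q leQ)"
    and "second_adds_new_set E (ext_poset E P leP) Q leQ"
  shows "forced E (iteration E (ext_poset E P leP) Q leQ)
      (\<^bold>\<not> supercompact (check E (iteration E (ext_poset E P leP) Q leQ) \<kappa>) \<^bold>\<and>
       \<^bold>\<not> strongly_compact (check E (iteration E (ext_poset E P leP) Q leQ) \<kappa>))"
proof -
  interpret zfc E by unfold_locales (rule assms(1))
  interpret splitting_two_step E P leP Q leQ \<kappa>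
    by unfold_locales (use assms in auto)
  have no: "\<not> forces E RR (strongly_compact (R.ck \<kappa>)) r" if "r \<in> R.C" for r
    by (rule not_strongly_compact[OF assms(8) that])
  then have "\<not> forces E RR (supercompact (R.ck \<kappa>)) r" if "r \<in> R.C" for r
    using R.supercompact_strongly_compact that by blast
  \<comment> \<open>A negation is forced when no extension forces the statement, and
    \<open>no\<close> covers all conditions.\<close>
  then show ?thesis unfolding forced_def forces.simps using no R.below_Cond by blast
qed

end
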